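(* Let $\kappa$ be a commutative unital ring, $H$ a Hopf algebra over $\kappa$, $B$ a unital right $H$-comodule algebra over $\kappa$ with coaction $\rho:B\to B\otimes H$, and let $A=B^{co H}$. Then the $H$-extension $A\subset B$ is partially cleft if and only if $B$ is isomorphic to a partial crossed product $A\#_{(\alpha,\omega)}H$ with respect to a symmetric twisted partial $H$-module structure $(\alpha,\omega)$ on $A$.
   Context: All tensor products and $\mathrm{Hom}$ are over the commutative unital ring $\kappa$. Sweedler notation is used for comultiplications, and $\rho(b)=\sum b_{(0)}\otimes b_{(1)}$, $(I\otimes\Delta)\rho(b)=\sum b_{(0)}\otimes b_{(1)}\otimes b_{(2)}$. $\mathrm{Hom}(H,-)$ and $\mathrm{Hom}(H\otimes H,-)$ with values in an algebra carry the convolution product $*$. $S$ is the antipode of $H$, $\varepsilon$ its counit, $B^{co H}=\{b\in B:\rho(b)=b\otimes 1_H\}$. Partially cleft extension. Let $B$ be a unital right $H$-comodule algebra and $A\subset B$ a subalgebra. $A\subset B$ is an $H$-extension if $A=B^{co H}$. An $H$-extension is partially cleft if there are $\kappa$-linear maps $\gamma,\gamma':H\to B$ such that, writing $e_h=(\gamma*\gamma')(h)$ and $\tilde e_h=(\gamma'*\gamma)(h)$, for all $h,k\in H$, $b\in B$: (i) $\gamma(1_H)=1_B$; (ii) $\rho(\gamma(h))=\sum\gamma(h_{(1)})\otimes h_{(2)}$ and $\rho(\gamma'(h))=\sum\gamma'(h_{(2)})\otimes S(h_{(1)})$; (iii) $(\gamma*\gamma')\circ M$ is central in the convolution algebra $\mathrm{Hom}(H\otimes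 H,A)$, where $M:H\otimes H\to H$ is the multiplication (by (ii), $\gamma*\gamma'$ takes values in $A$), and $(\gamma'*\gamma)(h)$ commutes with every element of $A$; (iv) $\sum b_{(0)}\gamma'(b_{(1)})\gamma(b_{(2)})=b$; (v) $\gamma(h)e_k=\sum e_{h_{(1)}k}\gamma(h_{(2)})$; (vi) $\gamma'(k)\tilde e_h=\sum\tilde e_{hk_{(1)}}\gamma'(k_{(2)})$; (vii) $\sum\gamma(hk_{(1)})\tilde e_{k_{(2)}}=\sum e_{h_{(1)}}\gamma(h_{(2)}k)$. Twisted partial action. For a unital $\kappa$-algebra $A$ with unit $\mathbf 1_A$, a twisted partial action of $H$ on $A$ is a pair of $\kappa$-linear maps $\alpha:H\otimes A\to A$, $\alpha(h\otimes a)=h\cdot a$, and $\omega:H\otimes H\to A$ such that for all $a,b\in A$, $h,l\in H$: $1_H\cdot a=a$; $h\cdot(ab)=\sum(h_{(1)}\cdot a)(h_{(2)}\cdot b)$; $\sum(h_{(1)}\cdot(l_{(1)}\cdot a))\omega(h_{(2)},l_{(2)})=\sum\omega(h_{(1)},l_{(1)})(h_{(2)}l_{(2)}\cdot a)$; $\omega(h,l)=\sum\omega(h_{(1)},l_{(1)})(h_{(2)}l_{(2)}\cdot\mathbf 1_A)$. Let $f_1(h\otimes k)=(h\cdot\mathbf 1_A)\varepsilon(k)$ and $f_2(h\otimes k)=hk\cdot\mathbf 1_A$; these are convolution idempotents in $\mathrm{Hom}(H\otimes H,A)$. The twisted partial action (twisted partial $H$-module structure) is symmetric if: (1) $f_1,f_2$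 are central in $\mathrm{Hom}(H\otimes H,A)$; (2) $\omega$ satisfies $\omega(h,1_H)=\omega(1_H,h)=h\cdot\mathbf 1_A$ and $\sum(h_{(1)}\cdot\omega(l_{(1)},m_{(1)}))\omega(h_{(2)},l_{(2)}m_{(2)})=\sum\omega(h_{(1)},l_{(1)})\omega(h_{(2)}l_{(2)},m)$ for all $h,l,m\in H$, and $\omega$ is an invertible element of the ideal $\langle f_1*f_2\rangle$ of $\mathrm{Hom}(H\otimes H,A)$ generated by $f_1*f_2$ (which has unit $f_1*f_2$), i.e. there is $\omega'\in\langle f_1*f_2\rangle$ with $\omega*\omega'=\omega'*\omega=f_1*f_2$; (3) $h\cdot(k\cdot\mathbf 1_A)=\sum(h_{(1)}\cdot\mathbf 1_A)(h_{(2)}k\cdot\mathbf 1_A)$ for all $h,k\in H$. Partial crossed product. On $A\otimes H$ put the multiplication $(a\otimes h)(b\otimes l)=\sum a(h_{(1)}\cdot b)\omega(h_{(2)},l_{(1)})\otimes h_{(3)}l_{(2)}$. Then $A\#_{(\alpha,\omega)}H=(A\otimes H)(\mathbf 1_A\otimes 1_H)$, the $\kappa$-submodule generated by the elements $a\#h:=\sum a(h_{(1)}\cdot\mathbf 1_A)\otimes h_{(2)}$; under the conditions above it is an associative algebra with unit $\mathbf 1_A\#1_H$. *)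

theory Defs
  imports "HOL-Algebra.Free_Abelian_Groups" "HOL-Algebra.QuotRing" "HOL-Algebra.Module"
begin

section \<open>Tensor products over a commutative ring\<close>

text \<open>
  The tensor product of two \<open>R\<close>-modules is the free abelian group on
  \<open>carrier M \<times> carrier N\<close> modulo the subgroup generated by the relations of
  biadditivity and \<open>R\<close>-balancedness. It always depends on the carriers: for a submodule \<open>A\<close> of
  \<open>B\<close> the module \<open>A \<otimes> N\<close> is formed from \<open>A\<close> itself and is not a
  subset of \<open>B \<otimes> N\<close>.
\<close>

type_synonym ('m, 'n) tens = "('m \<times> 'n \<Rightarrow>\<^sub>0 int) set"

definition tensor_free ::
    "('k, 'm, 'x) module_scheme \<Rightarrow> ('k, 'n, 'y) module_scheme \<Rightarrow> ('m \<times> 'n \<Rightarrow>\<^sub>0 int) monoid" where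
  "tensor_free M N = free_Abelian_group (carrier M \<times> carrier N)"

definition tensor_rels ::
    "('k, 'r) ring_scheme \<Rightarrow> ('k, 'm, 'x) module_scheme \<Rightarrow> ('k, 'n, 'y) module_scheme
      \<Rightarrow> ('m \<times> 'n \<Rightarrow>\<^sub>0 int) set" where
  "tensor_rels R M N =
     {frag_of (x \<oplus>\<^bsub>M\<^esub> x', y) - frag_of (x, y) - frag_of (x', y) | x x' y.
        x \<in> carrier M \<and> x' \<in> carrier M \<and> y \<in> carrier N} \<union>
     {frag_of (x, y \<oplus>\<^bsub>N\<^esub> y') - frag_of (x, y) - frag_of (x, y') | x y y'.
        x \<in> carrier M \<and> y \<in> carrier N \<and> y' \<in> carrier N} \<union>
     {frag_of (r \<odot>\<^bsub>M\<^esub> x, y) - frag_of (x, r \<odot>\<^bsub>N\<^esub> y) | r x y.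
        r \<in> carrier R \<and> x \<in> carrier M \<and> y \<in> carrier N}"

definition tensor_null ::
    "('k, 'r) ring_scheme \<Rightarrow> ('k, 'm, 'x) module_scheme \<Rightarrow> ('k, 'n, 'y) module_scheme
      \<Rightarrow> ('m \<times> 'n \<Rightarrow>\<^sub>0 int) set" where
  "tensor_null R M N = generate (tensor_free M N) (tensor_rels R M N)"

definition tensor_class ::
    "('k, 'r) ring_scheme \<Rightarrow> ('k, 'm, 'x) module_scheme \<Rightarrow> ('k, 'n, 'y) module_scheme
      \<Rightarrow> ('m \<times> 'n \<Rightarrow>\<^sub>0 int) \<Rightarrow> ('m, 'n) tens" where
  "tensor_class R M N c = tensor_null R M N #>\<^bsub>tensor_free M N\<^esub> c"

text \<open>The pure tensor \<open>x \<otimes> y\<close> in \<open>M \<otimes> N\<close>.\<close>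

definition tens ::
    "('k, 'r) ring_scheme \<Rightarrow> ('k, 'm, 'x) module_scheme \<Rightarrow> ('k, 'n, 'y) module_scheme
      \<Rightarrow> 'm \<Rightarrow> 'n \<Rightarrow> ('m, 'n) tens" where
  "tens R M N x y = tensor_class R M N (frag_of (x, y))"

text \<open>
  The fields \<open>mult\<close> and \<open>one\<close> are those of the tensor product of two algebras,
  \<open>(x \<otimes> y)(x' \<otimes> y') = xx' \<otimes> yy'\<close>; they are meaningless, and never used, when
  one of the factors is only a module.
\<close>

definition tensor ::
    "('k, 'r) ring_scheme \<Rightarrow> ('k, 'm, 'x) module_scheme \<Rightarrow> ('k, 'n, 'y) module_scheme
      \<Rightarrow> ('k, ('m, 'n) tens) module" where
  "tensor R M N =
    \<lparr>carrier = carrier (tensor_free M N Mod tensor_null R M N),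
     mult = (\<lambda>s t. \<Union>c\<in>s. \<Union>d\<in>t. tensor_class R M N
       (frag_extend (\<lambda>(x, y). frag_extend (\<lambda>(x', y'). frag_of (x \<otimes>\<^bsub>M\<^esub> x', y \<otimes>\<^bsub>N\<^esub> y')) d) c)),
     one = tens R M N \<one>\<^bsub>M\<^esub> \<one>\<^bsub>N\<^esub>,
     zero = \<one>\<^bsub>tensor_free M N Mod tensor_null R M N\<^esub>,
     add = mult (tensor_free M N Mod tensor_null R M N),
     smult = (\<lambda>r t. \<Union>c\<in>t. tensor_class R M N
       (frag_extend (\<lambda>(x, y). frag_of (r \<odot>\<^bsub>M\<^esub> x, y)) c))\<rparr>"

text \<open>
  Sweedler sums. If \<open>t = \<Sum>\<^sub>i x\<^sub>i \<otimes> y\<^sub>i\<close> in \<open>M \<otimes> N\<close> and \<open>f\<close> is an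
  \<open>R\<close>-bilinear map from \<open>M \<times> N\<close> to \<open>P\<close>, then \<open>tsum P t f = \<Sum>\<^sub>i f x\<^sub>i y\<^sub>i\<close>, the image of
  \<open>t\<close> under the linear map induced by \<open>f\<close>. The value is the same for all representatives
  \<open>c\<close> of the class \<open>t\<close> (lemma \<open>tsum_class\<close> below), which is what \<open>the_elem\<close> relies on.
\<close>

definition tsum :: "('p, 'x) ring_scheme \<Rightarrow> ('m, 'n) tens \<Rightarrow> ('m \<Rightarrow> 'n \<Rightarrow> 'p) \<Rightarrow> 'p" where
  "tsum P t f = the_elem
    ((\<lambda>c. \<Oplus>\<^bsub>P\<^esub>p \<in> Poly_Mapping.keys c. [Poly_Mapping.lookup c p] \<cdot>\<^bsub>P\<^esub> f (fst p) (snd p)) ` t)"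


section \<open>Linear maps and algebras\<close>

definition linear_maps ::
    "('k, 'r) ring_scheme \<Rightarrow> ('k, 'm, 'x) module_scheme \<Rightarrow> ('k, 'n, 'y) module_scheme
      \<Rightarrow> ('m \<Rightarrow> 'n) set" where
  "linear_maps R M N = {f \<in> carrier M \<rightarrow> carrier N.
    (\<forall>x\<in>carrier M. \<forall>y\<in>carrier M. f (x \<oplus>\<^bsub>M\<^esub> y) = f x \<oplus>\<^bsub>N\<^esub> f y) \<and>
    (\<forall>r\<in>carrier R. \<forall>x\<in>carrier M. f (r \<odot>\<^bsub>M\<^esub> x) = r \<odot>\<^bsub>N\<^esub> f x)}"

text \<open>The library's \<open>algebra\<close> is commutative.\<close>

locale assoc_algebra = module R A + ring A for R (structure) and A (structure) +
  assumes smult_mult_left: "\<lbrakk>r \<in> carrier R; x \<in> carrier A; y \<in> carrier A\<rbrakk> \<Longrightarrow>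
      (r \<odot>\<^bsub>A\<^esub> x) \<otimes>\<^bsub>A\<^esub> y = r \<odot>\<^bsub>A\<^esub> (x \<otimes>\<^bsub>A\<^esub> y)"
    and smult_mult_right: "\<lbrakk>r \<in> carrier R; x \<in> carrier A; y \<in> carrier A\<rbrakk> \<Longrightarrow>
      x \<otimes>\<^bsub>A\<^esub> (r \<odot>\<^bsub>A\<^esub> y) = r \<odot>\<^bsub>A\<^esub> (x \<otimes>\<^bsub>A\<^esub> y)"

definition algebra_homs ::
    "('k, 'r) ring_scheme \<Rightarrow> ('k, 'm, 'x) module_scheme \<Rightarrow> ('k, 'n, 'y) module_scheme
      \<Rightarrow> ('m \<Rightarrow> 'n) set" where
  "algebra_homs R A B = ring_hom A B \<inter> linear_maps R A B"

definition base_algebra :: "('k, 'r) ring_scheme \<Rightarrow> ('k, 'k) module" where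
  "base_algebra R = \<lparr>carrier = carrier R, mult = mult R, one = \<one>\<^bsub>R\<^esub>, zero = \<zero>\<^bsub>R\<^esub>,
    add = add R, smult = mult R\<rparr>"

definition subalgebra_on :: "('k, 'b, 'x) module_scheme \<Rightarrow> 'b set \<Rightarrow> ('k, 'b) module" where
  "subalgebra_on B S = module.truncate (B\<lparr>carrier := S\<rparr>)"

definition ring_center :: "('a, 'x) ring_scheme \<Rightarrow> 'a set" where
  "ring_center A = {z \<in> carrier A. \<forall>x\<in>carrier A. z \<otimes>\<^bsub>A\<^esub> x = x \<otimes>\<^bsub>A\<^esub> z}"


section \<open>Coalgebras, convolution, Hopf algebras, comodule algebras\<close>

record ('k, 'c) coalgebra = "('k, 'c) module" +
  comult :: "'c \<Rightarrow> ('c, 'c) tens"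
  counit :: "'c \<Rightarrow> 'k"

record ('k, 'h) hopf_algebra = "('k, 'h) coalgebra" +
  antipode :: "'h \<Rightarrow> 'h"

record ('k, 'h, 'b) comodule_algebra = "('k, 'b) module" +
  coaction :: "'b \<Rightarrow> ('b, 'h) tens"

locale coalgebra = module R C for R (structure) and C (structure) +
  assumes comult_linear: "comult C \<in> linear_maps R C (tensor R C C)"
    and counit_linear: "counit C \<in> linear_maps R C (base_algebra R)"
    and coassoc: "c \<in> carrier C \<Longrightarrow>
      tsum (tensor R C (tensor R C C)) (comult C c)
        (\<lambda>x y. tsum (tensor R C (tensor R C C)) (comult C x)
          (\<lambda>x1 x2. tens R C (tensor R C C) x1 (tens R C C x2 y)))
      = tsum (tensor R C (tensor R C C)) (comult C c)
        (\<lambda>x y. tens R C (tensor R C C) x (comult C y))"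
    and counit_left: "c \<in> carrier C \<Longrightarrow> tsum C (comult C c) (\<lambda>x y. counit C x \<odot>\<^bsub>C\<^esub> y) = c"
    and counit_right: "c \<in> carrier C \<Longrightarrow> tsum C (comult C c) (\<lambda>x y. counit C y \<odot>\<^bsub>C\<^esub> x) = c"

text \<open>
  The coalgebra \<open>C \<otimes> D\<close>, with \<open>\<Delta>(c \<otimes> d) = \<Sum> (c\<^sub>1 \<otimes> d\<^sub>1) \<otimes> (c\<^sub>2 \<otimes> d\<^sub>2)\<close>.
\<close>

definition tensor_coalgebra ::
    "('k, 'r) ring_scheme \<Rightarrow> ('k, 'c, 'x) coalgebra_scheme \<Rightarrow> ('k, 'd, 'y) coalgebra_scheme
      \<Rightarrow> ('k, ('c, 'd) tens) coalgebra" where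
  "tensor_coalgebra R C D = (let T = tensor R C D; TT = tensor R T T in
    module.extend T (coalgebra.fields
      (\<lambda>t. tsum TT t (\<lambda>c d. tsum TT (comult C c) (\<lambda>c1 c2. tsum TT (comult D d)
        (\<lambda>d1 d2. tens R T T (tens R C D c1 d1) (tens R C D c2 d2)))))
      (\<lambda>t. tsum R t (\<lambda>c d. counit C c \<otimes>\<^bsub>R\<^esub> counit D d))))"

definition convolution ::
    "('k, 'c, 'x) coalgebra_scheme \<Rightarrow> ('a, 'y) ring_scheme \<Rightarrow> ('c \<Rightarrow> 'a) \<Rightarrow> ('c \<Rightarrow> 'a) \<Rightarrow> 'c \<Rightarrow> 'a" where
  "convolution C A f g c = tsum A (comult C c) (\<lambda>x y. f x \<otimes>\<^bsub>A\<^esub> g y)"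

text \<open>
  \<open>Hom(C, A)\<close>. Its elements are extensional so that equality in this algebra is equality on \<open>C\<close>.
\<close>

definition conv_algebra ::
    "('k, 'r) ring_scheme \<Rightarrow> ('k, 'c, 'x) coalgebra_scheme \<Rightarrow> ('k, 'a, 'y) module_scheme
      \<Rightarrow> ('k, 'c \<Rightarrow> 'a) module" where
  "conv_algebra R C A =
    \<lparr>carrier = linear_maps R C A \<inter> extensional (carrier C),
     mult = (\<lambda>f g. \<lambda>c\<in>carrier C. convolution C A f g c),
     one = (\<lambda>c\<in>carrier C. counit C c \<odot>\<^bsub>A\<^esub> \<one>\<^bsub>A\<^esub>),
     zero = (\<lambda>c\<in>carrier C. \<zero>\<^bsub>A\<^esub>),
     add = (\<lambda>f g. \<lambda>c\<in>carrier C. f c \<oplus>\<^bsub>A\<^esub> g c),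
     smult = (\<lambda>r f. \<lambda>c\<in>carrier C. r \<odot>\<^bsub>A\<^esub> f c)\<rparr>"

locale hopf_algebra = assoc_algebra R H + coalgebra R H for R (structure) and H (structure) +
  assumes comult_hom: "comult H \<in> algebra_homs R H (tensor R H H)"
    and counit_hom: "counit H \<in> algebra_homs R H (base_algebra R)"
    and antipode_linear: "antipode H \<in> linear_maps R H H"
    and antipode_left: "h \<in> carrier H \<Longrightarrow>
      convolution H H (antipode H) (\<lambda>x. x) h = counit H h \<odot>\<^bsub>H\<^esub> \<one>\<^bsub>H\<^esub>"
    and antipode_right: "h \<in> carrier H \<Longrightarrow>
      convolution H H (\<lambda>x. x) (antipode H) h = counit H h \<odot>\<^bsub>H\<^esub> \<one>\<^bsub>H\<^esub>"

locale comodule_algebra = hopf_algebra R H + B: assoc_algebra R B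
  for R (structure) and H (structure) and B (structure) +
  assumes coaction_hom: "coaction B \<in> algebra_homs R B (tensor R B H)"
    and coaction_coassoc: "b \<in> carrier B \<Longrightarrow>
      tsum (tensor R B (tensor R H H)) (coaction B b)
        (\<lambda>x h. tsum (tensor R B (tensor R H H)) (coaction B x)
          (\<lambda>x0 x1. tens R B (tensor R H H) x0 (tens R H H x1 h)))
      = tsum (tensor R B (tensor R H H)) (coaction B b)
        (\<lambda>x h. tens R B (tensor R H H) x (comult H h))"
    and coaction_counit: "b \<in> carrier B \<Longrightarrow>
      tsum B (coaction B b) (\<lambda>x h. counit H h \<odot>\<^bsub>B\<^esub> x) = b"

definition coinvariants ::
    "('k, 'r) ring_scheme \<Rightarrow> ('k, 'h, 'x) hopf_algebra_scheme
      \<Rightarrow> ('k, 'h, 'b, 'y) comodule_algebra_scheme \<Rightarrow> 'b set" where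
  "coinvariants R H B = {b \<in> carrier B. coaction B b = tens R B H b \<one>\<^bsub>H\<^esub>}"

definition comodule_algebra_isos ::
    "('k, 'r) ring_scheme \<Rightarrow> ('k, 'h, 'x) hopf_algebra_scheme
      \<Rightarrow> ('k, 'h, 'b, 'y) comodule_algebra_scheme \<Rightarrow> ('k, 'h, 'c, 'z) comodule_algebra_scheme
      \<Rightarrow> ('b \<Rightarrow> 'c) set" where
  "comodule_algebra_isos R H B C = {\<phi> \<in> ring_iso B C \<inter> linear_maps R B C.
    \<forall>b\<in>carrier B. coaction C (\<phi> b) =
      tsum (tensor R C H) (coaction B b) (\<lambda>x h. tens R C H (\<phi> x) h)}"


section \<open>Partially cleft extensions\<close>

definition H_extension ::
    "('k, 'r) ring_scheme \<Rightarrow> ('k, 'h, 'x) hopf_algebra_scheme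
      \<Rightarrow> ('k, 'h, 'b, 'y) comodule_algebra_scheme \<Rightarrow> 'b set \<Rightarrow> bool" where
  "H_extension R H B A \<longleftrightarrow> A = coinvariants R H B"

definition partially_cleft ::
    "('k, 'r) ring_scheme \<Rightarrow> ('k, 'h, 'x) hopf_algebra_scheme
      \<Rightarrow> ('k, 'h, 'b, 'y) comodule_algebra_scheme \<Rightarrow> 'b set \<Rightarrow> bool" where
  "partially_cleft R H B A \<longleftrightarrow> H_extension R H B A \<and>
    (\<exists>\<gamma> \<in> linear_maps R H B. \<exists>\<gamma>' \<in> linear_maps R H B.
      let e = convolution H B \<gamma> \<gamma>'; e' = convolution H B \<gamma>' \<gamma> in
      \<gamma> \<one>\<^bsub>H\<^esub> = \<one>\<^bsub>B\<^esub> \<and>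
      (\<forall>h\<in>carrier H. coaction B (\<gamma> h) =
        tsum (tensor R B H) (comult H h) (\<lambda>h1 h2. tens R B H (\<gamma> h1) h2)) \<and>
      (\<forall>h\<in>carrier H. coaction B (\<gamma>' h) =
        tsum (tensor R B H) (comult H h) (\<lambda>h1 h2. tens R B H (\<gamma>' h2) (antipode H h1))) \<and>
      (\<lambda>t\<in>carrier (tensor R H H). e (tsum H t (\<lambda>h k. h \<otimes>\<^bsub>H\<^esub> k)))
        \<in> ring_center (conv_algebra R (tensor_coalgebra R H H) (subalgebra_on B A)) \<and>
      (\<forall>h\<in>carrier H. \<forall>a\<in>A. e' h \<otimes>\<^bsub>B\<^esub> a = a \<otimes>\<^bsub>B\<^esub> e' h) \<and>
      (\<forall>b\<in>carrier B. tsum B (coaction B b)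
        (\<lambda>b0 x. tsum B (comult H x) (\<lambda>b1 b2. b0 \<otimes>\<^bsub>B\<^esub> \<gamma>' b1 \<otimes>\<^bsub>B\<^esub> \<gamma> b2)) = b) \<and>
      (\<forall>h\<in>carrier H. \<forall>k\<in>carrier H.
        \<gamma> h \<otimes>\<^bsub>B\<^esub> e k = tsum B (comult H h) (\<lambda>h1 h2. e (h1 \<otimes>\<^bsub>H\<^esub> k) \<otimes>\<^bsub>B\<^esub> \<gamma> h2)) \<and>
      (\<forall>h\<in>carrier H. \<forall>k\<in>carrier H.
        \<gamma>' k \<otimes>\<^bsub>B\<^esub> e' h = tsum B (comult H k) (\<lambda>k1 k2. e' (h \<otimes>\<^bsub>H\<^esub> k1) \<otimes>\<^bsub>B\<^esub> \<gamma>' k2)) \<and>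
      (\<forall>h\<in>carrier H. \<forall>k\<in>carrier H.
        tsum B (comult H k) (\<lambda>k1 k2. \<gamma> (h \<otimes>\<^bsub>H\<^esub> k1) \<otimes>\<^bsub>B\<^esub> e' k2) =
        tsum B (comult H h) (\<lambda>h1 h2. e h1 \<otimes>\<^bsub>B\<^esub> \<gamma> (h2 \<otimes>\<^bsub>H\<^esub> k))))"


section \<open>Twisted partial actions and partial crossed products\<close>

locale twisted_action_data =
  fixes R :: "('k, 'r) ring_scheme"
    and H :: "('k, 'h, 'x) hopf_algebra_scheme"
    and A :: "('k, 'a, 'y) module_scheme"
    and \<alpha> :: "('h, 'a) tens \<Rightarrow> 'a"
    and \<omega> :: "('h, 'h) tens \<Rightarrow> 'a"
begin

abbreviation act :: "'h \<Rightarrow> 'a \<Rightarrow> 'a" (infixr \<open>\<rightharpoonup>\<close> 75) where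
  "h \<rightharpoonup> a \<equiv> \<alpha> (tens R H A h a)"

abbreviation cocyc :: "'h \<Rightarrow> 'h \<Rightarrow> 'a" where
  "cocyc h l \<equiv> \<omega> (tens R H H h l)"

abbreviation Hom_HH_A :: "('k, ('h, 'h) tens \<Rightarrow> 'a) module" where
  "Hom_HH_A \<equiv> conv_algebra R (tensor_coalgebra R H H) A"

definition twisted_partial_action :: bool where
  "twisted_partial_action \<longleftrightarrow>
    \<alpha> \<in> linear_maps R (tensor R H A) A \<and>
    \<omega> \<in> linear_maps R (tensor R H H) A \<and>
    (\<forall>a\<in>carrier A. \<one>\<^bsub>H\<^esub> \<rightharpoonup> a = a) \<and>
    (\<forall>h\<in>carrier H. \<forall>a\<in>carrier A. \<forall>b\<in>carrier A.
      h \<rightharpoonup> (a \<otimes>\<^bsub>A\<^esub> b) = tsum A (comult H h) (\<lambda>h1 h2. (h1 \<rightharpoonup> a) \<otimes>\<^bsub>A\<^esub> (h2 \<rightharpoonup> b))) \<and>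
    (\<forall>h\<in>carrier H. \<forall>l\<in>carrier H. \<forall>a\<in>carrier A.
      tsum A (comult H h) (\<lambda>h1 h2. tsum A (comult H l) (\<lambda>l1 l2.
        (h1 \<rightharpoonup> (l1 \<rightharpoonup> a)) \<otimes>\<^bsub>A\<^esub> cocyc h2 l2)) =
      tsum A (comult H h) (\<lambda>h1 h2. tsum A (comult H l) (\<lambda>l1 l2.
        cocyc h1 l1 \<otimes>\<^bsub>A\<^esub> ((h2 \<otimes>\<^bsub>H\<^esub> l2) \<rightharpoonup> a)))) \<and>
    (\<forall>h\<in>carrier H. \<forall>l\<in>carrier H.
      cocyc h l = tsum A (comult H h) (\<lambda>h1 h2. tsum A (comult H l) (\<lambda>l1 l2.
        cocyc h1 l1 \<otimes>\<^bsub>A\<^esub> ((h2 \<otimes>\<^bsub>H\<^esub> l2) \<rightharpoonup> \<one>\<^bsub>A\<^esub>))))"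

text \<open>The maps \<open>h \<otimes> k \<mapsto> \<epsilon>(k)(h \<cdot> \<one>)\<close> and \<open>h \<otimes> k \<mapsto> hk \<cdot> \<one>\<close> on \<open>H \<otimes> H\<close>.\<close>

definition f1 :: "('h, 'h) tens \<Rightarrow> 'a" where
  "f1 = (\<lambda>t\<in>carrier (tensor R H H). tsum A t (\<lambda>h k. counit H k \<odot>\<^bsub>A\<^esub> (h \<rightharpoonup> \<one>\<^bsub>A\<^esub>)))"

definition f2 :: "('h, 'h) tens \<Rightarrow> 'a" where
  "f2 = (\<lambda>t\<in>carrier (tensor R H H). tsum A t (\<lambda>h k. (h \<otimes>\<^bsub>H\<^esub> k) \<rightharpoonup> \<one>\<^bsub>A\<^esub>))"

definition symmetric_twisted_partial_action :: bool where
  "symmetric_twisted_partial_action \<longleftrightarrow>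
    twisted_partial_action \<and>
    f1 \<in> ring_center Hom_HH_A \<and> f2 \<in> ring_center Hom_HH_A \<and>
    (\<forall>h\<in>carrier H. cocyc h \<one>\<^bsub>H\<^esub> = h \<rightharpoonup> \<one>\<^bsub>A\<^esub> \<and> cocyc \<one>\<^bsub>H\<^esub> h = h \<rightharpoonup> \<one>\<^bsub>A\<^esub>) \<and>
    (\<forall>h\<in>carrier H. \<forall>l\<in>carrier H. \<forall>m\<in>carrier H.
      tsum A (comult H h) (\<lambda>h1 h2. tsum A (comult H l) (\<lambda>l1 l2. tsum A (comult H m) (\<lambda>m1 m2.
        (h1 \<rightharpoonup> cocyc l1 m1) \<otimes>\<^bsub>A\<^esub> cocyc h2 (l2 \<otimes>\<^bsub>H\<^esub> m2)))) =
      tsum A (comult H h) (\<lambda>h1 h2. tsum A (comult H l) (\<lambda>l1 l2.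
        cocyc h1 l1 \<otimes>\<^bsub>A\<^esub> cocyc (h2 \<otimes>\<^bsub>H\<^esub> l2) m))) \<and>
    (let I = Idl\<^bsub>Hom_HH_A\<^esub> {f1 \<otimes>\<^bsub>Hom_HH_A\<^esub> f2}; w = restrict \<omega> (carrier (tensor R H H)) in
      w \<in> I \<and> (\<exists>w'\<in>I. w \<otimes>\<^bsub>Hom_HH_A\<^esub> w' = f1 \<otimes>\<^bsub>Hom_HH_A\<^esub> f2 \<and>
                      w' \<otimes>\<^bsub>Hom_HH_A\<^esub> w = f1 \<otimes>\<^bsub>Hom_HH_A\<^esub> f2)) \<and>
    (\<forall>h\<in>carrier H. \<forall>k\<in>carrier H.
      h \<rightharpoonup> (k \<rightharpoonup> \<one>\<^bsub>A\<^esub>) =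
        tsum A (comult H h) (\<lambda>h1 h2. (h1 \<rightharpoonup> \<one>\<^bsub>A\<^esub>) \<otimes>\<^bsub>A\<^esub> ((h2 \<otimes>\<^bsub>H\<^esub> k) \<rightharpoonup> \<one>\<^bsub>A\<^esub>)))"

definition crossed_mult :: "('a, 'h) tens \<Rightarrow> ('a, 'h) tens \<Rightarrow> ('a, 'h) tens" where
  "crossed_mult s t = (let T = tensor R A H in
    tsum T s (\<lambda>a h. tsum T t (\<lambda>b l.
      tsum T (comult H h) (\<lambda>h1 h'. tsum T (comult H h') (\<lambda>h2 h3. tsum T (comult H l) (\<lambda>l1 l2.
        tens R A H (a \<otimes>\<^bsub>A\<^esub> (h1 \<rightharpoonup> b) \<otimes>\<^bsub>A\<^esub> cocyc h2 l1) (h3 \<otimes>\<^bsub>H\<^esub> l2)))))))"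

definition smash :: "'a \<Rightarrow> 'h \<Rightarrow> ('a, 'h) tens" (infix \<open>\<sharp>\<close> 65) where
  "a \<sharp> h = tsum (tensor R A H) (comult H h) (\<lambda>h1 h2. tens R A H (a \<otimes>\<^bsub>A\<^esub> (h1 \<rightharpoonup> \<one>\<^bsub>A\<^esub>)) h2)"

definition crossed_algebra :: "('k, ('a, 'h) tens) module" where
  "crossed_algebra =
    \<lparr>carrier = (\<lambda>t. crossed_mult t (tens R A H \<one>\<^bsub>A\<^esub> \<one>\<^bsub>H\<^esub>)) ` carrier (tensor R A H),
     mult = crossed_mult,
     one = \<one>\<^bsub>A\<^esub> \<sharp> \<one>\<^bsub>H\<^esub>,
     zero = \<zero>\<^bsub>tensor R A H\<^esub>,
     add = add (tensor R A H),
     smult = smult (tensor R A H)\<rparr>"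

text \<open>
  The coaction is the standard one, \<open>a \<sharp> h \<mapsto> \<Sum> (a \<sharp> h\<^sub>1) \<otimes> h\<^sub>2\<close>. An element \<open>\<Sum>\<^sub>i a\<^sub>i \<otimes> h\<^sub>i\<close> of
  \<open>A \<sharp> H\<close> equals its product with the unit \<open>\<one> \<otimes> \<one>\<close>, that is, \<open>\<Sum>\<^sub>i a\<^sub>i \<sharp> h\<^sub>i\<close>, so that the
  formula can be read off a representative in \<open>A \<otimes> H\<close>.
\<close>

definition crossed_product :: "('k, 'h, ('a, 'h) tens) comodule_algebra" where
  "crossed_product = (let C = crossed_algebra; T = tensor R C H in
    module.extend C (comodule_algebra.fields
      (\<lambda>t. tsum T t (\<lambda>a h. tsum T (comult H h) (\<lambda>h1 h2. tens R C H (a \<sharp> h1) h2)))))"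

end


section \<open>The tensor product is well defined\<close>

definition frag_sum :: "('p, 'x) ring_scheme \<Rightarrow> ('m \<times> 'n \<Rightarrow>\<^sub>0 int) \<Rightarrow> ('m \<Rightarrow> 'n \<Rightarrow> 'p) \<Rightarrow> 'p" where
  "frag_sum P c f = (\<Oplus>\<^bsub>P\<^esub>p \<in> Poly_Mapping.keys c. [Poly_Mapping.lookup c p] \<cdot>\<^bsub>P\<^esub> f (fst p) (snd p))"

lemma (in abelian_group) frag_sum_superset:
  assumes "\<And>x y. x \<in> X \<Longrightarrow> y \<in> Y \<Longrightarrow> f x y \<in> carrier G"
    and "Poly_Mapping.keys c \<subseteq> K" "K \<subseteq> X \<times> Y" "finite K"
  shows "frag_sum G c f = (\<Oplus>p \<in> K. [Poly_Mapping.lookup c p] \<cdot> f (fst p) (snd p))"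
proof -
  have cl: "f (fst i) (snd i) \<in> carrier G" if "i \<in> K" for i
  proof -
    have "fst i \<in> X" "snd i \<in> Y" using that assms(3) by (auto simp: mem_Times_iff)
    then show ?thesis by (rule assms(1))
  qed
  have z: "[Poly_Mapping.lookup c i] \<cdot> f (fst i) (snd i) = \<zero>" if "i \<in> K - Poly_Mapping.keys c" for i
  proof -
    have "Poly_Mapping.lookup c i = 0" using that by (simp add: in_keys_iff)
    then show ?thesis by (simp add: add_pow_def)
  qed
  have p: "(\<lambda>i. [Poly_Mapping.lookup c i] \<cdot> f (fst i) (snd i)) \<in> K \<rightarrow> carrier G"
    using cl by (intro Pi_I add.int_pow_closed)
  show ?thesis unfolding frag_sum_def
    by (rule add.finprod_mono_neutral_cong_left[OF assms(4) assms(2) z refl p])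
qed

lemma (in abelian_group) frag_sum_hom:
  assumes f: "\<And>x y. x \<in> X \<Longrightarrow> y \<in> Y \<Longrightarrow> f x y \<in> carrier G"
  shows "(\<lambda>c. frag_sum G c f) \<in> hom (free_Abelian_group (X \<times> Y)) (add_monoid G)"
proof (rule homI, goal_cases)
  case (1 c)
  have "[Poly_Mapping.lookup c p] \<cdot> f (fst p) (snd p) \<in> carrier G" if "p \<in> Poly_Mapping.keys c" for p
    using 1 that f by (fastforce intro!: add.int_pow_closed)
  then show ?case
    by (auto simp: frag_sum_def intro!: finsum_closed)
next
  case (2 c d)
  define K where "K = Poly_Mapping.keys c \<union> Poly_Mapping.keys d"
  have K: "K \<subseteq> X \<times> Y" "finite K" "Poly_Mapping.keys c \<subseteq> K" "Poly_Mapping.keys d \<subseteq> K"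
    "Poly_Mapping.keys (c + d) \<subseteq> K"
    using 2 keys_add[of c d] by (auto simp: K_def)
  have cl: "f (fst p) (snd p) \<in> carrier G" if "p \<in> K" for p using that K f by fastforce
  have "frag_sum G (c + d) f = (\<Oplus>p \<in> K. [Poly_Mapping.lookup (c + d) p] \<cdot> f (fst p) (snd p))"
    by (rule frag_sum_superset[OF f]) (use K in auto)
  also have "\<dots> = (\<Oplus>p \<in> K. [Poly_Mapping.lookup c p] \<cdot> f (fst p) (snd p) \<oplus> [Poly_Mapping.lookup d p] \<cdot> f (fst p) (snd p))"
    by (rule finsum_cong') (use cl in \<open>auto simp: lookup_add add.int_pow_mult add.int_pow_closed\<close>)
  also have "\<dots> = (\<Oplus>p \<in> K. [Poly_Mapping.lookup c p] \<cdot> f (fst p) (snd p)) \<oplus> (\<Oplus>p \<in> K. [Poly_Mapping.lookup d p] \<cdot> f (fst p) (snd p))"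
    by (rule finsum_addf) (use cl in \<open>auto simp: add.int_pow_closed\<close>)
  also have "\<dots> = frag_sum G c f \<oplus> frag_sum G d f"
    by (simp add: frag_sum_superset[where X = X and Y = Y and f = f and K = K] K f)
  finally show ?case by simp
qed

lemma (in abelian_group) frag_sum_diff:
  assumes f: "\<And>x y. x \<in> X \<Longrightarrow> y \<in> Y \<Longrightarrow> f x y \<in> carrier G"
    and c: "Poly_Mapping.keys c \<subseteq> X \<times> Y" and d: "Poly_Mapping.keys d \<subseteq> X \<times> Y"
  shows "frag_sum G (c - d) f = frag_sum G c f \<ominus> frag_sum G d f"
proof -
  interpret h: group_hom "free_Abelian_group (X \<times> Y)" "add_monoid G" "\<lambda>c. frag_sum G c f"
    using frag_sum_hom[where X = X and Y = Y and f = f, OF f] a_group by (simp add: group_hom_def group_hom_axioms_def)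
  have cl: "c - d \<in> carrier (free_Abelian_group (X \<times> Y))"
    using c d keys_diff[of c d] by auto
  show ?thesis
    using h.hom_mult[of "c - d" d] h.hom_closed[of c] h.hom_closed[of d] h.hom_closed[OF cl] c d cl
    by (simp add: a_minus_def a_assoc r_neg)
qed

lemma (in abelian_group) add_minus_minus:
  "\<lbrakk>x \<in> carrier G; y \<in> carrier G\<rbrakk> \<Longrightarrow> (x \<oplus> y) \<ominus> x \<ominus> y = \<zero>"
  unfolding a_comm[of x y] by (simp add: a_minus_def a_assoc r_neg)

lemma (in abelian_group) frag_sum_frag_of:
  "f x y \<in> carrier G \<Longrightarrow> frag_sum G (frag_of (x, y)) f = f x y"
  by (simp add: frag_sum_def keys_frag_of)

definition bilinear_map ::
    "('k, 'r) ring_scheme \<Rightarrow> ('k, 'm, 'x) module_scheme \<Rightarrow> ('k, 'n, 'y) module_scheme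
      \<Rightarrow> ('p, 'z) ring_scheme \<Rightarrow> ('m \<Rightarrow> 'n \<Rightarrow> 'p) \<Rightarrow> bool" where
  "bilinear_map R M N P f \<longleftrightarrow>
    (\<forall>x\<in>carrier M. \<forall>y\<in>carrier N. f x y \<in> carrier P) \<and>
    (\<forall>x\<in>carrier M. \<forall>x'\<in>carrier M. \<forall>y\<in>carrier N. f (x \<oplus>\<^bsub>M\<^esub> x') y = f x y \<oplus>\<^bsub>P\<^esub> f x' y) \<and>
    (\<forall>x\<in>carrier M. \<forall>y\<in>carrier N. \<forall>y'\<in>carrier N. f x (y \<oplus>\<^bsub>N\<^esub> y') = f x y \<oplus>\<^bsub>P\<^esub> f x y') \<and>
    (\<forall>r\<in>carrier R. \<forall>x\<in>carrier M. \<forall>y\<in>carrier N. f (r \<odot>\<^bsub>M\<^esub> x) y = f x (r \<odot>\<^bsub>N\<^esub> y))"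

context
  fixes R :: "('k, 'r) ring_scheme" and M :: "('k, 'm, 'x) module_scheme"
    and N :: "('k, 'n, 'y) module_scheme"
  assumes M: "module R M" and N: "module R N"
begin

interpretation M: module R M by (rule M)
interpretation N: module R N by (rule N)
interpretation F: comm_group "tensor_free M N"
  unfolding tensor_free_def by (rule abelian_free_Abelian_group)

lemma tensor_diff_closed: "c \<in> carrier (tensor_free M N) \<Longrightarrow> d \<in> carrier (tensor_free M N) \<Longrightarrow>
   c - d \<in> carrier (tensor_free M N)"
  using keys_diff[of c d] by (auto simp: tensor_free_def)

lemma tensor_frag_closed: "x \<in> carrier M \<Longrightarrow> y \<in> carrier N \<Longrightarrow> frag_of (x, y) \<in> carrier (tensor_free M N)"
  by (simp add: tensor_free_def)

lemma tensor_rels_sub: "tensor_rels R M N \<subseteq> carrier (tensor_free M N)"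
  unfolding tensor_rels_def by (auto intro!: tensor_diff_closed tensor_frag_closed)

lemma tensor_null_subgroup: "subgroup (tensor_null R M N) (tensor_free M N)"
  unfolding tensor_null_def by (rule F.generate_is_subgroup[OF tensor_rels_sub])

lemma tensor_null_normal: "tensor_null R M N \<lhd> tensor_free M N"
  using tensor_null_subgroup by (rule F.subgroup_imp_normal)

interpretation Nn: normal "tensor_null R M N" "tensor_free M N" by (rule tensor_null_normal)

lemma tensor_hom_null:
  assumes G: "group G" and h: "h \<in> hom (tensor_free M N) G" and r: "\<And>c. c \<in> tensor_rels R M N \<Longrightarrow> h c = \<one>\<^bsub>G\<^esub>"
    and c: "c \<in> tensor_null R M N"
  shows "h c = \<one>\<^bsub>G\<^esub>"
proof -
  interpret group_hom "tensor_free M N" G h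
    using G h F.is_group by (simp add: group_hom_def group_hom_axioms_def)
  have "kernel (tensor_free M N) G h \<supseteq> generate (tensor_free M N) (tensor_rels R M N)"
    by (rule F.generate_subgroup_incl[OF _ subgroup_kernel])
       (use r tensor_rels_sub in \<open>auto simp: kernel_def\<close>)
  then show ?thesis using c by (auto simp: kernel_def tensor_null_def)
qed

lemma frag_sum_hom':
  assumes "abelian_group P" "bilinear_map R M N P f"
  shows "(\<lambda>c. frag_sum P c f) \<in> hom (tensor_free M N) (add_monoid P)"
  unfolding tensor_free_def
  using assms by (intro abelian_group.frag_sum_hom) (auto simp: bilinear_map_def)

lemma frag_sum_null:
  assumes P: "abelian_group P" and f: "bilinear_map R M N P f"
    and c: "c \<in> tensor_null R M N"
  shows "frag_sum P c f = \<zero>\<^bsub>P\<^esub>"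
proof -
  interpret P: abelian_group P by (rule P)
  interpret group_hom "tensor_free M N" "add_monoid P" "\<lambda>c. frag_sum P c f"
    using frag_sum_hom'[OF P f] F.is_group P.a_group by (simp add: group_hom_def group_hom_axioms_def)
  have of: "frag_sum P (frag_of (x, y)) f = f x y" if "x \<in> carrier M" "y \<in> carrier N" for x y
    using that f by (intro P.frag_sum_frag_of) (auto simp: bilinear_map_def)
  have minus: "frag_sum P (c - d) f = frag_sum P c f \<ominus>\<^bsub>P\<^esub> frag_sum P d f"
    if "c \<in> carrier (tensor_free M N)" "d \<in> carrier (tensor_free M N)" for c d
    using that f P.frag_sum_diff[where X = "carrier M" and Y = "carrier N" and f = f and c = c and d = d]
    by (simp add: tensor_free_def bilinear_map_def)
  have "frag_sum P c f = \<zero>\<^bsub>P\<^esub>" if "c \<in> tensor_rels R M N" for c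
    using that unfolding tensor_rels_def Un_iff mem_Collect_eq
    proof (elim disjE exE conjE, goal_cases)
      case (1 x x' y)
      have [simp]: "f x y \<in> carrier P" "f x' y \<in> carrier P" "f (x \<oplus>\<^bsub>M\<^esub> x') y = f x y \<oplus>\<^bsub>P\<^esub> f x' y"
        using f 1 by (auto simp: bilinear_map_def)
      have "frag_sum P c f = (f x y \<oplus>\<^bsub>P\<^esub> f x' y) \<ominus>\<^bsub>P\<^esub> f x y \<ominus>\<^bsub>P\<^esub> f x' y"
        using 1 by (simp add: minus of tensor_frag_closed tensor_diff_closed)
      also have "\<dots> = \<zero>\<^bsub>P\<^esub>" by (simp add: P.add_minus_minus)
      finally show ?thesis .
    next
      case (2 x y y')
      have [simp]: "f x y \<in> carrier P" "f x y' \<in> carrier P" "f x (y \<oplus>\<^bsub>N\<^esub> y') = f x y \<oplus>\<^bsub>P\<^esub> f x y'"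
        using f 2 by (auto simp: bilinear_map_def)
      have "frag_sum P c f = (f x y \<oplus>\<^bsub>P\<^esub> f x y') \<ominus>\<^bsub>P\<^esub> f x y \<ominus>\<^bsub>P\<^esub> f x y'"
        using 2 by (simp add: minus of tensor_frag_closed tensor_diff_closed)
      also have "\<dots> = \<zero>\<^bsub>P\<^esub>" by (simp add: P.add_minus_minus)
      finally show ?thesis .
    next
      case (3 r x y)
      have [simp]: "f x (r \<odot>\<^bsub>N\<^esub> y) \<in> carrier P" "f (r \<odot>\<^bsub>M\<^esub> x) y = f x (r \<odot>\<^bsub>N\<^esub> y)"
        using f 3 by (auto simp: bilinear_map_def)
      have "frag_sum P c f = f x (r \<odot>\<^bsub>N\<^esub> y) \<ominus>\<^bsub>P\<^esub> f x (r \<odot>\<^bsub>N\<^esub> y)"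
        using 3 by (simp add: minus of tensor_frag_closed tensor_diff_closed)
      also have "\<dots> = \<zero>\<^bsub>P\<^esub>" by (simp add: a_minus_def P.r_neg)
      finally show ?thesis .
    qed
  then show ?thesis
    using tensor_hom_null[OF P.a_group frag_sum_hom'[OF P f] _ c] by simp
qed

lemma tsum_class:
  assumes P: "abelian_group P" and f: "bilinear_map R M N P f"
    and c: "c \<in> carrier (tensor_free M N)"
  shows "tsum P (tensor_class R M N c) f = frag_sum P c f"
proof -
  interpret P: abelian_group P by (rule P)
  interpret group_hom "tensor_free M N" "add_monoid P" "\<lambda>c. frag_sum P c f"
    using frag_sum_hom'[OF P f] F.is_group P.a_group by (simp add: group_hom_def group_hom_axioms_def)
  have "frag_sum P d f = frag_sum P c f" if "d \<in> tensor_class R M N c" for d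
  proof -
    obtain n where n: "n \<in> tensor_null R M N" "d = n \<otimes>\<^bsub>tensor_free M N\<^esub> c"
      using \<open>d \<in> _\<close> by (auto simp: tensor_class_def r_coset_def)
    show ?thesis using frag_sum_null[OF P f n(1)] n Nn.mem_carrier[OF n(1)] c hom_closed[OF c]
      by (simp)
  qed
  moreover have "c \<in> tensor_class R M N c"
    unfolding tensor_class_def using c tensor_null_subgroup by (rule F.rcos_self)
  ultimately have "(\<lambda>c. frag_sum P c f) ` tensor_class R M N c = {frag_sum P c f}"
    by (intro equalityI image_subsetI) blast+
  then show ?thesis by (simp add: tsum_def frag_sum_def[symmetric])
qed

lemma tsum_tens:
  assumes "abelian_group P" "bilinear_map R M N P f" "x \<in> carrier M" "y \<in> carrier N"
  shows "tsum P (tens R M N x y) f = f x y"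
  unfolding tens_def using assms
  by (subst tsum_class) (auto simp: tensor_frag_closed bilinear_map_def intro!: abelian_group.frag_sum_frag_of)

lemma tensor_carrier: "carrier (tensor R M N) = tensor_class R M N ` carrier (tensor_free M N)"
  by (simp add: tensor_def carrier_FactGroup tensor_class_def[abs_def])

lemma tensor_add: "c \<in> carrier (tensor_free M N) \<Longrightarrow> d \<in> carrier (tensor_free M N) \<Longrightarrow>
  tensor_class R M N c \<oplus>\<^bsub>tensor R M N\<^esub> tensor_class R M N d = tensor_class R M N (c + d)"
  using Nn.rcos_sum[of c d] by (simp add: tensor_def FactGroup_def tensor_class_def) (simp add: tensor_free_def)

lemma tensor_abelian_group: "abelian_group (tensor R M N)"
proof -
  interpret Q: comm_group "tensor_free M N Mod tensor_null R M N"
    by (rule F.abelian_FactGroup[OF tensor_null_subgroup])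
  show ?thesis
  proof (rule abelian_groupI)
    fix x assume x: "x \<in> carrier (tensor R M N)"
    show "\<exists>y\<in>carrier (tensor R M N). y \<oplus>\<^bsub>tensor R M N\<^esub> x = \<zero>\<^bsub>tensor R M N\<^esub>"
      using Q.l_inv_ex[of x] x unfolding tensor_def partial_object.simps ring.simps by auto
  next
    fix x y assume "x \<in> carrier (tensor R M N)" "y \<in> carrier (tensor R M N)"
    then show "x \<oplus>\<^bsub>tensor R M N\<^esub> y = y \<oplus>\<^bsub>tensor R M N\<^esub> x"
      unfolding tensor_def partial_object.simps ring.simps by (rule Q.m_comm)
  qed (simp_all only: tensor_def partial_object.simps ring.simps Q.m_closed Q.one_closed Q.m_assoc Q.l_one)
qed

lemma tensor_class_eq:
  assumes "c \<in> carrier (tensor_free M N)" "d \<in> carrier (tensor_free M N)" "c - d \<in> tensor_null R M N"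
  shows "tensor_class R M N c = tensor_class R M N d"
proof -
  have "c = (c - d) \<otimes>\<^bsub>tensor_free M N\<^esub> d" by (simp add: tensor_free_def)
  then have "c \<in> tensor_null R M N #>\<^bsub>tensor_free M N\<^esub> d"
    using assms(3) unfolding r_coset_def by blast
  then show ?thesis unfolding tensor_class_def
    using F.repr_independence[OF _ assms(2) tensor_null_subgroup] by metis
qed

lemma tens_bilinear: "bilinear_map R M N (tensor R M N) (tens R M N)"
proof -
  have sum_eq: "tensor_class R M N c = tensor_class R M N d \<oplus>\<^bsub>tensor R M N\<^esub> tensor_class R M N d'"
    if "c \<in> carrier (tensor_free M N)" "d \<in> carrier (tensor_free M N)" "d' \<in> carrier (tensor_free M N)"
     "c - d - d' \<in> tensor_rels R M N" for c d d'
  proof -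
    have "tensor_class R M N c = tensor_class R M N (d + d')"
    proof (rule tensor_class_eq)
      show "c - (d + d') \<in> tensor_null R M N"
        using that by (simp add: tensor_null_def generate.incl diff_diff_eq)
      show "d + d' \<in> carrier (tensor_free M N)"
        using F.m_closed[OF that(2,3)] by (simp add: tensor_free_def)
    qed (use that in auto)
    then show ?thesis using that by (simp add: tensor_add)
  qed
  show ?thesis
    unfolding bilinear_map_def tens_def
    by (intro conjI ballI sum_eq tensor_class_eq)
       (auto simp: tensor_carrier tensor_frag_closed tensor_null_def tensor_rels_def intro!: generate.incl)
qed


lemma tensor_self_class: "c \<in> carrier (tensor_free M N) \<Longrightarrow> c \<in> tensor_class R M N c"
  unfolding tensor_class_def by (rule F.rcos_self[OF _ tensor_null_subgroup])

lemma tensor_class_sub: "c \<in> carrier (tensor_free M N) \<Longrightarrow> d \<in> tensor_class R M N c \<Longrightarrow>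
   d \<in> carrier (tensor_free M N) \<and> tensor_class R M N d = tensor_class R M N c"
  unfolding tensor_class_def
  using F.r_coset_subset_G[OF Nn.subset, of c] F.repr_independence[OF _ _ tensor_null_subgroup, of d c]
  by auto

end

lemma tensor_class_extend:
  assumes M: "module R M" and N: "module R N" and P: "module R P" and Q: "module R Q"
    and g: "\<And>x y. x \<in> carrier M \<Longrightarrow> y \<in> carrier N \<Longrightarrow> g (x, y) \<in> carrier (tensor_free P Q)"
    and c: "c \<in> carrier (tensor_free M N)"
  shows "frag_extend g c \<in> carrier (tensor_free P Q)"
    and "tensor_class R P Q (frag_extend g c) = frag_sum (tensor R P Q) c (\<lambda>x y. tensor_class R P Q (g (x, y)))"
proof -
  interpret T: abelian_group "tensor R P Q" by (rule tensor_abelian_group[OF P Q])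
  let ?f = "\<lambda>x y. tensor_class R P Q (g (x, y))"
  have f: "?f x y \<in> carrier (tensor R P Q)" if "x \<in> carrier M" "y \<in> carrier N" for x y
    using g[OF that] by (simp add: tensor_carrier[OF P Q])
  interpret h: group_hom "tensor_free M N" "add_monoid (tensor R P Q)" "\<lambda>c. frag_sum (tensor R P Q) c ?f"
    unfolding tensor_free_def group_hom_def group_hom_axioms_def
    using T.frag_sum_hom[OF f] T.a_group by simp
  interpret F: comm_group "tensor_free P Q"
    unfolding tensor_free_def by (rule abelian_free_Abelian_group)
  have cl: "frag_extend g c \<in> carrier (tensor_free P Q)" if "c \<in> carrier (tensor_free M N)" for c
    using that g keys_frag_extend[of g c] unfolding tensor_free_def by fastforce
  show "frag_extend g c \<in> carrier (tensor_free P Q)" by (rule cl[OF c])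

  have "Poly_Mapping.keys c \<subseteq> carrier M \<times> carrier N" using c by (simp add: tensor_free_def)
  then have "Poly_Mapping.keys c \<subseteq> carrier M \<times> carrier N \<and>
    tensor_class R P Q (frag_extend g c) = frag_sum (tensor R P Q) c ?f"
  proof (induction rule: frag_induction)
    case zero
    have "tensor_class R P Q 0 = \<zero>\<^bsub>tensor R P Q\<^esub>"
      using subgroup.subset[OF tensor_null_subgroup[OF P Q]] F.coset_mult_one[of "tensor_null R P Q"]
      by (simp add: tensor_class_def tensor_def tensor_free_def)
    then show ?case by (simp add: frag_sum_def)
  next
    case (one p)
    then show ?case using f by (cases p) (auto simp: T.frag_sum_frag_of)
  next
    case (diff a b)
    then have a: "a \<in> carrier (tensor_free M N)" and b: "b \<in> carrier (tensor_free M N)"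
      and ab: "a - b \<in> carrier (tensor_free M N)"
      using keys_diff[of a b] by (auto simp: tensor_free_def)
    let ?c = "\<lambda>c. tensor_class R P Q (frag_extend g c)"
    have in_T: "?c c \<in> carrier (tensor R P Q)" if "c \<in> carrier (tensor_free M N)" for c
      using cl[OF that] by (simp add: tensor_carrier[OF P Q])
    have "?c (a - b) \<oplus>\<^bsub>tensor R P Q\<^esub> ?c b = ?c a"
      using tensor_add[OF P Q cl[OF ab] cl[OF b]] by (simp flip: frag_extend_add)
    then have "?c (a - b) = ?c a \<ominus>\<^bsub>tensor R P Q\<^esub> ?c b"
      using in_T[OF a] in_T[OF b] in_T[OF ab] by (metis a_minus_def T.add.inv_solve_right)
    moreover have "Poly_Mapping.keys (a - b) \<subseteq> carrier M \<times> carrier N"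
      using ab by (simp add: tensor_free_def)
    ultimately show ?case
      using diff T.frag_sum_diff[where c = a and d = b and f = ?f and X = "carrier M" and Y = "carrier N"] f by auto
  qed
  then show "tensor_class R P Q (frag_extend g c) = frag_sum (tensor R P Q) c ?f" by simp
qed

lemma tensor_smult_eq: "r \<odot>\<^bsub>tensor R M N\<^esub> t =
    (\<Union>c\<in>t. tensor_class R M N (frag_extend (\<lambda>(x, y). frag_of (r \<odot>\<^bsub>M\<^esub> x, y)) c))"
  by (simp add: tensor_def)

lemma tensor_mult_eq: "s \<otimes>\<^bsub>tensor R M N\<^esub> t = (\<Union>c\<in>s. \<Union>d\<in>t. tensor_class R M N
    (frag_extend (\<lambda>(x, y). frag_extend (\<lambda>(x', y'). frag_of (x \<otimes>\<^bsub>M\<^esub> x', y \<otimes>\<^bsub>N\<^esub> y')) d) c))"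
  by (simp add: tensor_def)

lemma tensor_smult:
  assumes M: "module R M" and N: "module R N" and r: "r \<in> carrier R"
    and t: "t \<in> carrier (tensor R M N)"
  shows "bilinear_map R M N (tensor R M N) (\<lambda>x y. tens R M N (r \<odot>\<^bsub>M\<^esub> x) y)"
    and "r \<odot>\<^bsub>tensor R M N\<^esub> t = tsum (tensor R M N) t (\<lambda>x y. tens R M N (r \<odot>\<^bsub>M\<^esub> x) y)"
proof -
  interpret M: module R M by (rule M)
  interpret N: module R N by (rule N)
  interpret T: abelian_group "tensor R M N" by (rule tensor_abelian_group[OF M N])
  have b: "bilinear_map R M N (tensor R M N) (tens R M N)" by (rule tens_bilinear[OF M N])
  show bl: "bilinear_map R M N (tensor R M N) (\<lambda>x y. tens R M N (r \<odot>\<^bsub>M\<^esub> x) y)"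
    using b r unfolding bilinear_map_def
    by (auto simp: M.smult_r_distr M.smult_assoc1[symmetric] N.smult_assoc1[symmetric] M.R.m_comm)
  obtain c0 where c0: "c0 \<in> carrier (tensor_free M N)" "t = tensor_class R M N c0"
    using t by (auto simp: tensor_carrier[OF M N])
  have "tensor_class R M N (frag_extend (\<lambda>(x, y). frag_of (r \<odot>\<^bsub>M\<^esub> x, y)) c) =
      tsum (tensor R M N) t (\<lambda>x y. tens R M N (r \<odot>\<^bsub>M\<^esub> x) y)" if "c \<in> t" for c
  proof -
    have c: "c \<in> carrier (tensor_free M N)" "tensor_class R M N c = t"
      using tensor_class_sub[OF M N c0(1)] that c0(2) by auto
    have "tensor_class R M N (frag_extend (\<lambda>(x, y). frag_of (r \<odot>\<^bsub>M\<^esub> x, y)) c) =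
      frag_sum (tensor R M N) c (\<lambda>x y. tensor_class R M N ((\<lambda>(x, y). frag_of (r \<odot>\<^bsub>M\<^esub> x, y)) (x, y)))"
      by (rule tensor_class_extend(2)[OF M N M N]) (use r c in \<open>auto simp: tensor_free_def\<close>)
    also have "\<dots> = tsum (tensor R M N) (tensor_class R M N c) (\<lambda>x y. tens R M N (r \<odot>\<^bsub>M\<^esub> x) y)"
      using tsum_class[OF M N T.abelian_group_axioms bl c(1)] by (simp add: tens_def)
    finally show ?thesis by (simp add: c)
  qed
  then have "r \<odot>\<^bsub>tensor R M N\<^esub> t = (\<Union>c\<in>t. tsum (tensor R M N) t (\<lambda>x y. tens R M N (r \<odot>\<^bsub>M\<^esub> x) y))"
    unfolding tensor_smult_eq by (rule SUP_cong[OF refl])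
  also have "\<dots> = tsum (tensor R M N) t (\<lambda>x y. tens R M N (r \<odot>\<^bsub>M\<^esub> x) y)"
    by (rule SUP_const) (use tensor_self_class[OF M N c0(1)] c0(2) in blast)
  finally show "r \<odot>\<^bsub>tensor R M N\<^esub> t = tsum (tensor R M N) t (\<lambda>x y. tens R M N (r \<odot>\<^bsub>M\<^esub> x) y)" .
qed

lemma tensor_smult_tens:
  assumes "module R M" "module R N" "r \<in> carrier R" "x \<in> carrier M" "y \<in> carrier N"
  shows "r \<odot>\<^bsub>tensor R M N\<^esub> tens R M N x y = tens R M N (r \<odot>\<^bsub>M\<^esub> x) y"
proof -
  have t: "tens R M N x y \<in> carrier (tensor R M N)"
    using tens_bilinear[OF assms(1,2)] assms(4,5) by (auto simp: bilinear_map_def)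
  show ?thesis
    unfolding tensor_smult(2)[OF assms(1-3) t]
    by (rule tsum_tens[OF assms(1,2) tensor_abelian_group[OF assms(1,2)] tensor_smult(1)[OF assms(1-3)] assms(4,5)])
       (use t in simp)
qed

lemma tensor_mult_tens:
  assumes M: "assoc_algebra R M" and N: "assoc_algebra R N"
    and x: "x \<in> carrier M" "x' \<in> carrier M" and y: "y \<in> carrier N" "y' \<in> carrier N"
  shows "tens R M N x y \<otimes>\<^bsub>tensor R M N\<^esub> tens R M N x' y' = tens R M N (x \<otimes>\<^bsub>M\<^esub> x') (y \<otimes>\<^bsub>N\<^esub> y')"
proof -
  interpret M: assoc_algebra R M by (rule M)
  interpret N: assoc_algebra R N by (rule N)
  note mM = assoc_algebra.axioms(1)[OF M] and mN = assoc_algebra.axioms(1)[OF N]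
  interpret T: abelian_group "tensor R M N" by (rule tensor_abelian_group[OF mM mN])
  have b: "bilinear_map R M N (tensor R M N) (tens R M N)" by (rule tens_bilinear[OF mM mN])
  let ?T = "tensor R M N" and ?p = "tens R M N"
  have rm: "bilinear_map R M N ?T (\<lambda>u v. ?p (a \<otimes>\<^bsub>M\<^esub> u) (c \<otimes>\<^bsub>N\<^esub> v))"
    if "a \<in> carrier M" "c \<in> carrier N" for a c
    using b that unfolding bilinear_map_def
    by (auto simp: M.r_distr N.r_distr M.smult_mult_right N.smult_mult_right)
  have lm: "bilinear_map R M N ?T (\<lambda>u v. ?p (u \<otimes>\<^bsub>M\<^esub> a) (v \<otimes>\<^bsub>N\<^esub> c))"
    if "a \<in> carrier M" "c \<in> carrier N" for a c
    using b that unfolding bilinear_map_def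
    by (auto simp: M.l_distr N.l_distr M.smult_mult_left N.smult_mult_left)
  have cls: "c \<in> carrier (tensor_free M N) \<and> tensor_class R M N c = ?p u v"
    if "c \<in> ?p u v" "u \<in> carrier M" "v \<in> carrier N" for c u v
    using tensor_class_sub[OF mM mN, of "frag_of (u, v)" c] that by (simp add: tens_def tensor_free_def)
  have "tensor_class R M N (frag_extend (\<lambda>(u, v). frag_extend (\<lambda>(u', v').
      frag_of (u \<otimes>\<^bsub>M\<^esub> u', v \<otimes>\<^bsub>N\<^esub> v')) d) c) = ?p (x \<otimes>\<^bsub>M\<^esub> x') (y \<otimes>\<^bsub>N\<^esub> y')"
    if c: "c \<in> ?p x y" and d: "d \<in> ?p x' y'" for c d
  proof -
    note c = cls[OF c x(1) y(1)] and d = cls[OF d x(2) y(2)]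
    have in_free: "frag_extend (\<lambda>(u', v'). frag_of (u \<otimes>\<^bsub>M\<^esub> u', v \<otimes>\<^bsub>N\<^esub> v')) d \<in> carrier (tensor_free M N)"
      and val: "tensor_class R M N (frag_extend (\<lambda>(u', v'). frag_of (u \<otimes>\<^bsub>M\<^esub> u', v \<otimes>\<^bsub>N\<^esub> v')) d)
        = ?p (u \<otimes>\<^bsub>M\<^esub> x') (v \<otimes>\<^bsub>N\<^esub> y')" if uv: "u \<in> carrier M" "v \<in> carrier N" for u v
    proof -
      have g: "(\<lambda>(u', v'). frag_of (u \<otimes>\<^bsub>M\<^esub> u', v \<otimes>\<^bsub>N\<^esub> v')) (a, b) \<in> carrier (tensor_free M N)"
        if "a \<in> carrier M" "b \<in> carrier N" for a b
        using that uv by (simp add: tensor_free_def)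
      note * = tensor_class_extend[OF mM mN mM mN,
          where g = "\<lambda>(u', v'). frag_of (u \<otimes>\<^bsub>M\<^esub> u', v \<otimes>\<^bsub>N\<^esub> v')" and c = d,
          OF g conjunct1[OF d]]
      show "frag_extend (\<lambda>(u', v'). frag_of (u \<otimes>\<^bsub>M\<^esub> u', v \<otimes>\<^bsub>N\<^esub> v')) d \<in> carrier (tensor_free M N)"
        by (rule *)
      show "tensor_class R M N (frag_extend (\<lambda>(u', v'). frag_of (u \<otimes>\<^bsub>M\<^esub> u', v \<otimes>\<^bsub>N\<^esub> v')) d)
        = ?p (u \<otimes>\<^bsub>M\<^esub> x') (v \<otimes>\<^bsub>N\<^esub> y')"
        using *(2) tsum_class[OF mM mN T.abelian_group_axioms rm[OF uv] conjunct1[OF d]]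
          tsum_tens[OF mM mN T.abelian_group_axioms rm[OF uv] x(2) y(2)] d
        by (simp add: tens_def)
    qed
    have "tensor_class R M N (frag_extend (\<lambda>(u, v). frag_extend (\<lambda>(u', v').
        frag_of (u \<otimes>\<^bsub>M\<^esub> u', v \<otimes>\<^bsub>N\<^esub> v')) d) c)
      = frag_sum ?T c (\<lambda>u v. tensor_class R M N ((\<lambda>(u, v). frag_extend (\<lambda>(u', v').
        frag_of (u \<otimes>\<^bsub>M\<^esub> u', v \<otimes>\<^bsub>N\<^esub> v')) d) (u, v)))"
      by (rule tensor_class_extend(2)[OF mM mN mM mN]) (use in_free c in auto)
    also have "\<dots> = frag_sum ?T c (\<lambda>u v. ?p (u \<otimes>\<^bsub>M\<^esub> x') (v \<otimes>\<^bsub>N\<^esub> y'))"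
      unfolding frag_sum_def
    proof (rule T.finsum_cong'[OF refl])
      have kc: "fst p \<in> carrier M" "snd p \<in> carrier N" if "p \<in> Poly_Mapping.keys c" for p
        using c that by (auto simp: tensor_free_def)
      show "(\<lambda>p. [Poly_Mapping.lookup c p] \<cdot>\<^bsub>?T\<^esub> ?p (fst p \<otimes>\<^bsub>M\<^esub> x') (snd p \<otimes>\<^bsub>N\<^esub> y'))
        \<in> Poly_Mapping.keys c \<rightarrow> carrier ?T"
        using kc lm[OF x(2) y(2)] by (auto simp: bilinear_map_def intro!: T.add.int_pow_closed)
      fix p assume "p \<in> Poly_Mapping.keys c"
      then show "[Poly_Mapping.lookup c p] \<cdot>\<^bsub>?T\<^esub> tensor_class R M N (case (fst p, snd p) of (u, v) \<Rightarrow>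
          frag_extend (\<lambda>(u', v'). frag_of (u \<otimes>\<^bsub>M\<^esub> u', v \<otimes>\<^bsub>N\<^esub> v')) d)
        = [Poly_Mapping.lookup c p] \<cdot>\<^bsub>?T\<^esub> ?p (fst p \<otimes>\<^bsub>M\<^esub> x') (snd p \<otimes>\<^bsub>N\<^esub> y')"
        using kc val by (simp only: prod.case)
    qed
    also have "\<dots> = ?p (x \<otimes>\<^bsub>M\<^esub> x') (y \<otimes>\<^bsub>N\<^esub> y')"
      using tsum_class[OF mM mN T.abelian_group_axioms lm[OF x(2) y(2)] conjunct1[OF c]]
        tsum_tens[OF mM mN T.abelian_group_axioms lm[OF x(2) y(2)] x(1) y(1)] c by simp
    finally show ?thesis .
  qed
  then have "?p x y \<otimes>\<^bsub>?T\<^esub> ?p x' y' = (\<Union>c\<in>?p x y. \<Union>d\<in>?p x' y'. ?p (x \<otimes>\<^bsub>M\<^esub> x') (y \<otimes>\<^bsub>N\<^esub> y'))"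
    unfolding tensor_mult_eq by (intro SUP_cong refl)
  moreover have "?p u v \<noteq> {}" if "u \<in> carrier M" "v \<in> carrier N" for u v
    using tensor_self_class[OF mM mN tensor_frag_closed[OF mM mN that]] by (auto simp: tens_def)
  ultimately show ?thesis using x y by auto
qed

end

theory Submission
  imports Defs
begin

text \<open>
  Write \<open>L X\<close> for the convolution algebra \<open>Hom(H, X)\<close>. A function of \<open>n\<close> elements of \<open>H\<close> with values in
  \<open>X\<close> is an element of the \<open>n\<close>-fold iterate \<open>L (\<dots> (L X))\<close>, so an identity between Sweedler sums
  becomes an identity between words in a ring, and substitutions such as \<open>f \<mapsto> (\<lambda>h k. f (hk))\<close> are
  algebra homomorphisms.

  Given a cleaving pair, put \<open>h \<cdot> a = \<Sum> \<gamma>(h\<^sub>1) a \<gamma>'(h\<^sub>2)\<close>,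
  \<open>\<omega>(h, k) = \<Sum> \<gamma>(h\<^sub>1) \<gamma>(k\<^sub>1) \<gamma>'(h\<^sub>2k\<^sub>2)\<close> and
  \<open>\<omega>'(h, k) = \<Sum> \<gamma>(h\<^sub>1k\<^sub>1) \<gamma>'(k\<^sub>2) \<gamma>'(h\<^sub>2)\<close>. Condition (iv) says that \<open>y * (\<gamma>' * \<gamma>) = y\<close> for every
  \<open>y\<close> that transforms like \<open>\<gamma>\<close> under the coaction; with this, the axioms of a symmetric twisted
  partial action reduce to the commutation rules (iii), (v), (vi). The isomorphism sends \<open>b\<close> to
  \<open>\<Sum> b\<^sub>0 \<gamma>'(b\<^sub>1) \<otimes> b\<^sub>2\<close>, with inverse \<open>a \<otimes> h \<mapsto> a \<gamma>(h)\<close>.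

  Conversely, a partial crossed product is cleft by \<open>\<gamma>(h) = 1 \<sharp> h\<close> and
  \<open>\<gamma>'(h) = \<Sum> \<omega>'(S(h\<^sub>2), h\<^sub>3) \<gamma>(S(h\<^sub>1))\<close>. The cocycle identity gives \<open>(\<gamma> * \<gamma>')(h) = h \<cdot> 1\<close>, and the
  remaining conditions follow from \<open>\<gamma>(h) a = \<Sum> (h\<^sub>1 \<cdot> a) \<gamma>(h\<^sub>2)\<close> and
  \<open>\<gamma>(h) \<gamma>(k) = \<Sum> \<omega>(h\<^sub>1, k\<^sub>1) \<gamma>(h\<^sub>2k\<^sub>2)\<close>.
\<close>

section \<open>Linear maps and tensor products\<close>

text \<open>Three obstacles shape the proof. First, \<open>e = \<gamma> * \<gamma>'\<close> and
  \<open>t = \<gamma>' * \<gamma>\<close> are idempotents rather than units, so nothing can be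
  cancelled. Cancellation is replaced by absorption, such as \<gamma> * t = \<gamma>, and by moving
  factors with the commutation rules. In the converse direction the rules for t are the hard ones,
  since its values need not be coinvariant. What makes them accessible is the formula t(h) = \<Sum>
  e(S(h2)) \<gamma>(S(h1) h3), from which \<omega>' has disappeared: S(h1) and h2 are treated as
  free variables, the word is rearranged, and only then is their product contracted to 1. Second,
  the given isomorphism need not restrict to the identity on A. The map taking x to the preimage of
  x # 1 is onto the coinvariants but need not be the inclusion, so the theory is developed for an
  algebra A with an embedding \<iota> in B. Third, H is not assumed flat over \<kappa>, so A
  \<otimes> H need not embed in B \<otimes> H. That a function takes values in A is deduced from the
  left exactness of Hom(C, -).\<close>

lemma linear_mapsI:
  assumes "\<And>x. x \<in> carrier M \<Longrightarrow> f x \<in> carrier N"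
    and "\<And>x y. \<lbrakk>x \<in> carrier M; y \<in> carrier M\<rbrakk> \<Longrightarrow> f (x \<oplus>\<^bsub>M\<^esub> y) = f x \<oplus>\<^bsub>N\<^esub> f y"
    and "\<And>r x. \<lbrakk>r \<in> carrier R; x \<in> carrier M\<rbrakk> \<Longrightarrow> f (r \<odot>\<^bsub>M\<^esub> x) = r \<odot>\<^bsub>N\<^esub> f x"
  shows "f \<in> linear_maps R M N"
  using assms by (auto simp: linear_maps_def)

lemma lin_closed: "f \<in> linear_maps R M N \<Longrightarrow> x \<in> carrier M \<Longrightarrow> f x \<in> carrier N"
  by (auto simp: linear_maps_def)

lemma lin_add: "f \<in> linear_maps R M N \<Longrightarrow> x \<in> carrier M \<Longrightarrow> y \<in> carrier M \<Longrightarrow>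
    f (x \<oplus>\<^bsub>M\<^esub> y) = f x \<oplus>\<^bsub>N\<^esub> f y"
  by (auto simp: linear_maps_def)

lemma lin_smult: "f \<in> linear_maps R M N \<Longrightarrow> r \<in> carrier R \<Longrightarrow> x \<in> carrier M \<Longrightarrow>
    f (r \<odot>\<^bsub>M\<^esub> x) = r \<odot>\<^bsub>N\<^esub> f x"
  by (auto simp: linear_maps_def)

lemma lin_cong:
  assumes "module R M" "\<And>x. x \<in> carrier M \<Longrightarrow> f x = g x"
  shows "f \<in> linear_maps R M N \<longleftrightarrow> g \<in> linear_maps R M N"
proof -
  interpret module R M by fact
  show ?thesis using assms(2) by (auto simp: linear_maps_def Pi_iff)
qed

lemma lin_id: "(\<lambda>x. x) \<in> linear_maps R M M"
  by (rule linear_mapsI) auto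

lemma lin_comp: "g \<in> linear_maps R N P \<Longrightarrow> f \<in> linear_maps R M N \<Longrightarrow> (\<lambda>x. g (f x)) \<in> linear_maps R M P"
  by (rule linear_mapsI) (auto simp: lin_closed lin_add lin_smult)

lemma lin_sum:
  assumes P: "module R P" and f: "f \<in> linear_maps R M P" and g: "g \<in> linear_maps R M P"
  shows "(\<lambda>x. f x \<oplus>\<^bsub>P\<^esub> g x) \<in> linear_maps R M P"
proof -
  interpret P: module R P by (rule P)
  show ?thesis
    using lin_closed[OF f] lin_closed[OF g]
    by (intro linear_mapsI)
      (auto simp: lin_add[OF f] lin_add[OF g] lin_smult[OF f] lin_smult[OF g] P.a_ac P.smult_r_distr)
qed

lemma additive_zero:
  assumes "abelian_group M" "abelian_group N"
    and "\<And>x. x \<in> carrier M \<Longrightarrow> f x \<in> carrier N"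
    and "\<And>x y. \<lbrakk>x \<in> carrier M; y \<in> carrier M\<rbrakk> \<Longrightarrow> f (x \<oplus>\<^bsub>M\<^esub> y) = f x \<oplus>\<^bsub>N\<^esub> f y"
  shows "f \<zero>\<^bsub>M\<^esub> = \<zero>\<^bsub>N\<^esub>"
proof -
  interpret M: abelian_group M by fact
  interpret N: abelian_group N by fact
  have "f \<zero>\<^bsub>M\<^esub> \<oplus>\<^bsub>N\<^esub> f \<zero>\<^bsub>M\<^esub> = f \<zero>\<^bsub>M\<^esub>"
    using assms(4)[of "\<zero>\<^bsub>M\<^esub>" "\<zero>\<^bsub>M\<^esub>"] by simp
  then show ?thesis using assms(3) N.add.l_cancel_one by blast
qed

lemma additive_minus:
  assumes "abelian_group M" "abelian_group N"
    and "\<And>x. x \<in> carrier M \<Longrightarrow> f x \<in> carrier N"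
    and "\<And>x y. \<lbrakk>x \<in> carrier M; y \<in> carrier M\<rbrakk> \<Longrightarrow> f (x \<oplus>\<^bsub>M\<^esub> y) = f x \<oplus>\<^bsub>N\<^esub> f y"
    and x: "x \<in> carrier M"
  shows "f (\<ominus>\<^bsub>M\<^esub> x) = \<ominus>\<^bsub>N\<^esub> f x"
proof -
  interpret M: abelian_group M by fact
  interpret N: abelian_group N by fact
  have "f (\<ominus>\<^bsub>M\<^esub> x) \<oplus>\<^bsub>N\<^esub> f x = \<zero>\<^bsub>N\<^esub>"
    using assms(4)[of "\<ominus>\<^bsub>M\<^esub> x" x] additive_zero[OF assms(1-4)] x by (simp add: M.l_neg)
  then show ?thesis using assms(3) x by (simp add: N.minus_equality)
qed

text \<open>\<open>bilinear_map\<close> is balanced biadditivity with values in a group, which is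
  what makes \<open>tsum\<close> well defined. Linearity over R in each variable is what makes
  \<open>tsum P t f\<close> an R-linear function of \<open>t\<close>.\<close>

definition bilin ::
    "('k, 'r) ring_scheme \<Rightarrow> ('k, 'm, 'x) module_scheme \<Rightarrow> ('k, 'n, 'y) module_scheme
      \<Rightarrow> ('k, 'p, 'z) module_scheme \<Rightarrow> ('m \<Rightarrow> 'n \<Rightarrow> 'p) \<Rightarrow> bool" where
  "bilin R M N P f \<longleftrightarrow> (\<forall>x\<in>carrier M. f x \<in> linear_maps R N P) \<and>
    (\<forall>y\<in>carrier N. (\<lambda>x. f x y) \<in> linear_maps R M P)"

lemma bilinI:
  assumes "\<And>x. x \<in> carrier M \<Longrightarrow> f x \<in> linear_maps R N P"
    and "\<And>y. y \<in> carrier N \<Longrightarrow> (\<lambda>x. f x y) \<in> linear_maps R M P"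
  shows "bilin R M N P f"
  using assms by (auto simp: bilin_def)

lemma bilin_r: "bilin R M N P f \<Longrightarrow> x \<in> carrier M \<Longrightarrow> f x \<in> linear_maps R N P"
  by (auto simp: bilin_def)

lemma bilin_l: "bilin R M N P f \<Longrightarrow> y \<in> carrier N \<Longrightarrow> (\<lambda>x. f x y) \<in> linear_maps R M P"
  by (auto simp: bilin_def)

lemma bilin_closed: "bilin R M N P f \<Longrightarrow> x \<in> carrier M \<Longrightarrow> y \<in> carrier N \<Longrightarrow> f x y \<in> carrier P"
  by (meson bilin_r lin_closed)

lemma bilin_bilinear: "bilin R M N P f \<Longrightarrow> bilinear_map R M N P f"
  unfolding bilin_def bilinear_map_def linear_maps_def by (auto simp: Pi_iff)

lemma bilin_cong:
  assumes "module R M" "module R N" "\<And>x y. x \<in> carrier M \<Longrightarrow> y \<in> carrier N \<Longrightarrow> f x y = g x y"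
  shows "bilin R M N P f \<longleftrightarrow> bilin R M N P g"
  unfolding bilin_def
  by (intro conj_cong ball_cong refl lin_cong) (use assms in auto)

lemma tens_closed: "module R M \<Longrightarrow> module R N \<Longrightarrow> x \<in> carrier M \<Longrightarrow> y \<in> carrier N \<Longrightarrow>
    tens R M N x y \<in> carrier (tensor R M N)"
  using tens_bilinear[of R M N] by (auto simp: bilinear_map_def)

text \<open>Sums of pure tensors exhaust the tensor product because -(x \<otimes> y) = x \<otimes>
  (-y). The induction on the free abelian group proceeds by differences, so it carries the claim for
  \<open>c\<close> and \<open>- c\<close> together.\<close>

lemma tensor_induct [consumes 3, case_names tens add]:
  assumes M: "module R M" and N: "module R N" and t: "t \<in> carrier (tensor R M N)"
    and tens: "\<And>x y. x \<in> carrier M \<Longrightarrow> y \<in> carrier N \<Longrightarrow> P (tens R M N x y)"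
    and add: "\<And>s t. \<lbrakk>s \<in> carrier (tensor R M N); t \<in> carrier (tensor R M N); P s; P t\<rbrakk> \<Longrightarrow>
      P (s \<oplus>\<^bsub>tensor R M N\<^esub> t)"
  shows "P t"
proof -
  interpret M: module R M by (rule M)
  interpret N: module R N by (rule N)
  interpret T: abelian_group "tensor R M N" by (rule tensor_abelian_group[OF M N])
  note bl = tens_bilinear[OF M N]
  let ?c = "tensor_class R M N"
  have cl: "?c c \<in> carrier (tensor R M N)" if "Poly_Mapping.keys c \<subseteq> carrier M \<times> carrier N" for c
    using that by (simp add: tensor_carrier[OF M N] tensor_free_def)
  have z: "?c 0 = \<zero>\<^bsub>tensor R M N\<^esub>"
    using tensor_add[OF M N, of 0 0] cl[of 0] T.add.l_cancel_one[of "?c 0" "?c 0"] by (simp add: tensor_free_def)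
  have "tens R M N (\<zero>\<^bsub>M\<^esub>) \<zero>\<^bsub>N\<^esub> = \<zero>\<^bsub>tensor R M N\<^esub>"
    by (rule additive_zero[OF N.abelian_group_axioms T.abelian_group_axioms, of "tens R M N \<zero>\<^bsub>M\<^esub>"])
       (use bl in \<open>auto simp: bilinear_map_def\<close>)
  then have P0: "P (?c 0)" using tens[of "\<zero>\<^bsub>M\<^esub>" "\<zero>\<^bsub>N\<^esub>"] z by simp
  have minus: "?c (-d) = \<ominus>\<^bsub>tensor R M N\<^esub> ?c d" if "Poly_Mapping.keys d \<subseteq> carrier M \<times> carrier N" for d
    using tensor_add[OF M N, of "-d" d] that z cl[of d] cl[of "-d"]
    by (intro T.minus_equality[symmetric]) (auto simp: tensor_free_def)
  obtain c where c: "Poly_Mapping.keys c \<subseteq> carrier M \<times> carrier N" "t = ?c c"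
    using t by (auto simp: tensor_carrier[OF M N] tensor_free_def)
  have "Poly_Mapping.keys c \<subseteq> carrier M \<times> carrier N \<and> P (?c c) \<and> P (?c (- c))"
    using c(1)
  proof (induction c rule: frag_induction)
    case zero
    show ?case using P0 by simp
  next
    case (one p)
    obtain x y where p: "p = (x, y)" "x \<in> carrier M" "y \<in> carrier N" using one by auto
    have "?c (- frag_of p) = \<ominus>\<^bsub>tensor R M N\<^esub> tens R M N x y"
      using minus[of "frag_of p"] p by (simp add: tens_def)
    also have "\<dots> = tens R M N x (\<ominus>\<^bsub>N\<^esub> y)"
      by (rule additive_minus[OF N.abelian_group_axioms T.abelian_group_axioms, of "tens R M N x", symmetric])
         (use bl p in \<open>auto simp: bilinear_map_def\<close>)
    finally show ?case using tens p by (auto simp: tens_def)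
  next
    case (diff a b)
    have k: "Poly_Mapping.keys (a - b) \<subseteq> carrier M \<times> carrier N" using diff keys_diff[of a b] by blast
    have "?c (a - b) = ?c a \<oplus>\<^bsub>tensor R M N\<^esub> ?c (- b)"
      using tensor_add[OF M N, of a "- b"] diff by (simp add: tensor_free_def)
    moreover have "?c (- (a - b)) = ?c b \<oplus>\<^bsub>tensor R M N\<^esub> ?c (- a)"
      using tensor_add[OF M N, of b "- a"] diff by (simp add: tensor_free_def)
    ultimately show ?case using diff k add cl[of a] cl[of b] cl[of "-a"] cl[of "-b"] by simp
  qed
  then show ?thesis using c by simp
qed

lemma
  assumes M: "module R M" and N: "module R N" and P: "abelian_group P" and f: "bilinear_map R M N P f"
  shows tsum_closed': "t \<in> carrier (tensor R M N) \<Longrightarrow> tsum P t f \<in> carrier P"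
    and tsum_add': "s \<in> carrier (tensor R M N) \<Longrightarrow> t \<in> carrier (tensor R M N) \<Longrightarrow>
      tsum P (s \<oplus>\<^bsub>tensor R M N\<^esub> t) f = tsum P s f \<oplus>\<^bsub>P\<^esub> tsum P t f"
proof -
  note h = frag_sum_hom'[OF M N P f]
  show "tsum P t f \<in> carrier P" if "t \<in> carrier (tensor R M N)"
    using that h by (auto simp: tensor_carrier[OF M N] tsum_class[OF M N P f] hom_def)
  show "tsum P (s \<oplus>\<^bsub>tensor R M N\<^esub> t) f = tsum P s f \<oplus>\<^bsub>P\<^esub> tsum P t f"
    if st: "s \<in> carrier (tensor R M N)" "t \<in> carrier (tensor R M N)"
  proof -
    obtain c d where cd: "c \<in> carrier (tensor_free M N)" "s = tensor_class R M N c"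
      "d \<in> carrier (tensor_free M N)" "t = tensor_class R M N d"
      using st by (auto simp: tensor_carrier[OF M N])
    have "c + d \<in> carrier (tensor_free M N)" using cd keys_add[of c d] by (auto simp: tensor_free_def)
    moreover have "frag_sum P (c + d) f = frag_sum P c f \<oplus>\<^bsub>P\<^esub> frag_sum P d f"
      using h cd by (auto simp: hom_def tensor_free_def)
    ultimately show ?thesis using cd by (simp add: tensor_add[OF M N] tsum_class[OF M N P f])
  qed
qed

text \<open>Multiplication by r is the \<open>tsum\<close> of a balanced map, hence additive. The
  remaining axioms are then checked on pure tensors.\<close>

lemma tensor_module:
  assumes M: "module R M" and N: "module R N"
  shows "module R (tensor R M N)"
proof -
  interpret M: module R M by (rule M)
  interpret N: module R N by (rule N)
  let ?T = "tensor R M N"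
  interpret T: abelian_group ?T by (rule tensor_abelian_group[OF M N])
  note ab = T.abelian_group_axioms
  have cl: "r \<odot>\<^bsub>?T\<^esub> t \<in> carrier ?T" if "r \<in> carrier R" "t \<in> carrier ?T" for r t
    using tsum_closed'[OF M N ab tensor_smult(1)[OF M N that] that(2)] tensor_smult(2)[OF M N that] by simp
  have add: "r \<odot>\<^bsub>?T\<^esub> (s \<oplus>\<^bsub>?T\<^esub> t) = r \<odot>\<^bsub>?T\<^esub> s \<oplus>\<^bsub>?T\<^esub> r \<odot>\<^bsub>?T\<^esub> t"
    if "r \<in> carrier R" "s \<in> carrier ?T" "t \<in> carrier ?T" for r s t
    using tsum_add'[OF M N ab tensor_smult(1)[OF M N that(1,2)] that(2,3)] that tensor_smult(2)[OF M N] by simp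
  note st = tensor_smult_tens[OF M N] and tc = tens_closed[OF M N]
  have bl: "tens R M N (x \<oplus>\<^bsub>M\<^esub> x') y = tens R M N x y \<oplus>\<^bsub>?T\<^esub> tens R M N x' y"
    if "x \<in> carrier M" "x' \<in> carrier M" "y \<in> carrier N" for x x' y
    using tens_bilinear[OF M N] that by (auto simp: bilinear_map_def)
  show ?thesis
  proof (rule moduleI)
    fix a b t assume a: "a \<in> carrier R" "b \<in> carrier R" and t: "t \<in> carrier ?T"
    show "(a \<oplus>\<^bsub>R\<^esub> b) \<odot>\<^bsub>?T\<^esub> t = a \<odot>\<^bsub>?T\<^esub> t \<oplus>\<^bsub>?T\<^esub> b \<odot>\<^bsub>?T\<^esub> t"
      using M N t
    proof (induction rule: tensor_induct)
      case (tens x y)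
      then show ?case using a by (simp add: st tc bl M.smult_l_distr)
    next
      case (add s t)
      then show ?case using a by (simp add: \<open>\<And>r s t. _ \<Longrightarrow> _ \<Longrightarrow> _ \<Longrightarrow> r \<odot>\<^bsub>?T\<^esub> (s \<oplus>\<^bsub>?T\<^esub> t) = _\<close> cl T.a_ac)
    qed
    show "(a \<otimes>\<^bsub>R\<^esub> b) \<odot>\<^bsub>?T\<^esub> t = a \<odot>\<^bsub>?T\<^esub> (b \<odot>\<^bsub>?T\<^esub> t)"
      using M N t
    proof (induction rule: tensor_induct)
      case (tens x y)
      then show ?case using a by (simp add: st tc M.smult_assoc1)
    next
      case (add s t)
      then show ?case using a by (simp add: \<open>\<And>r s t. _ \<Longrightarrow> _ \<Longrightarrow> _ \<Longrightarrow> r \<odot>\<^bsub>?T\<^esub> (s \<oplus>\<^bsub>?T\<^esub> t) = _\<close> cl)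
    qed
  next
    fix t assume t: "t \<in> carrier ?T"
    show "\<one>\<^bsub>R\<^esub> \<odot>\<^bsub>?T\<^esub> t = t"
      using M N t
    proof (induction rule: tensor_induct)
      case (tens x y)
      then show ?case by (simp add: st tc)
    next
      case (add s t)
      then show ?case by (simp add: \<open>\<And>r s t. _ \<Longrightarrow> _ \<Longrightarrow> _ \<Longrightarrow> r \<odot>\<^bsub>?T\<^esub> (s \<oplus>\<^bsub>?T\<^esub> t) = _\<close> cl)
    qed
  qed (use cl add M.R.cring_axioms ab in auto)
qed

lemma tens_bilin: "module R M \<Longrightarrow> module R N \<Longrightarrow> bilin R M N (tensor R M N) (tens R M N)"
  using tens_bilinear[of R M N] tensor_smult_tens[of R M N]
  by (intro bilinI linear_mapsI) (auto simp: bilinear_map_def dest: module.smult_closed)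

context
  fixes R :: "('k, 'r) ring_scheme" and M :: "('k, 'm, 'x) module_scheme"
    and N :: "('k, 'n, 'y) module_scheme" and P :: "('k, 'p, 'z) module_scheme"
  assumes M: "module R M" and N: "module R N" and P: "module R P"
begin

interpretation M: module R M by (rule M)
interpretation N: module R N by (rule N)
interpretation P: module R P by (rule P)

lemma tsum_pure: "bilin R M N P f \<Longrightarrow> x \<in> carrier M \<Longrightarrow> y \<in> carrier N \<Longrightarrow> tsum P (tens R M N x y) f = f x y"
  by (rule tsum_tens[OF M N P.abelian_group_axioms bilin_bilinear])

lemma tsum_lin: "bilin R M N P f \<Longrightarrow> (\<lambda>t. tsum P t f) \<in> linear_maps R (tensor R M N) P"
proof (rule linear_mapsI)
  assume f: "bilin R M N P f"
  note f' = bilin_bilinear[OF f]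
  show "tsum P t f \<in> carrier P" if "t \<in> carrier (tensor R M N)" for t
    by (rule tsum_closed'[OF M N P.abelian_group_axioms f' that])
  show ad: "tsum P (s \<oplus>\<^bsub>tensor R M N\<^esub> t) f = tsum P s f \<oplus>\<^bsub>P\<^esub> tsum P t f"
    if "s \<in> carrier (tensor R M N)" "t \<in> carrier (tensor R M N)" for s t
    by (rule tsum_add'[OF M N P.abelian_group_axioms f' that])
  fix r t assume r: "r \<in> carrier R" and t: "t \<in> carrier (tensor R M N)"
  interpret T: module R "tensor R M N" by (rule tensor_module[OF M N])
  show "tsum P (r \<odot>\<^bsub>tensor R M N\<^esub> t) f = r \<odot>\<^bsub>P\<^esub> tsum P t f"
    using M N t
  proof (induction rule: tensor_induct)
    case (tens x y)
    then show ?case using r f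
      by (simp add: tensor_smult_tens[OF M N] tsum_pure[OF f] lin_smult[OF bilin_l[OF f]])
  next
    case (add s t)
    then show ?case using r
      by (simp add: T.smult_r_distr ad P.smult_r_distr tsum_closed'[OF M N P.abelian_group_axioms f'])
  qed
qed

lemma tsum_closed: "bilin R M N P f \<Longrightarrow> t \<in> carrier (tensor R M N) \<Longrightarrow> tsum P t f \<in> carrier P"
  by (rule lin_closed[OF tsum_lin])

lemma tensor_lin_eqI:
  assumes "f \<in> linear_maps R (tensor R M N) P" "g \<in> linear_maps R (tensor R M N) P"
    and "\<And>x y. x \<in> carrier M \<Longrightarrow> y \<in> carrier N \<Longrightarrow> f (tens R M N x y) = g (tens R M N x y)"
    and "t \<in> carrier (tensor R M N)"
  shows "f t = g t"
  using M N assms(4) by (induction rule: tensor_induct) (auto simp: assms(3) lin_add[OF assms(1)] lin_add[OF assms(2)])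

lemma tsum_cong:
  assumes f: "bilin R M N P f" and eq: "\<And>x y. x \<in> carrier M \<Longrightarrow> y \<in> carrier N \<Longrightarrow> f x y = g x y"
    and t: "t \<in> carrier (tensor R M N)"
  shows "tsum P t f = tsum P t g"
proof -
  have g: "bilin R M N P g" using f bilin_cong[OF M N, of f g] eq by blast
  show ?thesis
    by (rule tensor_lin_eqI[OF tsum_lin[OF f] tsum_lin[OF g] _ t])
      (simp add: tsum_pure[OF f] tsum_pure[OF g] eq)
qed

lemma tsum_map:
  assumes Q: "module R Q" and f: "bilin R M N P f" and g: "g \<in> linear_maps R P Q"
    and t: "t \<in> carrier (tensor R M N)"
  shows "g (tsum P t f) = tsum Q t (\<lambda>x y. g (f x y))"
proof -
  interpret Q: module R Q by (rule Q)
  have gf: "bilin R M N Q (\<lambda>x y. g (f x y))"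
    by (intro bilinI lin_comp[OF g]) (use f in \<open>auto simp: bilin_def\<close>)
  note * = tsum_lin[OF f] and ** = bilin_bilinear[OF gf]
  show ?thesis using M N t
  proof (induction rule: tensor_induct)
    case (tens x y)
    then show ?case by (simp add: tsum_pure[OF f] tsum_tens[OF M N Q.abelian_group_axioms **])
  next
    case (add s t)
    then show ?case
      by (simp add: lin_add[OF *] lin_add[OF g] lin_closed[OF *] tsum_add'[OF M N Q.abelian_group_axioms **])
  qed
qed

text \<open>Linearity in a parameter of the summand instead of in the tensor. The conclusion
  concerns all q at once, and the induction over \<open>t\<close> carries it as a whole.\<close>

lemma lin_tsum_body:
  assumes Q: "module R Q"
    and F1: "\<And>q. q \<in> carrier Q \<Longrightarrow> bilin R M N P (F q)"
    and F2: "\<And>x y. x \<in> carrier M \<Longrightarrow> y \<in> carrier N \<Longrightarrow> (\<lambda>q. F q x y) \<in> linear_maps R Q P"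
    and t: "t \<in> carrier (tensor R M N)"
  shows "(\<lambda>q. tsum P t (F q)) \<in> linear_maps R Q P"
proof -
  interpret Q: module R Q by (rule Q)
  note l = tsum_lin[OF F1]
  show ?thesis using M N t
  proof (induction rule: tensor_induct)
    case (tens x y)
    have "(\<lambda>q. tsum P (tens R M N x y) (F q)) \<in> linear_maps R Q P \<longleftrightarrow> (\<lambda>q. F q x y) \<in> linear_maps R Q P"
      by (rule lin_cong[OF Q]) (simp add: tsum_pure[OF F1] tens)
    then show ?case using F2 tens by simp
  next
    case (add s t)
    have "(\<lambda>q. tsum P (s \<oplus>\<^bsub>tensor R M N\<^esub> t) (F q)) \<in> linear_maps R Q P \<longleftrightarrow>
      (\<lambda>q. tsum P s (F q) \<oplus>\<^bsub>P\<^esub> tsum P t (F q)) \<in> linear_maps R Q P"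
      by (rule lin_cong[OF Q]) (simp add: lin_add[OF l] add)
    moreover have "(\<lambda>q. tsum P s (F q) \<oplus>\<^bsub>P\<^esub> tsum P t (F q)) \<in> linear_maps R Q P"
      by (rule lin_sum[OF P add(3,4)])
    ultimately show ?case by simp
  qed
qed

end

lemma lin_tsum_arg:
  assumes "module R M" "module R N" "module R P" "bilin R M N P F" "t \<in> linear_maps R Q (tensor R M N)"
  shows "(\<lambda>q. tsum P (t q) F) \<in> linear_maps R Q P"
  by (rule lin_comp[OF tsum_lin[OF assms(1-4)] assms(5)])

text \<open>Both sides are linear in \<open>s\<close>. For a pure tensor \<open>s\<close> each of
  them is the single sum over \<open>t\<close>.\<close>

lemma tsum_swap:
  assumes M: "module R M" and N: "module R N" and P: "module R P" and M': "module R M'" and N': "module R N'"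
    and F1: "\<And>x y. x \<in> carrier M \<Longrightarrow> y \<in> carrier N \<Longrightarrow> bilin R M' N' P (F x y)"
    and F2: "\<And>u v. u \<in> carrier M' \<Longrightarrow> v \<in> carrier N' \<Longrightarrow> bilin R M N P (\<lambda>x y. F x y u v)"
    and s: "s \<in> carrier (tensor R M N)" and t: "t \<in> carrier (tensor R M' N')"
  shows "tsum P s (\<lambda>x y. tsum P t (F x y)) = tsum P t (\<lambda>u v. tsum P s (\<lambda>x y. F x y u v))"
proof -
  have a: "bilin R M N P (\<lambda>x y. tsum P t (F x y))"
  proof (rule bilinI)
    show "(\<lambda>y. tsum P t (F x y)) \<in> linear_maps R N P" if x: "x \<in> carrier M" for x
      by (rule lin_tsum_body[OF M' N' P N F1[OF x] _ t], assumption) (rule bilin_r[OF F2 x])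
    show "(\<lambda>x. tsum P t (F x y)) \<in> linear_maps R M P" if y: "y \<in> carrier N" for y
      by (rule lin_tsum_body[OF M' N' P M F1[OF _ y] _ t], assumption) (rule bilin_l[OF F2 y])
  qed
  have b: "bilin R M' N' P (\<lambda>u v. tsum P s (\<lambda>x y. F x y u v))" if s: "s \<in> carrier (tensor R M N)" for s
  proof (rule bilinI)
    show "(\<lambda>v. tsum P s (\<lambda>x y. F x y u v)) \<in> linear_maps R N' P" if u: "u \<in> carrier M'" for u
      by (rule lin_tsum_body[OF M N P N' F2[OF u] _ s], assumption) (rule bilin_r[OF F1 u])
    show "(\<lambda>u. tsum P s (\<lambda>x y. F x y u v)) \<in> linear_maps R M' P" if v: "v \<in> carrier N'" for v
      by (rule lin_tsum_body[OF M N P M' F2[OF _ v] _ s], assumption) (rule bilin_l[OF F1 v])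
  qed
  let ?g = "\<lambda>s. tsum P t (\<lambda>u v. tsum P s (\<lambda>x y. F x y u v))"
  have "?g \<in> linear_maps R (tensor R M N) P"
    by (rule lin_tsum_body[OF M' N' P tensor_module[OF M N] _ _ t])
       (auto intro!: b tsum_lin M N P F2)
  then show ?thesis
  proof (rule tensor_lin_eqI[OF M N P tsum_lin[OF M N P a] _ _ s])
    fix x y assume xy: "x \<in> carrier M" "y \<in> carrier N"
    have "tsum P t (F x y) = ?g (tens R M N x y)"
      by (rule tsum_cong[OF M' N' P F1[OF xy] _ t]) (simp add: tsum_pure[OF M N P F2] xy)
    then show "tsum P (tens R M N x y) (\<lambda>x y. tsum P t (F x y)) = ?g (tens R M N x y)"
      by (simp add: tsum_pure[OF M N P a] xy)
  qed
qed

lemma lin_mult_left: "assoc_algebra R X \<Longrightarrow> a \<in> carrier X \<Longrightarrow> f \<in> linear_maps R M X \<Longrightarrow>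
    (\<lambda>x. a \<otimes>\<^bsub>X\<^esub> f x) \<in> linear_maps R M X"
proof -
  assume "assoc_algebra R X" and a: "a \<in> carrier X" and f: "f \<in> linear_maps R M X"
  interpret X: assoc_algebra R X by fact
  show ?thesis using lin_closed[OF f] a
    by (intro linear_mapsI) (auto simp: lin_add[OF f] lin_smult[OF f] X.r_distr X.smult_mult_right)
qed

lemma lin_mult_right: "assoc_algebra R X \<Longrightarrow> a \<in> carrier X \<Longrightarrow> f \<in> linear_maps R M X \<Longrightarrow>
    (\<lambda>x. f x \<otimes>\<^bsub>X\<^esub> a) \<in> linear_maps R M X"
proof -
  assume "assoc_algebra R X" and a: "a \<in> carrier X" and f: "f \<in> linear_maps R M X"
  interpret X: assoc_algebra R X by fact
  show ?thesis using lin_closed[OF f] a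
    by (intro linear_mapsI) (auto simp: lin_add[OF f] lin_smult[OF f] X.l_distr X.smult_mult_left)
qed

lemma bilin_mult: "assoc_algebra R X \<Longrightarrow> f \<in> linear_maps R M X \<Longrightarrow> g \<in> linear_maps R N X \<Longrightarrow>
    bilin R M N X (\<lambda>x y. f x \<otimes>\<^bsub>X\<^esub> g y)"
  by (intro bilinI lin_mult_left lin_mult_right) (auto simp: lin_closed)

lemma lin_functional:
  assumes "module R X" "e \<in> linear_maps R M (base_algebra R)" "a \<in> carrier X"
  shows "(\<lambda>x. e x \<odot>\<^bsub>X\<^esub> a) \<in> linear_maps R M X"
proof -
  interpret X: module R X by fact
  note e = assms(2)
  have c: "e x \<in> carrier R" if "x \<in> carrier M" for x
    using lin_closed[OF e that] by (simp add: base_algebra_def)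
  show ?thesis using c assms(3) lin_add[OF e] lin_smult[OF e]
    by (intro linear_mapsI) (auto simp: X.smult_l_distr X.smult_assoc1 base_algebra_def)
qed

lemma lin_functional2:
  assumes "module R X" "r \<in> carrier R" "f \<in> linear_maps R M X"
  shows "(\<lambda>x. r \<odot>\<^bsub>X\<^esub> f x) \<in> linear_maps R M X"
proof -
  interpret X: module R X by fact
  note f = assms(3)
  show ?thesis using lin_closed[OF f] assms(2)
    by (intro linear_mapsI) (auto simp: lin_add[OF f] lin_smult[OF f] X.smult_r_distr X.smult_assoc1[symmetric] X.R.m_comm)
qed

lemma assoc_algebra_module: "assoc_algebra R X \<Longrightarrow> module R X"
  by (simp add: assoc_algebra_def)

definition trilin where
  "trilin R M N Q P f \<longleftrightarrow> (\<forall>x\<in>carrier M. bilin R N Q P (f x)) \<and>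
     (\<forall>y\<in>carrier N. \<forall>z\<in>carrier Q. (\<lambda>x. f x y z) \<in> linear_maps R M P)"

lemma trilinI:
  assumes "\<And>x y. x \<in> carrier M \<Longrightarrow> y \<in> carrier N \<Longrightarrow> f x y \<in> linear_maps R Q P"
    and "\<And>x z. x \<in> carrier M \<Longrightarrow> z \<in> carrier Q \<Longrightarrow> (\<lambda>y. f x y z) \<in> linear_maps R N P"
    and "\<And>y z. y \<in> carrier N \<Longrightarrow> z \<in> carrier Q \<Longrightarrow> (\<lambda>x. f x y z) \<in> linear_maps R M P"
  shows "trilin R M N Q P f"
  using assms by (auto simp: trilin_def bilin_def)

lemma trilinD:
  assumes "trilin R M N Q P f"
  shows "x \<in> carrier M \<Longrightarrow> bilin R N Q P (f x)"
    and "y \<in> carrier N \<Longrightarrow> bilin R M Q P (\<lambda>x. f x y)"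
    and "z \<in> carrier Q \<Longrightarrow> bilin R M N P (\<lambda>x y. f x y z)"
    and "x \<in> carrier M \<Longrightarrow> y \<in> carrier N \<Longrightarrow> f x y \<in> linear_maps R Q P"
    and "x \<in> carrier M \<Longrightarrow> z \<in> carrier Q \<Longrightarrow> (\<lambda>y. f x y z) \<in> linear_maps R N P"
    and "y \<in> carrier N \<Longrightarrow> z \<in> carrier Q \<Longrightarrow> (\<lambda>x. f x y z) \<in> linear_maps R M P"
  using assms by (auto simp: trilin_def bilin_def)

text \<open>The hypothesis \<open>eq\<close> is coassociativity in the form of the definitions, an
  identity in M \<otimes> (N \<otimes> Q). The linear map that \<open>f\<close> induces there turns
  it into a rule for arbitrary trilinear summands. M = N = Q = C gives the comultiplication, M = B
  and N = Q = H the coaction.\<close>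

lemma coassoc_transfer:
  assumes M: "module R M" and N: "module R N" and Q: "module R Q" and P: "module R P"
    and u: "u \<in> linear_maps R M (tensor R M N)" and v: "v \<in> linear_maps R Q (tensor R N Q)"
    and s: "s \<in> carrier (tensor R M Q)"
    and eq: "tsum (tensor R M (tensor R N Q)) s (\<lambda>x h. tsum (tensor R M (tensor R N Q)) (u x)
          (\<lambda>x0 x1. tens R M (tensor R N Q) x0 (tens R N Q x1 h)))
      = tsum (tensor R M (tensor R N Q)) s (\<lambda>x h. tens R M (tensor R N Q) x (v h))"
    and f: "trilin R M N Q P f"
  shows "tsum P s (\<lambda>x h. tsum P (u x) (\<lambda>x0 x1. f x0 x1 h)) = tsum P s (\<lambda>x h. tsum P (v h) (f x))"
proof -
  note NQ = tensor_module[OF N Q]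
  note MNQ = tensor_module[OF M NQ]
  let ?T = "tensor R M (tensor R N Q)"
  have Fb: "bilin R M (tensor R N Q) P (\<lambda>x r. tsum P r (f x))"
  proof (rule bilinI)
    show "(\<lambda>r. tsum P r (f x)) \<in> linear_maps R (tensor R N Q) P" if "x \<in> carrier M" for x
      by (rule tsum_lin[OF N Q P trilinD(1)[OF f that]])
    show "(\<lambda>x. tsum P r (f x)) \<in> linear_maps R M P" if "r \<in> carrier (tensor R N Q)" for r
      by (rule lin_tsum_body[OF N Q P M trilinD(1)[OF f] _ that], assumption) (rule trilinD(6)[OF f])
  qed
  let ?F = "\<lambda>t. tsum P t (\<lambda>x r. tsum P r (f x))"
  have Fl: "?F \<in> linear_maps R ?T P" by (rule tsum_lin[OF M NQ P Fb])
  note tb = tens_bilin[OF M NQ] and tNQ = tens_bilin[OF N Q]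
  have b1: "bilin R M N ?T (\<lambda>x0 x1. tens R M (tensor R N Q) x0 (tens R N Q x1 h))" if "h \<in> carrier Q" for h
  proof (rule bilinI)
    show "(\<lambda>x1. tens R M (tensor R N Q) x (tens R N Q x1 h)) \<in> linear_maps R N ?T" if "x \<in> carrier M" for x
      by (rule lin_comp[OF bilin_r[OF tb that] bilin_l[OF tNQ]]) fact
    show "(\<lambda>x0. tens R M (tensor R N Q) x0 (tens R N Q y h)) \<in> linear_maps R M ?T" if "y \<in> carrier N" for y
      by (rule bilin_l[OF tb bilin_closed[OF tNQ that]]) fact
  qed
  have b2: "bilin R M Q ?T (\<lambda>x h. tsum ?T (u x) (\<lambda>x0 x1. tens R M (tensor R N Q) x0 (tens R N Q x1 h)))"
  proof (rule bilinI)
    show "(\<lambda>x. tsum ?T (u x) (\<lambda>x0 x1. tens R M (tensor R N Q) x0 (tens R N Q x1 h))) \<in> linear_maps R M ?T"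
      if "h \<in> carrier Q" for h
      by (rule lin_tsum_arg[OF M N MNQ b1[OF that] u])
    show "(\<lambda>h. tsum ?T (u x) (\<lambda>x0 x1. tens R M (tensor R N Q) x0 (tens R N Q x1 h))) \<in> linear_maps R Q ?T"
      if "x \<in> carrier M" for x
    proof (rule lin_tsum_body[OF M N MNQ Q b1 _ lin_closed[OF u that]], assumption)
      fix x0 x1 assume "x0 \<in> carrier M" "x1 \<in> carrier N"
      then show "(\<lambda>h. tens R M (tensor R N Q) x0 (tens R N Q x1 h)) \<in> linear_maps R Q ?T"
        by (intro lin_comp[OF bilin_r[OF tb] bilin_r[OF tNQ]])
    qed
  qed
  have b3: "bilin R M Q ?T (\<lambda>x h. tens R M (tensor R N Q) x (v h))"
    by (rule bilinI) (auto intro: lin_comp[OF bilin_r[OF tb] v] bilin_l[OF tb] lin_closed[OF v])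
  have "tsum P s (\<lambda>x h. tsum P (u x) (\<lambda>x0 x1. f x0 x1 h)) = tsum P s (\<lambda>x h. ?F (tsum ?T (u x)
      (\<lambda>x0 x1. tens R M (tensor R N Q) x0 (tens R N Q x1 h))))"
  proof (rule sym, rule tsum_cong[OF M Q P _ _ s])
    show "bilin R M Q P (\<lambda>x h. ?F (tsum ?T (u x) (\<lambda>x0 x1. tens R M (tensor R N Q) x0 (tens R N Q x1 h))))"
      using lin_comp[OF Fl bilin_r[OF b2]] lin_comp[OF Fl bilin_l[OF b2]] by (intro bilinI)
    fix x h assume x: "x \<in> carrier M" and h: "h \<in> carrier Q"
    have "?F (tsum ?T (u x) (\<lambda>x0 x1. tens R M (tensor R N Q) x0 (tens R N Q x1 h)))
      = tsum P (u x) (\<lambda>x0 x1. ?F (tens R M (tensor R N Q) x0 (tens R N Q x1 h)))"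
      by (rule tsum_map[OF M N MNQ P b1[OF h] Fl lin_closed[OF u x]])
    also have "\<dots> = tsum P (u x) (\<lambda>x0 x1. f x0 x1 h)"
    proof (rule tsum_cong[OF M N P _ _ lin_closed[OF u x]])
      show "bilin R M N P (\<lambda>x0 x1. ?F (tens R M (tensor R N Q) x0 (tens R N Q x1 h)))"
        using lin_comp[OF Fl bilin_r[OF b1[OF h]]] lin_comp[OF Fl bilin_l[OF b1[OF h]]] by (intro bilinI)
    qed (simp add: tsum_pure[OF M NQ P Fb] tsum_pure[OF N Q P trilinD(1)[OF f]] bilin_closed[OF tNQ] h)
    finally show "?F (tsum ?T (u x) (\<lambda>x0 x1. tens R M (tensor R N Q) x0 (tens R N Q x1 h)))
      = tsum P (u x) (\<lambda>x0 x1. f x0 x1 h)" .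
  qed
  also have "\<dots> = ?F (tsum ?T s (\<lambda>x h. tsum ?T (u x)
      (\<lambda>x0 x1. tens R M (tensor R N Q) x0 (tens R N Q x1 h))))"
    by (rule tsum_map[OF M Q MNQ P b2 Fl s, symmetric])
  also have "\<dots> = ?F (tsum ?T s (\<lambda>x h. tens R M (tensor R N Q) x (v h)))"
    by (simp only: eq)
  also have "\<dots> = tsum P s (\<lambda>x h. ?F (tens R M (tensor R N Q) x (v h)))"
    by (rule tsum_map[OF M Q MNQ P b3 Fl s])
  also have "\<dots> = tsum P s (\<lambda>x h. tsum P (v h) (f x))"
  proof (rule tsum_cong[OF M Q P _ _ s])
    show "bilin R M Q P (\<lambda>x h. ?F (tens R M (tensor R N Q) x (v h)))"
      using lin_comp[OF Fl bilin_r[OF b3]] lin_comp[OF Fl bilin_l[OF b3]] by (intro bilinI)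
  qed (simp add: tsum_pure[OF M NQ P Fb] lin_closed[OF v])
  finally show ?thesis .
qed

section \<open>Convolution algebras\<close>

context coalgebra
begin

lemma comult_closed [simp]: "c \<in> carrier C \<Longrightarrow> comult C c \<in> carrier (tensor R C C)"
  by (rule lin_closed[OF comult_linear])

lemma counit_closed [simp]: "c \<in> carrier C \<Longrightarrow> counit C c \<in> carrier R"
  using lin_closed[OF counit_linear] by (simp add: base_algebra_def)

lemmas mC = module_axioms

lemma coassoc_tsum:
  assumes P: "module R P" and f: "trilin R C C C P f" and c: "c \<in> carrier C"
  shows "tsum P (comult C c) (\<lambda>x y. tsum P (comult C x) (\<lambda>x1 x2. f x1 x2 y)) =
    tsum P (comult C c) (\<lambda>x y. tsum P (comult C y) (f x))"
  by (rule coassoc_transfer[OF mC mC mC P comult_linear comult_linear comult_closed[OF c] coassoc[OF c] f])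

lemma sw_counit_left:
  assumes P: "module R P" and f: "f \<in> linear_maps R C P" and c: "c \<in> carrier C"
  shows "tsum P (comult C c) (\<lambda>x y. counit C x \<odot>\<^bsub>P\<^esub> f y) = f c"
proof -
  have b: "bilin R C C C (\<lambda>x y. counit C x \<odot>\<^bsub>C\<^esub> y)"
    by (intro bilinI lin_functional[OF mC counit_linear] lin_functional2[OF mC _ lin_id]) auto
  have "f c = tsum P (comult C c) (\<lambda>x y. f (counit C x \<odot>\<^bsub>C\<^esub> y))"
    using tsum_map[OF mC mC mC P b f comult_closed[OF c]] counit_left[OF c] by simp
  also have "\<dots> = tsum P (comult C c) (\<lambda>x y. counit C x \<odot>\<^bsub>P\<^esub> f y)"
  proof (rule tsum_cong[OF mC mC P _ _ comult_closed[OF c]])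
    show "bilin R C C P (\<lambda>x y. f (counit C x \<odot>\<^bsub>C\<^esub> y))"
      using lin_comp[OF f bilin_r[OF b]] lin_comp[OF f bilin_l[OF b]] by (intro bilinI)
  qed (simp add: lin_smult[OF f])
  finally show ?thesis by simp
qed

lemma sw_counit_right:
  assumes P: "module R P" and f: "f \<in> linear_maps R C P" and c: "c \<in> carrier C"
  shows "tsum P (comult C c) (\<lambda>x y. counit C y \<odot>\<^bsub>P\<^esub> f x) = f c"
proof -
  have b: "bilin R C C C (\<lambda>x y. counit C y \<odot>\<^bsub>C\<^esub> x)"
    by (intro bilinI lin_functional[OF mC counit_linear] lin_functional2[OF mC _ lin_id]) auto
  have "f c = tsum P (comult C c) (\<lambda>x y. f (counit C y \<odot>\<^bsub>C\<^esub> x))"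
    using tsum_map[OF mC mC mC P b f comult_closed[OF c]] counit_right[OF c] by simp
  also have "\<dots> = tsum P (comult C c) (\<lambda>x y. counit C y \<odot>\<^bsub>P\<^esub> f x)"
  proof (rule tsum_cong[OF mC mC P _ _ comult_closed[OF c]])
    show "bilin R C C P (\<lambda>x y. f (counit C y \<odot>\<^bsub>C\<^esub> x))"
      using lin_comp[OF f bilin_r[OF b]] lin_comp[OF f bilin_l[OF b]] by (intro bilinI)
  qed (simp add: lin_smult[OF f])
  finally show ?thesis by simp
qed

abbreviation L where "L X \<equiv> conv_algebra R C X"

lemma L_carrier: "f \<in> carrier (L X) \<longleftrightarrow> f \<in> linear_maps R C X \<and> f \<in> extensional (carrier C)"
  by (simp add: conv_algebra_def)

lemma L_lin: "f \<in> carrier (L X) \<Longrightarrow> f \<in> linear_maps R C X"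
  by (simp add: L_carrier)

lemma L_closed: "f \<in> carrier (L X) \<Longrightarrow> c \<in> carrier C \<Longrightarrow> f c \<in> carrier X"
  by (meson L_lin lin_closed)

lemma L_eqI:
  assumes "f \<in> carrier (L X)" "g \<in> carrier (L X)" "\<And>c. c \<in> carrier C \<Longrightarrow> f c = g c"
  shows "f = g"
  using assms by (auto simp: L_carrier intro: extensionalityI)

lemma L_I: "f \<in> linear_maps R C X \<Longrightarrow> (\<lambda>c\<in>carrier C. f c) \<in> carrier (L X)"
  using lin_cong[OF mC, of "\<lambda>c\<in>carrier C. f c" f X] by (simp add: L_carrier)

lemma L_mult: "c \<in> carrier C \<Longrightarrow>
    (f \<otimes>\<^bsub>L X\<^esub> g) c = tsum X (comult C c) (\<lambda>x y. f x \<otimes>\<^bsub>X\<^esub> g y)"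
  by (simp add: conv_algebra_def convolution_def)

lemma L_one: "c \<in> carrier C \<Longrightarrow> \<one>\<^bsub>L X\<^esub> c = counit C c \<odot>\<^bsub>X\<^esub> \<one>\<^bsub>X\<^esub>"
  by (simp add: conv_algebra_def)

lemma L_zero: "c \<in> carrier C \<Longrightarrow> \<zero>\<^bsub>L X\<^esub> c = \<zero>\<^bsub>X\<^esub>"
  by (simp add: conv_algebra_def)

lemma L_add: "c \<in> carrier C \<Longrightarrow> (f \<oplus>\<^bsub>L X\<^esub> g) c = f c \<oplus>\<^bsub>X\<^esub> g c"
  by (simp add: conv_algebra_def)

lemma L_smult: "c \<in> carrier C \<Longrightarrow> (r \<odot>\<^bsub>L X\<^esub> g) c = r \<odot>\<^bsub>X\<^esub> g c"
  by (simp add: conv_algebra_def)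

lemma L_bilin: "assoc_algebra R X \<Longrightarrow> f \<in> carrier (L X) \<Longrightarrow> g \<in> carrier (L X) \<Longrightarrow>
    bilin R C C X (\<lambda>x y. f x \<otimes>\<^bsub>X\<^esub> g y)"
  by (intro bilin_mult L_lin)

lemma L_mult_closed:
  assumes X: "assoc_algebra R X" and f: "f \<in> carrier (L X)" and g: "g \<in> carrier (L X)"
  shows "f \<otimes>\<^bsub>L X\<^esub> g \<in> carrier (L X)"
  using L_I[OF lin_tsum_arg[OF mC mC assoc_algebra_module[OF X] L_bilin[OF X f g] comult_linear]]
  by (simp add: conv_algebra_def convolution_def)

lemma L_one_closed: "assoc_algebra R X \<Longrightarrow> \<one>\<^bsub>L X\<^esub> \<in> carrier (L X)"
  unfolding conv_algebra_def monoid.simps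
  by (rule L_I[unfolded conv_algebra_def], rule lin_functional[OF assoc_algebra_module counit_linear])
    (auto simp: assoc_algebra_def ring_def monoid.one_closed)

text \<open>Associativity of convolution is coassociativity for the summand f(x) g(y) k(z), and the
  unit laws are the counit laws. Distributivity follows from \<open>lin_tsum_body\<close>, since
  evaluation at a point is linear.\<close>

lemma L_assoc_algebra:
  assumes X: "assoc_algebra R X"
  shows "assoc_algebra R (L X)"
proof -
  interpret X: assoc_algebra R X by (rule X)
  note mX = assoc_algebra_module[OF X]
  have addcl: "f \<oplus>\<^bsub>L X\<^esub> g \<in> carrier (L X)" if "f \<in> carrier (L X)" "g \<in> carrier (L X)" for f g
    using L_I[OF lin_sum[OF mX L_lin[OF that(1)] L_lin[OF that(2)]]] by (simp add: conv_algebra_def)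
  have smcl: "r \<odot>\<^bsub>L X\<^esub> f \<in> carrier (L X)" if "r \<in> carrier R" "f \<in> carrier (L X)" for r f
    using L_I[OF lin_functional2[OF mX that(1) L_lin[OF that(2)]]] by (simp add: conv_algebra_def)
  have "(\<lambda>c. \<zero>\<^bsub>X\<^esub>) \<in> linear_maps R C X"
    by (rule linear_mapsI) auto
  then have zcl: "\<zero>\<^bsub>L X\<^esub> \<in> carrier (L X)"
    using L_I by (fastforce simp: conv_algebra_def)
  note mcl = L_mult_closed[OF X] and ocl = L_one_closed[OF X]
  note cl = addcl smcl zcl mcl ocl L_closed
  note ap = L_add L_smult L_zero L_one
  have ab: "abelian_group (L X)"
  proof (rule abelian_groupI)
    fix f assume f: "f \<in> carrier (L X)"
    have "\<ominus>\<^bsub>R\<^esub> \<one>\<^bsub>R\<^esub> \<odot>\<^bsub>L X\<^esub> f \<oplus>\<^bsub>L X\<^esub> f = \<zero>\<^bsub>L X\<^esub>"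
      by (rule L_eqI[of _ X]) (auto simp: f cl ap X.smult_l_minus X.l_neg)
    then show "\<exists>g\<in>carrier (L X). g \<oplus>\<^bsub>L X\<^esub> f = \<zero>\<^bsub>L X\<^esub>" using f smcl by force
  next
    fix f g k assume "f \<in> carrier (L X)" "g \<in> carrier (L X)" "k \<in> carrier (L X)"
    then show "f \<oplus>\<^bsub>L X\<^esub> g \<oplus>\<^bsub>L X\<^esub> k = f \<oplus>\<^bsub>L X\<^esub> (g \<oplus>\<^bsub>L X\<^esub> k)"
      by (intro L_eqI[of _ X]) (auto simp: cl ap X.a_assoc)
  next
    fix f g assume "f \<in> carrier (L X)" "g \<in> carrier (L X)"
    then show "f \<oplus>\<^bsub>L X\<^esub> g = g \<oplus>\<^bsub>L X\<^esub> f"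
      by (intro L_eqI[of _ X]) (auto simp: cl ap X.a_comm)
  next
    fix f assume "f \<in> carrier (L X)"
    then show "\<zero>\<^bsub>L X\<^esub> \<oplus>\<^bsub>L X\<^esub> f = f"
      by (intro L_eqI[of _ X]) (auto simp: cl ap)
  qed (use cl in auto)
  have mod: "module R (L X)"
    by (rule moduleI[OF R.cring_axioms ab])
      (auto intro!: L_eqI[of _ X] simp: cl ap X.smult_l_distr X.smult_r_distr X.smult_assoc1)
  interpret LX: module R "L X" by (rule mod)
  have ev: "(\<lambda>f. f c) \<in> linear_maps R (L X) X" if "c \<in> carrier C" for c
    by (rule linear_mapsI) (auto simp: ap that cl)
  have distr: "bilin R (L X) (L X) (L X) (\<lambda>f g. f \<otimes>\<^bsub>L X\<^esub> g)"
  proof -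
    have 1: "(\<lambda>g. tsum X (comult C c) (\<lambda>x y. f x \<otimes>\<^bsub>X\<^esub> g y)) \<in> linear_maps R (L X) X"
      if "f \<in> carrier (L X)" "c \<in> carrier C" for f c
      using lin_mult_left[OF X L_closed[OF that(1)] ev]
      by (intro lin_tsum_body[OF mC mC mX mod L_bilin[OF X that(1)] _ comult_closed[OF that(2)]]) auto
    have 2: "(\<lambda>f. tsum X (comult C c) (\<lambda>x y. f x \<otimes>\<^bsub>X\<^esub> g y)) \<in> linear_maps R (L X) X"
      if "g \<in> carrier (L X)" "c \<in> carrier C" for g c
      using lin_mult_right[OF X L_closed[OF that(1)] ev]
      by (intro lin_tsum_body[OF mC mC mX mod L_bilin[OF X _ that(1)] _ comult_closed[OF that(2)]]) auto
    show ?thesis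
      by (intro bilinI linear_mapsI L_eqI[of _ X])
        (simp_all add: cl L_mult ap lin_add[OF 1] lin_add[OF 2] lin_smult[OF 1] lin_smult[OF 2])
  qed
  have assoc: "f \<otimes>\<^bsub>L X\<^esub> g \<otimes>\<^bsub>L X\<^esub> k = f \<otimes>\<^bsub>L X\<^esub> (g \<otimes>\<^bsub>L X\<^esub> k)"
    if f: "f \<in> carrier (L X)" and g: "g \<in> carrier (L X)" and k: "k \<in> carrier (L X)" for f g k
  proof (rule L_eqI[of _ X])
    fix c assume c: "c \<in> carrier C"
    note D = comult_closed[OF c]
    have tri: "trilin R C C C X (\<lambda>x1 x2 y. f x1 \<otimes>\<^bsub>X\<^esub> g x2 \<otimes>\<^bsub>X\<^esub> k y)"
      by (intro trilinI lin_mult_left[OF X] lin_mult_right[OF X] L_lin[OF f] L_lin[OF g] L_lin[OF k] X.m_closed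
          L_closed[OF f] L_closed[OF g] L_closed[OF k])
    have "(f \<otimes>\<^bsub>L X\<^esub> g \<otimes>\<^bsub>L X\<^esub> k) c = tsum X (comult C c) (\<lambda>x y. (f \<otimes>\<^bsub>L X\<^esub> g) x \<otimes>\<^bsub>X\<^esub> k y)"
      by (simp add: L_mult c)
    also have "\<dots> = tsum X (comult C c) (\<lambda>x y. tsum X (comult C x) (\<lambda>x1 x2. f x1 \<otimes>\<^bsub>X\<^esub> g x2 \<otimes>\<^bsub>X\<^esub> k y))"
    proof (rule tsum_cong[OF mC mC mX L_bilin[OF X mcl[OF f g] k] _ D])
      fix x y assume x: "x \<in> carrier C" and y: "y \<in> carrier C"
      show "(f \<otimes>\<^bsub>L X\<^esub> g) x \<otimes>\<^bsub>X\<^esub> k y = tsum X (comult C x) (\<lambda>x1 x2. f x1 \<otimes>\<^bsub>X\<^esub> g x2 \<otimes>\<^bsub>X\<^esub> k y)"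
        using tsum_map[OF mC mC mX mX L_bilin[OF X f g] lin_mult_right[OF X L_closed[OF k y] lin_id] comult_closed[OF x]]
        by (simp add: L_mult x)
    qed
    also have "\<dots> = tsum X (comult C c) (\<lambda>x y. tsum X (comult C y) (\<lambda>y1 y2. f x \<otimes>\<^bsub>X\<^esub> g y1 \<otimes>\<^bsub>X\<^esub> k y2))"
      by (rule coassoc_tsum[OF mX tri c])
    also have "\<dots> = tsum X (comult C c) (\<lambda>x y. f x \<otimes>\<^bsub>X\<^esub> (g \<otimes>\<^bsub>L X\<^esub> k) y)"
    proof (rule sym, rule tsum_cong[OF mC mC mX L_bilin[OF X f mcl[OF g k]] _ D])
      fix x y assume x: "x \<in> carrier C" and y: "y \<in> carrier C"
      have "f x \<otimes>\<^bsub>X\<^esub> (g \<otimes>\<^bsub>L X\<^esub> k) y = tsum X (comult C y) (\<lambda>y1 y2. f x \<otimes>\<^bsub>X\<^esub> (g y1 \<otimes>\<^bsub>X\<^esub> k y2))"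
        using tsum_map[OF mC mC mX mX L_bilin[OF X g k] lin_mult_left[OF X L_closed[OF f x] lin_id] comult_closed[OF y]]
        by (simp add: L_mult y)
      also have "\<dots> = tsum X (comult C y) (\<lambda>y1 y2. f x \<otimes>\<^bsub>X\<^esub> g y1 \<otimes>\<^bsub>X\<^esub> k y2)"
        by (rule sym, rule tsum_cong[OF mC mC mX trilinD(1)[OF tri x] _ comult_closed[OF y]])
          (simp add: X.m_assoc x L_closed[OF f] L_closed[OF g] L_closed[OF k])
      finally show "f x \<otimes>\<^bsub>X\<^esub> (g \<otimes>\<^bsub>L X\<^esub> k) y = tsum X (comult C y) (\<lambda>y1 y2. f x \<otimes>\<^bsub>X\<^esub> g y1 \<otimes>\<^bsub>X\<^esub> k y2)" .
    qed
    also have "\<dots> = (f \<otimes>\<^bsub>L X\<^esub> (g \<otimes>\<^bsub>L X\<^esub> k)) c" by (simp add: L_mult c)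
    finally show "(f \<otimes>\<^bsub>L X\<^esub> g \<otimes>\<^bsub>L X\<^esub> k) c = (f \<otimes>\<^bsub>L X\<^esub> (g \<otimes>\<^bsub>L X\<^esub> k)) c" .
  qed (use that cl in auto)
  have l_one: "\<one>\<^bsub>L X\<^esub> \<otimes>\<^bsub>L X\<^esub> f = f" if f: "f \<in> carrier (L X)" for f
  proof (rule L_eqI[of _ X])
    fix c assume c: "c \<in> carrier C"
    have "(\<one>\<^bsub>L X\<^esub> \<otimes>\<^bsub>L X\<^esub> f) c = tsum X (comult C c) (\<lambda>x y. counit C x \<odot>\<^bsub>X\<^esub> f y)"
      unfolding L_mult[OF c]
      by (rule tsum_cong[OF mC mC mX L_bilin[OF X ocl f] _ comult_closed[OF c]])
        (simp add: L_one X.smult_mult_left L_closed[OF f])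
    then show "(\<one>\<^bsub>L X\<^esub> \<otimes>\<^bsub>L X\<^esub> f) c = f c" by (simp add: sw_counit_left[OF mX L_lin[OF f] c])
  qed (use f cl in auto)
  have r_one: "f \<otimes>\<^bsub>L X\<^esub> \<one>\<^bsub>L X\<^esub> = f" if f: "f \<in> carrier (L X)" for f
  proof (rule L_eqI[of _ X])
    fix c assume c: "c \<in> carrier C"
    have "(f \<otimes>\<^bsub>L X\<^esub> \<one>\<^bsub>L X\<^esub>) c = tsum X (comult C c) (\<lambda>x y. counit C y \<odot>\<^bsub>X\<^esub> f x)"
      unfolding L_mult[OF c]
      by (rule tsum_cong[OF mC mC mX L_bilin[OF X f ocl] _ comult_closed[OF c]])
        (simp add: L_one X.smult_mult_right L_closed[OF f])
    then show "(f \<otimes>\<^bsub>L X\<^esub> \<one>\<^bsub>L X\<^esub>) c = f c" by (simp add: sw_counit_right[OF mX L_lin[OF f] c])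
  qed (use f cl in auto)
  show ?thesis
    by unfold_locales
      (use cl assoc l_one r_one in \<open>auto simp: lin_add[OF bilin_l[OF distr]] lin_add[OF bilin_r[OF distr]]
         lin_smult[OF bilin_l[OF distr]] lin_smult[OF bilin_r[OF distr]]\<close>)
qed

end

section \<open>Algebra homomorphisms and tensor products of algebras\<close>

lemma ahom_lin: "f \<in> algebra_homs R X Y \<Longrightarrow> f \<in> linear_maps R X Y"
  by (simp add: algebra_homs_def)

lemma ahom_closed: "f \<in> algebra_homs R X Y \<Longrightarrow> x \<in> carrier X \<Longrightarrow> f x \<in> carrier Y"
  by (rule lin_closed[OF ahom_lin])

lemma ahom_mult: "f \<in> algebra_homs R X Y \<Longrightarrow> x \<in> carrier X \<Longrightarrow> y \<in> carrier X \<Longrightarrow>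
    f (x \<otimes>\<^bsub>X\<^esub> y) = f x \<otimes>\<^bsub>Y\<^esub> f y"
  by (simp add: algebra_homs_def ring_hom_def)

lemma ahom_one: "f \<in> algebra_homs R X Y \<Longrightarrow> f \<one>\<^bsub>X\<^esub> = \<one>\<^bsub>Y\<^esub>"
  by (simp add: algebra_homs_def ring_hom_def)

lemma ahomI:
  assumes "f \<in> linear_maps R X Y"
    and "\<And>x y. x \<in> carrier X \<Longrightarrow> y \<in> carrier X \<Longrightarrow> f (x \<otimes>\<^bsub>X\<^esub> y) = f x \<otimes>\<^bsub>Y\<^esub> f y"
    and "f \<one>\<^bsub>X\<^esub> = \<one>\<^bsub>Y\<^esub>"
  shows "f \<in> algebra_homs R X Y"
  using assms by (auto simp: algebra_homs_def ring_hom_def linear_maps_def Pi_iff)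

lemma assoc_algebra_ring: "assoc_algebra R X \<Longrightarrow> ring X"
  by (simp add: assoc_algebra_def)

lemma assoc_algebra_one: "assoc_algebra R X \<Longrightarrow> \<one>\<^bsub>X\<^esub> \<in> carrier X"
  by (simp add: assoc_algebra_def ring_def monoid.one_closed)

lemma tsum_tens_id:
  assumes M: "module R M" and N: "module R N" and t: "t \<in> carrier (tensor R M N)"
  shows "tsum (tensor R M N) t (tens R M N) = t"
  by (rule tensor_lin_eqI[OF M N tensor_module[OF M N] tsum_lin[OF M N tensor_module[OF M N] tens_bilin[OF M N]] lin_id _ t])
    (rule tsum_pure[OF M N tensor_module[OF M N] tens_bilin[OF M N]])

text \<open>The product of two classes is defined as a union over all pairs of representatives.
  Every pair contributes the same class, namely the double \<open>tsum\<close>, so the union runs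
  over a constant nonempty family.\<close>

lemma tensor_mult_tsum:
  assumes M: "assoc_algebra R M" and N: "assoc_algebra R N"
    and s: "s \<in> carrier (tensor R M N)" and t: "t \<in> carrier (tensor R M N)"
  shows "s \<otimes>\<^bsub>tensor R M N\<^esub> t = tsum (tensor R M N) s (\<lambda>x y. tsum (tensor R M N) t
      (\<lambda>x' y'. tens R M N (x \<otimes>\<^bsub>M\<^esub> x') (y \<otimes>\<^bsub>N\<^esub> y')))"
    and "bilin R M N (tensor R M N) (\<lambda>x y. tsum (tensor R M N) t
      (\<lambda>x' y'. tens R M N (x \<otimes>\<^bsub>M\<^esub> x') (y \<otimes>\<^bsub>N\<^esub> y')))"
    and "bilin R M N (tensor R M N) (\<lambda>x y. tsum (tensor R M N) s
      (\<lambda>x' y'. tens R M N (x' \<otimes>\<^bsub>M\<^esub> x) (y' \<otimes>\<^bsub>N\<^esub> y)))"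
    and "x \<in> carrier M \<Longrightarrow> y \<in> carrier N \<Longrightarrow>
      bilin R M N (tensor R M N) (\<lambda>x' y'. tens R M N (x \<otimes>\<^bsub>M\<^esub> x') (y \<otimes>\<^bsub>N\<^esub> y'))"
proof -
  interpret M: assoc_algebra R M by (rule M)
  interpret N: assoc_algebra R N by (rule N)
  note mM = assoc_algebra_module[OF M] and mN = assoc_algebra_module[OF N]
  let ?T = "tensor R M N" and ?p = "tens R M N"
  note mT = tensor_module[OF mM mN]
  interpret T: module R ?T by (rule mT)
  note b = tens_bilin[OF mM mN]
  have b1: "bilin R M N ?T (\<lambda>u v. ?p (a \<otimes>\<^bsub>M\<^esub> u) (c \<otimes>\<^bsub>N\<^esub> v))" if "a \<in> carrier M" "c \<in> carrier N" for a c
    by (intro bilinI lin_comp[OF bilin_l[OF b]] lin_comp[OF bilin_r[OF b]] lin_mult_left[OF M] lin_mult_left[OF N] lin_id)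
      (use that in auto)
  have b2: "bilin R M N ?T (\<lambda>u v. ?p (u \<otimes>\<^bsub>M\<^esub> a) (v \<otimes>\<^bsub>N\<^esub> c))" if "a \<in> carrier M" "c \<in> carrier N" for a c
    by (intro bilinI lin_comp[OF bilin_l[OF b]] lin_comp[OF bilin_r[OF b]] lin_mult_right[OF M] lin_mult_right[OF N] lin_id)
      (use that in auto)
  show "bilin R M N ?T (\<lambda>x' y'. ?p (x \<otimes>\<^bsub>M\<^esub> x') (y \<otimes>\<^bsub>N\<^esub> y'))" if "x \<in> carrier M" "y \<in> carrier N"
    by (rule b1[OF that])
  let ?G = "\<lambda>t x y. tsum ?T t (\<lambda>x' y'. ?p (x \<otimes>\<^bsub>M\<^esub> x') (y \<otimes>\<^bsub>N\<^esub> y'))"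
  show G: "bilin R M N ?T (?G t)"
  proof (rule bilinI)
    fix x assume x: "x \<in> carrier M"
    show "?G t x \<in> linear_maps R N ?T"
      by (rule lin_tsum_body[OF mM mN mT mN b1[OF x] _ t], assumption) (rule bilin_r[OF b2 x])
  next
    fix y assume y: "y \<in> carrier N"
    show "(\<lambda>x. ?G t x y) \<in> linear_maps R M ?T"
      by (rule lin_tsum_body[OF mM mN mT mM b1[OF _ y] _ t], assumption) (rule bilin_l[OF b2 y])
  qed
  show "bilin R M N ?T (\<lambda>x y. tsum ?T s (\<lambda>x' y'. ?p (x' \<otimes>\<^bsub>M\<^esub> x) (y' \<otimes>\<^bsub>N\<^esub> y)))"
  proof (rule bilinI)
    fix x assume x: "x \<in> carrier M"
    show "(\<lambda>y. tsum ?T s (\<lambda>x' y'. ?p (x' \<otimes>\<^bsub>M\<^esub> x) (y' \<otimes>\<^bsub>N\<^esub> y))) \<in> linear_maps R N ?T"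
      by (rule lin_tsum_body[OF mM mN mT mN b2[OF x] _ s], assumption) (rule bilin_r[OF b1 x])
  next
    fix y assume y: "y \<in> carrier N"
    show "(\<lambda>x. tsum ?T s (\<lambda>x' y'. ?p (x' \<otimes>\<^bsub>M\<^esub> x) (y' \<otimes>\<^bsub>N\<^esub> y))) \<in> linear_maps R M ?T"
      by (rule lin_tsum_body[OF mM mN mT mM b2[OF _ y] _ s], assumption) (rule bilin_l[OF b1 y])
  qed
  obtain c0 d0 where c0: "c0 \<in> carrier (tensor_free M N)" "s = tensor_class R M N c0"
    and d0: "d0 \<in> carrier (tensor_free M N)" "t = tensor_class R M N d0"
    using s t by (auto simp: tensor_carrier[OF mM mN])
  have "tensor_class R M N (frag_extend (\<lambda>(u, v). frag_extend (\<lambda>(u', v').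
      frag_of (u \<otimes>\<^bsub>M\<^esub> u', v \<otimes>\<^bsub>N\<^esub> v')) d) c) = tsum ?T s (?G t)"
    if "c \<in> s" and "d \<in> t" for c d
  proof -
    have c: "c \<in> carrier (tensor_free M N)" "tensor_class R M N c = s"
      using tensor_class_sub[OF mM mN c0(1)] that c0(2) by auto
    have d: "d \<in> carrier (tensor_free M N)" "tensor_class R M N d = t"
      using tensor_class_sub[OF mM mN d0(1)] that d0(2) by auto
    have in_free: "frag_extend (\<lambda>(u', v'). frag_of (u \<otimes>\<^bsub>M\<^esub> u', v \<otimes>\<^bsub>N\<^esub> v')) d \<in> carrier (tensor_free M N)"
      and val: "tensor_class R M N (frag_extend (\<lambda>(u', v'). frag_of (u \<otimes>\<^bsub>M\<^esub> u', v \<otimes>\<^bsub>N\<^esub> v')) d) = ?G t u v"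
      if uv: "u \<in> carrier M" "v \<in> carrier N" for u v
    proof -
      have g: "(\<lambda>(u', v'). frag_of (u \<otimes>\<^bsub>M\<^esub> u', v \<otimes>\<^bsub>N\<^esub> v')) (a, b) \<in> carrier (tensor_free M N)"
        if "a \<in> carrier M" "b \<in> carrier N" for a b
        using that uv by (simp add: tensor_free_def)
      note * = tensor_class_extend[OF mM mN mM mN,
          where g = "\<lambda>(u', v'). frag_of (u \<otimes>\<^bsub>M\<^esub> u', v \<otimes>\<^bsub>N\<^esub> v')" and c = d, OF g d(1)]
      show "frag_extend (\<lambda>(u', v'). frag_of (u \<otimes>\<^bsub>M\<^esub> u', v \<otimes>\<^bsub>N\<^esub> v')) d \<in> carrier (tensor_free M N)"
        by (rule *)
      show "tensor_class R M N (frag_extend (\<lambda>(u', v'). frag_of (u \<otimes>\<^bsub>M\<^esub> u', v \<otimes>\<^bsub>N\<^esub> v')) d) = ?G t u v"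
        using *(2) tsum_class[OF mM mN T.abelian_group_axioms bilin_bilinear[OF b1[OF uv]] d(1)] d(2)
        by (simp add: tens_def)
    qed
    have "tensor_class R M N (frag_extend (\<lambda>(u, v). frag_extend (\<lambda>(u', v').
        frag_of (u \<otimes>\<^bsub>M\<^esub> u', v \<otimes>\<^bsub>N\<^esub> v')) d) c)
      = frag_sum ?T c (\<lambda>u v. tensor_class R M N ((\<lambda>(u, v). frag_extend (\<lambda>(u', v').
        frag_of (u \<otimes>\<^bsub>M\<^esub> u', v \<otimes>\<^bsub>N\<^esub> v')) d) (u, v)))"
      by (rule tensor_class_extend(2)[OF mM mN mM mN]) (use in_free c in auto)
    also have "\<dots> = frag_sum ?T c (?G t)"
      unfolding frag_sum_def
    proof (rule T.finsum_cong'[OF refl])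
      have kc: "fst p \<in> carrier M" "snd p \<in> carrier N" if "p \<in> Poly_Mapping.keys c" for p
        using c that by (auto simp: tensor_free_def)
      show "(\<lambda>p. [Poly_Mapping.lookup c p] \<cdot>\<^bsub>?T\<^esub> ?G t (fst p) (snd p)) \<in> Poly_Mapping.keys c \<rightarrow> carrier ?T"
        using kc bilin_closed[OF G] by (auto intro!: T.add.int_pow_closed)
      fix p assume "p \<in> Poly_Mapping.keys c"
      then show "[Poly_Mapping.lookup c p] \<cdot>\<^bsub>?T\<^esub> tensor_class R M N (case (fst p, snd p) of (u, v) \<Rightarrow>
          frag_extend (\<lambda>(u', v'). frag_of (u \<otimes>\<^bsub>M\<^esub> u', v \<otimes>\<^bsub>N\<^esub> v')) d)
        = [Poly_Mapping.lookup c p] \<cdot>\<^bsub>?T\<^esub> ?G t (fst p) (snd p)"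
        using kc val by (simp only: prod.case)
    qed
    also have "\<dots> = tsum ?T s (?G t)"
      using tsum_class[OF mM mN T.abelian_group_axioms bilin_bilinear[OF G] c(1)] c(2) by simp
    finally show ?thesis .
  qed
  then have "s \<otimes>\<^bsub>?T\<^esub> t = (\<Union>c\<in>s. \<Union>d\<in>t. tsum ?T s (?G t))"
    unfolding tensor_mult_eq by (intro SUP_cong refl)
  moreover have "s \<noteq> {}" "t \<noteq> {}"
    using tensor_self_class[OF mM mN c0(1)] tensor_self_class[OF mM mN d0(1)] c0 d0 by auto
  ultimately show "s \<otimes>\<^bsub>?T\<^esub> t = tsum ?T s (?G t)" by auto
qed

lemma tensor_mult_bilin:
  assumes M: "assoc_algebra R M" and N: "assoc_algebra R N"
  shows "bilin R (tensor R M N) (tensor R M N) (tensor R M N) (\<lambda>s t. s \<otimes>\<^bsub>tensor R M N\<^esub> t)"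
proof -
  note mM = assoc_algebra_module[OF M] and mN = assoc_algebra_module[OF N]
  let ?T = "tensor R M N"
  note mT = tensor_module[OF mM mN] and * = tensor_mult_tsum[OF M N]
  show ?thesis
  proof (rule bilinI)
    fix t assume t: "t \<in> carrier ?T"
    have "(\<lambda>s. s \<otimes>\<^bsub>?T\<^esub> t) \<in> linear_maps R ?T ?T \<longleftrightarrow> (\<lambda>s. tsum ?T s (\<lambda>x y. tsum ?T t
      (\<lambda>x' y'. tens R M N (x \<otimes>\<^bsub>M\<^esub> x') (y \<otimes>\<^bsub>N\<^esub> y')))) \<in> linear_maps R ?T ?T"
      by (rule lin_cong[OF mT *(1)[OF _ t]])
    then show "(\<lambda>s. s \<otimes>\<^bsub>?T\<^esub> t) \<in> linear_maps R ?T ?T"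
      using tsum_lin[OF mM mN mT *(2)[OF t t]] by simp
  next
    fix s assume s: "s \<in> carrier ?T"
    have "(\<lambda>t. s \<otimes>\<^bsub>?T\<^esub> t) \<in> linear_maps R ?T ?T \<longleftrightarrow> (\<lambda>t. tsum ?T s (\<lambda>x y. tsum ?T t
      (\<lambda>x' y'. tens R M N (x \<otimes>\<^bsub>M\<^esub> x') (y \<otimes>\<^bsub>N\<^esub> y')))) \<in> linear_maps R ?T ?T"
      by (rule lin_cong[OF mT *(1)[OF s]])
    moreover have "(\<lambda>t. tsum ?T s (\<lambda>x y. tsum ?T t
      (\<lambda>x' y'. tens R M N (x \<otimes>\<^bsub>M\<^esub> x') (y \<otimes>\<^bsub>N\<^esub> y')))) \<in> linear_maps R ?T ?T"
      by (rule lin_tsum_body[OF mM mN mT mT *(2)[OF s] _ s], assumption)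
        (rule tsum_lin[OF mM mN mT *(4)[OF s s]])
    ultimately show "(\<lambda>t. s \<otimes>\<^bsub>?T\<^esub> t) \<in> linear_maps R ?T ?T" by simp
  qed
qed

lemma tensor_assoc_algebra:
  assumes M: "assoc_algebra R M" and N: "assoc_algebra R N"
  shows "assoc_algebra R (tensor R M N)"
proof -
  interpret M: assoc_algebra R M by (rule M)
  interpret N: assoc_algebra R N by (rule N)
  note mM = assoc_algebra_module[OF M] and mN = assoc_algebra_module[OF N]
  let ?T = "tensor R M N"
  note mT = tensor_module[OF mM mN]
  interpret T: module R ?T by (rule mT)
  note b = tensor_mult_bilin[OF M N]
  note tc = tens_closed[OF mM mN]
  have mcl: "s \<otimes>\<^bsub>?T\<^esub> t \<in> carrier ?T" if "s \<in> carrier ?T" "t \<in> carrier ?T" for s t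
    using bilin_closed[OF b that] .
  have one: "\<one>\<^bsub>?T\<^esub> = tens R M N \<one>\<^bsub>M\<^esub> \<one>\<^bsub>N\<^esub>" by (simp add: tensor_def)
  have pm: "tens R M N x y \<otimes>\<^bsub>?T\<^esub> tens R M N x' y' = tens R M N (x \<otimes>\<^bsub>M\<^esub> x') (y \<otimes>\<^bsub>N\<^esub> y')"
    if "x \<in> carrier M" "y \<in> carrier N" "x' \<in> carrier M" "y' \<in> carrier N" for x y x' y'
    by (rule tensor_mult_tens[OF M N]) (use that in auto)
  note ld = lin_add[OF bilin_l[OF b]] and rd = lin_add[OF bilin_r[OF b]]
  have one_l: "\<one>\<^bsub>?T\<^esub> \<otimes>\<^bsub>?T\<^esub> t = t" and one_r: "t \<otimes>\<^bsub>?T\<^esub> \<one>\<^bsub>?T\<^esub> = t" if t: "t \<in> carrier ?T" for t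
    by (induction rule: tensor_induct[OF mM mN t]; simp add: one pm ld rd tc)+
  have assoc: "r \<otimes>\<^bsub>?T\<^esub> s \<otimes>\<^bsub>?T\<^esub> t = r \<otimes>\<^bsub>?T\<^esub> (s \<otimes>\<^bsub>?T\<^esub> t)"
    if r: "r \<in> carrier ?T" and s: "s \<in> carrier ?T" and t: "t \<in> carrier ?T" for r s t
  proof (induction rule: tensor_induct[OF mM mN r])
    case (1 x y)
    show ?case
    proof (induction rule: tensor_induct[OF mM mN s])
      case (1 x' y')
      show ?case
        by (induction rule: tensor_induct[OF mM mN t])
          (use 1 \<open>x \<in> carrier M\<close> \<open>y \<in> carrier N\<close> in \<open>simp_all add: pm M.m_assoc N.m_assoc rd tc mcl\<close>)
    qed (use 1 t in \<open>simp add: ld rd tc mcl\<close>)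
  qed (use s t in \<open>simp add: ld mcl\<close>)
  show ?thesis
    by unfold_locales
      (use mcl assoc one_l one_r tc in \<open>auto simp: ld rd one lin_smult[OF bilin_l[OF b]] lin_smult[OF bilin_r[OF b]]\<close>)
qed

section \<open>Functions of several variables as elements of iterated convolution algebras\<close>

context coalgebra
begin

text \<open>
  For \<open>f \<in> L X\<close>, the element \<open>post (cst X) f\<close> of \<open>L (L X)\<close> is \<open>f\<close> as a function of the first of two
  variables, and \<open>cst (L X) f\<close> is \<open>f\<close> as a function of the second; \<open>mpb f\<close> below is \<open>f\<close> of their product.
\<close>

definition cst where "cst X a = (\<lambda>c\<in>carrier C. counit C c \<odot>\<^bsub>X\<^esub> a)"
definition post where "post \<phi> f = (\<lambda>c\<in>carrier C. \<phi> (f c))"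
definition flp where "flp f = (\<lambda>h\<in>carrier C. \<lambda>k\<in>carrier C. f k h)"
text \<open>Pulling a two-variable function back along the comultiplication is linear but not
  multiplicative. Only factors in an outermost variable can be taken out, on the right by
  \<open>dg_mult_cst\<close> and on the left by \<open>dg_post_cst_mult\<close>.\<close>

definition dg where "dg X M = (\<lambda>c\<in>carrier C. tsum X (comult C c) M)"

lemma cst_apply: "c \<in> carrier C \<Longrightarrow> cst X a c = counit C c \<odot>\<^bsub>X\<^esub> a"
  by (simp add: cst_def)
lemma post_apply: "c \<in> carrier C \<Longrightarrow> post \<phi> f c = \<phi> (f c)"
  by (simp add: post_def)
lemma flp_apply: "h \<in> carrier C \<Longrightarrow> k \<in> carrier C \<Longrightarrow> flp f h k = f k h"
  by (simp add: flp_def)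
lemma dg_apply: "c \<in> carrier C \<Longrightarrow> dg X M c = tsum X (comult C c) M"
  by (simp add: dg_def)

lemma L_ev: "c \<in> carrier C \<Longrightarrow> (\<lambda>f. f c) \<in> linear_maps R (L X) X"
  by (rule linear_mapsI) (auto simp: L_add L_smult L_closed)

lemma cst_closed: "module R X \<Longrightarrow> a \<in> carrier X \<Longrightarrow> cst X a \<in> carrier (L X)"
  unfolding cst_def by (rule L_I[OF lin_functional[OF _ counit_linear]])

lemma post_closed: "\<phi> \<in> linear_maps R X Y \<Longrightarrow> f \<in> carrier (L X) \<Longrightarrow> post \<phi> f \<in> carrier (L Y)"
  unfolding post_def by (rule L_I[OF lin_comp[OF _ L_lin]])

text \<open>The counit inside \<open>cst\<close> swallows one leg of c, so convolution with a
  constant is pointwise multiplication. With L X in place of X this evaluates products with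
  functions of the last variable alone.\<close>

lemma cst_mult_apply:
  assumes X: "assoc_algebra R X" and a: "a \<in> carrier X" and f: "f \<in> carrier (L X)" and c: "c \<in> carrier C"
  shows "(cst X a \<otimes>\<^bsub>L X\<^esub> f) c = a \<otimes>\<^bsub>X\<^esub> f c" "(f \<otimes>\<^bsub>L X\<^esub> cst X a) c = f c \<otimes>\<^bsub>X\<^esub> a"
proof -
  interpret X: assoc_algebra R X by (rule X)
  note mX = assoc_algebra_module[OF X]
  note k = cst_closed[OF mX a]
  have "(cst X a \<otimes>\<^bsub>L X\<^esub> f) c = tsum X (comult C c) (\<lambda>x y. counit C x \<odot>\<^bsub>X\<^esub> (a \<otimes>\<^bsub>X\<^esub> f y))"
    unfolding L_mult[OF c]
    by (rule tsum_cong[OF mC mC mX L_bilin[OF X k f] _ comult_closed[OF c]])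
      (simp add: cst_apply X.smult_mult_left a L_closed[OF f])
  then show "(cst X a \<otimes>\<^bsub>L X\<^esub> f) c = a \<otimes>\<^bsub>X\<^esub> f c"
    by (simp add: sw_counit_left[OF mX lin_mult_left[OF X a L_lin[OF f]] c])
  have "(f \<otimes>\<^bsub>L X\<^esub> cst X a) c = tsum X (comult C c) (\<lambda>x y. counit C y \<odot>\<^bsub>X\<^esub> (f x \<otimes>\<^bsub>X\<^esub> a))"
    unfolding L_mult[OF c]
    by (rule tsum_cong[OF mC mC mX L_bilin[OF X f k] _ comult_closed[OF c]])
      (simp add: cst_apply X.smult_mult_right a L_closed[OF f])
  then show "(f \<otimes>\<^bsub>L X\<^esub> cst X a) c = f c \<otimes>\<^bsub>X\<^esub> a"
    by (simp add: sw_counit_right[OF mX lin_mult_right[OF X a L_lin[OF f]] c])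
qed

lemma cst_hom: "assoc_algebra R X \<Longrightarrow> cst X \<in> algebra_homs R X (L X)"
proof (rule ahomI)
  assume X: "assoc_algebra R X"
  interpret X: assoc_algebra R X by (rule X)
  note mX = assoc_algebra_module[OF X]
  interpret LX: assoc_algebra R "L X" by (rule L_assoc_algebra[OF X])
  show "cst X \<in> linear_maps R X (L X)"
    by (intro linear_mapsI L_eqI[of _ X])
      (auto simp: cst_closed[OF mX] L_add L_smult cst_apply X.smult_r_distr X.smult_assoc1[symmetric] R.m_comm)
  show "cst X \<one>\<^bsub>X\<^esub> = \<one>\<^bsub>L X\<^esub>"
    by (intro L_eqI[of _ X]) (auto simp: cst_closed[OF mX] L_one cst_apply)
  show "cst X (x \<otimes>\<^bsub>X\<^esub> y) = cst X x \<otimes>\<^bsub>L X\<^esub> cst X y" if "x \<in> carrier X" "y \<in> carrier X" for x y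
    by (intro L_eqI[of _ X])
      (auto simp: cst_closed[OF mX] cst_mult_apply[OF X] that, simp add: cst_apply that X.smult_mult_left)
qed

lemma post_hom: "assoc_algebra R X \<Longrightarrow> assoc_algebra R Y \<Longrightarrow> \<phi> \<in> algebra_homs R X Y \<Longrightarrow>
    post \<phi> \<in> algebra_homs R (L X) (L Y)"
proof (rule ahomI)
  assume X: "assoc_algebra R X" and Y: "assoc_algebra R Y" and p: "\<phi> \<in> algebra_homs R X Y"
  interpret X: assoc_algebra R X by (rule X)
  interpret LX: assoc_algebra R "L X" by (rule L_assoc_algebra[OF X])
  interpret LY: assoc_algebra R "L Y" by (rule L_assoc_algebra[OF Y])
  note mX = assoc_algebra_module[OF X] and mY = assoc_algebra_module[OF Y]
  note pl = ahom_lin[OF p] and pc = post_closed[OF ahom_lin[OF p]]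
  show "post \<phi> \<in> linear_maps R (L X) (L Y)"
    by (intro linear_mapsI L_eqI[of _ Y])
      (auto simp: pc post_apply L_add L_smult lin_add[OF pl] lin_smult[OF pl] L_closed)
  show "post \<phi> \<one>\<^bsub>L X\<^esub> = \<one>\<^bsub>L Y\<^esub>"
    by (intro L_eqI[of _ Y]) (auto simp: pc post_apply L_one lin_smult[OF pl] ahom_one[OF p])
  fix f g assume f: "f \<in> carrier (L X)" and g: "g \<in> carrier (L X)"
  show "post \<phi> (f \<otimes>\<^bsub>L X\<^esub> g) = post \<phi> f \<otimes>\<^bsub>L Y\<^esub> post \<phi> g"
  proof (rule L_eqI[of _ Y])
    fix c assume c: "c \<in> carrier C"
    have "post \<phi> (f \<otimes>\<^bsub>L X\<^esub> g) c = tsum Y (comult C c) (\<lambda>x y. \<phi> (f x \<otimes>\<^bsub>X\<^esub> g y))"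
      using tsum_map[OF mC mC mX mY L_bilin[OF X f g] pl comult_closed[OF c]]
      by (simp add: post_apply c L_mult)
    also have "\<dots> = (post \<phi> f \<otimes>\<^bsub>L Y\<^esub> post \<phi> g) c"
      unfolding L_mult[OF c]
      by (rule sym, rule tsum_cong[OF mC mC mY L_bilin[OF Y pc[OF f] pc[OF g]] _ comult_closed[OF c]])
        (simp add: post_apply ahom_mult[OF p] L_closed[OF f] L_closed[OF g])
    finally show "post \<phi> (f \<otimes>\<^bsub>L X\<^esub> g) c = (post \<phi> f \<otimes>\<^bsub>L Y\<^esub> post \<phi> g) c" .
  qed (use f g pc in auto)
qed

lemma LL_mult_apply:
  assumes X: "assoc_algebra R X" and f: "f \<in> carrier (L (L X))" and g: "g \<in> carrier (L (L X))"
    and h: "h \<in> carrier C" and k: "k \<in> carrier C"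
  shows "(f \<otimes>\<^bsub>L (L X)\<^esub> g) h k = tsum X (comult C h) (\<lambda>h1 h2. (f h1 \<otimes>\<^bsub>L X\<^esub> g h2) k)"
    and "(f \<otimes>\<^bsub>L (L X)\<^esub> g) h k = tsum X (comult C h) (\<lambda>h1 h2. tsum X (comult C k)
      (\<lambda>k1 k2. f h1 k1 \<otimes>\<^bsub>X\<^esub> g h2 k2))"
proof -
  note LX = L_assoc_algebra[OF X]
  show *: "(f \<otimes>\<^bsub>L (L X)\<^esub> g) h k = tsum X (comult C h) (\<lambda>h1 h2. (f h1 \<otimes>\<^bsub>L X\<^esub> g h2) k)"
    using tsum_map[OF mC mC assoc_algebra_module[OF LX] assoc_algebra_module[OF X] L_bilin[OF LX f g] L_ev[OF k]
        comult_closed[OF h]]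
    by (simp add: L_mult[OF h])
  show "(f \<otimes>\<^bsub>L (L X)\<^esub> g) h k = tsum X (comult C h) (\<lambda>h1 h2. tsum X (comult C k)
      (\<lambda>k1 k2. f h1 k1 \<otimes>\<^bsub>X\<^esub> g h2 k2))"
    unfolding * L_mult[OF k] ..
qed

lemma LL_bilin: "f \<in> carrier (L (L X)) \<Longrightarrow> bilin R C C X f"
proof (rule bilinI)
  assume f: "f \<in> carrier (L (L X))"
  show "f x \<in> linear_maps R C X" if "x \<in> carrier C" for x
    by (rule L_lin[OF L_closed[OF f that]])
  show "(\<lambda>x. f x y) \<in> linear_maps R C X" if "y \<in> carrier C" for y
    by (rule lin_comp[OF L_ev[OF that] L_lin[OF f]])
qed

lemma LL_I:
  assumes "bilin R C C X f"
  shows "(\<lambda>h\<in>carrier C. \<lambda>k\<in>carrier C. f h k) \<in> carrier (L (L X))"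
  by (rule L_I, rule linear_mapsI)
    (auto intro!: L_I bilin_r[OF assms] L_lin[OF L_I]
      simp: conv_algebra_def lin_add[OF bilin_l[OF assms]] lin_smult[OF bilin_l[OF assms]])

lemma LL_eqI:
  assumes "f \<in> carrier (L (L X))" "g \<in> carrier (L (L X))"
    "\<And>h k. h \<in> carrier C \<Longrightarrow> k \<in> carrier C \<Longrightarrow> f h k = g h k"
  shows "f = g"
  by (intro L_eqI[of _ "L X"] L_eqI[of _ X]) (use assms in \<open>auto simp: L_closed\<close>)

lemma flp_closed: "f \<in> carrier (L (L X)) \<Longrightarrow> flp f \<in> carrier (L (L X))"
  unfolding flp_def
  by (rule LL_I) (use LL_bilin in \<open>auto simp: bilin_def\<close>)

text \<open>A product in two variables is a double Sweedler sum over independent arguments, and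
  \<open>tsum_swap\<close> exchanges the two sums.\<close>

lemma flp_hom: assumes X: "assoc_algebra R X" shows "flp \<in> algebra_homs R (L (L X)) (L (L X))"
proof (rule ahomI)
  interpret X: assoc_algebra R X by (rule X)
  interpret LX: assoc_algebra R "L X" by (rule L_assoc_algebra[OF X])
  interpret LLX: assoc_algebra R "L (L X)" by (rule L_assoc_algebra[OF L_assoc_algebra[OF X]])
  note mX = assoc_algebra_module[OF X]
  show "flp \<in> linear_maps R (L (L X)) (L (L X))"
    by (intro linear_mapsI LL_eqI[of _ X])
      (auto simp: flp_closed flp_apply L_add L_smult)
  show "flp \<one>\<^bsub>L (L X)\<^esub> = \<one>\<^bsub>L (L X)\<^esub>"
    by (intro LL_eqI[of _ X])
      (auto simp: flp_closed flp_apply L_one L_smult X.smult_assoc1[symmetric] R.m_comm)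
  fix f g assume f: "f \<in> carrier (L (L X))" and g: "g \<in> carrier (L (L X))"
  show "flp (f \<otimes>\<^bsub>L (L X)\<^esub> g) = flp f \<otimes>\<^bsub>L (L X)\<^esub> flp g"
  proof (rule LL_eqI[of _ X])
    fix h k assume h: "h \<in> carrier C" and k: "k \<in> carrier C"
    have 1: "bilin R C C X (\<lambda>h1 h2. f k1 h1 \<otimes>\<^bsub>X\<^esub> g k2 h2)" if "k1 \<in> carrier C" "k2 \<in> carrier C" for k1 k2
      using that by (intro L_bilin[OF X] L_closed[OF f] L_closed[OF g])
    have 2: "bilin R C C X (\<lambda>k1 k2. f k1 h1 \<otimes>\<^bsub>X\<^esub> g k2 h2)" if "h1 \<in> carrier C" "h2 \<in> carrier C" for h1 h2
      using that by (intro bilin_mult[OF X] lin_comp[OF L_ev L_lin] f g)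
    have i: "bilin R C C X (\<lambda>h1 h2. tsum X (comult C k) (\<lambda>k1 k2. flp f h1 k1 \<otimes>\<^bsub>X\<^esub> flp g h2 k2))"
    proof (rule bilinI)
      have fb: "bilin R C C X (\<lambda>k1 k2. flp f h1 k1 \<otimes>\<^bsub>X\<^esub> flp g h2 k2)" if "h1 \<in> carrier C" "h2 \<in> carrier C" for h1 h2
        using that by (intro L_bilin[OF X] L_closed[OF flp_closed[OF f]] L_closed[OF flp_closed[OF g]])
      have ff: "bilin R C C X (\<lambda>h1 h2. flp f h1 k1 \<otimes>\<^bsub>X\<^esub> flp g h2 k2)" if "k1 \<in> carrier C" "k2 \<in> carrier C" for k1 k2
        using that by (intro bilin_mult[OF X] lin_comp[OF L_ev L_lin] flp_closed f g)
      show "(\<lambda>h2. tsum X (comult C k) (\<lambda>k1 k2. flp f h1 k1 \<otimes>\<^bsub>X\<^esub> flp g h2 k2)) \<in> linear_maps R C X"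
        if h1: "h1 \<in> carrier C" for h1
        by (rule lin_tsum_body[OF mC mC mX mC fb[OF h1] _ comult_closed[OF k]], assumption) (rule bilin_r[OF ff h1])
      show "(\<lambda>h1. tsum X (comult C k) (\<lambda>k1 k2. flp f h1 k1 \<otimes>\<^bsub>X\<^esub> flp g h2 k2)) \<in> linear_maps R C X"
        if h2: "h2 \<in> carrier C" for h2
        by (rule lin_tsum_body[OF mC mC mX mC fb[OF _ h2] _ comult_closed[OF k]], assumption) (rule bilin_l[OF ff h2])
    qed
    have "flp (f \<otimes>\<^bsub>L (L X)\<^esub> g) h k = tsum X (comult C h) (\<lambda>h1 h2. tsum X (comult C k)
      (\<lambda>k1 k2. f k1 h1 \<otimes>\<^bsub>X\<^esub> g k2 h2))"
      unfolding flp_apply[OF h k] LL_mult_apply(2)[OF X f g k h]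
      by (rule tsum_swap[OF mC mC mX mC mC 1 2 comult_closed[OF k] comult_closed[OF h]])
    also have "\<dots> = tsum X (comult C h) (\<lambda>h1 h2. tsum X (comult C k)
      (\<lambda>k1 k2. flp f h1 k1 \<otimes>\<^bsub>X\<^esub> flp g h2 k2))"
    proof (rule sym, rule tsum_cong[OF mC mC mX i _ comult_closed[OF h]])
      fix h1 h2 assume h12: "h1 \<in> carrier C" "h2 \<in> carrier C"
      show "tsum X (comult C k) (\<lambda>k1 k2. flp f h1 k1 \<otimes>\<^bsub>X\<^esub> flp g h2 k2) =
        tsum X (comult C k) (\<lambda>k1 k2. f k1 h1 \<otimes>\<^bsub>X\<^esub> g k2 h2)"
        by (rule sym, rule tsum_cong[OF mC mC mX 2[OF h12] _ comult_closed[OF k]]) (simp add: flp_apply h12)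
    qed
    finally show "flp (f \<otimes>\<^bsub>L (L X)\<^esub> g) h k = (flp f \<otimes>\<^bsub>L (L X)\<^esub> flp g) h k"
      by (simp add: LL_mult_apply(2)[OF X flp_closed[OF f] flp_closed[OF g] h k])
  qed (use f g in \<open>auto intro: flp_closed\<close>)
qed

lemma post_cst_mult_apply:
  assumes X: "assoc_algebra R X" and f: "f \<in> carrier (L X)" and y: "y \<in> carrier (L (L X))"
    and h: "h \<in> carrier C" and k: "k \<in> carrier C"
  shows "(post (cst X) f \<otimes>\<^bsub>L (L X)\<^esub> y) h k = tsum X (comult C h) (\<lambda>h1 h2. f h1 \<otimes>\<^bsub>X\<^esub> y h2 k)"
    and "(y \<otimes>\<^bsub>L (L X)\<^esub> post (cst X) f) h k = tsum X (comult C h) (\<lambda>h1 h2. y h1 k \<otimes>\<^bsub>X\<^esub> f h2)"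
proof -
  note mX = assoc_algebra_module[OF X] and LX = L_assoc_algebra[OF X]
  have pf: "post (cst X) f \<in> carrier (L (L X))" by (rule post_closed[OF ahom_lin[OF cst_hom[OF X]] f])
  note yk = lin_comp[OF L_ev[OF k] L_lin[OF y]]
  show "(post (cst X) f \<otimes>\<^bsub>L (L X)\<^esub> y) h k = tsum X (comult C h) (\<lambda>h1 h2. f h1 \<otimes>\<^bsub>X\<^esub> y h2 k)"
    unfolding LL_mult_apply(1)[OF X pf y h k]
    by (rule sym, rule tsum_cong[OF mC mC mX bilin_mult[OF X L_lin[OF f] yk] _ comult_closed[OF h]])
      (simp add: post_apply cst_mult_apply[OF X] L_closed[OF f] L_closed[OF y] k)
  show "(y \<otimes>\<^bsub>L (L X)\<^esub> post (cst X) f) h k = tsum X (comult C h) (\<lambda>h1 h2. y h1 k \<otimes>\<^bsub>X\<^esub> f h2)"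
    unfolding LL_mult_apply(1)[OF X y pf h k]
    by (rule sym, rule tsum_cong[OF mC mC mX bilin_mult[OF X yk L_lin[OF f]] _ comult_closed[OF h]])
      (simp add: post_apply cst_mult_apply[OF X] L_closed[OF f] L_closed[OF y] k)
qed

lemma dg_closed: "module R X \<Longrightarrow> M \<in> carrier (L (L X)) \<Longrightarrow> dg X M \<in> carrier (L X)"
  unfolding dg_def by (rule L_I[OF lin_tsum_arg[OF mC mC _ LL_bilin comult_linear]])

text \<open>The summand is M(x, y1) g(y2). Coassociativity regroups the three legs so that M takes
  the first two and g the last.\<close>

lemma dg_mult_cst:
  assumes X: "assoc_algebra R X" and M: "M \<in> carrier (L (L X))" and g: "g \<in> carrier (L X)"
  shows "dg X (M \<otimes>\<^bsub>L (L X)\<^esub> cst (L X) g) = dg X M \<otimes>\<^bsub>L X\<^esub> g"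
proof -
  note LX = L_assoc_algebra[OF X] and mX = assoc_algebra_module[OF X]
  note mLX = assoc_algebra_module[OF LX]
  note LLX = L_assoc_algebra[OF LX]
  have P: "M \<otimes>\<^bsub>L (L X)\<^esub> cst (L X) g \<in> carrier (L (L X))"
    by (rule L_mult_closed[OF LX M cst_closed[OF mLX g]])
  show ?thesis
  proof (rule L_eqI[of _ X])
    fix c assume c: "c \<in> carrier C"
    note D = comult_closed
    have tri: "trilin R C C C X (\<lambda>x y z. M x y \<otimes>\<^bsub>X\<^esub> g z)"
      by (intro trilinI lin_mult_left[OF X] lin_mult_right[OF X] L_lin[OF g] L_closed[OF g] bilin_l[OF LL_bilin[OF M]]
        bilin_r[OF LL_bilin[OF M]] bilin_closed[OF LL_bilin[OF M]])
    have "dg X (M \<otimes>\<^bsub>L (L X)\<^esub> cst (L X) g) c = tsum X (comult C c) (\<lambda>x y. tsum X (comult C y) (\<lambda>y1 y2. M x y1 \<otimes>\<^bsub>X\<^esub> g y2))"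
      unfolding dg_apply[OF c]
      by (rule tsum_cong[OF mC mC mX LL_bilin[OF P] _ D[OF c]])
        (simp only: cst_mult_apply(2)[OF LX g M], simp add: L_mult)
    also have "\<dots> = tsum X (comult C c) (\<lambda>x y. tsum X (comult C x) (\<lambda>x1 x2. M x1 x2 \<otimes>\<^bsub>X\<^esub> g y))"
      by (rule coassoc_tsum[OF mX tri c, symmetric])
    also have "\<dots> = (dg X M \<otimes>\<^bsub>L X\<^esub> g) c"
      unfolding L_mult[OF c]
    proof (rule sym, rule tsum_cong[OF mC mC mX L_bilin[OF X dg_closed[OF mX M] g] _ D[OF c]])
      fix x y assume x: "x \<in> carrier C" and y: "y \<in> carrier C"
      show "dg X M x \<otimes>\<^bsub>X\<^esub> g y = tsum X (comult C x) (\<lambda>x1 x2. M x1 x2 \<otimes>\<^bsub>X\<^esub> g y)"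
        using tsum_map[OF mC mC mX mX LL_bilin[OF M] lin_mult_right[OF X L_closed[OF g y] lin_id] D[OF x]]
        by (simp add: dg_apply x)
    qed
    finally show "dg X (M \<otimes>\<^bsub>L (L X)\<^esub> cst (L X) g) c = (dg X M \<otimes>\<^bsub>L X\<^esub> g) c" .
  qed (use dg_closed[OF mX] M g P L_mult_closed[OF X] in auto)
qed

lemma dg_post_cst_mult:
  assumes X: "assoc_algebra R X" and M: "M \<in> carrier (L (L X))" and f: "f \<in> carrier (L X)"
  shows "dg X (post (cst X) f \<otimes>\<^bsub>L (L X)\<^esub> M) = f \<otimes>\<^bsub>L X\<^esub> dg X M"
proof -
  note LX = L_assoc_algebra[OF X] and mX = assoc_algebra_module[OF X]
  note mLX = assoc_algebra_module[OF LX]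
  have P: "post (cst X) f \<otimes>\<^bsub>L (L X)\<^esub> M \<in> carrier (L (L X))"
    by (rule L_mult_closed[OF LX post_closed[OF ahom_lin[OF cst_hom[OF X]] f] M])
  show ?thesis
  proof (rule L_eqI[of _ X])
    fix c assume c: "c \<in> carrier C"
    note D = comult_closed
    have tri: "trilin R C C C X (\<lambda>x y z. f x \<otimes>\<^bsub>X\<^esub> M y z)"
      by (intro trilinI lin_mult_left[OF X] lin_mult_right[OF X] L_lin[OF f] L_closed[OF f] bilin_l[OF LL_bilin[OF M]]
        bilin_r[OF LL_bilin[OF M]] bilin_closed[OF LL_bilin[OF M]])
    have "dg X (post (cst X) f \<otimes>\<^bsub>L (L X)\<^esub> M) c = tsum X (comult C c) (\<lambda>x y. tsum X (comult C x) (\<lambda>x1 x2. f x1 \<otimes>\<^bsub>X\<^esub> M x2 y))"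
      unfolding dg_apply[OF c]
      by (rule tsum_cong[OF mC mC mX LL_bilin[OF P] _ D[OF c]])
        (simp add: post_cst_mult_apply[OF X f M])
    also have "\<dots> = tsum X (comult C c) (\<lambda>x y. tsum X (comult C y) (\<lambda>y1 y2. f x \<otimes>\<^bsub>X\<^esub> M y1 y2))"
      by (rule coassoc_tsum[OF mX tri c])
    also have "\<dots> = (f \<otimes>\<^bsub>L X\<^esub> dg X M) c"
      unfolding L_mult[OF c]
    proof (rule sym, rule tsum_cong[OF mC mC mX L_bilin[OF X f dg_closed[OF mX M]] _ D[OF c]])
      fix x y assume x: "x \<in> carrier C" and y: "y \<in> carrier C"
      show "f x \<otimes>\<^bsub>X\<^esub> dg X M y = tsum X (comult C y) (\<lambda>y1 y2. f x \<otimes>\<^bsub>X\<^esub> M y1 y2)"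
        using tsum_map[OF mC mC mX mX LL_bilin[OF M] lin_mult_left[OF X L_closed[OF f x] lin_id] D[OF y]]
        by (simp add: dg_apply y)
    qed
    finally show "dg X (post (cst X) f \<otimes>\<^bsub>L (L X)\<^esub> M) c = (f \<otimes>\<^bsub>L X\<^esub> dg X M) c" .
  qed (use dg_closed[OF mX] M f P L_mult_closed[OF X] in auto)
qed

end

section \<open>Regrouping Sweedler sums; compatibility of the operations on functions of several
  variables\<close>

context coalgebra
begin

lemma trilin_comult:
  assumes P: "module R P" and F: "trilin R C C C P F"
  shows "bilin R C C P (\<lambda>a y. tsum P (comult C y) (F a))"
    and "bilin R C C P (\<lambda>x z. tsum P (comult C x) (\<lambda>a b. F a b z))"
proof -
  show "bilin R C C P (\<lambda>a y. tsum P (comult C y) (F a))"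
  proof (rule bilinI)
    show "(\<lambda>y. tsum P (comult C y) (F a)) \<in> linear_maps R C P" if "a \<in> carrier C" for a
      by (rule lin_tsum_arg[OF mC mC P trilinD(1)[OF F that] comult_linear])
    show "(\<lambda>a. tsum P (comult C y) (F a)) \<in> linear_maps R C P" if "y \<in> carrier C" for y
      by (rule lin_tsum_body[OF mC mC P mC trilinD(1)[OF F] _ comult_closed[OF that]], assumption)
        (rule trilinD(6)[OF F])
  qed
  show "bilin R C C P (\<lambda>x z. tsum P (comult C x) (\<lambda>a b. F a b z))"
  proof (rule bilinI)
    show "(\<lambda>x. tsum P (comult C x) (\<lambda>a b. F a b z)) \<in> linear_maps R C P" if "z \<in> carrier C" for z
      by (rule lin_tsum_arg[OF mC mC P trilinD(3)[OF F that] comult_linear])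
    show "(\<lambda>z. tsum P (comult C x) (\<lambda>a b. F a b z)) \<in> linear_maps R C P" if "x \<in> carrier C" for x
      by (rule lin_tsum_body[OF mC mC P mC trilinD(3)[OF F] _ comult_closed[OF that]], assumption)
        (rule trilinD(4)[OF F])
  qed
qed

text \<open>Passage from the grouping (h1 h2)(h3 h4) to h1 ((h2 h3) h4). The middle legs become the
  comultiplication of a single element, to which the antipode axiom can be applied.\<close>

lemma comult_four:
  assumes P: "module R P" and h: "h \<in> carrier C"
    and f: "\<And>a. a \<in> carrier C \<Longrightarrow> trilin R C C C P (f a)"
    and f1: "\<And>b c d. b \<in> carrier C \<Longrightarrow> c \<in> carrier C \<Longrightarrow> d \<in> carrier C \<Longrightarrow> (\<lambda>a. f a b c d) \<in> linear_maps R C P"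
  shows "tsum P (comult C h) (\<lambda>x y. tsum P (comult C x) (\<lambda>a b. tsum P (comult C y) (\<lambda>c d. f a b c d))) =
    tsum P (comult C h) (\<lambda>a y. tsum P (comult C y) (\<lambda>z d. tsum P (comult C z) (\<lambda>b c. f a b c d)))"
proof -
  have F: "trilin R C C C P (\<lambda>a b y. tsum P (comult C y) (f a b))"
  proof (rule trilinI)
    fix a b assume ab: "a \<in> carrier C" "b \<in> carrier C"
    show "(\<lambda>y. tsum P (comult C y) (f a b)) \<in> linear_maps R C P"
      by (rule lin_tsum_arg[OF mC mC P trilinD(1)[OF f[OF ab(1)] ab(2)] comult_linear])
  next
    fix a y assume a: "a \<in> carrier C" and y: "y \<in> carrier C"
    show "(\<lambda>b. tsum P (comult C y) (f a b)) \<in> linear_maps R C P"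
      by (rule lin_tsum_body[OF mC mC P mC trilinD(1)[OF f[OF a]] _ comult_closed[OF y]], assumption)
        (rule trilinD(6)[OF f[OF a]])
  next
    fix b y assume b: "b \<in> carrier C" and y: "y \<in> carrier C"
    show "(\<lambda>a. tsum P (comult C y) (f a b)) \<in> linear_maps R C P"
      by (rule lin_tsum_body[OF mC mC P mC trilinD(1)[OF f b] _ comult_closed[OF y]], assumption)
        (rule f1[OF b])
  qed
  have "tsum P (comult C h) (\<lambda>x y. tsum P (comult C x) (\<lambda>a b. tsum P (comult C y) (f a b))) =
    tsum P (comult C h) (\<lambda>a y. tsum P (comult C y) (\<lambda>b w. tsum P (comult C w) (f a b)))"
    by (rule coassoc_tsum[OF P F h])
  also have "\<dots> = tsum P (comult C h) (\<lambda>a y. tsum P (comult C y) (\<lambda>z d. tsum P (comult C z) (\<lambda>b c. f a b c d)))"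
    by (rule tsum_cong[OF mC mC P trilin_comult(1)[OF P F] _ comult_closed[OF h]])
      (rule coassoc_tsum[OF P f, symmetric])
  finally show ?thesis .
qed

lemma dg_post:
  assumes X: "module R X" and Y: "module R Y" and p: "\<phi> \<in> linear_maps R X Y" and M: "M \<in> carrier (L (L X))"
  shows "post \<phi> (dg X M) = dg Y (post (post \<phi>) M)"
proof -
  have "\<phi> (tsum X (comult C c) M) = tsum Y (comult C c) (post (post \<phi>) M)" if c: "c \<in> carrier C" for c
  proof -
    have "bilin R C C Y (\<lambda>x y. \<phi> (M x y))"
      using lin_comp[OF p bilin_l[OF LL_bilin[OF M]]] lin_comp[OF p bilin_r[OF LL_bilin[OF M]]] by (intro bilinI)
    then have "tsum Y (comult C c) (\<lambda>x y. \<phi> (M x y)) = tsum Y (comult C c) (post (post \<phi>) M)"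
      by (rule tsum_cong[OF mC mC Y _ _ comult_closed[OF c]]) (simp add: post_apply)
    then show ?thesis using tsum_map[OF mC mC X Y LL_bilin[OF M] p comult_closed[OF c]] by simp
  qed
  then show ?thesis by (auto simp: post_def dg_def)
qed

lemma post_cst:
  assumes "module R X" "\<phi> \<in> linear_maps R X Y" "a \<in> carrier X"
  shows "post \<phi> (cst X a) = cst Y (\<phi> a)"
  using assms by (auto simp: post_def cst_def lin_smult)

lemma post_post: "post \<phi> (post \<psi> f) = post (\<lambda>x. \<phi> (\<psi> x)) f"
  by (auto simp: post_def)

lemma post_cong: "(\<And>x. x \<in> carrier X \<Longrightarrow> \<phi> x = \<psi> x) \<Longrightarrow> f \<in> carrier (L X) \<Longrightarrow> post \<phi> f = post \<psi> f"
  by (auto simp: post_def L_closed)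

lemma flp_cst:
  assumes X: "assoc_algebra R X" and f: "f \<in> carrier (L X)"
  shows "flp (cst (L X) f) = post (cst X) f" "flp (post (cst X) f) = cst (L X) f"
proof -
  interpret X: assoc_algebra R X by (rule X)
  interpret LX: assoc_algebra R "L X" by (rule L_assoc_algebra[OF X])
  have a: "cst (L X) f \<in> carrier (L (L X))" by (rule cst_closed[OF LX.module_axioms f])
  have b: "post (cst X) f \<in> carrier (L (L X))" by (rule post_closed[OF ahom_lin[OF cst_hom[OF X]] f])
  show "flp (cst (L X) f) = post (cst X) f"
    by (rule LL_eqI[OF flp_closed[OF a] b]) (simp add: flp_apply cst_apply post_apply L_smult)
  show "flp (post (cst X) f) = cst (L X) f"
    by (rule LL_eqI[OF flp_closed[OF b] a]) (simp add: flp_apply cst_apply post_apply L_smult)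
qed

text \<open>The arguments of f and g are independent, so no leg is shared: at (h, k) the two
  products are f(h) g(k) and g(k) f(h).\<close>

lemma post_cst_commute:
  assumes X: "assoc_algebra R X" and f: "f \<in> carrier (L X)" and g: "g \<in> carrier (L X)"
    and comm: "\<And>h k. h \<in> carrier C \<Longrightarrow> k \<in> carrier C \<Longrightarrow> f h \<otimes>\<^bsub>X\<^esub> g k = g k \<otimes>\<^bsub>X\<^esub> f h"
  shows "post (cst X) f \<otimes>\<^bsub>L (L X)\<^esub> cst (L X) g = cst (L X) g \<otimes>\<^bsub>L (L X)\<^esub> post (cst X) f"
proof -
  note LX = L_assoc_algebra[OF X]
  note LLX = L_assoc_algebra[OF LX]
  have b: "post (cst X) f \<in> carrier (L (L X))" by (rule post_closed[OF ahom_lin[OF cst_hom[OF X]] f])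
  have a: "cst (L X) g \<in> carrier (L (L X))" by (rule cst_closed[OF assoc_algebra_module[OF LX] g])
  show ?thesis
    by (rule LL_eqI[OF L_mult_closed[OF LX b a] L_mult_closed[OF LX a b]])
      (simp add: cst_mult_apply[OF LX g b] post_apply cst_mult_apply[OF X] L_closed[OF f] g comm)
qed

end

section \<open>Multiplication and antipode of H inside Sweedler sums\<close>

context hopf_algebra
begin

lemmas aH = assoc_algebra_axioms
lemmas aHH = tensor_assoc_algebra[OF aH aH]
lemmas mHH = tensor_module[OF mC mC]

lemma antipode_closed [simp]: "h \<in> carrier H \<Longrightarrow> antipode H h \<in> carrier H"
  by (rule lin_closed[OF antipode_linear])

lemma counit_mult: "h \<in> carrier H \<Longrightarrow> k \<in> carrier H \<Longrightarrow> counit H (h \<otimes>\<^bsub>H\<^esub> k) = counit H h \<otimes>\<^bsub>R\<^esub> counit H k"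
  using ahom_mult[OF counit_hom] by (simp add: base_algebra_def)

lemma counit_one: "counit H \<one>\<^bsub>H\<^esub> = \<one>\<^bsub>R\<^esub>"
  using ahom_one[OF counit_hom] by (simp add: base_algebra_def)

lemma tsum_comult_mult:
  assumes P: "module R P" and f: "bilin R H H P f" and h: "h \<in> carrier H" and k: "k \<in> carrier H"
  shows "tsum P (comult H (h \<otimes>\<^bsub>H\<^esub> k)) f =
    tsum P (comult H h) (\<lambda>h1 h2. tsum P (comult H k) (\<lambda>k1 k2. f (h1 \<otimes>\<^bsub>H\<^esub> k1) (h2 \<otimes>\<^bsub>H\<^esub> k2)))"
proof -
  let ?T = "tensor R H H"
  note Dh = comult_closed[OF h] and Dk = comult_closed[OF k]
  note F = tsum_lin[OF mC mC P f]
  note b = tensor_mult_tsum[OF aH aH Dh Dk]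
  have "tsum P (comult H (h \<otimes>\<^bsub>H\<^esub> k)) f = tsum P (tsum ?T (comult H h) (\<lambda>x y. tsum ?T (comult H k)
      (\<lambda>x' y'. tens R H H (x \<otimes>\<^bsub>H\<^esub> x') (y \<otimes>\<^bsub>H\<^esub> y')))) f"
    using ahom_mult[OF comult_hom h k] b(1) by simp
  also have "\<dots> = tsum P (comult H h) (\<lambda>x y. tsum P (tsum ?T (comult H k)
      (\<lambda>x' y'. tens R H H (x \<otimes>\<^bsub>H\<^esub> x') (y \<otimes>\<^bsub>H\<^esub> y'))) f)"
    by (rule tsum_map[OF mC mC mHH P b(2) F Dh])
  also have "\<dots> = tsum P (comult H h) (\<lambda>h1 h2. tsum P (comult H k) (\<lambda>k1 k2. f (h1 \<otimes>\<^bsub>H\<^esub> k1) (h2 \<otimes>\<^bsub>H\<^esub> k2)))"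
  proof (rule tsum_cong[OF mC mC P _ _ Dh])
    show "bilin R H H P (\<lambda>x y. tsum P (tsum ?T (comult H k)
      (\<lambda>x' y'. tens R H H (x \<otimes>\<^bsub>H\<^esub> x') (y \<otimes>\<^bsub>H\<^esub> y'))) f)"
      by (rule bilinI[OF lin_comp[OF F bilin_r[OF b(2)]] lin_comp[OF F bilin_l[OF b(2)]]])
    fix x y assume x: "x \<in> carrier H" and y: "y \<in> carrier H"
    note bb = tensor_mult_tsum(4)[OF aH aH Dh Dk x y]
    have "tsum P (tsum ?T (comult H k) (\<lambda>x' y'. tens R H H (x \<otimes>\<^bsub>H\<^esub> x') (y \<otimes>\<^bsub>H\<^esub> y'))) f =
      tsum P (comult H k) (\<lambda>x' y'. tsum P (tens R H H (x \<otimes>\<^bsub>H\<^esub> x') (y \<otimes>\<^bsub>H\<^esub> y')) f)"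
      by (rule tsum_map[OF mC mC mHH P bb F Dk])
    also have "\<dots> = tsum P (comult H k) (\<lambda>k1 k2. f (x \<otimes>\<^bsub>H\<^esub> k1) (y \<otimes>\<^bsub>H\<^esub> k2))"
    proof (rule tsum_cong[OF mC mC P _ _ Dk])
      show "bilin R H H P (\<lambda>x' y'. tsum P (tens R H H (x \<otimes>\<^bsub>H\<^esub> x') (y \<otimes>\<^bsub>H\<^esub> y')) f)"
        by (rule bilinI[OF lin_comp[OF F bilin_r[OF bb]] lin_comp[OF F bilin_l[OF bb]]])
    qed (simp add: tsum_pure[OF mC mC P f] x y)
    finally show "tsum P (tsum ?T (comult H k) (\<lambda>x' y'. tens R H H (x \<otimes>\<^bsub>H\<^esub> x') (y \<otimes>\<^bsub>H\<^esub> y'))) f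
      = tsum P (comult H k) (\<lambda>k1 k2. f (x \<otimes>\<^bsub>H\<^esub> k1) (y \<otimes>\<^bsub>H\<^esub> k2))" .
  qed
  finally show ?thesis .
qed

lemma tsum_comult_one:
  assumes P: "module R P" and f: "bilin R H H P f"
  shows "tsum P (comult H \<one>\<^bsub>H\<^esub>) f = f \<one>\<^bsub>H\<^esub> \<one>\<^bsub>H\<^esub>"
proof -
  have "comult H \<one>\<^bsub>H\<^esub> = tens R H H \<one>\<^bsub>H\<^esub> \<one>\<^bsub>H\<^esub>"
    using ahom_one[OF comult_hom] by (simp add: tensor_def)
  then show ?thesis by (simp add: tsum_pure[OF mC mC P f])
qed

text \<open>The comultiplication of 1 is 1 \<otimes> 1, so evaluation at 1 is multiplicative. This
  is how one variable of a word is specialised.\<close>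

lemma L_mult_at_one:
  assumes X: "assoc_algebra R X" and f: "f \<in> carrier (L X)" and g: "g \<in> carrier (L X)"
  shows "(f \<otimes>\<^bsub>L X\<^esub> g) \<one>\<^bsub>H\<^esub> = f \<one>\<^bsub>H\<^esub> \<otimes>\<^bsub>X\<^esub> g \<one>\<^bsub>H\<^esub>"
  by (simp add: L_mult tsum_comult_one[OF assoc_algebra_module[OF X] L_bilin[OF X f g]])

lemma cst_at_one: "module R X \<Longrightarrow> a \<in> carrier X \<Longrightarrow> cst X a \<one>\<^bsub>H\<^esub> = a"
  by (simp add: cst_apply counit_one module.smult_one)

definition mpb where "mpb f = (\<lambda>h\<in>carrier H. \<lambda>k\<in>carrier H. f (h \<otimes>\<^bsub>H\<^esub> k))"

lemma mpb_apply: "h \<in> carrier H \<Longrightarrow> k \<in> carrier H \<Longrightarrow> mpb f h k = f (h \<otimes>\<^bsub>H\<^esub> k)"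
  by (simp add: mpb_def)

lemma mpb_closed: "f \<in> carrier (L X) \<Longrightarrow> mpb f \<in> carrier (L (L X))"
  unfolding mpb_def
  by (rule LL_I[OF bilinI[OF lin_comp[OF L_lin lin_mult_left[OF aH _ lin_id]]
      lin_comp[OF L_lin lin_mult_right[OF aH _ lin_id]]]])

text \<open>Substituting hk respects convolution because the legs of hk are the products of the legs
  of h and k.\<close>

lemma mpb_hom:
  assumes X: "assoc_algebra R X"
  shows "mpb \<in> algebra_homs R (L X) (L (L X))"
proof (rule ahomI)
  interpret X: assoc_algebra R X by (rule X)
  interpret LX: assoc_algebra R "L X" by (rule L_assoc_algebra[OF X])
  interpret LLX: assoc_algebra R "L (L X)" by (rule L_assoc_algebra[OF L_assoc_algebra[OF X]])
  note mX = assoc_algebra_module[OF X]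
  show "mpb \<in> linear_maps R (L X) (L (L X))"
    by (intro linear_mapsI LL_eqI[of _ X]) (auto simp: mpb_closed mpb_apply L_add L_smult)
  show "mpb \<one>\<^bsub>L X\<^esub> = \<one>\<^bsub>L (L X)\<^esub>"
    by (intro LL_eqI[of _ X]) (auto simp: mpb_closed mpb_apply L_one L_smult counit_mult X.smult_assoc1)
  fix f g assume f: "f \<in> carrier (L X)" and g: "g \<in> carrier (L X)"
  show "mpb (f \<otimes>\<^bsub>L X\<^esub> g) = mpb f \<otimes>\<^bsub>L (L X)\<^esub> mpb g"
  proof (rule LL_eqI[of _ X])
    fix h k assume h: "h \<in> carrier H" and k: "k \<in> carrier H"
    note M = mpb_closed[OF f] mpb_closed[OF g]
    have b: "bilin R H H X (\<lambda>h1 h2. tsum X (comult H k) (\<lambda>k1 k2. mpb f h1 k1 \<otimes>\<^bsub>X\<^esub> mpb g h2 k2))"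
    proof -
      have "bilin R H H X (\<lambda>h1 h2. (mpb f h1 \<otimes>\<^bsub>L X\<^esub> mpb g h2) k)"
        using L_bilin[OF LX.assoc_algebra_axioms M]
        by (intro bilinI[OF lin_comp[OF L_ev[OF k]] lin_comp[OF L_ev[OF k]]]) (auto simp: bilin_def)
      then show ?thesis by (simp add: L_mult k)
    qed
    have "mpb (f \<otimes>\<^bsub>L X\<^esub> g) h k = tsum X (comult H h) (\<lambda>h1 h2. tsum X (comult H k)
        (\<lambda>k1 k2. f (h1 \<otimes>\<^bsub>H\<^esub> k1) \<otimes>\<^bsub>X\<^esub> g (h2 \<otimes>\<^bsub>H\<^esub> k2)))"
      by (simp add: mpb_apply h k L_mult tsum_comult_mult[OF mX L_bilin[OF X f g] h k])
    also have "\<dots> = tsum X (comult H h) (\<lambda>h1 h2. tsum X (comult H k) (\<lambda>k1 k2. mpb f h1 k1 \<otimes>\<^bsub>X\<^esub> mpb g h2 k2))"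
    proof (rule sym, rule tsum_cong[OF mC mC mX b _ comult_closed[OF h]])
      fix h1 h2 assume hh: "h1 \<in> carrier H" "h2 \<in> carrier H"
      show "tsum X (comult H k) (\<lambda>k1 k2. mpb f h1 k1 \<otimes>\<^bsub>X\<^esub> mpb g h2 k2) =
        tsum X (comult H k) (\<lambda>k1 k2. f (h1 \<otimes>\<^bsub>H\<^esub> k1) \<otimes>\<^bsub>X\<^esub> g (h2 \<otimes>\<^bsub>H\<^esub> k2))"
        by (rule tsum_cong[OF mC mC mX L_bilin[OF X L_closed[OF M(1) hh(1)] L_closed[OF M(2) hh(2)]] _ comult_closed[OF k]])
          (simp add: mpb_apply hh)
    qed
    also have "\<dots> = (mpb f \<otimes>\<^bsub>L (L X)\<^esub> mpb g) h k"
      by (simp add: LL_mult_apply(2)[OF X M h k])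
    finally show "mpb (f \<otimes>\<^bsub>L X\<^esub> g) h k = (mpb f \<otimes>\<^bsub>L (L X)\<^esub> mpb g) h k" .
  qed (use f g mpb_closed[OF LX.m_closed[OF f g]] LLX.m_closed[OF mpb_closed[OF f] mpb_closed[OF g]] in auto)
qed

lemma mpb_cst: "module R X \<Longrightarrow> a \<in> carrier X \<Longrightarrow> mpb (cst X a) = cst (L X) (cst X a)"
  by (auto simp: mpb_def cst_def restrict_def conv_algebra_def counit_mult module.smult_assoc1 fun_eq_iff)

lemma mpb_at_one: "f \<in> carrier (L X) \<Longrightarrow> mpb f \<one>\<^bsub>H\<^esub> = f"
  by (rule L_eqI[of _ X]) (auto simp: mpb_apply L_closed[OF mpb_closed])

lemma post_mpb: "f \<in> carrier (L X) \<Longrightarrow> post (post \<phi>) (mpb f) = mpb (post \<phi> f)"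
  by (auto simp: post_def mpb_def restrict_def fun_eq_iff)

lemma mpb_post: "f \<in> carrier (L X) \<Longrightarrow> mpb (post \<phi> f) = post (post \<phi>) (mpb f)"
  by (auto simp: post_def mpb_def restrict_def fun_eq_iff)

lemma antipode_L: "(\<lambda>h\<in>carrier H. antipode H h) \<in> carrier (L H)" "(\<lambda>h\<in>carrier H. h) \<in> carrier (L H)"
  by (rule L_I[OF antipode_linear]) (rule L_I[OF lin_id])

lemma antipode_conv:
  "(\<lambda>h\<in>carrier H. antipode H h) \<otimes>\<^bsub>L H\<^esub> (\<lambda>h\<in>carrier H. h) = \<one>\<^bsub>L H\<^esub>"
  "(\<lambda>h\<in>carrier H. h) \<otimes>\<^bsub>L H\<^esub> (\<lambda>h\<in>carrier H. antipode H h) = \<one>\<^bsub>L H\<^esub>"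
proof -
  have bl: "bilin R H H H (\<lambda>x y. antipode H x \<otimes>\<^bsub>H\<^esub> y)" "bilin R H H H (\<lambda>x y. x \<otimes>\<^bsub>H\<^esub> antipode H y)"
    by (rule bilin_mult[OF aH antipode_linear lin_id] bilin_mult[OF aH lin_id antipode_linear])+
  have 1: "((\<lambda>h\<in>carrier H. antipode H h) \<otimes>\<^bsub>L H\<^esub> (\<lambda>h\<in>carrier H. h)) h = \<one>\<^bsub>L H\<^esub> h"
    if h: "h \<in> carrier H" for h
  proof -
    have "tsum H (comult H h) (\<lambda>x y. antipode H x \<otimes>\<^bsub>H\<^esub> y) =
      tsum H (comult H h) (\<lambda>x y. (\<lambda>h\<in>carrier H. antipode H h) x \<otimes>\<^bsub>H\<^esub> (\<lambda>h\<in>carrier H. h) y)"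
      by (rule tsum_cong[OF mC mC mC bl(1) _ comult_closed[OF h]]) simp
    then show ?thesis using antipode_left[OF h] by (simp add: L_mult L_one h convolution_def)
  qed
  have 2: "((\<lambda>h\<in>carrier H. h) \<otimes>\<^bsub>L H\<^esub> (\<lambda>h\<in>carrier H. antipode H h)) h = \<one>\<^bsub>L H\<^esub> h"
    if h: "h \<in> carrier H" for h
  proof -
    have "tsum H (comult H h) (\<lambda>x y. x \<otimes>\<^bsub>H\<^esub> antipode H y) =
      tsum H (comult H h) (\<lambda>x y. (\<lambda>h\<in>carrier H. h) x \<otimes>\<^bsub>H\<^esub> (\<lambda>h\<in>carrier H. antipode H h) y)"
      by (rule tsum_cong[OF mC mC mC bl(2) _ comult_closed[OF h]]) simp
    then show ?thesis using antipode_right[OF h] by (simp add: L_mult L_one h convolution_def)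
  qed
  note cl = L_mult_closed[OF aH antipode_L] L_mult_closed[OF aH antipode_L(2,1)] L_one_closed[OF aH]
  show "(\<lambda>h\<in>carrier H. antipode H h) \<otimes>\<^bsub>L H\<^esub> (\<lambda>h\<in>carrier H. h) = \<one>\<^bsub>L H\<^esub>"
    by (rule L_eqI[OF cl(1,3) 1])
  show "(\<lambda>h\<in>carrier H. h) \<otimes>\<^bsub>L H\<^esub> (\<lambda>h\<in>carrier H. antipode H h) = \<one>\<^bsub>L H\<^esub>"
    by (rule L_eqI[OF cl(2,3) 2])
qed

end

lemma tens_left_hom:
  assumes X: "assoc_algebra R X" and Y: "assoc_algebra R Y"
  shows "(\<lambda>x. tens R X Y x \<one>\<^bsub>Y\<^esub>) \<in> algebra_homs R X (tensor R X Y)"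
proof (rule ahomI)
  interpret X: assoc_algebra R X by (rule X)
  interpret Y: assoc_algebra R Y by (rule Y)
  show "(\<lambda>x. tens R X Y x \<one>\<^bsub>Y\<^esub>) \<in> linear_maps R X (tensor R X Y)"
    by (rule bilin_l[OF tens_bilin[OF X.module_axioms Y.module_axioms]]) simp
  show "tens R X Y \<one>\<^bsub>X\<^esub> \<one>\<^bsub>Y\<^esub> = \<one>\<^bsub>tensor R X Y\<^esub>" by (simp add: tensor_def)
qed (simp add: tensor_mult_tens[OF assms] assoc_algebra_one[OF Y] ring.ring_simprules[OF assoc_algebra_ring[OF Y]])

lemma tens_right_hom:
  assumes X: "assoc_algebra R X" and Y: "assoc_algebra R Y"
  shows "tens R X Y \<one>\<^bsub>X\<^esub> \<in> algebra_homs R Y (tensor R X Y)"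
proof (rule ahomI)
  interpret X: assoc_algebra R X by (rule X)
  interpret Y: assoc_algebra R Y by (rule Y)
  show "tens R X Y \<one>\<^bsub>X\<^esub> \<in> linear_maps R Y (tensor R X Y)"
    by (rule bilin_r[OF tens_bilin[OF X.module_axioms Y.module_axioms]]) simp
  show "tens R X Y \<one>\<^bsub>X\<^esub> \<one>\<^bsub>Y\<^esub> = \<one>\<^bsub>tensor R X Y\<^esub>" by (simp add: tensor_def)
qed (simp add: tensor_mult_tens[OF assms] assoc_algebra_one[OF X] ring.ring_simprules[OF assoc_algebra_ring[OF X]])

context hopf_algebra
begin

text \<open>Both sides are convolution inverses of \<open>\<Delta>\<close>.\<close>

lemma tsum_comult_antipode:
  assumes P: "module R P" and f: "bilin R H H P f" and h: "h \<in> carrier H"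
  shows "tsum P (comult H (antipode H h)) f =
    tsum P (comult H h) (\<lambda>h1 h2. f (antipode H h2) (antipode H h1))"
proof -
  let ?T = "tensor R H H"
  interpret LT: assoc_algebra R "L ?T" by (rule L_assoc_algebra[OF aHH])
  interpret LH: assoc_algebra R "L H" by (rule L_assoc_algebra[OF aH])
  define i where "i = (\<lambda>h\<in>carrier H. h)"
  define s where "s = (\<lambda>h\<in>carrier H. antipode H h)"
  have iis: "i \<in> carrier (L H)" "s \<in> carrier (L H)" and si: "s \<otimes>\<^bsub>L H\<^esub> i = \<one>\<^bsub>L H\<^esub>" "i \<otimes>\<^bsub>L H\<^esub> s = \<one>\<^bsub>L H\<^esub>"
    using antipode_L antipode_conv by (simp_all add: i_def s_def)
  let ?l = "\<lambda>x. tens R H H x \<one>\<^bsub>H\<^esub>" and ?r = "tens R H H \<one>\<^bsub>H\<^esub>"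
  note ph = post_hom[OF aH aHH]
  note l = ph[OF tens_left_hom[OF aH aH]] and r = ph[OF tens_right_hom[OF aH aH]] and d = ph[OF comult_hom]
  note cl = ahom_closed[OF l] ahom_closed[OF r] ahom_closed[OF d]
  \<comment> \<open>Since \<Delta>(h) = \<Sum> (h1 \<otimes> 1)(1 \<otimes> h2), \<Delta> is a
    convolution product of two invertible factors. Its inverse is the product of their inverses in
    reverse order, \<Sum> (1 \<otimes> S(h1))(S(h2) \<otimes> 1).\<close>
  have D: "post (comult H) i = post ?l i \<otimes>\<^bsub>L ?T\<^esub> post ?r i"
  proof (rule L_eqI[of _ ?T])
    fix c assume c: "c \<in> carrier H"
    note b = tens_bilin[OF mC mC]
    have "(post ?l i \<otimes>\<^bsub>L ?T\<^esub> post ?r i) c = tsum ?T (comult H c) (tens R H H)"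
      unfolding L_mult[OF c]
      by (rule sym, rule tsum_cong[OF mC mC mHH b _ comult_closed[OF c]])
        (simp add: post_apply i_def tensor_mult_tens[OF aH aH])
    then show "post (comult H) i c = (post ?l i \<otimes>\<^bsub>L ?T\<^esub> post ?r i) c"
      by (simp add: post_apply c i_def tsum_tens_id[OF mC mC])
  qed (use iis cl in auto)
  have e1: "post (comult H) s \<otimes>\<^bsub>L ?T\<^esub> post (comult H) i = \<one>\<^bsub>L ?T\<^esub>"
    using ahom_mult[OF d iis(2,1)] ahom_one[OF d] si by simp
  have e2: "post ?l i \<otimes>\<^bsub>L ?T\<^esub> post ?l s = \<one>\<^bsub>L ?T\<^esub>"
    using ahom_mult[OF l iis] ahom_one[OF l] si by simp
  have e3: "post ?r i \<otimes>\<^bsub>L ?T\<^esub> post ?r s = \<one>\<^bsub>L ?T\<^esub>"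
    using ahom_mult[OF r iis] ahom_one[OF r] si by simp
  let ?n = "post ?r s \<otimes>\<^bsub>L ?T\<^esub> post ?l s"
  have c: "post (comult H) s \<in> carrier (L ?T)" "post (comult H) i \<in> carrier (L ?T)"
    "post ?l i \<in> carrier (L ?T)" "post ?l s \<in> carrier (L ?T)" "post ?r i \<in> carrier (L ?T)" "post ?r s \<in> carrier (L ?T)"
    using iis cl by auto
  have "post ?r i \<otimes>\<^bsub>L ?T\<^esub> ?n = post ?l s"
    using e3 c by (simp add: LT.m_assoc[symmetric])
  then have "post (comult H) i \<otimes>\<^bsub>L ?T\<^esub> ?n = \<one>\<^bsub>L ?T\<^esub>"
    using D e2 c by (simp add: LT.m_assoc)
  then have "post (comult H) s = post (comult H) s \<otimes>\<^bsub>L ?T\<^esub> (post (comult H) i \<otimes>\<^bsub>L ?T\<^esub> ?n)"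
    using c by simp
  also have "\<dots> = ?n" using e1 c by (simp add: LT.m_assoc[symmetric])
  finally have "post (comult H) s h = ?n h" by simp
  moreover have b: "bilin R H H ?T (\<lambda>h1 h2. tens R H H (antipode H h2) (antipode H h1))"
    using lin_comp[OF bilin_l[OF tens_bilin[OF mC mC]] antipode_linear]
      lin_comp[OF bilin_r[OF tens_bilin[OF mC mC]] antipode_linear] by (intro bilinI) auto
  moreover have "?n h = tsum ?T (comult H h) (\<lambda>h1 h2. tens R H H (antipode H h2) (antipode H h1))"
    unfolding L_mult[OF h]
    by (rule sym, rule tsum_cong[OF mC mC mHH b _ comult_closed[OF h]])
      (simp add: post_apply s_def tensor_mult_tens[OF aH aH])
  ultimately have "comult H (antipode H h) = tsum ?T (comult H h) (\<lambda>h1 h2. tens R H H (antipode H h2) (antipode H h1))"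
    using h by (simp add: post_apply s_def)
  then have "tsum P (comult H (antipode H h)) f =
      tsum P (comult H h) (\<lambda>h1 h2. tsum P (tens R H H (antipode H h2) (antipode H h1)) f)"
    using tsum_map[OF mC mC mHH P b tsum_lin[OF mC mC P f] comult_closed[OF h]] by simp
  also have "\<dots> = tsum P (comult H h) (\<lambda>h1 h2. f (antipode H h2) (antipode H h1))"
    by (rule sym, rule tsum_cong[OF mC mC P _ _ comult_closed[OF h]])
      (use lin_comp[OF bilin_l[OF f] antipode_linear] lin_comp[OF bilin_r[OF f] antipode_linear] in
        \<open>auto intro!: bilinI simp: tsum_pure[OF mC mC P f]\<close>)
  finally show ?thesis .
qed

end

context hopf_algebra
begin

section \<open>Contraction with the antipode\<close>

text \<open>
  In Sweedler notation \<open>evL X M h = \<Sum> M(S(h\<^sub>1), h\<^sub>2)\<close>, \<open>evR X M h = \<Sum> M(h\<^sub>1, S(h\<^sub>2))\<close> and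
  \<open>ev3 X M h = \<Sum> M(h\<^sub>1, S(h\<^sub>2), h\<^sub>3)\<close>.
\<close>

definition preL where "preL M = (\<lambda>x\<in>carrier H. M (antipode H x))"
definition preR where "preR M = (\<lambda>x\<in>carrier H. \<lambda>y\<in>carrier H. M x (antipode H y))"
definition evL where "evL X M = dg X (preL M)"
definition evR where "evR X M = dg X (preR M)"
definition ev3 where "ev3 X M = dg X (evR (L X) M)"

lemma preL_apply: "x \<in> carrier H \<Longrightarrow> preL M x = M (antipode H x)"
  by (simp add: preL_def)

lemma preR_apply: "x \<in> carrier H \<Longrightarrow> y \<in> carrier H \<Longrightarrow> preR M x y = M x (antipode H y)"
  by (simp add: preR_def)

lemma preL_closed: "M \<in> carrier (L Y) \<Longrightarrow> preL M \<in> carrier (L Y)"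
  unfolding preL_def by (rule L_I[OF lin_comp[OF L_lin antipode_linear]])

lemma preR_closed: "M \<in> carrier (L (L X)) \<Longrightarrow> preR M \<in> carrier (L (L X))"
  unfolding preR_def
proof (rule LL_I, rule bilinI)
  assume M: "M \<in> carrier (L (L X))"
  note b = LL_bilin[OF M]
  show "(\<lambda>y. M x (antipode H y)) \<in> linear_maps R H X" if "x \<in> carrier H" for x
    by (rule lin_comp[OF bilin_r[OF b that] antipode_linear])
  show "(\<lambda>x. M x (antipode H y)) \<in> linear_maps R H X" if "y \<in> carrier H" for y
    by (rule bilin_l[OF b]) (simp add: that)
qed

lemma evL_closed: "module R X \<Longrightarrow> M \<in> carrier (L (L X)) \<Longrightarrow> evL X M \<in> carrier (L X)"
  unfolding evL_def by (rule dg_closed[OF _ preL_closed])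

lemma evR_closed: "module R X \<Longrightarrow> M \<in> carrier (L (L X)) \<Longrightarrow> evR X M \<in> carrier (L X)"
  unfolding evR_def by (rule dg_closed[OF _ preR_closed])

lemma ev3_closed: "assoc_algebra R X \<Longrightarrow> M \<in> carrier (L (L (L X))) \<Longrightarrow> ev3 X M \<in> carrier (L X)"
  unfolding ev3_def
  by (intro dg_closed[OF assoc_algebra_module] evR_closed[OF assoc_algebra_module[OF L_assoc_algebra]])

lemma evL_apply:
  assumes X: "module R X" and M: "M \<in> carrier (L (L X))" and c: "c \<in> carrier H"
  shows "evL X M c = tsum X (comult H c) (\<lambda>x y. M (antipode H x) y)"
  unfolding evL_def dg_apply[OF c]
  by (rule tsum_cong[OF mC mC X LL_bilin[OF preL_closed[OF M]] _ comult_closed[OF c]]) (simp add: preL_apply)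

lemma evR_apply:
  assumes X: "module R X" and M: "M \<in> carrier (L (L X))" and c: "c \<in> carrier H"
  shows "evR X M c = tsum X (comult H c) (\<lambda>x y. M x (antipode H y))"
  unfolding evR_def dg_apply[OF c]
  by (rule tsum_cong[OF mC mC X LL_bilin[OF preR_closed[OF M]] _ comult_closed[OF c]]) (simp add: preR_apply)

lemma evL_post:
  assumes X: "module R X" and Y: "module R Y" and p: "\<phi> \<in> linear_maps R X Y" and M: "M \<in> carrier (L (L X))"
  shows "post \<phi> (evL X M) = evL Y (post (post \<phi>) M)"
proof -
  have "post (post \<phi>) (preL M) = preL (post (post \<phi>) M)"
    by (auto simp: post_def preL_def)
  then show ?thesis unfolding evL_def by (simp add: dg_post[OF X Y p preL_closed[OF M]])
qed

lemma evR_post: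
  assumes X: "module R X" and Y: "module R Y" and p: "\<phi> \<in> linear_maps R X Y" and M: "M \<in> carrier (L (L X))"
  shows "post \<phi> (evR X M) = evR Y (post (post \<phi>) M)"
proof -
  have "post (post \<phi>) (preR M) = preR (post (post \<phi>) M)"
    by (auto simp: post_def preR_def restrict_def fun_eq_iff)
  then show ?thesis unfolding evR_def by (simp add: dg_post[OF X Y p preR_closed[OF M]])
qed

lemma ev3_post:
  assumes X: "assoc_algebra R X" and Y: "assoc_algebra R Y" and p: "\<phi> \<in> algebra_homs R X Y"
    and M: "M \<in> carrier (L (L (L X)))"
  shows "post \<phi> (ev3 X M) = ev3 Y (post (post (post \<phi>)) M)"
proof -
  note LX = assoc_algebra_module[OF L_assoc_algebra[OF X]] and LY = assoc_algebra_module[OF L_assoc_algebra[OF Y]]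
  show ?thesis unfolding ev3_def
    by (simp add: dg_post[OF assoc_algebra_module[OF X] assoc_algebra_module[OF Y] ahom_lin[OF p] evR_closed[OF LX M]]
      evR_post[OF LX LY ahom_lin[OF post_hom[OF X Y p]] M])
qed

lemma evL_mult_cst:
  assumes X: "assoc_algebra R X" and M: "M \<in> carrier (L (L X))" and g: "g \<in> carrier (L X)"
  shows "evL X (M \<otimes>\<^bsub>L (L X)\<^esub> cst (L X) g) = evL X M \<otimes>\<^bsub>L X\<^esub> g"
proof -
  note LX = L_assoc_algebra[OF X]
  note mLX = assoc_algebra_module[OF LX]
  note P = cst_closed[OF mLX g]
  have "preL (M \<otimes>\<^bsub>L (L X)\<^esub> cst (L X) g) = preL M \<otimes>\<^bsub>L (L X)\<^esub> cst (L X) g"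
    by (rule L_eqI[OF preL_closed[OF L_mult_closed[OF LX M P]] L_mult_closed[OF LX preL_closed[OF M] P]])
      (simp add: preL_apply cst_mult_apply[OF LX g M] cst_mult_apply[OF LX g preL_closed[OF M]])
  then show ?thesis unfolding evL_def by (simp add: dg_mult_cst[OF X preL_closed[OF M] g])
qed

lemma antipode_mult_left:
  assumes X: "module R X" and g: "g \<in> linear_maps R H X" and c: "c \<in> carrier H"
  shows "tsum X (comult H c) (\<lambda>x y. g (antipode H x \<otimes>\<^bsub>H\<^esub> y)) = counit H c \<odot>\<^bsub>X\<^esub> g \<one>\<^bsub>H\<^esub>"
  using tsum_map[OF mC mC mC X bilin_mult[OF aH antipode_linear lin_id] g comult_closed[OF c]]
    antipode_left[OF c] by (simp add: convolution_def lin_smult[OF g] c)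

lemma antipode_mult_right:
  assumes X: "module R X" and g: "g \<in> linear_maps R H X" and c: "c \<in> carrier H"
  shows "tsum X (comult H c) (\<lambda>x y. g (x \<otimes>\<^bsub>H\<^esub> antipode H y)) = counit H c \<odot>\<^bsub>X\<^esub> g \<one>\<^bsub>H\<^esub>"
  using tsum_map[OF mC mC mC X bilin_mult[OF aH lin_id antipode_linear] g comult_closed[OF c]]
    antipode_right[OF c] by (simp add: convolution_def lin_smult[OF g] c)

text \<open>\<open>\<Sum> g(S(h\<^sub>2) h\<^sub>3) M(S(h\<^sub>1), h\<^sub>4) = g(1) \<Sum> M(S(h\<^sub>1), h\<^sub>2)\<close>.\<close>

lemma evL_mpb_mult:
  assumes X: "assoc_algebra R X" and M: "M \<in> carrier (L (L X))" and g: "g \<in> carrier (L X)"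
  shows "evL X (mpb g \<otimes>\<^bsub>L (L X)\<^esub> M) = cst X (g \<one>\<^bsub>H\<^esub>) \<otimes>\<^bsub>L X\<^esub> evL X M"
proof -
  interpret X: assoc_algebra R X by (rule X)
  note LX = L_assoc_algebra[OF X] and mX = assoc_algebra_module[OF X]
  note mLX = assoc_algebra_module[OF LX]
  note mg = mpb_closed[OF g]
  note P = L_mult_closed[OF LX mg M]
  note D = comult_closed
  note bM = LL_bilin[OF M]
  have g1: "g \<one>\<^bsub>H\<^esub> \<in> carrier X" by (rule L_closed[OF g]) simp
  have Sl: "(\<lambda>a. M (antipode H a) d) \<in> linear_maps R H X" if "d \<in> carrier H" for d
    by (rule lin_comp[OF bilin_l[OF bM that] antipode_linear])
  have gl: "(\<lambda>b. g (antipode H b \<otimes>\<^bsub>H\<^esub> c)) \<in> linear_maps R H X" if "c \<in> carrier H" for c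
    by (rule lin_comp[OF L_lin[OF g] lin_mult_right[OF aH that antipode_linear]])
  have gr: "(\<lambda>c. g (antipode H b \<otimes>\<^bsub>H\<^esub> c)) \<in> linear_maps R H X" if "b \<in> carrier H" for b
    by (rule lin_comp[OF L_lin[OF g] lin_mult_left[OF aH _ lin_id]]) (simp add: that)
  let ?f = "\<lambda>a b c d. g (antipode H b \<otimes>\<^bsub>H\<^esub> c) \<otimes>\<^bsub>X\<^esub> M (antipode H a) d"
  have f: "trilin R H H H X (?f a)" if "a \<in> carrier H" for a
    by (rule trilinI) (auto intro!: lin_mult_left[OF X] lin_mult_right[OF X] gl gr bilin_r[OF bM]
      bilin_closed[OF bM] L_closed[OF g] simp: that)
  have f1: "(\<lambda>a. ?f a b c d) \<in> linear_maps R H X" if "b \<in> carrier H" "c \<in> carrier H" "d \<in> carrier H" for b c d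
    by (rule lin_mult_left[OF X _ Sl]) (auto simp: that L_closed[OF g])
  show ?thesis
  proof (rule L_eqI[of _ X])
    fix h assume h: "h \<in> carrier H"
    have "evL X (mpb g \<otimes>\<^bsub>L (L X)\<^esub> M) h = tsum X (comult H h) (\<lambda>x y. (mpb g \<otimes>\<^bsub>L (L X)\<^esub> M) (antipode H x) y)"
      by (rule evL_apply[OF mX P h])
    also have "\<dots> = tsum X (comult H h) (\<lambda>x y. tsum X (comult H x) (\<lambda>a b. tsum X (comult H y) (\<lambda>c d. ?f a b c d)))"
    proof (rule tsum_cong[OF mC mC mX _ _ D[OF h]])
      show "bilin R H H X (\<lambda>x y. (mpb g \<otimes>\<^bsub>L (L X)\<^esub> M) (antipode H x) y)"
        by (rule bilinI[OF bilin_r[OF LL_bilin[OF P]] lin_comp[OF bilin_l[OF LL_bilin[OF P]] antipode_linear]]) simp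
      fix x y assume x: "x \<in> carrier H" and y: "y \<in> carrier H"
      have b: "bilin R H H X (\<lambda>u v. (mpb g u \<otimes>\<^bsub>L X\<^esub> M v) y)"
        using L_bilin[OF LX mg M] by (intro bilinI[OF lin_comp[OF L_ev[OF y]] lin_comp[OF L_ev[OF y]]]) (auto simp: bilin_def)
      have b': "bilin R H H X (\<lambda>a b. (mpb g (antipode H b) \<otimes>\<^bsub>L X\<^esub> M (antipode H a)) y)"
        by (rule bilinI[OF lin_comp[OF bilin_l[OF b] antipode_linear] lin_comp[OF bilin_r[OF b] antipode_linear]]) auto
      have "(mpb g \<otimes>\<^bsub>L (L X)\<^esub> M) (antipode H x) y =
        tsum X (comult H x) (\<lambda>a b. (mpb g (antipode H b) \<otimes>\<^bsub>L X\<^esub> M (antipode H a)) y)"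
        using LL_mult_apply(1)[OF X mg M antipode_closed[OF x] y] tsum_comult_antipode[OF mX b x] by simp
      also have "\<dots> = tsum X (comult H x) (\<lambda>a b. tsum X (comult H y) (\<lambda>c d. ?f a b c d))"
      proof (rule tsum_cong[OF mC mC mX b' _ D[OF x]])
        fix a b assume a: "a \<in> carrier H" and b: "b \<in> carrier H"
        show "(mpb g (antipode H b) \<otimes>\<^bsub>L X\<^esub> M (antipode H a)) y = tsum X (comult H y) (\<lambda>c d. ?f a b c d)"
          unfolding L_mult[OF y]
          by (rule sym, rule tsum_cong[OF mC mC mX trilinD(1)[OF f[OF a] b] _ D[OF y]]) (simp add: mpb_apply b)
      qed
      finally show "(mpb g \<otimes>\<^bsub>L (L X)\<^esub> M) (antipode H x) y =
        tsum X (comult H x) (\<lambda>a b. tsum X (comult H y) (\<lambda>c d. ?f a b c d))" .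
    qed
    \<comment> \<open>The antipode has reversed the legs of x, which brings b next to c. Regrouped
      as the legs of one element z, this pair gives g(S(b) c) = \<epsilon>(z) g(1).\<close>
    also have "\<dots> = tsum X (comult H h) (\<lambda>a y. tsum X (comult H y) (\<lambda>z d. tsum X (comult H z) (\<lambda>b c. ?f a b c d)))"
      by (rule comult_four[OF mX h f f1])
    also have "\<dots> = tsum X (comult H h) (\<lambda>a y. g \<one>\<^bsub>H\<^esub> \<otimes>\<^bsub>X\<^esub> M (antipode H a) y)"
    proof (rule sym, rule tsum_cong[OF mC mC mX _ _ D[OF h]])
      show "bilin R H H X (\<lambda>a y. g \<one>\<^bsub>H\<^esub> \<otimes>\<^bsub>X\<^esub> M (antipode H a) y)"
        by (rule bilinI[OF lin_mult_left[OF X g1 bilin_r[OF bM]] lin_mult_left[OF X g1 Sl]]) auto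
      fix a y assume a: "a \<in> carrier H" and y: "y \<in> carrier H"
      have l: "(\<lambda>d. g \<one>\<^bsub>H\<^esub> \<otimes>\<^bsub>X\<^esub> M (antipode H a) d) \<in> linear_maps R H X"
        by (rule lin_mult_left[OF X g1 bilin_r[OF bM]]) (simp add: a)
      have "g \<one>\<^bsub>H\<^esub> \<otimes>\<^bsub>X\<^esub> M (antipode H a) y = tsum X (comult H y)
          (\<lambda>z d. counit H z \<odot>\<^bsub>X\<^esub> (g \<one>\<^bsub>H\<^esub> \<otimes>\<^bsub>X\<^esub> M (antipode H a) d))"
        by (rule sw_counit_left[OF mX l y, symmetric])
      also have "\<dots> = tsum X (comult H y) (\<lambda>z d. tsum X (comult H z) (\<lambda>b c. ?f a b c d))"
      proof (rule tsum_cong[OF mC mC mX _ _ D[OF y]])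
        show "bilin R H H X (\<lambda>z d. counit H z \<odot>\<^bsub>X\<^esub> (g \<one>\<^bsub>H\<^esub> \<otimes>\<^bsub>X\<^esub> M (antipode H a) d))"
          by (rule bilinI[OF lin_functional2[OF mX _ l] lin_functional[OF mX counit_linear]]) (auto simp: lin_closed[OF l])
        fix z d assume z: "z \<in> carrier H" and d: "d \<in> carrier H"
        have m: "M (antipode H a) d \<in> carrier X" using a d by (simp add: bilin_closed[OF bM])
        have gb: "bilin R H H X (\<lambda>b c. g (antipode H b \<otimes>\<^bsub>H\<^esub> c))"
          by (rule bilinI[OF gr gl])
        show "counit H z \<odot>\<^bsub>X\<^esub> (g \<one>\<^bsub>H\<^esub> \<otimes>\<^bsub>X\<^esub> M (antipode H a) d) = tsum X (comult H z) (\<lambda>b c. ?f a b c d)"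
          using tsum_map[OF mC mC mX mX gb lin_mult_right[OF X m lin_id] D[OF z]]
            antipode_mult_left[OF mX L_lin[OF g] z] z by (simp add: X.smult_mult_left m g1)
      qed
      finally show "g \<one>\<^bsub>H\<^esub> \<otimes>\<^bsub>X\<^esub> M (antipode H a) y =
        tsum X (comult H y) (\<lambda>z d. tsum X (comult H z) (\<lambda>b c. ?f a b c d))" .
    qed
    also have "\<dots> = g \<one>\<^bsub>H\<^esub> \<otimes>\<^bsub>X\<^esub> evL X M h"
    proof -
      have b: "bilin R H H X (\<lambda>x y. M (antipode H x) y)"
        by (rule bilinI[OF bilin_r[OF bM] Sl]) simp
      show ?thesis unfolding evL_apply[OF mX M h]
        by (rule tsum_map[OF mC mC mX mX b lin_mult_left[OF X g1 lin_id] D[OF h], symmetric])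
    qed
    also have "\<dots> = (cst X (g \<one>\<^bsub>H\<^esub>) \<otimes>\<^bsub>L X\<^esub> evL X M) h"
      by (simp add: cst_mult_apply[OF X g1 evL_closed[OF mX M] h])
    finally show "evL X (mpb g \<otimes>\<^bsub>L (L X)\<^esub> M) h = (cst X (g \<one>\<^bsub>H\<^esub>) \<otimes>\<^bsub>L X\<^esub> evL X M) h" .
  qed (auto intro: evL_closed[OF mX] P M L_mult_closed[OF X] cst_closed[OF mX] g1)
qed

text \<open>Mirror image of \<open>evL_mpb_mult\<close>: the reversal of legs by the antipode leaves
  g(b S(c)) with b and c the two middle legs, and this contracts to g(1).\<close>

lemma evR_mult_mpb:
  assumes X: "assoc_algebra R X" and M: "M \<in> carrier (L (L X))" and g: "g \<in> carrier (L X)"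
  shows "evR X (M \<otimes>\<^bsub>L (L X)\<^esub> mpb g) = evR X M \<otimes>\<^bsub>L X\<^esub> cst X (g \<one>\<^bsub>H\<^esub>)"
proof -
  interpret X: assoc_algebra R X by (rule X)
  note LX = L_assoc_algebra[OF X] and mX = assoc_algebra_module[OF X]
  note mLX = assoc_algebra_module[OF LX]
  note mg = mpb_closed[OF g]
  note P = L_mult_closed[OF LX M mg]
  note D = comult_closed
  note bM = LL_bilin[OF M]
  have g1: "g \<one>\<^bsub>H\<^esub> \<in> carrier X" by (rule L_closed[OF g]) simp
  have Sl: "(\<lambda>d. M a (antipode H d)) \<in> linear_maps R H X" if "a \<in> carrier H" for a
    by (rule lin_comp[OF bilin_r[OF bM that] antipode_linear])
  have gl: "(\<lambda>b. g (b \<otimes>\<^bsub>H\<^esub> antipode H c)) \<in> linear_maps R H X" if "c \<in> carrier H" for c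
    by (rule lin_comp[OF L_lin[OF g] lin_mult_right[OF aH _ lin_id]]) (simp add: that)
  have gr: "(\<lambda>c. g (b \<otimes>\<^bsub>H\<^esub> antipode H c)) \<in> linear_maps R H X" if "b \<in> carrier H" for b
    by (rule lin_comp[OF L_lin[OF g] lin_mult_left[OF aH that antipode_linear]])
  let ?f = "\<lambda>a b c d. M a (antipode H d) \<otimes>\<^bsub>X\<^esub> g (b \<otimes>\<^bsub>H\<^esub> antipode H c)"
  have f: "trilin R H H H X (?f a)" if "a \<in> carrier H" for a
    by (rule trilinI) (auto intro!: lin_mult_left[OF X] lin_mult_right[OF X] gl gr Sl
      bilin_closed[OF bM] L_closed[OF g] simp: that)
  have f1: "(\<lambda>a. ?f a b c d) \<in> linear_maps R H X" if "b \<in> carrier H" "c \<in> carrier H" "d \<in> carrier H" for b c d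
    by (rule lin_mult_right[OF X _ bilin_l[OF bM]]) (auto simp: that L_closed[OF g])
  show ?thesis
  proof (rule L_eqI[of _ X])
    fix h assume h: "h \<in> carrier H"
    have "evR X (M \<otimes>\<^bsub>L (L X)\<^esub> mpb g) h = tsum X (comult H h) (\<lambda>x y. (M \<otimes>\<^bsub>L (L X)\<^esub> mpb g) x (antipode H y))"
      by (rule evR_apply[OF mX P h])
    also have "\<dots> = tsum X (comult H h) (\<lambda>x y. tsum X (comult H x) (\<lambda>a b. tsum X (comult H y) (\<lambda>c d. ?f a b c d)))"
    proof (rule tsum_cong[OF mC mC mX _ _ D[OF h]])
      show "bilin R H H X (\<lambda>x y. (M \<otimes>\<^bsub>L (L X)\<^esub> mpb g) x (antipode H y))"
        by (rule bilinI[OF lin_comp[OF bilin_r[OF LL_bilin[OF P]] antipode_linear] bilin_l[OF LL_bilin[OF P]]]) auto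
      fix x y assume x: "x \<in> carrier H" and y: "y \<in> carrier H"
      note Sy = antipode_closed[OF y]
      have b: "bilin R H H X (\<lambda>u v. (M u \<otimes>\<^bsub>L X\<^esub> mpb g v) (antipode H y))"
        using L_bilin[OF LX M mg] by (intro bilinI[OF lin_comp[OF L_ev[OF Sy]] lin_comp[OF L_ev[OF Sy]]]) (auto simp: bilin_def)
      show "(M \<otimes>\<^bsub>L (L X)\<^esub> mpb g) x (antipode H y) =
        tsum X (comult H x) (\<lambda>a b. tsum X (comult H y) (\<lambda>c d. ?f a b c d))"
        unfolding LL_mult_apply(1)[OF X M mg x Sy]
      proof (rule tsum_cong[OF mC mC mX b _ D[OF x]])
        fix a b assume a: "a \<in> carrier H" and b: "b \<in> carrier H"
        note b1 = L_bilin[OF X L_closed[OF M a] L_closed[OF mg b]]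
        show "(M a \<otimes>\<^bsub>L X\<^esub> mpb g b) (antipode H y) = tsum X (comult H y) (\<lambda>c d. ?f a b c d)"
          unfolding L_mult[OF Sy] tsum_comult_antipode[OF mX b1 y]
          by (rule sym, rule tsum_cong[OF mC mC mX trilinD(1)[OF f[OF a] b] _ D[OF y]]) (simp add: mpb_apply b)
      qed
    qed
    also have "\<dots> = tsum X (comult H h) (\<lambda>a y. tsum X (comult H y) (\<lambda>z d. tsum X (comult H z) (\<lambda>b c. ?f a b c d)))"
      by (rule comult_four[OF mX h f f1])
    also have "\<dots> = tsum X (comult H h) (\<lambda>a y. M a (antipode H y) \<otimes>\<^bsub>X\<^esub> g \<one>\<^bsub>H\<^esub>)"
    proof (rule sym, rule tsum_cong[OF mC mC mX _ _ D[OF h]])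
      show "bilin R H H X (\<lambda>a y. M a (antipode H y) \<otimes>\<^bsub>X\<^esub> g \<one>\<^bsub>H\<^esub>)"
        by (rule bilinI[OF lin_mult_right[OF X g1 Sl] lin_mult_right[OF X g1 bilin_l[OF bM]]]) auto
      fix a y assume a: "a \<in> carrier H" and y: "y \<in> carrier H"
      note l = lin_mult_right[OF X g1 Sl[OF a]]
      have "M a (antipode H y) \<otimes>\<^bsub>X\<^esub> g \<one>\<^bsub>H\<^esub> = tsum X (comult H y)
          (\<lambda>z d. counit H z \<odot>\<^bsub>X\<^esub> (M a (antipode H d) \<otimes>\<^bsub>X\<^esub> g \<one>\<^bsub>H\<^esub>))"
        by (rule sw_counit_left[OF mX l y, symmetric])
      also have "\<dots> = tsum X (comult H y) (\<lambda>z d. tsum X (comult H z) (\<lambda>b c. ?f a b c d))"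
      proof (rule tsum_cong[OF mC mC mX _ _ D[OF y]])
        show "bilin R H H X (\<lambda>z d. counit H z \<odot>\<^bsub>X\<^esub> (M a (antipode H d) \<otimes>\<^bsub>X\<^esub> g \<one>\<^bsub>H\<^esub>))"
          by (rule bilinI[OF lin_functional2[OF mX _ l] lin_functional[OF mX counit_linear]]) (auto simp: lin_closed[OF l])
        fix z d assume z: "z \<in> carrier H" and d: "d \<in> carrier H"
        have m: "M a (antipode H d) \<in> carrier X" using a d by (simp add: bilin_closed[OF bM])
        have gb: "bilin R H H X (\<lambda>b c. g (b \<otimes>\<^bsub>H\<^esub> antipode H c))"
          by (rule bilinI[OF gr gl])
        show "counit H z \<odot>\<^bsub>X\<^esub> (M a (antipode H d) \<otimes>\<^bsub>X\<^esub> g \<one>\<^bsub>H\<^esub>) = tsum X (comult H z) (\<lambda>b c. ?f a b c d)"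
          using tsum_map[OF mC mC mX mX gb lin_mult_left[OF X m lin_id] D[OF z]]
            antipode_mult_right[OF mX L_lin[OF g] z] z by (simp add: X.smult_mult_right m g1)
      qed
      finally show "M a (antipode H y) \<otimes>\<^bsub>X\<^esub> g \<one>\<^bsub>H\<^esub> =
        tsum X (comult H y) (\<lambda>z d. tsum X (comult H z) (\<lambda>b c. ?f a b c d))" .
    qed
    also have "\<dots> = evR X M h \<otimes>\<^bsub>X\<^esub> g \<one>\<^bsub>H\<^esub>"
    proof -
      have b: "bilin R H H X (\<lambda>x y. M x (antipode H y))"
        by (rule bilinI[OF Sl bilin_l[OF bM]]) auto
      show ?thesis unfolding evR_apply[OF mX M h]
        by (rule tsum_map[OF mC mC mX mX b lin_mult_right[OF X g1 lin_id] D[OF h], symmetric])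
    qed
    also have "\<dots> = (evR X M \<otimes>\<^bsub>L X\<^esub> cst X (g \<one>\<^bsub>H\<^esub>)) h"
      by (simp add: cst_mult_apply[OF X g1 evR_closed[OF mX M] h])
    finally show "evR X (M \<otimes>\<^bsub>L (L X)\<^esub> mpb g) h = (evR X M \<otimes>\<^bsub>L X\<^esub> cst X (g \<one>\<^bsub>H\<^esub>)) h" .
  qed (auto intro: evR_closed[OF mX] P M L_mult_closed[OF X] cst_closed[OF mX] g1)
qed

text \<open>The antipode reverses legs, so the right factor \<open>j\<close> receives the outermost
  leg h1. The commutation hypothesis brings it to the left, where coassociativity splits it
  off.\<close>

lemma evL_mult_post_cst:
  assumes X: "assoc_algebra R X" and M: "M \<in> carrier (L (L X))" and j: "j \<in> carrier (L X)"
    and comm: "\<And>x u v. \<lbrakk>x \<in> carrier H; u \<in> carrier H; v \<in> carrier H\<rbrakk> \<Longrightarrow> j x \<otimes>\<^bsub>X\<^esub> M u v = M u v \<otimes>\<^bsub>X\<^esub> j x"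
  shows "evL X (M \<otimes>\<^bsub>L (L X)\<^esub> post (cst X) j) = preL j \<otimes>\<^bsub>L X\<^esub> evL X M"
proof -
  note LX = L_assoc_algebra[OF X] and mX = assoc_algebra_module[OF X]
  have pj: "post (cst X) j \<in> carrier (L (L X))" by (rule post_closed[OF ahom_lin[OF cst_hom[OF X]] j])
  note P = L_mult_closed[OF LX M pj]
  note D = comult_closed
  note bM = LL_bilin[OF M]
  have Sj: "(\<lambda>a. j (antipode H a)) \<in> linear_maps R H X" by (rule lin_comp[OF L_lin[OF j] antipode_linear])
  have Sl: "(\<lambda>a. M (antipode H a) d) \<in> linear_maps R H X" if "d \<in> carrier H" for d
    by (rule lin_comp[OF bilin_l[OF bM that] antipode_linear])
  have tri: "trilin R H H H X (\<lambda>a b y. j (antipode H a) \<otimes>\<^bsub>X\<^esub> M (antipode H b) y)"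
    by (rule trilinI[OF lin_mult_left[OF X _ bilin_r[OF bM]] lin_mult_left[OF X _ Sl] lin_mult_right[OF X _ Sj]])
      (auto simp: L_closed[OF j] bilin_closed[OF bM])
  show ?thesis
  proof (rule L_eqI[of _ X])
    fix h assume h: "h \<in> carrier H"
    have "evL X (M \<otimes>\<^bsub>L (L X)\<^esub> post (cst X) j) h =
      tsum X (comult H h) (\<lambda>x y. (M \<otimes>\<^bsub>L (L X)\<^esub> post (cst X) j) (antipode H x) y)"
      by (rule evL_apply[OF mX P h])
    also have "\<dots> = tsum X (comult H h) (\<lambda>x y. tsum X (comult H x) (\<lambda>a b. j (antipode H a) \<otimes>\<^bsub>X\<^esub> M (antipode H b) y))"
    proof (rule tsum_cong[OF mC mC mX _ _ D[OF h]])
      show "bilin R H H X (\<lambda>x y. (M \<otimes>\<^bsub>L (L X)\<^esub> post (cst X) j) (antipode H x) y)"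
        by (rule bilinI[OF bilin_r[OF LL_bilin[OF P]] lin_comp[OF bilin_l[OF LL_bilin[OF P]] antipode_linear]]) simp
      fix x y assume x: "x \<in> carrier H" and y: "y \<in> carrier H"
      note b = bilin_mult[OF X bilin_l[OF bM y] L_lin[OF j]]
      show "(M \<otimes>\<^bsub>L (L X)\<^esub> post (cst X) j) (antipode H x) y =
        tsum X (comult H x) (\<lambda>a b. j (antipode H a) \<otimes>\<^bsub>X\<^esub> M (antipode H b) y)"
        unfolding post_cst_mult_apply(2)[OF X j M antipode_closed[OF x] y] tsum_comult_antipode[OF mX b x]
        by (rule sym, rule tsum_cong[OF mC mC mX trilinD(3)[OF tri y] _ D[OF x]]) (simp add: comm y)
    qed
    also have "\<dots> = tsum X (comult H h) (\<lambda>a y. tsum X (comult H y) (\<lambda>b z. j (antipode H a) \<otimes>\<^bsub>X\<^esub> M (antipode H b) z))"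
      by (rule coassoc_tsum[OF mX tri h])
    also have "\<dots> = (preL j \<otimes>\<^bsub>L X\<^esub> evL X M) h"
      unfolding L_mult[OF h]
    proof (rule sym, rule tsum_cong[OF mC mC mX L_bilin[OF X preL_closed[OF j] evL_closed[OF mX M]] _ D[OF h]])
      fix a y assume a: "a \<in> carrier H" and y: "y \<in> carrier H"
      have ja: "j (antipode H a) \<in> carrier X" using a by (simp add: L_closed[OF j])
      have b: "bilin R H H X (\<lambda>x y. M (antipode H x) y)"
        by (rule bilinI[OF bilin_r[OF bM] Sl]) simp
      show "preL j a \<otimes>\<^bsub>X\<^esub> evL X M y = tsum X (comult H y) (\<lambda>b z. j (antipode H a) \<otimes>\<^bsub>X\<^esub> M (antipode H b) z)"
        unfolding evL_apply[OF mX M y] preL_apply[OF a]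
        by (rule tsum_map[OF mC mC mX mX b lin_mult_left[OF X ja lin_id] D[OF y]])
    qed
    finally show "evL X (M \<otimes>\<^bsub>L (L X)\<^esub> post (cst X) j) h = (preL j \<otimes>\<^bsub>L X\<^esub> evL X M) h" .
  qed (auto intro: evL_closed[OF mX] P M L_mult_closed[OF X] preL_closed j)
qed

lemma evR_post_cst_mult:
  assumes X: "assoc_algebra R X" and M: "M \<in> carrier (L (L X))" and f: "f \<in> carrier (L X)"
  shows "evR X (post (cst X) f \<otimes>\<^bsub>L (L X)\<^esub> M) = f \<otimes>\<^bsub>L X\<^esub> evR X M"
proof -
  note LX = L_assoc_algebra[OF X] and mX = assoc_algebra_module[OF X]
  have pf: "post (cst X) f \<in> carrier (L (L X))" by (rule post_closed[OF ahom_lin[OF cst_hom[OF X]] f])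
  have "preR (post (cst X) f \<otimes>\<^bsub>L (L X)\<^esub> M) = post (cst X) f \<otimes>\<^bsub>L (L X)\<^esub> preR M"
  proof (rule LL_eqI[OF preR_closed[OF L_mult_closed[OF LX pf M]] L_mult_closed[OF LX pf preR_closed[OF M]]])
    fix h k assume h: "h \<in> carrier H" and k: "k \<in> carrier H"
    note b = bilin_mult[OF X L_lin[OF f] bilin_l[OF LL_bilin[OF M] antipode_closed[OF k]]]
    show "preR (post (cst X) f \<otimes>\<^bsub>L (L X)\<^esub> M) h k = (post (cst X) f \<otimes>\<^bsub>L (L X)\<^esub> preR M) h k"
      unfolding preR_apply[OF h k] post_cst_mult_apply(1)[OF X f M h antipode_closed[OF k]]
        post_cst_mult_apply(1)[OF X f preR_closed[OF M] h k]
      by (rule tsum_cong[OF mC mC mX b _ comult_closed[OF h]]) (simp add: preR_apply k)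
  qed
  then show ?thesis unfolding evR_def by (simp add: dg_post_cst_mult[OF X preR_closed[OF M] f])
qed

lemma ev3_left:
  assumes X: "assoc_algebra R X" and M: "M \<in> carrier (L (L (L X)))" and f: "f \<in> carrier (L X)"
  shows "ev3 X (post (cst (L X)) (post (cst X) f) \<otimes>\<^bsub>L (L (L X))\<^esub> M) = f \<otimes>\<^bsub>L X\<^esub> ev3 X M"
  using evR_post_cst_mult[OF L_assoc_algebra[OF X] M post_closed[OF ahom_lin[OF cst_hom[OF X]] f]]
    dg_post_cst_mult[OF X evR_closed[OF assoc_algebra_module[OF L_assoc_algebra[OF X]] M] f]
  by (simp add: ev3_def)

text \<open>In the factor g the first two slots enter through h1 S(h2), which contracts to 1. What
  is left of g is a function of the third variable.\<close>

lemma ev3_mult_mpb: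
  assumes X: "assoc_algebra R X" and M: "M \<in> carrier (L (L (L X)))" and g: "g \<in> carrier (L (L X))"
  shows "ev3 X (M \<otimes>\<^bsub>L (L (L X))\<^esub> mpb g) = ev3 X M \<otimes>\<^bsub>L X\<^esub> g \<one>\<^bsub>H\<^esub>"
  using evR_mult_mpb[OF L_assoc_algebra[OF X] M g] dg_mult_cst[OF X evR_closed[OF assoc_algebra_module[OF L_assoc_algebra[OF X]] M] L_closed[OF g one_closed]]
  by (simp add: ev3_def)

lemma ev3_cst:
  assumes X: "assoc_algebra R X" and K: "K \<in> carrier (L (L X))"
  shows "ev3 X (cst (L (L X)) K) = evL X K"
proof -
  note LLX = L_assoc_algebra[OF L_assoc_algebra[OF X]]
  note cK = cst_closed[OF assoc_algebra_module[OF LLX] K]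
  have "evR (L X) (cst (L (L X)) K) = preL K"
  proof (rule L_eqI[OF evR_closed[OF assoc_algebra_module[OF L_assoc_algebra[OF X]] cK] preL_closed[OF K]])
    fix c assume c: "c \<in> carrier H"
    have l: "(\<lambda>y. K (antipode H y)) \<in> linear_maps R H (L X)" by (rule lin_comp[OF L_lin[OF K] antipode_linear])
    have "evR (L X) (cst (L (L X)) K) c = tsum (L X) (comult H c) (\<lambda>x y. counit H x \<odot>\<^bsub>L X\<^esub> K (antipode H y))"
      unfolding evR_apply[OF assoc_algebra_module[OF L_assoc_algebra[OF X]] cK c]
      by (rule sym, rule tsum_cong[OF mC mC assoc_algebra_module[OF L_assoc_algebra[OF X]] _ _ comult_closed[OF c]],
        rule bilinI[OF lin_functional2[OF assoc_algebra_module[OF L_assoc_algebra[OF X]] _ l] lin_functional[OF assoc_algebra_module[OF L_assoc_algebra[OF X]] counit_linear]])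
        (auto simp: L_closed[OF K] cst_apply L_smult)
    then show "evR (L X) (cst (L (L X)) K) c = preL K c"
      by (simp add: sw_counit_left[OF assoc_algebra_module[OF L_assoc_algebra[OF X]] l c] preL_apply c)
  qed
  then show ?thesis by (simp add: ev3_def evL_def)
qed

text \<open>Here it is S(h2) and h3 that meet, inside the second argument of K, which therefore
  becomes 1.\<close>

lemma ev3_post_mpb:
  assumes X: "assoc_algebra R X" and K: "K \<in> carrier (L (L X))"
  shows "ev3 X (post mpb K) = (\<lambda>h\<in>carrier H. K h \<one>\<^bsub>H\<^esub>)"
proof (rule L_eqI[of _ X])
  have P: "post mpb K \<in> carrier (L (L (L X)))" by (rule post_closed[OF ahom_lin[OF mpb_hom[OF X]] K])
  show "ev3 X (post mpb K) \<in> carrier (L X)" by (rule ev3_closed[OF X P])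
  note bK = LL_bilin[OF K]
  note K1 = bilin_l[OF bK one_closed]
  show "(\<lambda>h\<in>carrier H. K h \<one>\<^bsub>H\<^esub>) \<in> carrier (L X)" by (rule L_I[OF K1])
  fix c assume c: "c \<in> carrier H"
  have tri: "trilin R H H H X (\<lambda>a b y. K a (antipode H b \<otimes>\<^bsub>H\<^esub> y))"
    by (rule trilinI[OF lin_comp[OF bilin_r[OF bK] lin_mult_left[OF aH _ lin_id]]
      lin_comp[OF bilin_r[OF bK] lin_mult_right[OF aH _ antipode_linear]] bilin_l[OF bK]]) auto
  have "ev3 X (post mpb K) c = tsum X (comult H c) (\<lambda>x y. evR (L X) (post mpb K) x y)"
    by (simp add: ev3_def dg_apply c)
  also have "\<dots> = tsum X (comult H c) (\<lambda>x y. tsum X (comult H x) (\<lambda>a b. K a (antipode H b \<otimes>\<^bsub>H\<^esub> y)))"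
  proof (rule tsum_cong[OF mC mC assoc_algebra_module[OF X] LL_bilin[OF evR_closed[OF assoc_algebra_module[OF L_assoc_algebra[OF X]] P]] _ comult_closed[OF c]])
    fix x y assume x: "x \<in> carrier H" and y: "y \<in> carrier H"
    have b: "bilin R H H (L X) (\<lambda>a b. post mpb K a (antipode H b))"
      by (rule bilinI[OF lin_comp[OF bilin_r[OF LL_bilin[OF P]] antipode_linear] bilin_l[OF LL_bilin[OF P]]]) auto
    have "evR (L X) (post mpb K) x y = tsum X (comult H x) (\<lambda>a b. post mpb K a (antipode H b) y)"
      unfolding evR_apply[OF assoc_algebra_module[OF L_assoc_algebra[OF X]] P x]
      by (rule tsum_map[OF mC mC assoc_algebra_module[OF L_assoc_algebra[OF X]] assoc_algebra_module[OF X] b L_ev[OF y] comult_closed[OF x]])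
    also have "\<dots> = tsum X (comult H x) (\<lambda>a b. K a (antipode H b \<otimes>\<^bsub>H\<^esub> y))"
      by (rule sym, rule tsum_cong[OF mC mC assoc_algebra_module[OF X] trilinD(3)[OF tri y] _ comult_closed[OF x]])
        (simp add: post_apply mpb_apply y)
    finally show "evR (L X) (post mpb K) x y = tsum X (comult H x) (\<lambda>a b. K a (antipode H b \<otimes>\<^bsub>H\<^esub> y))" .
  qed
  also have "\<dots> = tsum X (comult H c) (\<lambda>a y. tsum X (comult H y) (\<lambda>b z. K a (antipode H b \<otimes>\<^bsub>H\<^esub> z)))"
    by (rule coassoc_tsum[OF assoc_algebra_module[OF X] tri c])
  also have "\<dots> = tsum X (comult H c) (\<lambda>a y. counit H y \<odot>\<^bsub>X\<^esub> K a \<one>\<^bsub>H\<^esub>)"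
  proof (rule sym, rule tsum_cong[OF mC mC assoc_algebra_module[OF X] _ _ comult_closed[OF c]])
    show "bilin R H H X (\<lambda>a y. counit H y \<odot>\<^bsub>X\<^esub> K a \<one>\<^bsub>H\<^esub>)"
      by (rule bilinI[OF lin_functional[OF assoc_algebra_module[OF X] counit_linear] lin_functional2[OF assoc_algebra_module[OF X] _ K1]]) (auto simp: bilin_closed[OF bK])
  qed (simp add: antipode_mult_left[OF assoc_algebra_module[OF X] L_lin[OF L_closed[OF K]]])
  also have "\<dots> = K c \<one>\<^bsub>H\<^esub>" by (rule sw_counit_right[OF assoc_algebra_module[OF X] K1 c])
  finally show "ev3 X (post mpb K) c = (\<lambda>h\<in>carrier H. K h \<one>\<^bsub>H\<^esub>) c" using c by simp
qed

end

section \<open>Change of coefficients: equalizers, commutation and centrality\<close>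

context coalgebra
begin

lemma post_linear:
  assumes X: "assoc_algebra R X" and Y: "assoc_algebra R Y" and p: "\<phi> \<in> linear_maps R X Y"
  shows "post \<phi> \<in> linear_maps R (L X) (L Y)"
proof -
  interpret LX: assoc_algebra R "L X" by (rule L_assoc_algebra[OF X])
  interpret LY: assoc_algebra R "L Y" by (rule L_assoc_algebra[OF Y])
  show ?thesis
    by (intro linear_mapsI L_eqI[of _ Y])
      (auto simp: post_closed[OF p] post_apply L_add L_smult lin_add[OF p] lin_smult[OF p] L_closed)
qed

lemma post_conv:
  assumes X: "assoc_algebra R X" and Y: "assoc_algebra R Y" and p: "\<phi> \<in> linear_maps R X Y"
    and f: "f \<in> linear_maps R C X'" and g: "g \<in> linear_maps R C X''"
    and u: "u \<in> linear_maps R X' Y" and v: "v \<in> linear_maps R X'' Y"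
    and u': "u' \<in> linear_maps R X' X" and v': "v' \<in> linear_maps R X'' X"
    and eq: "\<And>x y. x \<in> carrier X' \<Longrightarrow> y \<in> carrier X'' \<Longrightarrow> \<phi> (u' x \<otimes>\<^bsub>X\<^esub> v' y) = u x \<otimes>\<^bsub>Y\<^esub> v y"
  shows "post \<phi> (post u' f \<otimes>\<^bsub>L X\<^esub> post v' g) = post u f \<otimes>\<^bsub>L Y\<^esub> post v g"
proof -
  note mX = assoc_algebra_module[OF X] and mY = assoc_algebra_module[OF Y]
  have cl: "post s k \<in> carrier (L Z)" if "s \<in> linear_maps R W Z" "k \<in> linear_maps R C W" for s k Z W
    unfolding post_def by (rule L_I[OF lin_comp[OF that]])
  note cl = cl[OF u' f] cl[OF v' g] cl[OF u f] cl[OF v g]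
  show ?thesis
  proof (rule L_eqI[OF post_closed[OF p L_mult_closed[OF X cl(1,2)]] L_mult_closed[OF Y cl(3,4)]])
    fix c assume c: "c \<in> carrier C"
    show "post \<phi> (post u' f \<otimes>\<^bsub>L X\<^esub> post v' g) c = (post u f \<otimes>\<^bsub>L Y\<^esub> post v g) c"
      unfolding post_apply[OF c] L_mult[OF c]
        tsum_map[OF mC mC mX mY L_bilin[OF X cl(1,2)] p comult_closed[OF c]]
      by (rule sym, rule tsum_cong[OF mC mC mY L_bilin[OF Y cl(3,4)] _ comult_closed[OF c]])
        (simp add: post_apply eq lin_closed[OF f] lin_closed[OF g])
  qed
qed

text \<open>\<open>post_hom\<close> asks for a unital map. A partial action is multiplicative, but h
  \<cdot> 1 is only an idempotent of the convolution algebra.\<close>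

lemma post_mult:
  assumes X: "assoc_algebra R X" and Y: "assoc_algebra R Y" and p: "\<phi> \<in> linear_maps R X Y"
    and m: "\<And>x y. x \<in> carrier X \<Longrightarrow> y \<in> carrier X \<Longrightarrow> \<phi> (x \<otimes>\<^bsub>X\<^esub> y) = \<phi> x \<otimes>\<^bsub>Y\<^esub> \<phi> y"
    and f: "f \<in> carrier (L X)" and g: "g \<in> carrier (L X)"
  shows "post \<phi> (f \<otimes>\<^bsub>L X\<^esub> g) = post \<phi> f \<otimes>\<^bsub>L Y\<^esub> post \<phi> g"
proof -
  have "post (\<lambda>x. x) k = k" if "k \<in> carrier (L X)" for k
    by (rule L_eqI[OF post_closed[OF lin_id that] that]) (simp add: post_apply)
  then show ?thesis
    using post_conv[OF X Y p L_lin[OF f] L_lin[OF g] p p lin_id lin_id m] f g by simp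
qed

lemma flp_flp: "M \<in> carrier (L (L X)) \<Longrightarrow> flp (flp M) = M"
  by (rule LL_eqI[of _ X]) (auto simp: flp_closed flp_apply)

lemma flp_post: "flp (post (post \<phi>) M) = post (post \<phi>) (flp M)"
  by (auto simp: flp_def post_def restrict_def fun_eq_iff)

lemma post_inj:
  assumes "inj_on \<phi> (carrier X)"
  shows "inj_on (post \<phi>) (carrier (L X))"
proof (rule inj_onI)
  fix f g assume f: "f \<in> carrier (L X)" and g: "g \<in> carrier (L X)" and eq: "post \<phi> f = post \<phi> g"
  show "f = g"
  proof (rule L_eqI[OF f g])
    fix c assume c: "c \<in> carrier C"
    have "\<phi> (f c) = \<phi> (g c)" using fun_cong[OF eq, of c] c by (simp add: post_apply)
    then show "f c = g c" using assms L_closed[OF f c] L_closed[OF g c] by (simp add: inj_on_def)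
  qed
qed

text \<open>Membership in the image of an injective map, made testable by an equation p = q. For
  \<phi> = \<iota> the equation is the one defining the coinvariants.\<close>

definition equalizes where
  "equalizes X Y \<phi> p q \<longleftrightarrow> \<phi> \<in> linear_maps R X Y \<and> inj_on \<phi> (carrier X) \<and>
    (\<forall>y\<in>carrier Y. p y = q y \<longrightarrow> y \<in> \<phi> ` carrier X)"

text \<open>Left exactness of Hom(C, -): a map whose values solve the equation has pointwise
  preimages, and injectivity makes the resulting map into X linear. Iterating it treats functions of
  several variables.\<close>

lemma equalizes_post:
  assumes X: "assoc_algebra R X" and Y: "assoc_algebra R Y" and e: "equalizes X Y \<phi> p q"
  shows "equalizes (L X) (L Y) (post \<phi>) (post p) (post q)"
proof -
  interpret X: assoc_algebra R X by (rule X)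
  have l: "\<phi> \<in> linear_maps R X Y" and i: "inj_on \<phi> (carrier X)"
    and im: "\<And>y. y \<in> carrier Y \<Longrightarrow> p y = q y \<Longrightarrow> y \<in> \<phi> ` carrier X"
    using e by (auto simp: equalizes_def)
  have "z \<in> post \<phi> ` carrier (L X)" if z: "z \<in> carrier (L Y)" and eq: "post p z = post q z" for z
  proof -
    define k where "k = (\<lambda>c\<in>carrier C. inv_into (carrier X) \<phi> (z c))"
    have zc: "z c \<in> \<phi> ` carrier X" if "c \<in> carrier C" for c
      using fun_cong[OF eq, of c] im[OF L_closed[OF z that]] that by (simp add: post_apply)
    have kc: "k c \<in> carrier X" "\<phi> (k c) = z c" if "c \<in> carrier C" for c
      using inv_into_into[OF zc[OF that]] f_inv_into_f[OF zc[OF that]] that by (simp_all add: k_def)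
    have "k \<in> linear_maps R C X"
    proof (rule linear_mapsI)
      fix x y assume x: "x \<in> carrier C" and y: "y \<in> carrier C"
      have "\<phi> (k (x \<oplus>\<^bsub>C\<^esub> y)) = \<phi> (k x \<oplus>\<^bsub>X\<^esub> k y)"
        using x y by (simp add: kc lin_add[OF l] lin_add[OF L_lin[OF z]])
      then show "k (x \<oplus>\<^bsub>C\<^esub> y) = k x \<oplus>\<^bsub>X\<^esub> k y" using i x y kc by (simp add: inj_on_def)
    next
      fix r x assume r: "r \<in> carrier R" and x: "x \<in> carrier C"
      have "\<phi> (k (r \<odot>\<^bsub>C\<^esub> x)) = \<phi> (r \<odot>\<^bsub>X\<^esub> k x)"
        using x r by (simp add: kc lin_smult[OF l] lin_smult[OF L_lin[OF z]])
      then show "k (r \<odot>\<^bsub>C\<^esub> x) = r \<odot>\<^bsub>X\<^esub> k x" using i x r kc by (simp add: inj_on_def)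
    qed (rule kc)
    then have kk: "k \<in> carrier (L X)" by (simp add: L_carrier k_def)
    moreover have "post \<phi> k = z"
      by (rule L_eqI[OF post_closed[OF l kk] z]) (simp add: post_apply kc)
    ultimately show ?thesis by blast
  qed
  then show ?thesis by (simp add: equalizes_def post_linear[OF X Y l] post_inj[OF i])
qed

text \<open>Commutation of g with single elements \<open>j x\<close> extends to functions y of an
  independent variable. The hypothesis is applied at each argument of y, with that variable first,
  and \<open>flp\<close> then restores the order.\<close>

lemma commutation_lift:
  assumes X: "assoc_algebra R X" and Z: "assoc_algebra R Z" and g: "g \<in> carrier (L Z)"
    and j: "j \<in> linear_maps R X Z" and ac: "ac \<in> linear_maps R X (L X)"
    and comm: "\<And>x. x \<in> carrier X \<Longrightarrow> g \<otimes>\<^bsub>L Z\<^esub> cst Z (j x) = post j (ac x) \<otimes>\<^bsub>L Z\<^esub> g"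
    and y: "y \<in> carrier (L X)"
  shows "post (cst Z) g \<otimes>\<^bsub>L (L Z)\<^esub> cst (L Z) (post j y) =
    post (post j) (flp (post ac y)) \<otimes>\<^bsub>L (L Z)\<^esub> post (cst Z) g"
proof -
  note LX = L_assoc_algebra[OF X] and LZ = L_assoc_algebra[OF Z]
  note LLX = L_assoc_algebra[OF LX] and LLZ = L_assoc_algebra[OF LZ]
  note mLZ = assoc_algebra_module[OF LZ]
  note cg = cst_closed[OF mLZ g]
  note jy = post_closed[OF j y]
  have pc: "post (cst Z) (post j y) \<in> carrier (L (L Z))" by (rule post_closed[OF ahom_lin[OF cst_hom[OF Z]] jy])
  have pa: "post ac y \<in> carrier (L (L X))" by (rule post_closed[OF ac y])
  have pja: "post (post j) (post ac y) \<in> carrier (L (L Z))"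
    by (rule post_closed[OF post_linear[OF X Z j] pa])
  have "cst (L Z) g \<otimes>\<^bsub>L (L Z)\<^esub> post (cst Z) (post j y) = post (post j) (post ac y) \<otimes>\<^bsub>L (L Z)\<^esub> cst (L Z) g"
    by (rule L_eqI[OF L_mult_closed[OF LZ cg pc] L_mult_closed[OF LZ pja cg]])
      (simp add: cst_mult_apply[OF LZ g pc] cst_mult_apply[OF LZ g pja] post_apply comm L_closed[OF y])
  then have "flp (cst (L Z) g \<otimes>\<^bsub>L (L Z)\<^esub> post (cst Z) (post j y)) = flp (post (post j) (post ac y) \<otimes>\<^bsub>L (L Z)\<^esub> cst (L Z) g)"
    by simp
  then show ?thesis
    using cg pc pja by (simp add: ahom_mult[OF flp_hom[OF Z]] flp_cst[OF Z g] flp_cst[OF Z jy] flp_post)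
qed

text \<open>A permutation of variables sends M to the function (c, a, b) \<mapsto> M(a, b, c). Being
  composed of flips it is multiplicative and injective. It turns z, as a function of the first two
  of three variables, into a constant, and the products can be compared slice by slice in L (L X),
  where z is central.\<close>

lemma central_lift:
  assumes X: "assoc_algebra R X" and z: "z \<in> carrier (L (L X))"
    and cen: "\<And>y. y \<in> carrier (L (L X)) \<Longrightarrow> z \<otimes>\<^bsub>L (L X)\<^esub> y = y \<otimes>\<^bsub>L (L X)\<^esub> z"
    and Y: "Y \<in> carrier (L (L (L X)))"
  shows "post (post (cst X)) z \<otimes>\<^bsub>L (L (L X))\<^esub> Y = Y \<otimes>\<^bsub>L (L (L X))\<^esub> post (post (cst X)) z"
proof -
  note LX = L_assoc_algebra[OF X]
  note LLX = L_assoc_algebra[OF LX]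
  note LLLX = L_assoc_algebra[OF LLX]
  note pf = post_hom[OF LLX LLX flp_hom[OF X]] and fl = flp_hom[OF LX]
  let ?r = "\<lambda>M. flp (post flp M)"
  have rc: "?r M \<in> carrier (L (L (L X)))" if "M \<in> carrier (L (L (L X)))" for M
    by (rule ahom_closed[OF fl ahom_closed[OF pf that]])
  have rm: "?r (M \<otimes>\<^bsub>L (L (L X))\<^esub> N) = ?r M \<otimes>\<^bsub>L (L (L X))\<^esub> ?r N"
    if "M \<in> carrier (L (L (L X)))" "N \<in> carrier (L (L (L X)))" for M N
    by (simp add: ahom_mult[OF pf that] ahom_mult[OF fl ahom_closed[OF pf that(1)] ahom_closed[OF pf that(2)]])
  have inj: "M = N" if "M \<in> carrier (L (L (L X)))" "N \<in> carrier (L (L (L X)))" "?r M = ?r N" for M N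
  proof -
    have "flp (?r M) = flp (?r N)" using that(3) by simp
    then have e: "post flp M = post flp N"
      unfolding flp_flp[OF ahom_closed[OF pf that(1)]] flp_flp[OF ahom_closed[OF pf that(2)]] .
    have "flp (flp (M c)) = flp (flp (N c))" if "c \<in> carrier C" for c
      using fun_cong[OF e, of c] that by (simp add: post_apply)
    then show ?thesis using that(1,2) by (intro L_eqI[of _ "L (L X)"]) (auto simp: flp_flp[OF L_closed])
  qed
  let ?z = "post (post (cst X)) z"
  have zc: "?z \<in> carrier (L (L (L X)))"
    by (rule post_closed[OF post_linear[OF X LX ahom_lin[OF cst_hom[OF X]]] z])
  have pz: "post (cst (L X)) z \<in> carrier (L (L (L X)))" by (rule post_closed[OF ahom_lin[OF cst_hom[OF LX]] z])
  have "post flp ?z = post (cst (L X)) z"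
    by (rule L_eqI[OF ahom_closed[OF pf zc] pz]) (simp add: post_apply flp_cst[OF X L_closed[OF z]])
  then have rz: "?r ?z = cst (L (L X)) z" by (simp add: flp_cst[OF LX z])
  note rY = rc[OF Y]
  note cz = cst_closed[OF assoc_algebra_module[OF LLX] z]
  have "?r (?z \<otimes>\<^bsub>L (L (L X))\<^esub> Y) = ?r (Y \<otimes>\<^bsub>L (L (L X))\<^esub> ?z)"
    unfolding rm[OF zc Y] rm[OF Y zc] rz
    by (rule L_eqI[OF L_mult_closed[OF LLX cz rY] L_mult_closed[OF LLX rY cz]])
      (simp add: cst_mult_apply[OF LLX z rY] cen[OF L_closed[OF rY]])
  then show ?thesis by (rule inj[OF L_mult_closed[OF LLX zc Y] L_mult_closed[OF LLX Y zc]])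
qed

text \<open>Two ways of regarding f as a function of the first of three variables.\<close>

lemma post_cst_post:
  assumes X: "assoc_algebra R X" and f: "f \<in> carrier (L X)"
  shows "post (post (cst X)) (post (cst X) f) = post (cst (L X)) (post (cst X) f)"
proof -
  note LX = L_assoc_algebra[OF X] and mX = assoc_algebra_module[OF X]
  note c = ahom_lin[OF cst_hom[OF X]]
  show ?thesis
    unfolding post_post by (rule post_cong[OF _ f]) (simp add: post_cst[OF mX c])
qed

lemma cst_natural: "module R X \<Longrightarrow> \<phi> \<in> linear_maps R X Y \<Longrightarrow> f \<in> carrier (L X) \<Longrightarrow>
    post (post \<phi>) (post (cst X) f) = post (cst Y) (post \<phi> f)"
  unfolding post_post by (rule post_cong) (auto simp: post_cst)

lemma cst_natural2:
  assumes "assoc_algebra R X" "assoc_algebra R Y" "\<phi> \<in> linear_maps R X Y" "f \<in> carrier (L X)"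
  shows "post (post \<phi>) (cst (L X) f) = cst (L Y) (post \<phi> f)"
  by (rule post_cst[OF assoc_algebra_module[OF L_assoc_algebra[OF assms(1)]] post_linear[OF assms(1-3)] assms(4)])

end

context hopf_algebra
begin

definition "idH = (\<lambda>h\<in>carrier H. h)"

lemma idH_closed: "idH \<in> carrier (L H)"
  unfolding idH_def by (rule L_I[OF lin_id])

lemma idH_apply [simp]: "h \<in> carrier H \<Longrightarrow> idH h = h"
  by (simp add: idH_def)

lemma evL_mpb:
  assumes X: "assoc_algebra R X" and g: "g \<in> carrier (L X)"
  shows "evL X (mpb g) = cst X (g \<one>\<^bsub>H\<^esub>)"
proof -
  note mX = assoc_algebra_module[OF X]
  have g1: "g \<one>\<^bsub>H\<^esub> \<in> carrier X" by (rule L_closed[OF g]) simp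
  show ?thesis
  proof (rule L_eqI[OF evL_closed[OF mX mpb_closed[OF g]] cst_closed[OF mX g1]])
    fix c assume c: "c \<in> carrier H"
    have b: "bilin R H H X (\<lambda>x y. mpb g (antipode H x) y)"
      by (rule bilinI[OF bilin_r[OF LL_bilin[OF mpb_closed[OF g]]] lin_comp[OF bilin_l[OF LL_bilin[OF mpb_closed[OF g]]] antipode_linear]]) auto
    have "evL X (mpb g) c = tsum X (comult H c) (\<lambda>x y. g (antipode H x \<otimes>\<^bsub>H\<^esub> y))"
      unfolding evL_apply[OF mX mpb_closed[OF g] c]
      by (rule tsum_cong[OF mC mC mX b _ comult_closed[OF c]]) (simp add: mpb_apply)
    then show "evL X (mpb g) c = cst X (g \<one>\<^bsub>H\<^esub>) c"
      by (simp add: antipode_mult_left[OF mX L_lin[OF g] c] cst_apply c)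
  qed
qed

text \<open>Associativity of H: both sides are f(hkl).\<close>

lemma mpb_mpb: "f \<in> carrier (L X) \<Longrightarrow> post mpb (mpb f) = mpb (mpb f)"
  by (auto simp: post_def mpb_def restrict_def fun_eq_iff m_assoc)

lemma post_mpb_cst:
  assumes X: "assoc_algebra R X" and f: "f \<in> carrier (L X)"
  shows "post mpb (post (cst X) f) = post (cst (L X)) (post (cst X) f)"
    and "post mpb (cst (L X) f) = cst (L (L X)) (mpb f)"
    and "mpb (post (cst X) f) = post (post (cst X)) (mpb f)"
    and "mpb (cst (L X) f) = cst (L (L X)) (cst (L X) f)"
proof -
  note mX = assoc_algebra_module[OF X] and LX = L_assoc_algebra[OF X]
  show "post mpb (post (cst X) f) = post (cst (L X)) (post (cst X) f)"
    unfolding post_post by (rule post_cong[OF _ f]) (simp add: mpb_cst[OF mX])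
  show "post mpb (cst (L X) f) = cst (L (L X)) (mpb f)"
    by (rule post_cst[OF assoc_algebra_module[OF LX] ahom_lin[OF mpb_hom[OF X]] f])
  show "mpb (post (cst X) f) = post (post (cst X)) (mpb f)"
    by (rule mpb_post[OF f])
  show "mpb (cst (L X) f) = cst (L (L X)) (cst (L X) f)"
    by (rule mpb_cst[OF assoc_algebra_module[OF LX] f])
qed

end

section \<open>Extensions of the coinvariants\<close>

text \<open>A is kept separate from the set of coinvariants. In the direction from a crossed
  product, A reaches B through the given isomorphism, and the resulting embedding need not be the
  inclusion.\<close>

locale coinvariant_extension = comodule_algebra R H B + A: assoc_algebra R A
  for R (structure) and H (structure) and B (structure) and A (structure) +
  fixes \<iota>
  assumes iota_hom: "\<iota> \<in> algebra_homs R A B"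
    and iota_inj: "inj_on \<iota> (carrier A)"
    and iota_image: "\<iota> ` carrier A = coinvariants R H B"
begin

abbreviation "T \<equiv> tensor R B H"
abbreviation inB where "inB b \<equiv> tens R B H b \<one>\<^bsub>H\<^esub>"
abbreviation inH where "inH \<equiv> tens R B H \<one>\<^bsub>B\<^esub>"
abbreviation jH where "jH \<equiv> post inH idH"

abbreviation mB1 (infixl \<open>\<bullet>\<close> 70) where "x \<bullet> y \<equiv> x \<otimes>\<^bsub>L B\<^esub> y"
abbreviation mB2 (infixl \<open>\<bullet>\<bullet>\<close> 70) where "x \<bullet>\<bullet> y \<equiv> x \<otimes>\<^bsub>L (L B)\<^esub> y"
abbreviation mB3 (infixl \<open>\<bullet>\<bullet>\<bullet>\<close> 70) where "x \<bullet>\<bullet>\<bullet> y \<equiv> x \<otimes>\<^bsub>L (L (L B))\<^esub> y"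
abbreviation mA1 (infixl \<open>\<star>\<close> 70) where "x \<star> y \<equiv> x \<otimes>\<^bsub>L A\<^esub> y"
abbreviation mA2 (infixl \<open>\<star>\<star>\<close> 70) where "x \<star>\<star> y \<equiv> x \<otimes>\<^bsub>L (L A)\<^esub> y"
abbreviation mA3 (infixl \<open>\<star>\<star>\<star>\<close> 70) where "x \<star>\<star>\<star> y \<equiv> x \<otimes>\<^bsub>L (L (L A))\<^esub> y"

lemmas aA = A.assoc_algebra_axioms
lemmas aB = B.assoc_algebra_axioms
lemmas aLA = L_assoc_algebra[OF aA]
lemmas aLB = L_assoc_algebra[OF aB]
lemmas aLLA = L_assoc_algebra[OF aLA]
lemmas aLLB = L_assoc_algebra[OF aLB]
lemmas aLLLA = L_assoc_algebra[OF aLLA]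
lemmas aLLLB = L_assoc_algebra[OF aLLB]
lemmas aT = tensor_assoc_algebra[OF aB aH]
lemmas aLT = L_assoc_algebra[OF aT]
lemmas aLLT = L_assoc_algebra[OF aLT]
lemmas mA = A.module_axioms
lemmas mB = B.module_axioms
lemmas mT = assoc_algebra_module[OF aT]
lemmas mLB = assoc_algebra_module[OF aLB]
lemmas mLA = assoc_algebra_module[OF aLA]

lemmas iota1 = post_hom[OF aA aB iota_hom]
lemmas iota2 = post_hom[OF aLA aLB iota1]
lemmas iota3 = post_hom[OF aLLA aLLB iota2]
lemmas inB_hom = tens_left_hom[OF aB aH]
lemmas inB1 = post_hom[OF aB aT inB_hom]
lemmas inB2 = post_hom[OF aLB aLT inB1]
lemmas inH_hom = tens_right_hom[OF aB aH]
lemmas inH1 = post_hom[OF aH aT inH_hom]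
lemmas rho1 = post_hom[OF aB aT coaction_hom]
lemmas rho2 = post_hom[OF aLB aLT rho1]

lemma jH_closed: "jH \<in> carrier (L T)"
  by (rule ahom_closed[OF inH1 idH_closed])

lemma coinvariants_equalizes: "equalizes A B \<iota> (coaction B) inB"
  using iota_hom iota_inj iota_image by (auto simp: equalizes_def coinvariants_def ahom_lin)

lemma iota_coinvariant: "x \<in> carrier A \<Longrightarrow> coaction B (\<iota> x) = inB (\<iota> x)"
  using iota_image by (auto simp: coinvariants_def)

lemma inB_inH_commute: "b \<in> carrier B \<Longrightarrow> h \<in> carrier H \<Longrightarrow> inB b \<otimes>\<^bsub>T\<^esub> inH h = inH h \<otimes>\<^bsub>T\<^esub> inB b"
  by (simp add: tensor_mult_tens[OF aB aH])

text \<open>1 \<otimes> h and 1 \<otimes> S(h) are convolution inverse to each other. Every proof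
  that an expression in \<gamma> and \<gamma>' is coinvariant rests on this cancellation.\<close>

lemma jH_preL: "jH \<otimes>\<^bsub>L T\<^esub> preL jH = \<one>\<^bsub>L T\<^esub>"
proof -
  have "preL jH = post inH (\<lambda>h\<in>carrier H. antipode H h)"
    by (auto simp: preL_def post_def restrict_def fun_eq_iff idH_def)
  then show ?thesis unfolding idH_def
    using ahom_mult[OF inH1 antipode_L(2,1)] antipode_conv(2) ahom_one[OF inH1] by simp
qed

text \<open>For t = \<gamma>' * \<gamma>, condition (iv) says that \<open>contract t\<close> undoes
  the coaction.\<close>

definition contract where "contract t s = tsum B s (\<lambda>b x. b \<otimes>\<^bsub>B\<^esub> t x)"

lemma contract:
  assumes "t \<in> carrier (L B)"
  shows "contract t \<in> linear_maps R T B"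
    and "b \<in> carrier B \<Longrightarrow> h \<in> carrier H \<Longrightarrow> contract t (inB b \<otimes>\<^bsub>T\<^esub> inH h) = b \<otimes>\<^bsub>B\<^esub> t h"
proof -
  have b: "bilin R B H B (\<lambda>b x. b \<otimes>\<^bsub>B\<^esub> t x)" by (rule bilin_mult[OF aB lin_id L_lin[OF assms]])
  show "contract t \<in> linear_maps R T B"
    unfolding contract_def[abs_def] by (rule tsum_lin[OF mB mC mB b])
  show "contract t (inB b \<otimes>\<^bsub>T\<^esub> inH h) = b \<otimes>\<^bsub>B\<^esub> t h" if "b \<in> carrier B" "h \<in> carrier H"
    using that by (simp add: tensor_mult_tens[OF aB aH] contract_def tsum_pure[OF mB mC mB b])
qed

lemma post_id: "f \<in> carrier (L X) \<Longrightarrow> post (\<lambda>x. x) f = f"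
  by (rule L_eqI[of _ X]) (auto simp: post_apply post_closed[OF lin_id])

text \<open>Applying \<open>contract t\<close> to the coaction of y gives y by condition (iv), and
  gives y * (t \<circ> s) by the formula \<open>eq\<close>.\<close>

lemma absorb1:
  assumes t: "t \<in> carrier (L B)" and iv: "\<And>b. b \<in> carrier B \<Longrightarrow> contract t (coaction B b) = b"
    and y: "y \<in> carrier (L B)" and s: "s \<in> carrier (L H)"
    and eq: "post (coaction B) y = post inB y \<otimes>\<^bsub>L T\<^esub> post inH s"
  shows "y \<bullet> post t s = y"
proof -
  have "post (contract t) (post (coaction B) y) = y \<bullet> post t s"
    unfolding eq using post_conv[where \<phi> = "contract t" and u = "\<lambda>x. x" and v = t and u' = inB and v' = inH,
        OF aT aB contract(1)[OF t] L_lin[OF y] L_lin[OF s] lin_id L_lin[OF t]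
        ahom_lin[OF inB_hom] ahom_lin[OF inH_hom] contract(2)[OF t]] post_id[OF y] by simp
  moreover have "post (contract t) (post (coaction B) y) = post (\<lambda>x. x) y"
    unfolding post_post by (rule post_cong[OF _ y]) (rule iv)
  ultimately show ?thesis by (simp add: post_id[OF y])
qed

text \<open>The two-variable version of \<open>absorb1\<close>. The map \<open>s\<close> records
  which element of H appears in the coaction: hk for \<gamma>(h) \<gamma>(k), and h alone for
  \<open>Y\<close> below.\<close>

lemma absorb2:
  assumes t: "t \<in> carrier (L B)" and iv: "\<And>b. b \<in> carrier B \<Longrightarrow> contract t (coaction B b) = b"
    and y: "y \<in> carrier (L (L B))" and s: "s \<in> carrier (L (L H))"
    and eq: "post (post (coaction B)) y = post (post inB) y \<otimes>\<^bsub>L (L T)\<^esub> post (post inH) s"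
  shows "y \<bullet>\<bullet> post (post t) s = y"
proof -
  note c = contract[OF t]
  have 1: "post (contract t) (post inB u \<otimes>\<^bsub>L T\<^esub> post inH v) = u \<bullet> post t v"
    if "u \<in> carrier (L B)" "v \<in> carrier (L H)" for u v
    using post_conv[where \<phi> = "contract t" and u = "\<lambda>x. x" and v = t and u' = inB and v' = inH,
        OF aT aB c(1) L_lin[OF that(1)] L_lin[OF that(2)] lin_id L_lin[OF t]
        ahom_lin[OF inB_hom] ahom_lin[OF inH_hom] c(2)] post_id[OF that(1)] by simp
  have "post (post (contract t)) (post (post (coaction B)) y) = y \<bullet>\<bullet> post (post t) s"
    unfolding eq using post_conv[where \<phi> = "post (contract t)" and u = "\<lambda>x. x" and v = "post t"
        and u' = "post inB" and v' = "post inH", OF aLT aLB post_linear[OF aT aB c(1)] L_lin[OF y] L_lin[OF s] lin_id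
        post_linear[OF aH aB L_lin[OF t]] ahom_lin[OF inB1] ahom_lin[OF inH1] 1] post_id[OF y] by simp
  moreover have "post (post (contract t)) (post (post (coaction B)) y) = post (\<lambda>x. x) y"
    unfolding post_post
  proof (rule post_cong[OF _ y])
    fix u assume u: "u \<in> carrier (L B)"
    show "post (\<lambda>x. contract t (coaction B x)) u = u"
      using post_cong[OF iv u] post_id[OF u] by simp
  qed
  ultimately show ?thesis by (simp add: post_id[OF y])
qed

lemma post_t_idH:
  assumes t: "t \<in> carrier (L X)"
  shows "post t idH = t" "post (post t) (mpb idH) = mpb t"
  using t by (auto simp: L_carrier post_def mpb_def extensional_def restrict_def fun_eq_iff idH_def)

lemma post_t_fst:
  assumes t: "t \<in> carrier (L B)"
  shows "post (post t) (post (cst H) idH) = post (cst B) t"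
  using cst_natural[OF mC L_lin[OF t] idH_closed] post_t_idH(1)[OF t] by simp

lemma mpb_jH: "mpb jH = post (post inH) (mpb idH)"
  by (rule mpb_post[OF idH_closed])

lemma fst_jH: "post (cst T) jH = post (post inH) (post (cst H) idH)"
  by (rule cst_natural[OF mC ahom_lin[OF inH_hom] idH_closed, symmetric])

lemma mpb_jH_split: "mpb jH = post (cst T) jH \<otimes>\<^bsub>L (L T)\<^esub> cst (L T) jH"
proof (rule LL_eqI[OF mpb_closed[OF jH_closed]])
  have p: "post (cst T) jH \<in> carrier (L (L T))"
    by (rule post_closed[OF ahom_lin[OF cst_hom[OF aT]] jH_closed])
  show "post (cst T) jH \<otimes>\<^bsub>L (L T)\<^esub> cst (L T) jH \<in> carrier (L (L T))"
    by (rule L_mult_closed[OF aLT p cst_closed[OF assoc_algebra_module[OF aLT] jH_closed]])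
  fix h k assume h: "h \<in> carrier H" and k: "k \<in> carrier H"
  show "mpb jH h k = (post (cst T) jH \<otimes>\<^bsub>L (L T)\<^esub> cst (L T) jH) h k"
    using h k ahom_mult[OF inH_hom h k]
    by (simp add: mpb_apply cst_mult_apply(2)[OF aLT jH_closed p] post_apply
        cst_mult_apply(1)[OF aT _ jH_closed] ahom_closed[OF inH_hom])
qed

lemma rho_iota1: "y \<in> carrier (L A) \<Longrightarrow> post (coaction B) (post \<iota> y) = post inB (post \<iota> y)"
  unfolding post_post by (rule post_cong) (auto simp: iota_coinvariant)

lemma rho_iota2: "y \<in> carrier (L (L A)) \<Longrightarrow>
    post (post (coaction B)) (post (post \<iota>) y) = post (post inB) (post (post \<iota>) y)"
  unfolding post_post[of "post (coaction B)"] post_post[of "post inB"] by (rule post_cong) (auto simp: rho_iota1)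

lemma coinvariant2: "y \<in> carrier (L (L B)) \<Longrightarrow> post (post (coaction B)) y = post (post inB) y \<Longrightarrow>
    \<exists>z\<in>carrier (L (L A)). post (post \<iota>) z = y"
  using equalizes_post[OF aLA aLB equalizes_post[OF aA aB coinvariants_equalizes]] by (force simp: equalizes_def)

end

text \<open>The transformation rule (ii) by itself. It serves both for a given cleaving pair and for
  the pair that is built from a crossed product.\<close>

locale comodule_pair = coinvariant_extension +
  fixes \<gamma> \<gamma>'
  assumes gamma_closed: "\<gamma> \<in> carrier (L B)"
    and gamma'_closed: "\<gamma>' \<in> carrier (L B)"
    and rho_gamma: "post (coaction B) \<gamma> = post inB \<gamma> \<otimes>\<^bsub>L T\<^esub> jH"
    and rho_gamma': "post (coaction B) \<gamma>' = preL jH \<otimes>\<^bsub>L T\<^esub> post inB \<gamma>'"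
begin

interpretation LB: assoc_algebra R "L B" by (rule aLB)
interpretation LLB: assoc_algebra R "L (L B)" by (rule aLLB)
interpretation LT: assoc_algebra R "L T" by (rule aLT)
interpretation LLT: assoc_algebra R "L (L T)" by (rule aLLT)

lemmas fB_hom = post_hom[OF aB aLB cst_hom[OF aB]]
lemmas sB_hom = cst_hom[OF aLB]
lemmas fT_hom = post_hom[OF aT aLT cst_hom[OF aT]]
lemmas sT_hom = cst_hom[OF aLT]
lemmas mpbT = mpb_hom[OF aT]
lemmas nat_rho = cst_natural[OF mB ahom_lin[OF coaction_hom]] cst_natural2[OF aB aT ahom_lin[OF coaction_hom]]
lemmas nat_inB = cst_natural[OF mB ahom_lin[OF inB_hom]] cst_natural2[OF aB aT ahom_lin[OF inB_hom]]

lemma fj_sinB: "z \<in> carrier (L B) \<Longrightarrow> post (cst T) jH \<otimes>\<^bsub>L (L T)\<^esub> cst (L T) (post inB z) =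
    cst (L T) (post inB z) \<otimes>\<^bsub>L (L T)\<^esub> post (cst T) jH"
  by (rule post_cst_commute[OF aT jH_closed ahom_closed[OF inB1]])
    (simp_all add: post_apply inB_inH_commute L_closed)

lemmas cB = ahom_closed[OF fB_hom gamma_closed] ahom_closed[OF sB_hom gamma_closed] mpb_closed[OF gamma_closed]
  ahom_closed[OF fB_hom gamma'_closed] ahom_closed[OF sB_hom gamma'_closed] mpb_closed[OF gamma'_closed]

lemmas cT = ahom_closed[OF fT_hom jH_closed] ahom_closed[OF sT_hom jH_closed] mpb_closed[OF jH_closed]
  ahom_closed[OF inB1 gamma_closed] ahom_closed[OF inB1 gamma'_closed]
  ahom_closed[OF fT_hom ahom_closed[OF inB1 gamma_closed]] ahom_closed[OF sT_hom ahom_closed[OF inB1 gamma_closed]]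
  ahom_closed[OF fT_hom ahom_closed[OF inB1 gamma'_closed]] ahom_closed[OF sT_hom ahom_closed[OF inB1 gamma'_closed]]
  mpb_closed[OF ahom_closed[OF inB1 gamma_closed]] mpb_closed[OF ahom_closed[OF inB1 gamma'_closed]] preL_closed[OF jH_closed]
  ahom_closed[OF fT_hom preL_closed[OF jH_closed]] ahom_closed[OF sT_hom preL_closed[OF jH_closed]]
  mpb_closed[OF preL_closed[OF jH_closed]]

lemma jH_inverse:
  "post (cst T) jH \<otimes>\<^bsub>L (L T)\<^esub> post (cst T) (preL jH) = \<one>\<^bsub>L (L T)\<^esub>"
  "cst (L T) jH \<otimes>\<^bsub>L (L T)\<^esub> cst (L T) (preL jH) = \<one>\<^bsub>L (L T)\<^esub>"
  "mpb jH \<otimes>\<^bsub>L (L T)\<^esub> mpb (preL jH) = \<one>\<^bsub>L (L T)\<^esub>"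
  using ahom_mult[OF fT_hom jH_closed preL_closed[OF jH_closed]] ahom_one[OF fT_hom]
    ahom_mult[OF sT_hom jH_closed preL_closed[OF jH_closed]] ahom_one[OF sT_hom]
    ahom_mult[OF mpbT jH_closed preL_closed[OF jH_closed]] ahom_one[OF mpbT]
  by (simp_all add: jH_preL)

text \<open>Elements b \<otimes> 1 and 1 \<otimes> h commute, so the H-parts of the two factors
  collect on the right as 1 \<otimes> hk.\<close>

lemma rho_gamma_gamma: "post (post (coaction B)) (post (cst B) \<gamma> \<bullet>\<bullet> cst (L B) \<gamma>) =
    post (post inB) (post (cst B) \<gamma> \<bullet>\<bullet> cst (L B) \<gamma>) \<otimes>\<^bsub>L (L T)\<^esub> mpb jH"
proof -
  let ?y = "post (cst B) \<gamma> \<bullet>\<bullet> cst (L B) \<gamma>" and ?F = "post (cst T) (post inB \<gamma>)" and ?S = "cst (L T) (post inB \<gamma>)"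
  let ?fj = "post (cst T) jH" and ?sj = "cst (L T) jH"
  have "post (post (coaction B)) ?y = ?F \<otimes>\<^bsub>L (L T)\<^esub> (?fj \<otimes>\<^bsub>L (L T)\<^esub> ?S \<otimes>\<^bsub>L (L T)\<^esub> ?sj)"
    using cT by (simp add: ahom_mult[OF rho2] cB nat_rho gamma_closed rho_gamma ahom_mult[OF fT_hom] ahom_mult[OF sT_hom]
        jH_closed LLT.m_assoc)
  also have "\<dots> = post (post inB) ?y \<otimes>\<^bsub>L (L T)\<^esub> mpb jH"
    using cT by (simp add: fj_sinB[OF gamma_closed] ahom_mult[OF inB2] cB nat_inB gamma_closed mpb_jH_split LLT.m_assoc)
  finally show ?thesis .
qed

text \<open>\<open>\<gamma>(h) \<gamma>(k)\<close> transforms under the coaction like \<open>\<gamma>(hk)\<close>, so condition (iv) applies to it.\<close>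

lemma gamma_gamma_absorb:
  assumes t: "t \<in> carrier (L B)" and iv: "\<And>b. b \<in> carrier B \<Longrightarrow> contract t (coaction B b) = b"
  shows "post (cst B) \<gamma> \<bullet>\<bullet> cst (L B) \<gamma> \<bullet>\<bullet> mpb t = post (cst B) \<gamma> \<bullet>\<bullet> cst (L B) \<gamma>"
proof -
  let ?y = "post (cst B) \<gamma> \<bullet>\<bullet> cst (L B) \<gamma>"
  have "?y \<bullet>\<bullet> post (post t) (mpb idH) = ?y"
    by (rule absorb2[OF t iv _ mpb_closed[OF idH_closed] rho_gamma_gamma[unfolded mpb_jH]]) (use cB in auto)
  then show ?thesis by (simp add: post_t_idH[OF t])
qed

text \<open>The part of \<omega>' that precedes \<gamma>'(h2). In its coaction the legs of k cancel
  against the antipode, so it transforms like \<gamma>(h), and condition (iv) applies to it in the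
  first variable (\<open>Y_absorb\<close>).\<close>

definition "Y = mpb \<gamma> \<bullet>\<bullet> cst (L B) \<gamma>'"

lemma Y_closed: "Y \<in> carrier (L (L B))"
  unfolding Y_def using cB by simp

lemma rho_Y: "post (post (coaction B)) Y = post (post inB) Y \<otimes>\<^bsub>L (L T)\<^esub> post (cst T) jH"
proof -
  let ?G = "mpb (post inB \<gamma>)" and ?S = "cst (L T) (post inB \<gamma>')"
  let ?fj = "post (cst T) jH" and ?sj = "cst (L T) jH" and ?sj' = "cst (L T) (preL jH)"
  have "post (post (coaction B)) Y = ?G \<otimes>\<^bsub>L (L T)\<^esub> (?fj \<otimes>\<^bsub>L (L T)\<^esub> (?sj \<otimes>\<^bsub>L (L T)\<^esub> ?sj') \<otimes>\<^bsub>L (L T)\<^esub> ?S)"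
    unfolding Y_def using cT
    by (simp add: ahom_mult[OF rho2] cB nat_rho gamma'_closed post_mpb[OF gamma_closed] rho_gamma rho_gamma'
        ahom_mult[OF mpbT] ahom_mult[OF sT_hom] mpb_jH_split jH_closed LLT.m_assoc)
  also have "\<dots> = ?G \<otimes>\<^bsub>L (L T)\<^esub> (?S \<otimes>\<^bsub>L (L T)\<^esub> ?fj)"
    using cT by (simp add: jH_inverse fj_sinB[OF gamma'_closed])
  also have "\<dots> = post (post inB) Y \<otimes>\<^bsub>L (L T)\<^esub> ?fj"
    unfolding Y_def using cT
    by (simp add: ahom_mult[OF inB2] cB nat_inB gamma'_closed post_mpb[OF gamma_closed] LLT.m_assoc)
  finally show ?thesis .
qed

lemma Y_absorb:
  assumes t: "t \<in> carrier (L B)" and iv: "\<And>b. b \<in> carrier B \<Longrightarrow> contract t (coaction B b) = b"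
  shows "Y \<bullet>\<bullet> post (cst B) t = Y"
proof -
  have fid: "post (cst H) idH \<in> carrier (L (L H))"
    by (rule post_closed[OF ahom_lin[OF cst_hom[OF aH]] idH_closed])
  have "Y \<bullet>\<bullet> post (post t) (post (cst H) idH) = Y"
    by (rule absorb2[OF t iv Y_closed fid rho_Y[unfolded fst_jH]])
  then show ?thesis by (simp add: post_t_fst[OF t])
qed

text \<open>This makes \<omega>' take values in A: the factor 1 \<otimes> h in the coaction of
  \<open>Y\<close> meets 1 \<otimes> S(h) in that of \<gamma>' and cancels.\<close>

lemma Y_coinvariant: "\<exists>z\<in>carrier (L (L A)). post (post \<iota>) z = Y \<bullet>\<bullet> post (cst B) \<gamma>'"
proof (rule coinvariant2)
  let ?F = "post (cst T) (post inB \<gamma>')" and ?fj = "post (cst T) jH" and ?fj' = "post (cst T) (preL jH)"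
  note c = ahom_closed[OF inB2 Y_closed] cT
  have "post (post (coaction B)) (Y \<bullet>\<bullet> post (cst B) \<gamma>') = post (post inB) Y \<otimes>\<^bsub>L (L T)\<^esub> (?fj \<otimes>\<^bsub>L (L T)\<^esub> ?fj') \<otimes>\<^bsub>L (L T)\<^esub> ?F"
    using c by (simp add: ahom_mult[OF rho2] Y_closed cB rho_Y nat_rho gamma'_closed rho_gamma' ahom_mult[OF fT_hom] LLT.m_assoc)
  also have "\<dots> = post (post inB) (Y \<bullet>\<bullet> post (cst B) \<gamma>')"
    using c by (simp add: jH_inverse ahom_mult[OF inB2] Y_closed cB nat_inB gamma'_closed)
  finally show "post (post (coaction B)) (Y \<bullet>\<bullet> post (cst B) \<gamma>') = post (post inB) (Y \<bullet>\<bullet> post (cst B) \<gamma>')" .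
qed (use Y_closed cB in simp)

text \<open>The same cancellation for \<omega>, with hk in place of h.\<close>

lemma gamma_gamma_coinvariant:
  "\<exists>z\<in>carrier (L (L A)). post (post \<iota>) z = post (cst B) \<gamma> \<bullet>\<bullet> cst (L B) \<gamma> \<bullet>\<bullet> mpb \<gamma>'"
proof (rule coinvariant2)
  let ?y = "post (cst B) \<gamma> \<bullet>\<bullet> cst (L B) \<gamma>" and ?G = "mpb (post inB \<gamma>')"
  have yc: "?y \<in> carrier (L (L B))" using cB by simp
  note c = ahom_closed[OF inB2 yc] cT
  have "post (post (coaction B)) (?y \<bullet>\<bullet> mpb \<gamma>') =
      post (post inB) ?y \<otimes>\<^bsub>L (L T)\<^esub> (mpb jH \<otimes>\<^bsub>L (L T)\<^esub> mpb (preL jH)) \<otimes>\<^bsub>L (L T)\<^esub> ?G"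
    using c by (simp add: ahom_mult[OF rho2] yc cB(6) rho_gamma_gamma post_mpb[OF gamma'_closed] rho_gamma'
        ahom_mult[OF mpbT] LLT.m_assoc del: mpb_jH_split)
  also have "\<dots> = post (post inB) (?y \<bullet>\<bullet> mpb \<gamma>')"
    using c by (simp add: jH_inverse ahom_mult[OF inB2 yc cB(6)] post_mpb[OF gamma'_closed])
  finally show "post (post (coaction B)) (?y \<bullet>\<bullet> mpb \<gamma>') = post (post inB) (?y \<bullet>\<bullet> mpb \<gamma>')" .
qed (use cB in simp)

text \<open>The coaction of \<iota> x is \<iota> x \<otimes> 1, which commutes with 1 \<otimes> h.
  The H-parts of \<gamma> and \<gamma>' therefore still meet and cancel.\<close>

lemma conjugate_coinvariant:
  assumes x: "x \<in> carrier A"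
  shows "\<exists>z\<in>carrier (L A). post \<iota> z = \<gamma> \<bullet> cst B (\<iota> x) \<bullet> \<gamma>'"
proof -
  have ix: "\<iota> x \<in> carrier B" by (rule ahom_closed[OF iota_hom x])
  note cx = cst_closed[OF mB ix]
  note c = cT ahom_closed[OF inB1 cx]
  let ?y = "\<gamma> \<bullet> cst B (\<iota> x) \<bullet> \<gamma>'"
  have yc: "?y \<in> carrier (L B)" using cx gamma_closed gamma'_closed by simp
  have rx: "post (coaction B) (cst B (\<iota> x)) = post inB (cst B (\<iota> x))"
    by (simp add: post_cst[OF mB ahom_lin[OF coaction_hom] ix] post_cst[OF mB ahom_lin[OF inB_hom] ix] iota_coinvariant x)
  have jx: "jH \<otimes>\<^bsub>L T\<^esub> post inB (cst B (\<iota> x)) = post inB (cst B (\<iota> x)) \<otimes>\<^bsub>L T\<^esub> jH"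
    unfolding post_cst[OF mB ahom_lin[OF inB_hom] ix]
    by (rule L_eqI[of _ T])
      (use ahom_closed[OF inB_hom ix] jH_closed in
        \<open>auto simp: cst_mult_apply[OF aT] cst_closed[OF mT] post_apply inB_inH_commute ix\<close>)
  have "post (coaction B) ?y =
      post inB \<gamma> \<otimes>\<^bsub>L T\<^esub> (jH \<otimes>\<^bsub>L T\<^esub> post inB (cst B (\<iota> x))) \<otimes>\<^bsub>L T\<^esub> preL jH \<otimes>\<^bsub>L T\<^esub> post inB \<gamma>'"
    using c by (simp add: ahom_mult[OF rho1] gamma_closed gamma'_closed cx rho_gamma rho_gamma' rx LT.m_assoc jH_closed)
  also have "\<dots> = post inB \<gamma> \<otimes>\<^bsub>L T\<^esub> post inB (cst B (\<iota> x)) \<otimes>\<^bsub>L T\<^esub> (jH \<otimes>\<^bsub>L T\<^esub> preL jH) \<otimes>\<^bsub>L T\<^esub> post inB \<gamma>'"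
    using c by (simp add: jx LT.m_assoc jH_closed)
  also have "\<dots> = post inB ?y"
    using c by (simp add: jH_preL ahom_mult[OF inB1] gamma_closed gamma'_closed cx)
  finally have "?y \<in> post \<iota> ` carrier (L A)"
    using equalizes_post[OF aA aB coinvariants_equalizes] yc by (simp add: equalizes_def)
  then show ?thesis by force
qed

end

section \<open>The cleaving map of a crossed product\<close>

text \<open>The facts about a crossed product from which \<gamma>' is constructed, transported to B.
  Here \<open>act x\<close> is h \<mapsto> h \<cdot> x, \<open>w\<close> is \<omega> and
  \<open>w'\<close> its inverse in the ideal sense, \<open>act \<one>\<close> is the idempotent h
  \<mapsto> h \<cdot> 1, and \<open>spanning\<close> says that B is generated by products of
  \<iota>(A) with values of \<gamma>.\<close>

locale crossed_data = coinvariant_extension +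
  fixes act w w' \<gamma>
  assumes act_lin: "act \<in> linear_maps R A (L A)"
    and w_closed: "w \<in> carrier (L (L A))"
    and w'_closed: "w' \<in> carrier (L (L A))"
    and g_closed: "\<gamma> \<in> carrier (L B)"
    and act_mult: "\<And>x y. x \<in> carrier A \<Longrightarrow> y \<in> carrier A \<Longrightarrow> act (x \<otimes>\<^bsub>A\<^esub> y) = act x \<star> act y"
    and act_at_one: "\<And>x. x \<in> carrier A \<Longrightarrow> act x \<one>\<^bsub>H\<^esub> = x"
    and w_one: "w \<one>\<^bsub>H\<^esub> = act \<one>\<^bsub>A\<^esub>"
    and w_one': "\<And>h. h \<in> carrier H \<Longrightarrow> w h \<one>\<^bsub>H\<^esub> = act \<one>\<^bsub>A\<^esub> h"
    and twisted: "flp (post act (act \<one>\<^bsub>A\<^esub>)) \<star>\<star> w = w"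
    and cocycle: "flp (post (\<lambda>y. flp (post act y)) w) \<star>\<star>\<star> post mpb w = post (post (cst A)) w \<star>\<star>\<star> mpb w"
    and f1_central: "\<And>y. y \<in> carrier (L (L A)) \<Longrightarrow>
      post (cst A) (act \<one>\<^bsub>A\<^esub>) \<star>\<star> y = y \<star>\<star> post (cst A) (act \<one>\<^bsub>A\<^esub>)"
    and f2_central: "\<And>y. y \<in> carrier (L (L A)) \<Longrightarrow> mpb (act \<one>\<^bsub>A\<^esub>) \<star>\<star> y = y \<star>\<star> mpb (act \<one>\<^bsub>A\<^esub>)"
    and w'_w: "w' \<star>\<star> w = post (cst A) (act \<one>\<^bsub>A\<^esub>) \<star>\<star> mpb (act \<one>\<^bsub>A\<^esub>)"
    and w'_f2: "w' \<star>\<star> mpb (act \<one>\<^bsub>A\<^esub>) = w'"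
    and act_e: "flp (post act (act \<one>\<^bsub>A\<^esub>)) = post (cst A) (act \<one>\<^bsub>A\<^esub>) \<star>\<star> mpb (act \<one>\<^bsub>A\<^esub>)"
    and g_iota: "\<And>x. x \<in> carrier A \<Longrightarrow> \<gamma> \<bullet> cst B (\<iota> x) = post \<iota> (act x) \<bullet> \<gamma>"
    and g_g: "post (cst B) \<gamma> \<bullet>\<bullet> cst (L B) \<gamma> = post (post \<iota>) w \<bullet>\<bullet> mpb \<gamma>"
    and e_g: "post \<iota> (act \<one>\<^bsub>A\<^esub>) \<bullet> \<gamma> = \<gamma>"
    and g_one: "\<gamma> \<one>\<^bsub>H\<^esub> = \<one>\<^bsub>B\<^esub>"
    and rho_g: "post (coaction B) \<gamma> = post inB \<gamma> \<otimes>\<^bsub>L T\<^esub> jH"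
    and spanning: "\<And>b. b \<in> carrier B \<Longrightarrow>
      \<exists>s\<in>carrier (tensor R A H). b = tsum B s (\<lambda>x h. \<iota> x \<otimes>\<^bsub>B\<^esub> \<gamma> h)"
begin

interpretation LA: assoc_algebra R "L A" by (rule aLA)
interpretation LLA: assoc_algebra R "L (L A)" by (rule aLLA)
interpretation LLLA: assoc_algebra R "L (L (L A))" by (rule aLLLA)
interpretation LB: assoc_algebra R "L B" by (rule aLB)
interpretation LLB: assoc_algebra R "L (L B)" by (rule aLLB)
interpretation LLLB: assoc_algebra R "L (L (L B))" by (rule aLLLB)
interpretation LT: assoc_algebra R "L T" by (rule aLT)
interpretation LLT: assoc_algebra R "L (L T)" by (rule aLLT)

abbreviation "e \<equiv> act \<one>\<^bsub>A\<^esub>"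
text \<open>\<open>post act\<close> alone puts the argument of y in front of the acting element.
  After the flip, \<open>act1 y\<close> is (h, k) \<mapsto> h \<cdot> y(k), and
  \<open>act2 y\<close> below is (h, k, l) \<mapsto> h \<cdot> y(k, l).\<close>

abbreviation "act1 y \<equiv> flp (post act y)"
abbreviation "act2 y \<equiv> flp (post act1 y)"

lemma e_closed: "e \<in> carrier (L A)"
  using lin_closed[OF act_lin] by simp

lemma act1_lin: "act1 \<in> linear_maps R (L A) (L (L A))"
  by (rule lin_comp[OF ahom_lin[OF flp_hom[OF aA]] post_linear[OF aA aLA act_lin]])

lemma act2_lin: "act2 \<in> linear_maps R (L (L A)) (L (L (L A)))"
  by (rule lin_comp[OF ahom_lin[OF flp_hom[OF aLA]] post_linear[OF aLA aLLA act1_lin]])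

lemma act1_mult: "x \<in> carrier (L A) \<Longrightarrow> y \<in> carrier (L A) \<Longrightarrow> act1 (x \<star> y) = act1 x \<star>\<star> act1 y"
  using post_mult[where \<phi> = act, OF aA aLA act_lin act_mult] ahom_mult[OF flp_hom[OF aA]] post_closed[OF act_lin] by simp

lemma act2_mult: "x \<in> carrier (L (L A)) \<Longrightarrow> y \<in> carrier (L (L A)) \<Longrightarrow> act2 (x \<star>\<star> y) = act2 x \<star>\<star>\<star> act2 y"
  using post_mult[where \<phi> = act1, OF aLA aLLA act1_lin act1_mult] ahom_mult[OF flp_hom[OF aLA]] post_closed[OF act1_lin] by simp

abbreviation "fA y \<equiv> post (cst A) y"
abbreviation "fB y \<equiv> post (cst B) y"
abbreviation "sB y \<equiv> cst (L B) y"
abbreviation "i1 y \<equiv> post \<iota> y"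
abbreviation "i2 y \<equiv> post (post \<iota>) y"
abbreviation "i3 y \<equiv> post (post (post \<iota>)) y"

lemmas i1_c = ahom_closed[OF iota1]
lemmas i2_c = ahom_closed[OF iota2]
lemmas i3_c = ahom_closed[OF iota3]
lemmas i2_m = ahom_mult[OF iota2]
lemmas i3_m = ahom_mult[OF iota3]
lemmas fA_hom = post_hom[OF aA aLA cst_hom[OF aA]]
lemmas fB_hom = post_hom[OF aB aLB cst_hom[OF aB]]
lemmas fB_c = ahom_closed[OF fB_hom]
lemmas fA_c = ahom_closed[OF fA_hom]
lemmas fB_m = ahom_mult[OF fB_hom, symmetric]
lemmas sB_hom = cst_hom[OF aLB]
lemmas sB_c = ahom_closed[OF sB_hom]
lemmas sB_m = ahom_mult[OF sB_hom, symmetric]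
lemmas mpbB = mpb_hom[OF aB]
lemmas mpbA = mpb_hom[OF aA]
lemmas mpb_c = mpb_closed
lemmas fcB_hom = post_hom[OF aLB aLLB fB_hom]
lemmas fcA_hom = post_hom[OF aLA aLLA fA_hom]
lemmas fmB_hom = post_hom[OF aLB aLLB mpbB]
lemmas fmA_hom = post_hom[OF aLA aLLA mpbA]

lemma fA_i: "y \<in> carrier (L A) \<Longrightarrow> i2 (fA y) = fB (i1 y)"
  by (rule cst_natural[OF mA ahom_lin[OF iota_hom]])

lemma mpb_i: "y \<in> carrier (L A) \<Longrightarrow> i2 (mpb y) = mpb (i1 y)"
  by (rule post_mpb)

lemma e_e: "e \<star> e = e"
  using act_mult[of "\<one>\<^bsub>A\<^esub>" "\<one>\<^bsub>A\<^esub>"] by simp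

text \<open>Functions of the first variable form a copy of L A in the two-variable algebra.
  Evaluating the second variable at 1 brings the centrality of f1 back to L A.\<close>

lemma e_central:
  assumes z: "z \<in> carrier (L A)"
  shows "e \<star> z = z \<star> e"
proof -
  have "fA (e \<star> z) = fA (z \<star> e)"
    using f1_central[OF fA_c[OF z]] by (simp add: ahom_mult[OF fA_hom] e_closed z)
  then have "cst A ((e \<star> z) h) \<one>\<^bsub>H\<^esub> = cst A ((z \<star> e) h) \<one>\<^bsub>H\<^esub>" if "h \<in> carrier H" for h
    using fun_cong[of _ _ h] that by (metis post_apply)
  then show ?thesis
    by (intro L_eqI[of _ A]) (auto simp: cst_at_one[OF mA] L_closed e_closed z)
qed

lemma g_act1:
  assumes y: "y \<in> carrier (L A)"
  shows "fB \<gamma> \<bullet>\<bullet> sB (i1 y) = i2 (act1 y) \<bullet>\<bullet> fB \<gamma>"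
  by (rule commutation_lift[OF aA aB g_closed ahom_lin[OF iota_hom] act_lin g_iota y])

lemma g_act2:
  assumes y: "y \<in> carrier (L (L A))"
  shows "post (cst (L B)) (fB \<gamma>) \<bullet>\<bullet>\<bullet> cst (L (L B)) (i2 y) = i3 (act2 y) \<bullet>\<bullet>\<bullet> post (cst (L B)) (fB \<gamma>)"
  by (rule commutation_lift[OF aLA aLB fB_c[OF g_closed] ahom_lin[OF iota1] act1_lin g_act1 y])

text \<open>On a group element g this is the classical inverse \<omega>(g^-1, g)^-1 \<gamma>(g^-1),
  read off from \<gamma>(g^-1) \<gamma>(g) = \<omega>(g^-1, g) \<gamma>(1). Convolution in two
  variables and the contraction \<open>evL\<close> distribute the Sweedler legs.\<close>

definition "g' = evL B (i2 w' \<bullet>\<bullet> fB \<gamma>)"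

lemmas fg_c = fB_c[OF g_closed]
lemmas sg_c = sB_c[OF g_closed]
lemmas wg_c = LLB.m_closed[OF i2_c[OF w'_closed] fg_c]

lemma g'_closed: "g' \<in> carrier (L B)"
  unfolding g'_def by (rule evL_closed[OF mB wg_c])

text \<open>Only the factor \<gamma> contributes an H-part, which stands at the right end in the
  first variable. It commutes with everything of the form b \<otimes> 1, so
  \<open>evL_mult_post_cst\<close> moves it to the front as 1 \<otimes> S(h1).\<close>

lemma rho_g': "post (coaction B) g' = preL jH \<otimes>\<^bsub>L T\<^esub> post inB g'"
proof -
  let ?Q = "i2 w' \<bullet>\<bullet> fB \<gamma>"
  have fr: "post (post (coaction B)) (fB \<gamma>) = post (cst T) (post (coaction B) \<gamma>)"
    by (rule cst_natural[OF mB ahom_lin[OF coaction_hom] g_closed])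
  have fi: "post (post inB) (fB \<gamma>) = post (cst T) (post inB \<gamma>)"
    by (rule cst_natural[OF mB ahom_lin[OF inB_hom] g_closed])
  note fT = post_hom[OF aT aLT cst_hom[OF aT]]
  note ic = ahom_closed[OF inB1 g_closed] ahom_closed[OF inB2 i2_c[OF w'_closed]]
  have "post (coaction B) g' = evL T (post (post (coaction B)) ?Q)"
    unfolding g'_def by (rule evL_post[OF mB mT ahom_lin[OF coaction_hom] wg_c])
  also have "post (post (coaction B)) ?Q = post (post inB) ?Q \<otimes>\<^bsub>L (L T)\<^esub> post (cst T) jH"
    using ic ahom_closed[OF fT ic(1)] ahom_closed[OF fT jH_closed]
    by (simp add: ahom_mult[OF rho2] ahom_mult[OF inB2] i2_c w'_closed fg_c rho_iota2 fr fi rho_g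
        ahom_mult[OF fT] jH_closed LLT.m_assoc)
  also have "evL T \<dots> = preL jH \<otimes>\<^bsub>L T\<^esub> evL T (post (post inB) ?Q)"
  proof (rule evL_mult_post_cst[OF aT ahom_closed[OF inB2 wg_c] jH_closed])
    fix x u v assume x: "x \<in> carrier H" and u: "u \<in> carrier H" and v: "v \<in> carrier H"
    have "?Q u v \<in> carrier B" by (rule L_closed[OF L_closed[OF wg_c u] v])
    then show "jH x \<otimes>\<^bsub>T\<^esub> post (post inB) ?Q u v = post (post inB) ?Q u v \<otimes>\<^bsub>T\<^esub> jH x"
      using x u v by (simp add: post_apply inB_inH_commute)
  qed
  also have "evL T (post (post inB) ?Q) = post inB g'"
    unfolding g'_def by (rule evL_post[OF mB mT ahom_lin[OF inB_hom] wg_c, symmetric])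
  finally show ?thesis .
qed

text \<open>In Sweedler notation \<Sum> (h1 \<cdot> \<omega>'(S(h4), h5)) \<omega>(h2, S(h3)), the
  expression to which \<gamma> * \<open>g'\<close> reduces.\<close>

definition "y0 = ev3 A (act2 w' \<star>\<star>\<star> post (post (cst A)) w)"

lemmas act2_c = lin_closed[OF act2_lin]
lemmas act1_c = lin_closed[OF act1_lin]
lemmas w12_c = ahom_closed[OF fcA_hom w_closed]

text \<open>Moving \<gamma> to the right across \<omega>' lets its first leg act on \<omega>'. Then
  \<gamma>(h) \<gamma>(S(h')) yields a value of \<omega> and \<gamma>(h S(h')), and the last factor
  contracts to \<gamma>(1) = 1.\<close>

lemma g_g'_y0: "\<gamma> \<bullet> g' = i1 y0"
proof -
  let ?gx = "post (cst (L B)) (fB \<gamma>)" and ?w12 = "post (post (cst A)) w"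
  note fLB = post_hom[OF aLB aLLB cst_hom[OF aLB]] and sLB = cst_hom[OF aLLB]
  note c = ahom_closed[OF fLB fg_c] ahom_closed[OF sLB i2_c[OF w'_closed]] ahom_closed[OF sLB fg_c]
    i3_c[OF act2_c[OF w'_closed]] i3_c[OF w12_c] mpb_c[OF fg_c] ahom_closed[OF sLB wg_c]
  \<comment> \<open>The rule for \<gamma>(h) \<gamma>(k), read in the first two of three
    variables.\<close>
  have gxu: "?gx \<bullet>\<bullet>\<bullet> cst (L (L B)) (fB \<gamma>) = i3 ?w12 \<bullet>\<bullet>\<bullet> mpb (fB \<gamma>)"
  proof -
    have "?gx \<bullet>\<bullet>\<bullet> cst (L (L B)) (fB \<gamma>) = post fB (fB \<gamma>) \<bullet>\<bullet>\<bullet> post fB (sB \<gamma>)"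
      by (simp add: post_cst_post[OF aB g_closed] post_cst[OF mLB ahom_lin[OF fB_hom] g_closed])
    also have "\<dots> = post fB (i2 w \<bullet>\<bullet> mpb \<gamma>)"
      by (simp add: ahom_mult[OF fcB_hom fg_c sg_c, symmetric] g_g)
    also have "\<dots> = post fB (i2 w) \<bullet>\<bullet>\<bullet> post fB (mpb \<gamma>)"
      by (rule ahom_mult[OF fcB_hom i2_c[OF w_closed] mpb_c[OF g_closed]])
    also have "post fB (i2 w) = i3 ?w12"
      unfolding post_post[of fB] post_post[of "post (post \<iota>)"]
      by (rule post_cong[OF _ w_closed]) (simp add: fA_i)
    also have "post fB (mpb \<gamma>) = mpb (fB \<gamma>)"
      by (rule mpb_post[OF g_closed, symmetric])
    finally show ?thesis .
  qed
  have one: "fB \<gamma> \<one>\<^bsub>H\<^esub> = \<one>\<^bsub>L B\<^esub>"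
    by (simp add: post_apply g_one ahom_one[OF cst_hom[OF aB]])
  have "\<gamma> \<bullet> g' = ev3 B (?gx \<bullet>\<bullet>\<bullet> cst (L (L B)) (i2 w' \<bullet>\<bullet> fB \<gamma>))"
    unfolding g'_def ev3_left[OF aB c(7) g_closed] ev3_cst[OF aB wg_c] ..
  also have "?gx \<bullet>\<bullet>\<bullet> cst (L (L B)) (i2 w' \<bullet>\<bullet> fB \<gamma>) =
      i3 (act2 w') \<bullet>\<bullet>\<bullet> i3 ?w12 \<bullet>\<bullet>\<bullet> mpb (fB \<gamma>)"
    using c gxu g_act2[OF w'_closed]
    by (simp add: ahom_mult[OF sLB] i2_c w'_closed fg_c LLLB.m_assoc[symmetric])
       (simp add: LLLB.m_assoc)
  also have "\<dots> = i3 (act2 w' \<star>\<star>\<star> ?w12) \<bullet>\<bullet>\<bullet> mpb (fB \<gamma>)"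
    by (simp add: i3_m act2_c w'_closed w12_c)
  also have "ev3 B \<dots> = ev3 B (i3 (act2 w' \<star>\<star>\<star> ?w12))"
    using ev3_mult_mpb[OF aB i3_c[OF LLLA.m_closed[OF act2_c[OF w'_closed] w12_c]] fg_c]
    by (simp add: one ev3_closed[OF aB] i3_c act2_c w'_closed w12_c)
  also have "\<dots> = i1 y0"
    unfolding y0_def by (rule ev3_post[OF aA aB iota_hom, symmetric]) (simp add: act2_c w'_closed w12_c)
  finally show ?thesis .
qed

lemma act2_mpb: "act2 (mpb e) = post mpb (act1 e)"
  using e_closed lin_closed[OF act_lin]
  by (auto simp: flp_def post_def mpb_def restrict_def fun_eq_iff)

lemma act2_fst:
  assumes y: "y \<in> carrier (L A)"
  shows "act2 (fA y) = post (post (cst A)) (act1 y)"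
proof -
  have "act1 (cst A x) = fA (act x)" if x: "x \<in> carrier A" for x
    using post_cst[OF mA act_lin x] flp_cst(1)[OF aA lin_closed[OF act_lin x]] by simp
  then have "post act1 (fA y) = post fA (post act y)"
    unfolding post_post by (intro post_cong[OF _ y]) auto
  then show ?thesis by (simp add: flp_post)
qed

text \<open>The partial action does not fix the unit: h \<cdot> 1 survives as a function of the
  first variable.\<close>

lemma act2_one: "act2 \<one>\<^bsub>L (L A)\<^esub> = post (cst (L A)) (fA e)"
proof -
  have "act1 \<one>\<^bsub>L A\<^esub> = fA e"
    using post_cst[OF mA act_lin, of "\<one>\<^bsub>A\<^esub>"] ahom_one[OF cst_hom[OF aA]] flp_cst(1)[OF aA e_closed] by simp
  then show ?thesis
    using post_cst[OF mLA act1_lin, of "\<one>\<^bsub>L A\<^esub>"] ahom_one[OF cst_hom[OF aLA]] flp_cst(1)[OF aLA fA_c[OF e_closed]] by simp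
qed

text \<open>The cocycle identity enters here. It exchanges \<omega>(h1, k1) \<omega>(h2 k2, l) for
  (h1 \<cdot> \<omega>(k1, l1)) \<omega>(h2, k2 l2), and the first factor cancels against h \<cdot>
  \<omega>' up to idempotents, because the action is multiplicative. This yields y0 * e = e; with e
  * y0 = y0 and the centrality of \<open>e\<close> it follows that y0 = e.\<close>

lemma y0_e: "y0 = e"
proof -
  let ?w12 = "post (post (cst A)) w" and ?W = "post mpb w" and ?Ex = "post (cst (L A)) (fA e)"
  let ?m = "mpb (fA e)"
  note W_c = ahom_closed[OF fmA_hom w_closed]
  note Ex_c = post_closed[OF ahom_lin[OF cst_hom[OF aLA]] fA_c[OF e_closed]]
  note m_c = mpb_c[OF fA_c[OF e_closed]]
  note aw = act2_c[OF w'_closed]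
  note c = W_c Ex_c m_c aw w12_c act2_c[OF w_closed] act2_c[OF fA_c[OF e_closed]] act2_c[OF mpb_c[OF e_closed]]
  have m_post: "?m = post (post (cst A)) (mpb e)" by (rule mpb_post[OF e_closed])
  have one: "fA e \<one>\<^bsub>H\<^esub> = \<one>\<^bsub>L A\<^esub>"
    by (simp add: post_apply act_at_one ahom_one[OF cst_hom[OF aA]])
  have 1: "act2 (mpb e) \<star>\<star>\<star> ?W = ?W"
    using ahom_mult[OF fmA_hom act1_c[OF e_closed] w_closed] twisted by (simp add: act2_mpb)
  have 2: "act2 (fA e) = ?Ex \<star>\<star>\<star> ?m"
    using ahom_mult[OF fcA_hom fA_c[OF e_closed] mpb_c[OF e_closed]] e_closed
    by (simp add: act2_fst act_e post_cst_post[OF aA] m_post)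
  have y0c: "y0 \<in> carrier (L A)"
    unfolding y0_def by (rule ev3_closed[OF aA]) (use c in simp)
  have Ey0: "e \<star> y0 = y0"
  proof -
    have "?Ex \<star>\<star>\<star> act2 w' = act2 w'"
      using act2_mult[OF LLA.one_closed w'_closed] w'_closed by (simp add: act2_one)
    then have "?Ex \<star>\<star>\<star> (act2 w' \<star>\<star>\<star> ?w12) = act2 w' \<star>\<star>\<star> ?w12"
      using c by (simp add: LLLA.m_assoc[symmetric])
    then show ?thesis unfolding y0_def
      using ev3_left[OF aA LLLA.m_closed[OF aw w12_c] e_closed] by simp
  qed
  \<comment> \<open>Since \<omega>(1, -) is \<open>e\<close>, right multiplication by
    \<open>e\<close> arises from a factor \<open>mpb w\<close>. Together with \<omega> of the first
    two variables this is one side of the cocycle identity.\<close>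
  have "y0 \<star> e = ev3 A (act2 w' \<star>\<star>\<star> ?w12 \<star>\<star>\<star> mpb w)"
    unfolding y0_def using ev3_mult_mpb[OF aA LLLA.m_closed[OF aw w12_c] w_closed] by (simp add: w_one)
  also have "act2 w' \<star>\<star>\<star> ?w12 \<star>\<star>\<star> mpb w = act2 w' \<star>\<star>\<star> act2 w \<star>\<star>\<star> ?W"
    using c cocycle mpb_c[OF w_closed] by (simp add: LLLA.m_assoc)
  also have "\<dots> = act2 (fA e) \<star>\<star>\<star> (act2 (mpb e) \<star>\<star>\<star> ?W)"
    using c by (simp add: act2_mult[symmetric] w'_closed w_closed w'_w)
       (simp add: act2_mult fA_c mpb_c e_closed LLLA.m_assoc)
  also have "\<dots> = ?Ex \<star>\<star>\<star> (?m \<star>\<star>\<star> ?W)"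
    using c by (simp add: 1 2 LLLA.m_assoc)
  \<comment> \<open>The factor hk \<cdot> 1 is moved to the right end, where the contraction
    replaces hk by h1 S(h2), so that 1 \<cdot> 1 = 1 remains.\<close>
  also have "?m \<star>\<star>\<star> ?W = ?W \<star>\<star>\<star> ?m"
    unfolding m_post by (rule central_lift[OF aA mpb_c[OF e_closed] f2_central W_c])
  also have "ev3 A (?Ex \<star>\<star>\<star> (?W \<star>\<star>\<star> ?m)) = ev3 A (?Ex \<star>\<star>\<star> ?W)"
    using ev3_mult_mpb[OF aA LLLA.m_closed[OF Ex_c W_c] fA_c[OF e_closed]] c
    by (simp add: one ev3_closed[OF aA] LLLA.m_assoc)
  also have "\<dots> = e \<star> (\<lambda>h\<in>carrier H. w h \<one>\<^bsub>H\<^esub>)"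
    unfolding ev3_left[OF aA W_c e_closed] ev3_post_mpb[OF aA w_closed] ..
  also have "(\<lambda>h\<in>carrier H. w h \<one>\<^bsub>H\<^esub>) = e"
    using e_closed by (auto simp: w_one' L_carrier extensional_def restrict_def fun_eq_iff)
  finally have "y0 \<star> e = e" by (simp add: e_e)
  then show ?thesis using Ey0 e_central[OF y0c] by simp
qed

lemma g_g': "\<gamma> \<bullet> g' = i1 e"
  by (simp add: g_g'_y0 y0_e)

end

section \<open>The second idempotent of the crossed product and conditions (iii) to (vii)\<close>

context crossed_data
begin

interpretation LA: assoc_algebra R "L A" by (rule aLA)
interpretation LLA: assoc_algebra R "L (L A)" by (rule aLLA)
interpretation LLLA: assoc_algebra R "L (L (L A))" by (rule aLLLA)
interpretation LB: assoc_algebra R "L B" by (rule aLB)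
interpretation LLB: assoc_algebra R "L (L B)" by (rule aLLB)
interpretation LLLB: assoc_algebra R "L (L (L B))" by (rule aLLLB)
interpretation LT: assoc_algebra R "L T" by (rule aLT)
interpretation LLT: assoc_algebra R "L (L T)" by (rule aLLT)

definition "t = g' \<bullet> \<gamma>"

lemma t_closed: "t \<in> carrier (L B)"
  unfolding t_def by (rule LB.m_closed[OF g'_closed g_closed])

abbreviation "E1 \<equiv> fB (i1 e)"
abbreviation "E2 \<equiv> sB (i1 e)"
abbreviation "E12 \<equiv> mpb (i1 e)"

lemmas ie_c = i1_c[OF e_closed]
lemmas E_c = fB_c[OF ie_c] sB_c[OF ie_c] mpb_c[OF ie_c]
lemmas mg_c = mpb_c[OF g_closed]
lemmas g'_cs = fB_c[OF g'_closed] sB_c[OF g'_closed] mpb_c[OF g'_closed]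
lemmas t_cs = fB_c[OF t_closed] sB_c[OF t_closed] mpb_c[OF t_closed]
lemmas iw_c = i2_c[OF w_closed]
lemmas iw'_c = i2_c[OF w'_closed]
lemmas c2 = E_c mg_c fg_c sg_c g'_cs t_cs iw_c iw'_c
lemmas mpbB_m = ahom_mult[OF mpbB, symmetric]

lemma ie_g: "i1 e \<bullet> \<gamma> = \<gamma>"
  by (rule e_g)

lemma E1_comm: "y \<in> carrier (L (L A)) \<Longrightarrow> E1 \<bullet>\<bullet> i2 y = i2 y \<bullet>\<bullet> E1"
  using f1_central[of y] by (simp add: fA_i[OF e_closed, symmetric] i2_m[symmetric] fA_c e_closed)

lemma E1_E12: "E1 \<bullet>\<bullet> E12 = E12 \<bullet>\<bullet> E1"
  using E1_comm[OF mpb_c[OF e_closed]] by (simp add: mpb_i e_closed)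

lemma ww_B: "i2 w' \<bullet>\<bullet> i2 w = E1 \<bullet>\<bullet> E12"
  by (simp add: i2_m[symmetric] w_closed w'_closed w'_w) (simp add: i2_m fA_c mpb_c e_closed fA_i mpb_i)

lemma w'_E12: "i2 w' \<bullet>\<bullet> E12 = i2 w'"
  by (simp add: mpb_i[OF e_closed, symmetric] i2_m[symmetric] mpb_c e_closed w'_closed w'_f2)

lemma E12_mg: "E12 \<bullet>\<bullet> mpb \<gamma> = mpb \<gamma>"
  by (simp add: mpbB_m ie_c g_closed ie_g)

lemma E1_fg: "E1 \<bullet>\<bullet> fB \<gamma> = fB \<gamma>"
  by (simp add: fB_m ie_c g_closed ie_g)

lemma E2_sg: "E2 \<bullet>\<bullet> sB \<gamma> = sB \<gamma>"
  by (simp add: sB_m ie_c g_closed ie_g)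

text \<open>Condition (v). In \<gamma>(h) a = \<Sum> (h1 \<cdot> a) \<gamma>(h2) take a = k \<cdot>
  1. The symmetry axiom for h \<cdot> (k \<cdot> 1) produces e(h1) e(h2 k), and the factor in h
  alone is absorbed by \<gamma>.\<close>

lemma g_E2: "fB \<gamma> \<bullet>\<bullet> E2 = E12 \<bullet>\<bullet> fB \<gamma>"
proof -
  have "fB \<gamma> \<bullet>\<bullet> E2 = i2 (act1 e) \<bullet>\<bullet> fB \<gamma>" by (rule g_act1[OF e_closed])
  also have "\<dots> = E1 \<bullet>\<bullet> E12 \<bullet>\<bullet> fB \<gamma>"
    by (simp add: act_e i2_m fA_c mpb_c e_closed fA_i mpb_i)
  also have "\<dots> = E12 \<bullet>\<bullet> fB \<gamma>"
    using c2 by (simp add: E1_E12 LLB.m_assoc E1_fg)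
  finally show ?thesis .
qed

lemma w'_g_g: "i2 w' \<bullet>\<bullet> fB \<gamma> \<bullet>\<bullet> sB \<gamma> = E1 \<bullet>\<bullet> mpb \<gamma>"
proof -
  have "i2 w' \<bullet>\<bullet> fB \<gamma> \<bullet>\<bullet> sB \<gamma> = i2 w' \<bullet>\<bullet> i2 w \<bullet>\<bullet> mpb \<gamma>"
    using c2 by (simp add: LLB.m_assoc g_g)
  also have "\<dots> = E1 \<bullet>\<bullet> mpb \<gamma>" using c2 by (simp add: ww_B LLB.m_assoc E12_mg)
  finally show ?thesis .
qed

definition "Q = E1 \<bullet>\<bullet> mpb \<gamma>"

lemma Q_closed: "Q \<in> carrier (L (L B))"
  unfolding Q_def using c2 by simp

text \<open>Explicitly t(h) = \<Sum> e(S(h2)) \<gamma>(S(h1) h3). The two \<gamma> in t produce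
  \<omega>, which cancels \<omega>'; only \<open>e\<close> and \<gamma> remain, and their
  commutation rules are known.\<close>

lemma t_evL: "t = evL B Q"
  unfolding t_def g'_def Q_def evL_mult_cst[OF aB wg_c g_closed, symmetric] by (simp add: w'_g_g)

text \<open>Moving x to the left across \<gamma>(S(h) h') lets S(h) h' act on it. By centrality
  \<open>e\<close> does not obstruct this, and the contraction turns the action into 1 \<cdot> x =
  x.\<close>

lemma t_iota:
  assumes x: "x \<in> carrier A"
  shows "t \<bullet> cst B (\<iota> x) = cst B (\<iota> x) \<bullet> t"
proof -
  have ix: "\<iota> x \<in> carrier B" by (rule ahom_closed[OF iota_hom x])
  note cx = cst_closed[OF mB ix]
  note ax = lin_closed[OF act_lin x]
  note c = c2 cx sB_c[OF cx] mpb_c[OF i1_c[OF ax]]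
  have "t \<bullet> cst B (\<iota> x) = evL B (Q \<bullet>\<bullet> sB (cst B (\<iota> x)))"
    unfolding t_evL by (rule evL_mult_cst[OF aB Q_closed cx, symmetric])
  also have "Q \<bullet>\<bullet> sB (cst B (\<iota> x)) = E1 \<bullet>\<bullet> (mpb \<gamma> \<bullet>\<bullet> mpb (cst B (\<iota> x)))"
    using c by (simp add: Q_def mpb_cst[OF mB ix] LLB.m_assoc)
  also have "\<dots> = E1 \<bullet>\<bullet> mpb (i1 (act x)) \<bullet>\<bullet> mpb \<gamma>"
    using c by (simp add: mpbB_m g_closed g_iota x)
      (simp add: ahom_mult[OF mpbB] i1_c ax g_closed LLB.m_assoc)
  also have "E1 \<bullet>\<bullet> mpb (i1 (act x)) = mpb (i1 (act x)) \<bullet>\<bullet> E1"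
    using E1_comm[OF mpb_c[OF ax]] by (simp add: mpb_i ax)
  also have "mpb (i1 (act x)) \<bullet>\<bullet> E1 \<bullet>\<bullet> mpb \<gamma> = mpb (i1 (act x)) \<bullet>\<bullet> Q"
    using c by (simp add: Q_def LLB.m_assoc)
  also have "evL B \<dots> = cst B (i1 (act x) \<one>\<^bsub>H\<^esub>) \<bullet> t"
    unfolding t_evL by (rule evL_mpb_mult[OF aB Q_closed i1_c[OF ax]])
  also have "i1 (act x) \<one>\<^bsub>H\<^esub> = \<iota> x" by (simp add: post_apply act_at_one x)
  finally show ?thesis .
qed

lemma t_iota_apply: "x \<in> carrier A \<Longrightarrow> h \<in> carrier H \<Longrightarrow> t h \<otimes>\<^bsub>B\<^esub> \<iota> x = \<iota> x \<otimes>\<^bsub>B\<^esub> t h"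
  using t_iota[of x] cst_mult_apply[OF aB ahom_closed[OF iota_hom] t_closed] by metis

lemma t_E2: "fB t \<bullet>\<bullet> E2 = E2 \<bullet>\<bullet> fB t"
  by (rule post_cst_commute[OF aB t_closed ie_c]) (simp add: post_apply t_iota_apply L_closed e_closed)

lemma g_t: "\<gamma> \<bullet> t = \<gamma>"
  unfolding t_def using g_g' by (simp add: LB.m_assoc[symmetric] g_closed g'_closed ie_g)

text \<open>Condition (iv). By \<open>spanning\<close> it is enough to treat products \<iota>(x)
  \<gamma>(h). These transform like \<gamma>(h), so \<open>contract t\<close> multiplies them by t,
  which \<gamma> absorbs.\<close>

lemma contract_rho:
  assumes b: "b \<in> carrier B"
  shows "contract t (coaction B b) = b"
proof -
  have eq: "contract t (coaction B (\<iota> x \<otimes>\<^bsub>B\<^esub> \<gamma> h)) = \<iota> x \<otimes>\<^bsub>B\<^esub> \<gamma> h" if x: "x \<in> carrier A" and h: "h \<in> carrier H" for x h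
  proof -
    have ix: "\<iota> x \<in> carrier B" by (rule ahom_closed[OF iota_hom x])
    note cx = cst_closed[OF mB ix]
    let ?y = "cst B (\<iota> x) \<bullet> \<gamma>"
    have yc: "?y \<in> carrier (L B)" using cx g_closed by simp
    have "post (coaction B) ?y = post (coaction B) (cst B (\<iota> x)) \<otimes>\<^bsub>L T\<^esub> (post inB \<gamma> \<otimes>\<^bsub>L T\<^esub> jH)"
      by (simp add: ahom_mult[OF rho1] cx g_closed rho_g)
    also have "post (coaction B) (cst B (\<iota> x)) = post inB (cst B (\<iota> x))"
      by (simp add: post_cst[OF mB ahom_lin[OF coaction_hom] ix] post_cst[OF mB ahom_lin[OF inB_hom] ix] iota_coinvariant x)
    finally have r: "post (coaction B) ?y = post inB ?y \<otimes>\<^bsub>L T\<^esub> jH"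
      using ahom_closed[OF inB1] by (simp add: ahom_mult[OF inB1] cx g_closed LT.m_assoc jH_closed)
    have "post (contract t) (post (coaction B) ?y) = ?y \<bullet> t"
      unfolding r using post_conv[where \<phi> = "contract t" and u = "\<lambda>x. x" and v = t and u' = inB and v' = inH,
        OF aT aB contract(1)[OF t_closed] L_lin[OF yc] L_lin[OF idH_closed] lin_id L_lin[OF t_closed]
        ahom_lin[OF inB_hom] ahom_lin[OF inH_hom] contract(2)[OF t_closed]] post_id[OF yc] post_t_idH(1)[OF t_closed] by simp
    also have "\<dots> = ?y" by (simp add: LB.m_assoc cx g_closed t_closed g_t)
    finally have "post (contract t) (post (coaction B) ?y) h = ?y h" by simp
    then have "contract t (coaction B (?y h)) = ?y h"
      by (simp only: post_apply[OF h])
    then show ?thesis by (simp add: cst_mult_apply[OF aB ix g_closed h])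
  qed
  obtain s where s: "s \<in> carrier (tensor R A H)" "b = tsum B s (\<lambda>x h. \<iota> x \<otimes>\<^bsub>B\<^esub> \<gamma> h)"
    using spanning[OF b] by blast
  have bl: "bilin R A H B (\<lambda>x h. \<iota> x \<otimes>\<^bsub>B\<^esub> \<gamma> h)"
    by (rule bilin_mult[OF aB ahom_lin[OF iota_hom] L_lin[OF g_closed]])
  have cr: "(\<lambda>b. contract t (coaction B b)) \<in> linear_maps R B B"
    by (rule lin_comp[OF contract(1)[OF t_closed] ahom_lin[OF coaction_hom]])
  have "contract t (coaction B b) = tsum B s (\<lambda>x h. contract t (coaction B (\<iota> x \<otimes>\<^bsub>B\<^esub> \<gamma> h)))"
    unfolding s(2) by (rule tsum_map[OF mA mC mB mB bl cr s(1)])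
  also have "\<dots> = b" unfolding s(2)
    by (rule sym, rule tsum_cong[OF mA mC mB bl _ s(1)]) (simp add: eq)
  finally show ?thesis .
qed

interpretation pair: comodule_pair R H B A \<iota> \<gamma> g'
  by unfold_locales (rule g_closed g'_closed rho_g rho_g')+

lemmas gg_t12 = pair.gamma_gamma_absorb[OF t_closed contract_rho]

abbreviation "Y \<equiv> pair.Y"
lemmas Y_def = pair.Y_def and Y_closed = pair.Y_closed and Y_t1 = pair.Y_absorb[OF t_closed contract_rho]

text \<open>Absorption of t writes \<open>Y\<close> as z(h1, k) \<gamma>(h2) with z A-valued. Then
  e(h) commutes with z and is absorbed by \<gamma>.\<close>

lemma E1_Y: "E1 \<bullet>\<bullet> Y = Y"
proof -
  obtain z where z: "z \<in> carrier (L (L A))" "i2 z = Y \<bullet>\<bullet> fB g'" using pair.Y_coinvariant by blast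
  have "fB t = fB g' \<bullet>\<bullet> fB \<gamma>" by (simp add: t_def fB_m g'_closed g_closed)
  then have Y: "Y = i2 z \<bullet>\<bullet> fB \<gamma>" using Y_t1 c2 Y_closed by (simp add: z LLB.m_assoc)
  have "E1 \<bullet>\<bullet> (i2 z \<bullet>\<bullet> fB \<gamma>) = i2 z \<bullet>\<bullet> fB \<gamma>"
    using c2 i2_c[OF z(1)] E1_comm[OF z(1)] by (simp add: LLB.m_assoc[symmetric]) (simp add: LLB.m_assoc E1_fg)
  then show ?thesis using Y by simp
qed

text \<open>This is the identity \<Sum> \<gamma>(h k1) \<gamma>'(k2) = \<Sum> \<omega>'(h1, k)
  \<gamma>(h2). After e(h) is inserted by \<open>E1_Y\<close>, the word e(h) \<gamma>(hk) can be
  replaced by \<omega>'(h, k) \<gamma>(h) \<gamma>(k), and \<gamma>(k) \<gamma>'(k) collapses to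
  e(k).\<close>

lemma Y_eq: "Y = i2 w' \<bullet>\<bullet> fB \<gamma>"
proof -
  have s: "sB \<gamma> \<bullet>\<bullet> sB g' = E2" by (simp add: sB_m g_closed g'_closed g_g')
  have "Y = E1 \<bullet>\<bullet> mpb \<gamma> \<bullet>\<bullet> sB g'" using E1_Y c2 by (simp add: Y_def LLB.m_assoc)
  also have "\<dots> = i2 w' \<bullet>\<bullet> (fB \<gamma> \<bullet>\<bullet> E2)" using c2 by (simp add: w'_g_g[symmetric] LLB.m_assoc s)
  also have "\<dots> = i2 w' \<bullet>\<bullet> fB \<gamma>" using c2 by (simp add: g_E2 LLB.m_assoc[symmetric] w'_E12)
  finally show ?thesis .
qed

text \<open>Condition (vii): expanding t exhibits the left side as \<open>Y\<close> times
  \<gamma>(k), to which \<open>Y_eq\<close> applies.\<close>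

lemma mg_t2: "mpb \<gamma> \<bullet>\<bullet> sB t = E1 \<bullet>\<bullet> mpb \<gamma>"
proof -
  have "mpb \<gamma> \<bullet>\<bullet> sB t = Y \<bullet>\<bullet> sB \<gamma>"
    using c2 by (simp add: Y_def t_def sB_m[symmetric] ahom_mult[OF sB_hom] g_closed g'_closed LLB.m_assoc)
  then show ?thesis by (simp add: Y_eq w'_g_g)
qed

definition "Z = sB \<gamma> \<bullet>\<bullet> mpb g'"

lemma Z_closed: "Z \<in> carrier (L (L B))"
  unfolding Z_def using c2 by simp

text \<open>Expand t as in \<open>t_evL\<close> and let a, b, c be free variables standing for S(h),
  h, k. Then \<gamma>(ab) \<gamma>(c) becomes \<omega>(ab, c) \<gamma>(abc), and e(a) passes
  \<omega> by centrality. It is absorbed there because \<gamma>(abc) g'(bc) is \<open>Y\<close> at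
  (a, bc). Finally ab contracts to 1, leaving e(c) \<gamma>(c) g'(hc).\<close>

lemma t1_Z: "fB t \<bullet>\<bullet> Z = Z"
proof -
  let ?s = "cst (L (L B))"
  let ?E = "post (cst (L B)) E1" and ?C = "mpb (mpb \<gamma>)"
  note s_hom = cst_hom[OF aLLB] and mpbL = mpb_hom[OF aLB]
  note c3 = ahom_closed[OF post_hom[OF aLB aLLB cst_hom[OF aLB]] E_c(1)] mpb_c[OF mpb_c[OF g_closed]]
    ahom_closed[OF s_hom g'_cs(3)] mpb_c[OF fg_c] ahom_closed[OF s_hom sg_c] ahom_closed[OF s_hom Z_closed]
    mpb_c[OF iw_c] ahom_closed[OF fcB_hom Q_closed]
  have Ei: "?E = i3 (post (post (cst A)) (fA e))"
  proof -
    have "?E = post fB (i2 (fA e))"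
      by (simp add: post_cst_post[OF aB ie_c] fA_i e_closed)
    also have "\<dots> = i3 (post (post (cst A)) (fA e))"
      unfolding post_post[of fB] post_post[of "post (post \<iota>)"]
      by (rule post_cong[OF _ fA_c[OF e_closed]]) (simp add: fA_i)
    finally show ?thesis .
  qed
  have comm: "?E \<bullet>\<bullet>\<bullet> mpb (i2 w) = mpb (i2 w) \<bullet>\<bullet>\<bullet> ?E"
  proof -
    have m: "mpb (i2 w) = i3 (mpb w)" by (rule post_mpb[OF w_closed, symmetric])
    note cc = ahom_closed[OF fcA_hom fA_c[OF e_closed]] mpb_c[OF w_closed]
    show ?thesis unfolding Ei m i3_m[OF cc, symmetric] i3_m[OF cc(2,1), symmetric]
      using central_lift[OF aA fA_c[OF e_closed] f1_central mpb_c[OF w_closed]] by simp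
  qed
  have absE: "?E \<bullet>\<bullet>\<bullet> (?C \<bullet>\<bullet>\<bullet> ?s (mpb g')) = ?C \<bullet>\<bullet>\<bullet> ?s (mpb g')"
  proof -
    have Y': "post mpb Y = ?C \<bullet>\<bullet>\<bullet> ?s (mpb g')"
      unfolding Y_def using c2
      by (simp add: ahom_mult[OF fmB_hom] mpb_mpb[OF g_closed] post_mpb_cst(2)[OF aB g'_closed])
    have "post mpb (E1 \<bullet>\<bullet> Y) = ?E \<bullet>\<bullet>\<bullet> post mpb Y"
      by (simp add: ahom_mult[OF fmB_hom] E_c Y_closed post_mpb_cst(1)[OF aB ie_c])
    then show ?thesis by (simp add: E1_Y Y')
  qed
  have PQ: "post fB Q = ?E \<bullet>\<bullet>\<bullet> mpb (fB \<gamma>)"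
    unfolding Q_def using c2
    by (simp add: ahom_mult[OF fcB_hom] post_cst_post[OF aB ie_c] mpb_post[OF g_closed])
  have sZ: "?s Z = mpb (sB \<gamma>) \<bullet>\<bullet>\<bullet> ?s (mpb g')"
    unfolding Z_def using c2 by (simp add: ahom_mult[OF s_hom] mpb_cst[OF mLB g_closed])
  have mm: "mpb (fB \<gamma>) \<bullet>\<bullet>\<bullet> mpb (sB \<gamma>) = mpb (i2 w) \<bullet>\<bullet>\<bullet> ?C"
    using c2 by (simp add: ahom_mult[OF mpbL, symmetric] g_g)
  have "fB t \<bullet>\<bullet> Z = evL (L B) (post fB Q) \<bullet>\<bullet> Z"
    by (simp add: t_evL evL_post[OF mB mLB ahom_lin[OF cst_hom[OF aB]] Q_closed])
  also have "\<dots> = evL (L B) (post fB Q \<bullet>\<bullet>\<bullet> ?s Z)"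
    by (rule evL_mult_cst[OF aLB ahom_closed[OF fcB_hom Q_closed] Z_closed, symmetric])
  also have "post fB Q \<bullet>\<bullet>\<bullet> ?s Z = ?E \<bullet>\<bullet>\<bullet> (mpb (fB \<gamma>) \<bullet>\<bullet>\<bullet> mpb (sB \<gamma>)) \<bullet>\<bullet>\<bullet> ?s (mpb g')"
    using c3 mpb_c[OF sg_c] by (simp add: PQ sZ LLLB.m_assoc)
  also have "\<dots> = mpb (i2 w) \<bullet>\<bullet>\<bullet> (?E \<bullet>\<bullet>\<bullet> (?C \<bullet>\<bullet>\<bullet> ?s (mpb g')))"
    using c3 comm by (simp add: mm LLLB.m_assoc[symmetric])
  also have "\<dots> = mpb (i2 w) \<bullet>\<bullet>\<bullet> (?C \<bullet>\<bullet>\<bullet> ?s (mpb g'))" by (simp only: absE)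
  \<comment> \<open>Here ab is contracted: \<omega>(ab, c) becomes \<omega>(1, c) = e(c), and in the
    next step \<gamma>(abc) becomes \<gamma>(c).\<close>
  also have "evL (L B) \<dots> = cst (L B) (i2 w \<one>\<^bsub>H\<^esub>) \<bullet>\<bullet> evL (L B) (?C \<bullet>\<bullet>\<bullet> ?s (mpb g'))"
    by (rule evL_mpb_mult[OF aLB _ iw_c]) (use c3 in simp)
  also have "evL (L B) (?C \<bullet>\<bullet>\<bullet> ?s (mpb g')) = sB (mpb \<gamma> \<one>\<^bsub>H\<^esub>) \<bullet>\<bullet> mpb g'"
    by (simp add: evL_mult_cst[OF aLB c3(2) g'_cs(3)] evL_mpb[OF aLB mg_c])
  also have "\<dots> = Z" by (simp add: Z_def mpb_at_one[OF g_closed])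
  also have "i2 w \<one>\<^bsub>H\<^esub> = i1 e" by (simp add: post_apply w_one)
  also have "E2 \<bullet>\<bullet> Z = Z" unfolding Z_def using c2 by (simp add: LLB.m_assoc[symmetric] E2_sg)
  finally show ?thesis .
qed

text \<open>\<gamma>(h) \<gamma>(k) absorbs t(hk) on the right, hence so does t(h) \<gamma>(k).
  Expanding t(hk) shows the word \<open>Z\<close> next to t(h), which disappears by
  \<open>t1_Z\<close>.\<close>

lemma t1_sg: "fB t \<bullet>\<bullet> sB \<gamma> = sB \<gamma> \<bullet>\<bullet> mpb t"
proof -
  have mt: "mpb t = mpb g' \<bullet>\<bullet> mpb \<gamma>" by (simp add: t_def mpbB_m g'_closed g_closed)
  have "fB g' \<bullet>\<bullet> (fB \<gamma> \<bullet>\<bullet> sB \<gamma> \<bullet>\<bullet> mpb t) = fB g' \<bullet>\<bullet> (fB \<gamma> \<bullet>\<bullet> sB \<gamma>)"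
    by (simp only: gg_t12)
  moreover have ft: "fB t = fB g' \<bullet>\<bullet> fB \<gamma>" by (simp add: t_def fB_m g'_closed g_closed)
  ultimately have "fB t \<bullet>\<bullet> sB \<gamma> = fB t \<bullet>\<bullet> sB \<gamma> \<bullet>\<bullet> mpb t"
    using c2 by (simp add: LLB.m_assoc)
  also have "\<dots> = fB t \<bullet>\<bullet> Z \<bullet>\<bullet> mpb \<gamma>"
    using c2 by (simp add: mt Z_def LLB.m_assoc)
  also have "\<dots> = sB \<gamma> \<bullet>\<bullet> mpb t"
    using c2 by (simp add: t1_Z) (simp add: Z_def mt LLB.m_assoc)
  finally show ?thesis .
qed

text \<open>The values t(hk) and t(k) share the legs of k, so this is a genuine convolution
  identity. For fixed h put u(k) = t(hk). Expand t by \<open>t_evL\<close>: u commutes with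
  \<open>e\<close>, whose values lie in A, and is carried across \<gamma> by \<open>t1_sg\<close>.
  There its argument grows to k1 S(k2) k3, which contracts back to k.\<close>

lemma t12_t2: "mpb t \<bullet>\<bullet> sB t = sB t \<bullet>\<bullet> mpb t"
proof -
  have row: "mpb t h \<bullet> t = t \<bullet> mpb t h" if h: "h \<in> carrier H" for h
  proof -
    let ?u = "mpb t h"
    have uc: "?u \<in> carrier (L B)" by (rule L_closed[OF t_cs(3) h])
    let ?f = "post (cst (L B))" and ?s = "cst (L (L B))"
    note f_hom = post_hom[OF aLB aLLB cst_hom[OF aLB]] and s_hom = cst_hom[OF aLLB]
    note u_cs = fB_c[OF uc] mpb_c[OF uc]
    note c3 = ahom_closed[OF f_hom u_cs(1)] ahom_closed[OF s_hom E_c(1)] ahom_closed[OF s_hom mg_c]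
      ahom_closed[OF s_hom Q_closed] mpb_c[OF u_cs(2)]
    \<comment> \<open>\<open>t1_sg\<close> with h x as its first argument, rewritten by
      associativity of H.\<close>
    have ug: "fB ?u \<bullet>\<bullet> sB \<gamma> = sB \<gamma> \<bullet>\<bullet> mpb ?u"
    proof (rule LL_eqI[of _ B])
      fix x k assume x: "x \<in> carrier H" and k: "k \<in> carrier H"
      have m: "mpb ?u x = mpb t (h \<otimes>\<^bsub>H\<^esub> x)"
        using h x by (intro L_eqI[of _ B] L_closed[OF u_cs(2)] L_closed[OF t_cs(3)]) (auto simp: mpb_apply m_assoc)
      have "(fB ?u \<bullet>\<bullet> sB \<gamma>) x k = (cst B (t (h \<otimes>\<^bsub>H\<^esub> x)) \<bullet> \<gamma>) k"
        using x h by (simp add: cst_mult_apply(2)[OF aLB g_closed u_cs(1)] post_apply mpb_apply)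
      also have "\<dots> = (fB t \<bullet>\<bullet> sB \<gamma>) (h \<otimes>\<^bsub>H\<^esub> x) k"
        using x h by (simp add: cst_mult_apply(2)[OF aLB g_closed t_cs(1)] post_apply)
      also have "\<dots> = (\<gamma> \<bullet> mpb t (h \<otimes>\<^bsub>H\<^esub> x)) k"
        using x h by (simp add: t1_sg cst_mult_apply(1)[OF aLB g_closed t_cs(3)])
      also have "\<dots> = (sB \<gamma> \<bullet>\<bullet> mpb ?u) x k"
        using x by (simp add: cst_mult_apply(1)[OF aLB g_closed u_cs(2)] m)
      finally show "(fB ?u \<bullet>\<bullet> sB \<gamma>) x k = (sB \<gamma> \<bullet>\<bullet> mpb ?u) x k" .
    qed (use u_cs c2 in auto)
    have uE: "?f (fB ?u) \<bullet>\<bullet>\<bullet> ?s E1 = ?s E1 \<bullet>\<bullet>\<bullet> ?f (fB ?u)"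
    proof (rule post_cst_commute[OF aLB u_cs(1) E_c(1)])
      fix x k assume x: "x \<in> carrier H" and k: "k \<in> carrier H"
      have u: "?u x \<in> carrier B" and i: "\<iota> (e k) \<in> carrier B"
        using L_closed[OF uc x] L_closed[OF ie_c k] k by (auto simp: post_apply)
      have ux: "?u x = t (h \<otimes>\<^bsub>H\<^esub> x)" using h x by (simp add: mpb_apply)
      have "?u x \<otimes>\<^bsub>B\<^esub> \<iota> (e k) = \<iota> (e k) \<otimes>\<^bsub>B\<^esub> ?u x"
        unfolding ux using h x k by (simp add: t_iota_apply L_closed[OF e_closed])
      then have "cst B (?u x) \<bullet> cst B (\<iota> (e k)) = cst B (\<iota> (e k)) \<bullet> cst B (?u x)"
        using ahom_mult[OF cst_hom[OF aB] u i] ahom_mult[OF cst_hom[OF aB] i u] by simp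
      then show "fB ?u x \<bullet> E1 k = E1 k \<bullet> fB ?u x"
        using x k by (simp add: post_apply)
    qed
    have ug3: "?f (fB ?u) \<bullet>\<bullet>\<bullet> ?s (mpb \<gamma>) = ?s (mpb \<gamma>) \<bullet>\<bullet>\<bullet> mpb (mpb ?u)"
    proof -
      have "post mpb (fB ?u \<bullet>\<bullet> sB \<gamma>) = post mpb (sB \<gamma> \<bullet>\<bullet> mpb ?u)" by (simp only: ug)
      then show ?thesis using u_cs c2
        by (simp add: ahom_mult[OF fmB_hom] post_mpb_cst[OF aB uc] post_mpb_cst[OF aB g_closed] mpb_mpb[OF uc])
    qed
    have "?u \<bullet> t = ev3 B (?f (fB ?u) \<bullet>\<bullet>\<bullet> ?s Q)"
      unfolding ev3_left[OF aB c3(4) uc] ev3_cst[OF aB Q_closed] t_evL[symmetric] ..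
    also have "?f (fB ?u) \<bullet>\<bullet>\<bullet> ?s Q = ?f (fB ?u) \<bullet>\<bullet>\<bullet> ?s E1 \<bullet>\<bullet>\<bullet> ?s (mpb \<gamma>)"
      using c3 c2 by (simp add: Q_def ahom_mult[OF s_hom] LLLB.m_assoc)
    also have "\<dots> = ?s E1 \<bullet>\<bullet>\<bullet> (?s (mpb \<gamma>) \<bullet>\<bullet>\<bullet> mpb (mpb ?u))"
      using c3 by (simp add: uE LLLB.m_assoc ug3)
    also have "\<dots> = ?s Q \<bullet>\<bullet>\<bullet> mpb (mpb ?u)"
      using c3 c2 by (simp add: Q_def ahom_mult[OF s_hom] LLLB.m_assoc)
    also have "ev3 B \<dots> = t \<bullet> ?u"
      unfolding ev3_mult_mpb[OF aB c3(4) u_cs(2)] ev3_cst[OF aB Q_closed] t_evL[symmetric] mpb_at_one[OF uc] ..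
    finally show ?thesis .
  qed
  show ?thesis
    by (rule L_eqI[of _ "L B"])
      (use c2 row in \<open>auto simp: cst_mult_apply[OF aLB t_closed t_cs(3)]\<close>)
qed

lemma g'_ie: "g' \<bullet> i1 e = g'"
proof -
  have "g' \<bullet> i1 e = evL B (i2 w' \<bullet>\<bullet> fB \<gamma> \<bullet>\<bullet> E2)"
    unfolding g'_def by (rule evL_mult_cst[OF aB wg_c ie_c, symmetric])
  also have "i2 w' \<bullet>\<bullet> fB \<gamma> \<bullet>\<bullet> E2 = i2 w' \<bullet>\<bullet> fB \<gamma>"
    using c2 by (simp add: LLB.m_assoc g_E2) (simp add: LLB.m_assoc[symmetric] w'_E12)
  finally show ?thesis by (simp add: g'_def)
qed

text \<open>Condition (vi). Inserting e(k) = \<gamma>(k) \<gamma>'(k) in front of t(h) gives t a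
  factor \<gamma>(k) to pass by \<open>t1_sg\<close>. This leaves t(k) t(hk) \<gamma>'(k); after
  \<open>t12_t2\<close> the factor t(k) is reabsorbed by \<gamma>'(k).\<close>

lemma g'_t1: "sB g' \<bullet>\<bullet> fB t = mpb t \<bullet>\<bullet> sB g'"
proof -
  have gE: "sB g' \<bullet>\<bullet> E2 = sB g'" by (simp add: sB_m g'_closed ie_c g'_ie)
  have gg: "sB \<gamma> \<bullet>\<bullet> sB g' = E2" by (simp add: sB_m g_closed g'_closed g_g')
  have g't: "sB g' \<bullet>\<bullet> sB \<gamma> = sB t" by (simp add: sB_m g_closed g'_closed t_def)
  have "sB g' \<bullet>\<bullet> fB t = sB g' \<bullet>\<bullet> (E2 \<bullet>\<bullet> fB t)"
    using c2 by (simp add: LLB.m_assoc[symmetric] gE)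
  also have "\<dots> = sB g' \<bullet>\<bullet> (fB t \<bullet>\<bullet> (sB \<gamma> \<bullet>\<bullet> sB g'))"
    by (simp only: t_E2 gg)
  also have "\<dots> = sB g' \<bullet>\<bullet> (fB t \<bullet>\<bullet> sB \<gamma>) \<bullet>\<bullet> sB g'"
    using c2 by (simp add: LLB.m_assoc)
  also have "\<dots> = sB g' \<bullet>\<bullet> sB \<gamma> \<bullet>\<bullet> mpb t \<bullet>\<bullet> sB g'"
    using c2 by (simp add: t1_sg LLB.m_assoc)
  also have "\<dots> = mpb t \<bullet>\<bullet> (sB g' \<bullet>\<bullet> (sB \<gamma> \<bullet>\<bullet> sB g'))"
    using c2 by (simp add: g't t12_t2[symmetric]) (simp add: g't[symmetric] LLB.m_assoc)
  also have "\<dots> = mpb t \<bullet>\<bullet> sB g'" by (simp add: gg gE)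
  finally show ?thesis .
qed

end

context coalgebra
begin

text \<open>The transposition argument of \<open>commutation_lift\<close>, for x \<mapsto> g x
  g'.\<close>

lemma conjugation_lift:
  assumes X: "assoc_algebra R X" and Z: "assoc_algebra R Z" and g: "g \<in> carrier (L Z)" and g': "g' \<in> carrier (L Z)"
    and j: "j \<in> linear_maps R X Z" and ac: "ac \<in> linear_maps R X (L X)"
    and conj: "\<And>x. x \<in> carrier X \<Longrightarrow> post j (ac x) = g \<otimes>\<^bsub>L Z\<^esub> cst Z (j x) \<otimes>\<^bsub>L Z\<^esub> g'"
    and y: "y \<in> carrier (L X)"
  shows "post (post j) (flp (post ac y)) =
    post (cst Z) g \<otimes>\<^bsub>L (L Z)\<^esub> cst (L Z) (post j y) \<otimes>\<^bsub>L (L Z)\<^esub> post (cst Z) g'"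
proof -
  note LX = L_assoc_algebra[OF X] and LZ = L_assoc_algebra[OF Z]
  note LLZ = L_assoc_algebra[OF LZ]
  note mLZ = assoc_algebra_module[OF LZ]
  note cg = cst_closed[OF mLZ g] and cg' = cst_closed[OF mLZ g']
  note jy = post_closed[OF j y]
  have pc: "post (cst Z) (post j y) \<in> carrier (L (L Z))" by (rule post_closed[OF ahom_lin[OF cst_hom[OF Z]] jy])
  have pa: "post ac y \<in> carrier (L (L X))" by (rule post_closed[OF ac y])
  have pja: "post (post j) (post ac y) \<in> carrier (L (L Z))"
    by (rule post_closed[OF post_linear[OF X Z j] pa])
  note m1 = L_mult_closed[OF LZ cg pc]
  have "post (post j) (post ac y) =
      cst (L Z) g \<otimes>\<^bsub>L (L Z)\<^esub> post (cst Z) (post j y) \<otimes>\<^bsub>L (L Z)\<^esub> cst (L Z) g'"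
    by (rule L_eqI[OF pja L_mult_closed[OF LZ m1 cg']])
      (simp add: cst_mult_apply(2)[OF LZ g' m1] cst_mult_apply(1)[OF LZ g pc] post_apply conj L_closed[OF y])
  then have "flp (post (post j) (post ac y)) =
      flp (cst (L Z) g \<otimes>\<^bsub>L (L Z)\<^esub> post (cst Z) (post j y) \<otimes>\<^bsub>L (L Z)\<^esub> cst (L Z) g')"
    by simp
  then show ?thesis
    using cg cg' pc m1 by (simp add: ahom_mult[OF flp_hom[OF Z]] flp_cst[OF Z g] flp_cst[OF Z g'] flp_cst[OF Z jy] flp_post)
qed

end

section \<open>The twisted partial action of a cleft extension\<close>

text \<open>The remaining conditions as words: \<open>gamma_one\<close> is (i),
  \<open>e12_central\<close> and \<open>t_iota\<close> are the two halves of (iii), and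
  \<open>contract_rho\<close>, \<open>g_E2\<close>, \<open>g'_t1\<close>, \<open>mg_t2\<close> are
  (iv) to (vii).\<close>

locale cleft_data = comodule_pair +
  assumes gamma_one: "\<gamma> \<one>\<^bsub>H\<^esub> = \<one>\<^bsub>B\<^esub>"
    and e12_central: "\<And>z. z \<in> carrier (L (L A)) \<Longrightarrow>
      mpb (\<gamma> \<bullet> \<gamma>') \<bullet>\<bullet> post (post \<iota>) z = post (post \<iota>) z \<bullet>\<bullet> mpb (\<gamma> \<bullet> \<gamma>')"
    and t_iota: "\<And>x. x \<in> carrier A \<Longrightarrow> (\<gamma>' \<bullet> \<gamma>) \<bullet> cst B (\<iota> x) = cst B (\<iota> x) \<bullet> (\<gamma>' \<bullet> \<gamma>)"
    and contract_rho: "\<And>b. b \<in> carrier B \<Longrightarrow> contract (\<gamma>' \<bullet> \<gamma>) (coaction B b) = b"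
    and g_E2: "post (cst B) \<gamma> \<bullet>\<bullet> cst (L B) (\<gamma> \<bullet> \<gamma>') = mpb (\<gamma> \<bullet> \<gamma>') \<bullet>\<bullet> post (cst B) \<gamma>"
    and g'_t1: "cst (L B) \<gamma>' \<bullet>\<bullet> post (cst B) (\<gamma>' \<bullet> \<gamma>) = mpb (\<gamma>' \<bullet> \<gamma>) \<bullet>\<bullet> cst (L B) \<gamma>'"
    and mg_t2: "mpb \<gamma> \<bullet>\<bullet> cst (L B) (\<gamma>' \<bullet> \<gamma>) = post (cst B) (\<gamma> \<bullet> \<gamma>') \<bullet>\<bullet> mpb \<gamma>"
begin

interpretation LA: assoc_algebra R "L A" by (rule aLA)
interpretation LLA: assoc_algebra R "L (L A)" by (rule aLLA)
interpretation LLLA: assoc_algebra R "L (L (L A))" by (rule aLLLA)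
interpretation LB: assoc_algebra R "L B" by (rule aLB)
interpretation LLB: assoc_algebra R "L (L B)" by (rule aLLB)
interpretation LLLB: assoc_algebra R "L (L (L B))" by (rule aLLLB)

abbreviation "i1 y \<equiv> post \<iota> y"
abbreviation "i2 y \<equiv> post (post \<iota>) y"
abbreviation "i3 y \<equiv> post (post (post \<iota>)) y"
abbreviation "fA y \<equiv> post (cst A) y"
abbreviation "fB y \<equiv> post (cst B) y"
abbreviation "sB y \<equiv> cst (L B) y"
abbreviation "t \<equiv> \<gamma>' \<bullet> \<gamma>"
abbreviation "e \<equiv> \<gamma> \<bullet> \<gamma>'"

lemmas gc = gamma_closed gamma'_closed
lemmas fA_hom = post_hom[OF aA aLA cst_hom[OF aA]]
lemmas mpbB = mpb_hom[OF aB]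
lemmas mpbA = mpb_hom[OF aA]
lemmas fcB_hom = post_hom[OF aLB aLLB fB_hom]
lemmas fmB_hom = post_hom[OF aLB aLLB mpbB]
lemmas fB_m = ahom_mult[OF fB_hom]
lemmas sB_m = ahom_mult[OF sB_hom]
lemmas mpbB_m = ahom_mult[OF mpbB]

lemma t_closed: "t \<in> carrier (L B)" and ee_closed: "e \<in> carrier (L B)"
  using gc by auto

lemmas c2 = cB ahom_closed[OF fB_hom t_closed] ahom_closed[OF sB_hom t_closed] mpb_closed[OF t_closed]
  ahom_closed[OF fB_hom ee_closed] ahom_closed[OF sB_hom ee_closed] mpb_closed[OF ee_closed]

lemma t_iota_apply: "x \<in> carrier A \<Longrightarrow> h \<in> carrier H \<Longrightarrow> t h \<otimes>\<^bsub>B\<^esub> \<iota> x = \<iota> x \<otimes>\<^bsub>B\<^esub> t h"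
  using t_iota[of x] cst_mult_apply[OF aB ahom_closed[OF iota_hom] t_closed] by metis

lemma g_t: "\<gamma> \<bullet> t = \<gamma>"
  using absorb1[OF t_closed contract_rho gamma_closed idH_closed rho_gamma] by (simp add: post_t_idH[OF t_closed])

text \<open>Condition (iv) for b = 1 reads t(1) = 1. Since \<gamma>(1) = 1, this is also the value
  of \<gamma>' at 1.\<close>

lemma t_one: "t \<one>\<^bsub>H\<^esub> = \<one>\<^bsub>B\<^esub>" and gamma'_one: "\<gamma>' \<one>\<^bsub>H\<^esub> = \<one>\<^bsub>B\<^esub>"
proof -
  have "contract t (inB \<one>\<^bsub>B\<^esub> \<otimes>\<^bsub>T\<^esub> inH \<one>\<^bsub>H\<^esub>) = \<one>\<^bsub>B\<^esub> \<otimes>\<^bsub>B\<^esub> t \<one>\<^bsub>H\<^esub>"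
    by (rule contract(2)[OF t_closed]) auto
  then have "contract t (coaction B \<one>\<^bsub>B\<^esub>) = t \<one>\<^bsub>H\<^esub>"
    using ahom_one[OF coaction_hom] L_closed[OF t_closed, of "\<one>\<^bsub>H\<^esub>"]
    by (simp add: tensor_mult_tens[OF aB aH]) (simp add: tensor_def)
  then show "t \<one>\<^bsub>H\<^esub> = \<one>\<^bsub>B\<^esub>" using contract_rho[of "\<one>\<^bsub>B\<^esub>"] by simp
  then show "\<gamma>' \<one>\<^bsub>H\<^esub> = \<one>\<^bsub>B\<^esub>"
    using L_mult_at_one[OF aB gc(2,1)] L_closed[OF gc(2), of "\<one>\<^bsub>H\<^esub>"] by (simp add: gamma_one)
qed

lemma at_one:
  assumes X: "assoc_algebra R X" and f: "f \<in> carrier (L X)"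
  shows "post (cst X) f \<one>\<^bsub>H\<^esub> = cst X (f \<one>\<^bsub>H\<^esub>)" "cst (L X) f \<one>\<^bsub>H\<^esub> = f" "mpb f \<one>\<^bsub>H\<^esub> = f"
  using cst_at_one[OF assoc_algebra_module[OF L_assoc_algebra[OF X]] f] mpb_at_one[OF f] by (auto simp: post_apply)

text \<open>Condition (vi) at h = 1.\<close>

lemma t_g': "t \<bullet> \<gamma>' = \<gamma>'"
proof -
  have "(sB \<gamma>' \<bullet>\<bullet> fB t) \<one>\<^bsub>H\<^esub> = (mpb t \<bullet>\<bullet> sB \<gamma>') \<one>\<^bsub>H\<^esub>" by (simp only: g'_t1)
  then show ?thesis
    using gc by (simp add: L_mult_at_one[OF aLB] c2 at_one[OF aB] t_closed t_one ahom_one[OF cst_hom[OF aB]])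
qed

lemma e_g: "e \<bullet> \<gamma> = \<gamma>"
  using gc g_t by (simp add: LB.m_assoc)

lemma g'_e: "\<gamma>' \<bullet> e = \<gamma>'"
  using gc t_g' by (simp add: LB.m_assoc)

definition "act x = inv_into (carrier (L A)) (post \<iota>) (\<gamma> \<bullet> cst B (\<iota> x) \<bullet> \<gamma>')"
definition "w = inv_into (carrier (L (L A))) (post (post \<iota>)) (fB \<gamma> \<bullet>\<bullet> sB \<gamma> \<bullet>\<bullet> mpb \<gamma>')"
definition "w' = inv_into (carrier (L (L A))) (post (post \<iota>)) (mpb \<gamma> \<bullet>\<bullet> sB \<gamma>' \<bullet>\<bullet> fB \<gamma>')"

lemmas i1_inj = post_inj[OF iota_inj]
lemmas i2_inj = post_inj[OF i1_inj]
lemmas i3_inj = post_inj[OF i2_inj]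
lemmas i1_c = ahom_closed[OF iota1] and i2_c = ahom_closed[OF iota2] and i3_c = ahom_closed[OF iota3]
lemmas i1_m = ahom_mult[OF iota1] and i2_m = ahom_mult[OF iota2] and i3_m = ahom_mult[OF iota3]

lemma act:
  assumes "x \<in> carrier A"
  shows "act x \<in> carrier (L A)" "i1 (act x) = \<gamma> \<bullet> cst B (\<iota> x) \<bullet> \<gamma>'"
proof -
  have "\<gamma> \<bullet> cst B (\<iota> x) \<bullet> \<gamma>' \<in> post \<iota> ` carrier (L A)"
    using conjugate_coinvariant[OF assms] by (metis imageI)
  from inv_into_into[OF this] f_inv_into_f[OF this]
  show "act x \<in> carrier (L A)" "i1 (act x) = \<gamma> \<bullet> cst B (\<iota> x) \<bullet> \<gamma>'"
    by (simp_all only: act_def)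
qed

lemma w: "w \<in> carrier (L (L A))" "i2 w = fB \<gamma> \<bullet>\<bullet> sB \<gamma> \<bullet>\<bullet> mpb \<gamma>'"
proof -
  have "fB \<gamma> \<bullet>\<bullet> sB \<gamma> \<bullet>\<bullet> mpb \<gamma>' \<in> post (post \<iota>) ` carrier (L (L A))"
    using gamma_gamma_coinvariant by (metis imageI)
  from inv_into_into[OF this] f_inv_into_f[OF this]
  show "w \<in> carrier (L (L A))" "i2 w = fB \<gamma> \<bullet>\<bullet> sB \<gamma> \<bullet>\<bullet> mpb \<gamma>'"
    by (simp_all only: w_def)
qed

lemma w': "w' \<in> carrier (L (L A))" "i2 w' = mpb \<gamma> \<bullet>\<bullet> sB \<gamma>' \<bullet>\<bullet> fB \<gamma>'"
proof -
  have "mpb \<gamma> \<bullet>\<bullet> sB \<gamma>' \<bullet>\<bullet> fB \<gamma>' \<in> post (post \<iota>) ` carrier (L (L A))"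
    using Y_coinvariant unfolding Y_def by (metis imageI)
  from inv_into_into[OF this] f_inv_into_f[OF this]
  show "w' \<in> carrier (L (L A))" "i2 w' = mpb \<gamma> \<bullet>\<bullet> sB \<gamma>' \<bullet>\<bullet> fB \<gamma>'"
    by (simp_all only: w'_def)
qed

text \<open>Injectivity of \<iota> passes to functions, so identities between A-valued functions may
  be verified in B, where \<gamma> and \<gamma>' are available.\<close>

lemma L1_eq: "y \<in> carrier (L A) \<Longrightarrow> z \<in> carrier (L A) \<Longrightarrow> i1 y = i1 z \<Longrightarrow> y = z"
  using i1_inj by (simp add: inj_on_def)
lemma L2_eq: "y \<in> carrier (L (L A)) \<Longrightarrow> z \<in> carrier (L (L A)) \<Longrightarrow> i2 y = i2 z \<Longrightarrow> y = z"
  using i2_inj by (simp add: inj_on_def)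
lemma L3_eq: "y \<in> carrier (L (L (L A))) \<Longrightarrow> z \<in> carrier (L (L (L A))) \<Longrightarrow> i3 y = i3 z \<Longrightarrow> y = z"
  using i3_inj by (simp add: inj_on_def)

lemma cx: "x \<in> carrier A \<Longrightarrow> cst B (\<iota> x) \<in> carrier (L B)"
  by (rule cst_closed[OF mB ahom_closed[OF iota_hom]])

lemma cx_lin: "(\<lambda>x. cst B (\<iota> x)) \<in> linear_maps R A (L B)"
  by (rule lin_comp[OF ahom_lin[OF cst_hom[OF aB]] ahom_lin[OF iota_hom]])

lemma act_lin: "act \<in> linear_maps R A (L A)"
proof -
  have l: "(\<lambda>x. \<gamma> \<bullet> cst B (\<iota> x) \<bullet> \<gamma>') \<in> linear_maps R A (L B)"
    by (rule lin_mult_right[OF aLB gc(2) lin_mult_left[OF aLB gc(1) cx_lin]])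
  show ?thesis
  proof (rule linear_mapsI)
    fix x y assume x: "x \<in> carrier A" and y: "y \<in> carrier A"
    show "act (x \<oplus>\<^bsub>A\<^esub> y) = act x \<oplus>\<^bsub>L A\<^esub> act y"
      by (rule L1_eq) (use x y in \<open>simp_all add: act lin_add[OF ahom_lin[OF iota1]] lin_add[OF l]\<close>)
  next
    fix r x assume r: "r \<in> carrier R" and x: "x \<in> carrier A"
    show "act (r \<odot>\<^bsub>A\<^esub> x) = r \<odot>\<^bsub>L A\<^esub> act x"
      by (rule L1_eq) (use x r in \<open>simp_all add: act lin_smult[OF ahom_lin[OF iota1]] lin_smult[OF l]\<close>)
  qed (rule act)
qed

abbreviation "E \<equiv> act \<one>\<^bsub>A\<^esub>"

lemma E_closed: "E \<in> carrier (L A)"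
  by (rule act) simp

lemma iE: "i1 E = e"
  using gc by (simp add: act ahom_one[OF iota_hom] ahom_one[OF cst_hom[OF aB]])

lemma fE: "i2 (fA E) = fB e"
  using cst_natural[OF mA ahom_lin[OF iota_hom] E_closed] by (simp add: iE)

lemma mE: "i2 (mpb E) = mpb e"
  using post_mpb[OF E_closed, of \<iota>] by (simp add: iE)

lemmas E_cs = ahom_closed[OF fA_hom E_closed] mpb_closed[OF E_closed]

lemma f2_central: "y \<in> carrier (L (L A)) \<Longrightarrow> mpb E \<star>\<star> y = y \<star>\<star> mpb E"
  by (rule L2_eq) (use E_cs e12_central in \<open>auto simp: i2_m mE\<close>)

text \<open>Evaluation of the second variable at 1 is multiplicative and sends \<open>mpb E\<close>
  to \<open>E\<close> and \<open>fA z\<close> to z.\<close>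

lemma E_central:
  assumes z: "z \<in> carrier (L A)"
  shows "E \<star> z = z \<star> E"
proof -
  note p = post_mult[where \<phi> = "\<lambda>f. f \<one>\<^bsub>H\<^esub>", OF aLA aA L_ev[OF one_closed] L_mult_at_one[OF aA]]
  have pf: "post (\<lambda>f. f \<one>\<^bsub>H\<^esub>) (fA z) = z"
    unfolding post_post by (rule L_eqI[OF post_closed[OF _ z] z])
      (auto simp: post_apply cst_at_one[OF mA] L_closed z intro!: lin_comp[OF L_ev[OF one_closed] ahom_lin[OF cst_hom[OF aA]]])
  have pm: "post (\<lambda>f. f \<one>\<^bsub>H\<^esub>) (mpb E) = E"
    by (rule L_eqI[OF post_closed[OF L_ev[OF one_closed] E_cs(2)] E_closed]) (simp add: post_apply mpb_apply)
  note fz = ahom_closed[OF fA_hom z]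
  have "post (\<lambda>f. f \<one>\<^bsub>H\<^esub>) (mpb E \<star>\<star> fA z) = post (\<lambda>f. f \<one>\<^bsub>H\<^esub>) (fA z \<star>\<star> mpb E)"
    by (simp only: f2_central[OF fz])
  then show ?thesis by (simp add: p E_cs fz pf pm)
qed

text \<open>For a fixed second argument k the product with a function of the first variable is a
  convolution in L A alone, where \<open>E\<close> is central.\<close>

lemma f1_central:
  assumes y: "y \<in> carrier (L (L A))"
  shows "fA E \<star>\<star> y = y \<star>\<star> fA E"
proof (rule LL_eqI[of _ A])
  fix h k assume h: "h \<in> carrier H" and k: "k \<in> carrier H"
  let ?z = "\<lambda>h\<in>carrier H. y h k"
  have l: "(\<lambda>h. y h k) \<in> linear_maps R H A" by (rule bilin_l[OF LL_bilin[OF y] k])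
  have z: "?z \<in> carrier (L A)" by (rule L_I[OF l])
  have "(fA E \<star>\<star> y) h k = (E \<star> ?z) h"
    unfolding post_cst_mult_apply(1)[OF aA E_closed y h k] L_mult[OF h, where X = A]
    by (rule tsum_cong[OF mC mC mA bilin_mult[OF aA L_lin[OF E_closed] l] _ comult_closed[OF h]]) simp
  also have "\<dots> = (y \<star>\<star> fA E) h k"
    unfolding E_central[OF z] post_cst_mult_apply(2)[OF aA E_closed y h k] L_mult[OF h, where X = A]
    by (rule sym, rule tsum_cong[OF mC mC mA bilin_mult[OF aA l L_lin[OF E_closed]] _ comult_closed[OF h]]) simp
  finally show "(fA E \<star>\<star> y) h k = (y \<star>\<star> fA E) h k" .
qed (use y E_cs in auto)

text \<open>The product of the two conjugates has t in the middle. It commutes with \<iota>(A) and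
  is absorbed by \<gamma>.\<close>

lemma act_mult:
  assumes x: "x \<in> carrier A" and y: "y \<in> carrier A"
  shows "act (x \<otimes>\<^bsub>A\<^esub> y) = act x \<star> act y"
proof (rule L1_eq)
  note c = gc cx[OF x] cx[OF y]
  have "i1 (act x \<star> act y) = \<gamma> \<bullet> (cst B (\<iota> x) \<bullet> t) \<bullet> cst B (\<iota> y) \<bullet> \<gamma>'"
    using c x y by (simp add: i1_m act LB.m_assoc)
  also have "\<dots> = \<gamma> \<bullet> t \<bullet> (cst B (\<iota> x) \<bullet> cst B (\<iota> y)) \<bullet> \<gamma>'"
    using c by (simp add: t_iota[OF x, symmetric]) (simp add: LB.m_assoc)
  also have "\<dots> = i1 (act (x \<otimes>\<^bsub>A\<^esub> y))"
    using x y by (simp add: g_t act ahom_mult[OF iota_hom] ahom_mult[OF cst_hom[OF aB]] ahom_closed[OF iota_hom])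
  finally show "i1 (act (x \<otimes>\<^bsub>A\<^esub> y)) = i1 (act x \<star> act y)" by simp
qed (use x y act in auto)

lemma act_at_one:
  assumes x: "x \<in> carrier A"
  shows "act x \<one>\<^bsub>H\<^esub> = x"
proof -
  have "\<iota> (act x \<one>\<^bsub>H\<^esub>) = i1 (act x) \<one>\<^bsub>H\<^esub>" by (simp add: post_apply)
  also have "\<dots> = \<iota> x"
    using gc cx[OF x] ahom_closed[OF iota_hom x]
    by (simp add: act x L_mult_at_one[OF aB] gamma_one gamma'_one cst_at_one[OF mB])
  finally show ?thesis using iota_inj L_closed[OF act(1)[OF x]] x by (simp add: inj_on_def)
qed

abbreviation "act1 y \<equiv> flp (post act y)"
abbreviation "act2 y \<equiv> flp (post act1 y)"

lemma act1_lin: "act1 \<in> linear_maps R (L A) (L (L A))"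
  by (rule lin_comp[OF ahom_lin[OF flp_hom[OF aA]] post_linear[OF aA aLA act_lin]])

lemma act2_lin: "act2 \<in> linear_maps R (L (L A)) (L (L (L A)))"
  by (rule lin_comp[OF ahom_lin[OF flp_hom[OF aLA]] post_linear[OF aLA aLLA act1_lin]])

lemma i_act1: "y \<in> carrier (L A) \<Longrightarrow> i2 (act1 y) = fB \<gamma> \<bullet>\<bullet> sB (i1 y) \<bullet>\<bullet> fB \<gamma>'"
  by (rule conjugation_lift[OF aA aB gc ahom_lin[OF iota_hom] act_lin act(2)])

lemma i_act2: "y \<in> carrier (L (L A)) \<Longrightarrow> i3 (act2 y) =
    post (cst (L B)) (fB \<gamma>) \<bullet>\<bullet>\<bullet> cst (L (L B)) (i2 y) \<bullet>\<bullet>\<bullet> post (cst (L B)) (fB \<gamma>')"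
  by (rule conjugation_lift[OF aLA aLB cB(1,4) ahom_lin[OF iota1] act1_lin i_act1])

text \<open>The symmetry axiom for h \<cdot> (k \<cdot> 1) is condition (v), multiplied by
  \<gamma>'(h) on the right.\<close>

lemma act_E: "act1 E = fA E \<star>\<star> mpb E"
proof (rule L2_eq)
  have "i2 (act1 E) = mpb e \<bullet>\<bullet> fB e"
    using c2 by (simp add: i_act1 E_closed iE g_E2) (simp add: LLB.m_assoc fB_m gc)
  also have "\<dots> = i2 (fA E \<star>\<star> mpb E)"
    by (simp add: f1_central E_cs i2_m fE mE)
  finally show "i2 (act1 E) = i2 (fA E \<star>\<star> mpb E)" .
qed (use E_cs E_closed lin_closed[OF act1_lin] in auto)

lemmas ab_t = gamma_gamma_absorb[OF t_closed contract_rho]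

text \<open>This and the following three rules say that \<omega> and \<omega>' are fixed by both
  idempotents, which puts them in the ideal generated by f1 * f2.\<close>

lemma w_f2: "w \<star>\<star> mpb E = w"
proof (rule L2_eq)
  have "mpb \<gamma>' \<bullet>\<bullet> mpb e = mpb \<gamma>'" using mpbB_m[OF gc(2) ee_closed] g'_e by simp
  then show "i2 (w \<star>\<star> mpb E) = i2 w" using c2 by (simp add: i2_m w E_cs mE LLB.m_assoc)
qed (use w E_cs in auto)

lemma w'_f1: "w' \<star>\<star> fA E = w'"
proof (rule L2_eq)
  have "fB \<gamma>' \<bullet>\<bullet> fB e = fB \<gamma>'" using fB_m[OF gc(2) ee_closed] g'_e by simp
  then show "i2 (w' \<star>\<star> fA E) = i2 w'" using c2 by (simp add: i2_m w' E_cs fE LLB.m_assoc)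
qed (use w' E_cs in auto)

lemma w_f1: "w \<star>\<star> fA E = w"
proof -
  have "fB e \<bullet>\<bullet> fB \<gamma> = fB \<gamma>" using fB_m[OF ee_closed gc(1)] e_g by simp
  then have "fA E \<star>\<star> w = w"
    by (intro L2_eq) (use w E_cs c2 in \<open>auto simp: i2_m fE LLB.m_assoc[symmetric]\<close>)
  then show ?thesis using f1_central[OF w(1)] by simp
qed

lemma w'_f2: "w' \<star>\<star> mpb E = w'"
proof -
  have "mpb e \<bullet>\<bullet> mpb \<gamma> = mpb \<gamma>" using mpbB_m[OF ee_closed gc(1)] e_g by simp
  then have "mpb E \<star>\<star> w' = w'"
    by (intro L2_eq) (use w' E_cs c2 in \<open>auto simp: i2_m mE LLB.m_assoc[symmetric]\<close>)
  then show ?thesis using f2_central[OF w'(1)] by simp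
qed

lemma w_one: "w \<one>\<^bsub>H\<^esub> = E"
proof (rule L1_eq)
  have "i1 (w \<one>\<^bsub>H\<^esub>) = i2 w \<one>\<^bsub>H\<^esub>" by (simp add: post_apply)
  also have "\<dots> = e"
    using c2 gc by (simp add: w L_mult_at_one[OF aLB] at_one[OF aB] gamma_one ahom_one[OF cst_hom[OF aB]])
  finally show "i1 (w \<one>\<^bsub>H\<^esub>) = i1 E" by (simp add: iE)
qed (use w E_closed in \<open>auto intro: L_closed\<close>)

lemma w_one':
  assumes h: "h \<in> carrier H"
  shows "w h \<one>\<^bsub>H\<^esub> = E h"
proof -
  let ?p = "post (\<lambda>f. f \<one>\<^bsub>H\<^esub>)"
  note p = post_mult[where \<phi> = "\<lambda>f. f \<one>\<^bsub>H\<^esub>", OF aLB aB L_ev[OF one_closed] L_mult_at_one[OF aB]]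
  have pc: "f \<in> carrier (L (L B)) \<Longrightarrow> ?p f \<in> carrier (L B)" for f
    by (rule post_closed[OF L_ev[OF one_closed]])
  have pf: "?p (fB \<gamma>) = \<gamma>"
    by (rule L_eqI[OF pc[OF cB(1)] gc(1)]) (auto simp: post_apply cst_at_one[OF mB] L_closed gc)
  have ps: "?p (sB \<gamma>) = \<one>\<^bsub>L B\<^esub>"
    by (rule L_eqI[OF pc[OF cB(2)] LB.one_closed]) (auto simp: post_apply cst_apply L_smult L_one gamma_one)
  have pm: "?p (mpb \<gamma>') = \<gamma>'"
    by (rule L_eqI[OF pc[OF cB(6)] gc(2)]) (auto simp: post_apply mpb_apply)
  have "?p (i2 w) = e"
    using c2 gc by (simp add: w p pf ps pm)
  then have "?p (i2 w) h = i1 E h" by (simp add: iE)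
  then have "\<iota> (w h \<one>\<^bsub>H\<^esub>) = \<iota> (E h)" using h by (simp add: post_apply)
  then show ?thesis using iota_inj L_closed[OF L_closed[OF w(1) h]] L_closed[OF E_closed h] by (simp add: inj_on_def)
qed

text \<open>The inner factor \<gamma>'(hk) \<gamma>(hk) = t(hk) is absorbed by \<gamma>(h)
  \<gamma>(k). Then \<gamma>(k) \<gamma>'(k) collapses to e(k), which passes \<gamma>(h) by
  condition (v).\<close>

lemma w_w': "w \<star>\<star> w' = fA E \<star>\<star> mpb E"
proof (rule L2_eq)
  have m: "mpb \<gamma>' \<bullet>\<bullet> mpb \<gamma> = mpb t" by (simp add: mpbB_m gc)
  have "i2 (w \<star>\<star> w') = fB \<gamma> \<bullet>\<bullet> sB \<gamma> \<bullet>\<bullet> (mpb \<gamma>' \<bullet>\<bullet> mpb \<gamma>) \<bullet>\<bullet> sB \<gamma>' \<bullet>\<bullet> fB \<gamma>'"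
    using c2 by (simp add: i2_m w w' LLB.m_assoc)
  also have "\<dots> = fB \<gamma> \<bullet>\<bullet> sB e \<bullet>\<bullet> fB \<gamma>'"
    using c2 by (simp add: m ab_t) (simp add: sB_m gc LLB.m_assoc)
  also have "\<dots> = mpb e \<bullet>\<bullet> fB e"
    using c2 by (simp add: g_E2) (simp add: fB_m gc LLB.m_assoc)
  also have "\<dots> = i2 (fA E \<star>\<star> mpb E)"
    by (simp add: f1_central E_cs i2_m fE mE)
  finally show "i2 (w \<star>\<star> w') = i2 (fA E \<star>\<star> mpb E)" .
qed (use w w' E_cs in auto)

text \<open>In this order t(h) stands to the right of \<gamma>'(k). Condition (vi) turns it into
  t(hk), which \<gamma>(hk) absorbs, and condition (vii) then turns \<gamma>(hk) t(k) into e(h)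
  \<gamma>(hk).\<close>

lemma w'_w: "w' \<star>\<star> w = fA E \<star>\<star> mpb E"
proof (rule L2_eq)
  have s: "sB \<gamma>' \<bullet>\<bullet> sB \<gamma> = sB t" by (simp add: sB_m gc)
  have f: "fB \<gamma>' \<bullet>\<bullet> fB \<gamma> = fB t" by (simp add: fB_m gc)
  have m: "mpb \<gamma> \<bullet>\<bullet> mpb t = mpb \<gamma>" using mpbB_m[OF gc(1) t_closed] g_t by simp
  have "i2 (w' \<star>\<star> w) = mpb \<gamma> \<bullet>\<bullet> (sB \<gamma>' \<bullet>\<bullet> (fB \<gamma>' \<bullet>\<bullet> fB \<gamma>)) \<bullet>\<bullet> sB \<gamma> \<bullet>\<bullet> mpb \<gamma>'"
    using c2 by (simp add: i2_m w w' LLB.m_assoc)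
  also have "\<dots> = mpb \<gamma> \<bullet>\<bullet> mpb t \<bullet>\<bullet> (sB \<gamma>' \<bullet>\<bullet> sB \<gamma>) \<bullet>\<bullet> mpb \<gamma>'"
    using c2 by (simp add: f g'_t1) (simp add: LLB.m_assoc)
  also have "\<dots> = fB e \<bullet>\<bullet> mpb e"
    using c2 by (simp add: m s mg_t2) (simp add: mpbB_m gc LLB.m_assoc)
  also have "\<dots> = i2 (fA E \<star>\<star> mpb E)" by (simp add: E_cs i2_m fE mE)
  finally show "i2 (w' \<star>\<star> w) = i2 (fA E \<star>\<star> mpb E)" .
qed (use w w' E_cs in auto)

text \<open>Both sides equal \<Sum> \<gamma>(h1) \<gamma>(k1) x \<gamma>'(h2 k2). On the left t(h)
  and t(k) commute with A and are absorbed by \<gamma>; on the right t(hk) is absorbed by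
  \<gamma>(h) \<gamma>(k).\<close>

lemma twisted:
  assumes x: "x \<in> carrier A"
  shows "act1 (act x) \<star>\<star> w = w \<star>\<star> mpb (act x)"
proof (rule L2_eq)
  note ax = act[OF x]
  let ?X = "sB (cst B (\<iota> x))"
  have Xc: "?X \<in> carrier (L (L B))" by (rule ahom_closed[OF sB_hom cx[OF x]])
  note sc = ahom_closed[OF sB_hom i1_c[OF ax(1)]]
  note c = c2 Xc sc
  have f: "fB \<gamma>' \<bullet>\<bullet> fB \<gamma> = fB t" and s: "sB \<gamma>' \<bullet>\<bullet> sB \<gamma> = sB t" by (simp_all add: fB_m sB_m gc)
  have m: "mpb \<gamma>' \<bullet>\<bullet> mpb \<gamma> = mpb t" by (simp add: mpbB_m gc)
  have ft: "fB \<gamma> \<bullet>\<bullet> fB t = fB \<gamma>" and st: "sB \<gamma> \<bullet>\<bullet> sB t = sB \<gamma>"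
    using fB_m[OF gc(1) t_closed] sB_m[OF gc(1) t_closed] g_t by simp_all
  have comm: "fB t \<bullet>\<bullet> sB (i1 (act x)) = sB (i1 (act x)) \<bullet>\<bullet> fB t"
    by (rule post_cst_commute[OF aB t_closed i1_c[OF ax(1)]]) (simp add: post_apply t_iota_apply L_closed[OF ax(1)])
  have sa: "sB (i1 (act x)) = sB \<gamma> \<bullet>\<bullet> ?X \<bullet>\<bullet> sB \<gamma>'"
    using cx[OF x] gc by (simp add: ax sB_m)
  have tX: "?X \<bullet>\<bullet> sB t = sB t \<bullet>\<bullet> ?X"
    using sB_m[OF cx[OF x] t_closed] sB_m[OF t_closed cx[OF x]] t_iota[OF x] by simp
  have "i2 (act1 (act x) \<star>\<star> w) = fB \<gamma> \<bullet>\<bullet> (sB (i1 (act x)) \<bullet>\<bullet> (fB \<gamma>' \<bullet>\<bullet> fB \<gamma>)) \<bullet>\<bullet> sB \<gamma> \<bullet>\<bullet> mpb \<gamma>'"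
    using c by (simp add: i2_m lin_closed[OF act1_lin] ax(1) w i_act1 LLB.m_assoc)
  also have "\<dots> = fB \<gamma> \<bullet>\<bullet> fB t \<bullet>\<bullet> sB (i1 (act x)) \<bullet>\<bullet> sB \<gamma> \<bullet>\<bullet> mpb \<gamma>'"
    using c by (simp add: f comm[symmetric]) (simp add: LLB.m_assoc)
  also have "\<dots> = fB \<gamma> \<bullet>\<bullet> sB \<gamma> \<bullet>\<bullet> (?X \<bullet>\<bullet> (sB \<gamma>' \<bullet>\<bullet> sB \<gamma>)) \<bullet>\<bullet> mpb \<gamma>'"
    using c by (simp add: ft sa) (simp add: LLB.m_assoc)
  also have "\<dots> = fB \<gamma> \<bullet>\<bullet> (sB \<gamma> \<bullet>\<bullet> sB t) \<bullet>\<bullet> ?X \<bullet>\<bullet> mpb \<gamma>'"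
    using c by (simp add: s tX) (simp add: LLB.m_assoc)
  finally have 1: "i2 (act1 (act x) \<star>\<star> w) = fB \<gamma> \<bullet>\<bullet> sB \<gamma> \<bullet>\<bullet> ?X \<bullet>\<bullet> mpb \<gamma>'" by (simp add: st)
  have mx: "mpb (i1 (act x)) = mpb \<gamma> \<bullet>\<bullet> ?X \<bullet>\<bullet> mpb \<gamma>'"
    using cx[OF x] gc by (simp add: ax mpbB_m mpb_cst[OF mB ahom_closed[OF iota_hom x]])
  have "i2 (w \<star>\<star> mpb (act x)) = fB \<gamma> \<bullet>\<bullet> sB \<gamma> \<bullet>\<bullet> (mpb \<gamma>' \<bullet>\<bullet> mpb \<gamma>) \<bullet>\<bullet> ?X \<bullet>\<bullet> mpb \<gamma>'"
    using c by (simp add: i2_m w mpb_closed ax(1) post_mpb[OF ax(1)] mx LLB.m_assoc)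
  also have "\<dots> = fB \<gamma> \<bullet>\<bullet> sB \<gamma> \<bullet>\<bullet> ?X \<bullet>\<bullet> mpb \<gamma>'"
    by (simp add: m ab_t)
  finally show "i2 (act1 (act x) \<star>\<star> w) = i2 (w \<star>\<star> mpb (act x))" by (simp add: 1)
qed (use x act w lin_closed[OF act1_lin] mpb_closed[OF act(1)[OF x]] in auto)

text \<open>Both sides equal \<Sum> \<gamma>(h1) \<gamma>(k1) \<gamma>(l1) \<gamma>'(h2 k2 l2). Each
  inner pair \<gamma>' \<gamma> is a value of t. It is absorbed by a single \<gamma> after commuting
  with an A-valued factor, or by a product of two \<gamma>.\<close>

lemma cocycle: "act2 w \<star>\<star>\<star> post mpb w = post (post (cst A)) w \<star>\<star>\<star> mpb w"
proof (rule L3_eq)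
  let ?s = "cst (L (L B))" and ?f = "post (cst (L B))"
  note s_hom = cst_hom[OF aLLB] and f_hom = post_hom[OF aLB aLLB cst_hom[OF aLB]] and mpbL = mpb_hom[OF aLB]
  let ?a = "?f (fB \<gamma>)" and ?a' = "?f (fB \<gamma>')" and ?b = "?s (fB \<gamma>)" and ?d = "?s (sB \<gamma>)"
    and ?f23 = "?s (mpb \<gamma>)" and ?f' = "?s (mpb \<gamma>')" and ?p' = "mpb (mpb \<gamma>')"
  note c = ahom_closed[OF f_hom cB(1)] ahom_closed[OF f_hom cB(4)] ahom_closed[OF s_hom cB(1)] ahom_closed[OF s_hom cB(2)]
    ahom_closed[OF s_hom cB(3)] ahom_closed[OF s_hom cB(6)] mpb_closed[OF cB(6)] mpb_closed[OF cB(1)] mpb_closed[OF cB(2)]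
    ahom_closed[OF s_hom i2_c[OF w(1)]] mpb_closed[OF c2(7)] mpb_closed[OF c2(9)] ahom_closed[OF f_hom c2(7)] mpb_closed[OF cB(4)]
    ahom_closed[OF s_hom c2(9)]
  have sw: "?s (i2 w) = ?b \<bullet>\<bullet>\<bullet> ?d \<bullet>\<bullet>\<bullet> ?f'"
    using cB by (simp add: w ahom_mult[OF s_hom])
  have pmw: "i3 (post mpb w) = ?a \<bullet>\<bullet>\<bullet> ?f23 \<bullet>\<bullet>\<bullet> ?p'"
  proof -
    have "i3 (post mpb w) = post mpb (i2 w)"
      unfolding post_post[of "post (post \<iota>)"] post_post[of mpb]
      by (rule post_cong[OF _ w(1)]) (simp add: post_mpb)
    then show ?thesis
      using cB by (simp add: w ahom_mult[OF fmB_hom] post_mpb_cst[OF aB gc(1)] mpb_mpb[OF gc(2)])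
  qed
  have pcw: "i3 (post (post (cst A)) w) = ?a \<bullet>\<bullet>\<bullet> ?b \<bullet>\<bullet>\<bullet> mpb (fB \<gamma>')"
  proof -
    have "i3 (post (post (cst A)) w) = post fB (i2 w)"
      unfolding post_post[of "post (post \<iota>)"] post_post[of fB]
      by (rule post_cong[OF _ w(1)]) (simp add: cst_natural[OF mA ahom_lin[OF iota_hom]])
    then show ?thesis
      using cB by (simp add: w ahom_mult[OF fcB_hom] post_cst_post[OF aB gc(1)]
          post_cst[OF mLB ahom_lin[OF fB_hom] gc(1)] mpb_post[OF gc(2)])
  qed
  have mw: "i3 (mpb w) = mpb (fB \<gamma>) \<bullet>\<bullet>\<bullet> ?d \<bullet>\<bullet>\<bullet> ?p'"
    using cB by (simp add: post_mpb[OF w(1)] w ahom_mult[OF mpbL] mpb_cst[OF mLB gc(1)])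
  have ft: "?a \<bullet>\<bullet>\<bullet> ?f (fB t) = ?a"
    using ahom_mult[OF f_hom cB(1) c2(7)] fB_m[OF gc(1) t_closed] g_t by simp
  have f: "?a' \<bullet>\<bullet>\<bullet> ?a = ?f (fB t)" using cB by (simp add: ahom_mult[OF f_hom, symmetric] fB_m gc)
  have ff: "?f' \<bullet>\<bullet>\<bullet> ?f23 = ?s (mpb t)" using cB by (simp add: ahom_mult[OF s_hom, symmetric] mpbB_m gc)
  have bdt: "?b \<bullet>\<bullet>\<bullet> (?d \<bullet>\<bullet>\<bullet> ?s (mpb t)) = ?b \<bullet>\<bullet>\<bullet> ?d"
    using ab_t c2 by (simp add: ahom_mult[OF s_hom, symmetric] LLB.m_assoc)
  have comm: "?f (fB t) \<bullet>\<bullet>\<bullet> ?s (i2 w) = ?s (i2 w) \<bullet>\<bullet>\<bullet> ?f (fB t)"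
  proof (rule post_cst_commute[OF aLB c2(7) i2_c[OF w(1)]])
    fix h k assume h: "h \<in> carrier H" and k: "k \<in> carrier H"
    note wk = L_closed[OF w(1) k]
    have "cst B (t h) \<bullet> i1 (w k) = i1 (w k) \<bullet> cst B (t h)"
    proof (rule L_eqI[of _ B])
      fix m assume m: "m \<in> carrier H"
      show "(cst B (t h) \<bullet> i1 (w k)) m = (i1 (w k) \<bullet> cst B (t h)) m"
        unfolding cst_mult_apply[OF aB L_closed[OF t_closed h] i1_c[OF wk] m] post_apply[OF m]
        by (rule t_iota_apply[OF L_closed[OF wk m] h])
    qed (use i1_c[OF wk] cst_closed[OF mB L_closed[OF t_closed h]] in auto)
    then show "fB t h \<bullet> i2 w k = i2 w k \<bullet> fB t h" using h k by (simp add: post_apply)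
  qed
  have "i3 (act2 w \<star>\<star>\<star> post mpb w) = ?a \<bullet>\<bullet>\<bullet> (?s (i2 w) \<bullet>\<bullet>\<bullet> (?a' \<bullet>\<bullet>\<bullet> ?a)) \<bullet>\<bullet>\<bullet> ?f23 \<bullet>\<bullet>\<bullet> ?p'"
    using c by (simp add: i3_m lin_closed[OF act2_lin] ahom_closed[OF post_hom[OF aLA aLLA mpbA]] w(1) pmw i_act2 LLLB.m_assoc)
  also have "\<dots> = ?a \<bullet>\<bullet>\<bullet> ?f (fB t) \<bullet>\<bullet>\<bullet> ?s (i2 w) \<bullet>\<bullet>\<bullet> ?f23 \<bullet>\<bullet>\<bullet> ?p'"
    using c by (simp add: f comm[symmetric]) (simp add: LLLB.m_assoc)
  also have "\<dots> = ?a \<bullet>\<bullet>\<bullet> (?b \<bullet>\<bullet>\<bullet> (?d \<bullet>\<bullet>\<bullet> (?f' \<bullet>\<bullet>\<bullet> ?f23))) \<bullet>\<bullet>\<bullet> ?p'"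
    using c by (simp add: ft sw) (simp add: LLLB.m_assoc)
  finally have l: "i3 (act2 w \<star>\<star>\<star> post mpb w) = ?a \<bullet>\<bullet>\<bullet> (?b \<bullet>\<bullet>\<bullet> ?d) \<bullet>\<bullet>\<bullet> ?p'"
    by (simp only: ff bdt)
  have cc: "mpb (fB \<gamma>') \<bullet>\<bullet>\<bullet> mpb (fB \<gamma>) = mpb (fB t)" using cB by (simp add: ahom_mult[OF mpbL, symmetric] fB_m gc)
  have abt: "?a \<bullet>\<bullet>\<bullet> ?b \<bullet>\<bullet>\<bullet> mpb (fB t) = ?a \<bullet>\<bullet>\<bullet> ?b"
  proof -
    have "post fB (fB \<gamma> \<bullet>\<bullet> sB \<gamma> \<bullet>\<bullet> mpb t) = post fB (fB \<gamma> \<bullet>\<bullet> sB \<gamma>)" by (simp only: ab_t)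
    then show ?thesis using c2
      by (simp add: ahom_mult[OF fcB_hom] post_cst_post[OF aB gc(1)] post_cst[OF mLB ahom_lin[OF fB_hom] gc(1)] mpb_post[OF t_closed])
  qed
  have "i3 (post (post (cst A)) w \<star>\<star>\<star> mpb w) = ?a \<bullet>\<bullet>\<bullet> ?b \<bullet>\<bullet>\<bullet> (mpb (fB \<gamma>') \<bullet>\<bullet>\<bullet> mpb (fB \<gamma>)) \<bullet>\<bullet>\<bullet> ?d \<bullet>\<bullet>\<bullet> ?p'"
    using c by (simp add: i3_m ahom_closed[OF post_hom[OF aLA aLLA fA_hom]] w(1) mpb_closed pcw mw LLLB.m_assoc)
  also have "\<dots> = ?a \<bullet>\<bullet>\<bullet> (?b \<bullet>\<bullet>\<bullet> ?d) \<bullet>\<bullet>\<bullet> ?p'"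
    using c by (simp add: cc abt) (simp add: LLLB.m_assoc)
  finally show "i3 (act2 w \<star>\<star>\<star> post mpb w) = i3 (post (post (cst A)) w \<star>\<star>\<star> mpb w)" by (simp add: l)
qed (use w(1) lin_closed[OF act2_lin] ahom_closed[OF post_hom[OF aLA aLLA mpbA]]
    ahom_closed[OF post_hom[OF aLA aLLA fA_hom]] mpb_closed[OF w(1)] in auto)

lemma gamma_iota: "x \<in> carrier A \<Longrightarrow> \<gamma> \<bullet> cst B (\<iota> x) = i1 (act x) \<bullet> \<gamma>"
proof -
  assume x: "x \<in> carrier A"
  have "i1 (act x) \<bullet> \<gamma> = \<gamma> \<bullet> (cst B (\<iota> x) \<bullet> t)"
    using gc cx[OF x] x by (simp add: act LB.m_assoc)
  also have "\<dots> = \<gamma> \<bullet> t \<bullet> cst B (\<iota> x)"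
    using gc cx[OF x] by (simp add: t_iota[OF x, symmetric]) (simp add: LB.m_assoc)
  finally show ?thesis by (simp add: g_t)
qed

lemma gamma_gamma: "fB \<gamma> \<bullet>\<bullet> sB \<gamma> = i2 w \<bullet>\<bullet> mpb \<gamma>"
proof -
  have m: "mpb \<gamma>' \<bullet>\<bullet> mpb \<gamma> = mpb t" by (simp add: mpbB_m gc)
  have "i2 w \<bullet>\<bullet> mpb \<gamma> = fB \<gamma> \<bullet>\<bullet> sB \<gamma> \<bullet>\<bullet> (mpb \<gamma>' \<bullet>\<bullet> mpb \<gamma>)" using cB by (simp add: w LLB.m_assoc)
  then show ?thesis by (simp add: m ab_t)
qed

end

section \<open>Evaluation of words as Sweedler sums\<close>

context coalgebra
begin

lemma L_eq_iff: "f \<in> carrier (L X) \<Longrightarrow> g \<in> carrier (L X) \<Longrightarrow> f = g \<longleftrightarrow> (\<forall>h\<in>carrier C. f h = g h)"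
  by (auto intro: L_eqI[of f X g])

lemma LL_eq_iff: "f \<in> carrier (L (L X)) \<Longrightarrow> g \<in> carrier (L (L X)) \<Longrightarrow>
    f = g \<longleftrightarrow> (\<forall>h\<in>carrier C. \<forall>k\<in>carrier C. f h k = g h k)"
  by (auto intro: LL_eqI[of f X g])

text \<open>Turns a word into the nested sum that occurs in a definition. F has to agree with the
  product on carriers; its multilinearity is inherited from there.\<close>

lemma LL_mult_map:
  assumes X: "assoc_algebra R X" and Z: "module R Z" and p: "\<phi> \<in> linear_maps R X Z"
    and f: "f \<in> carrier (L (L X))" and g: "g \<in> carrier (L (L X))"
    and h: "h \<in> carrier C" and k: "k \<in> carrier C"
    and eq: "\<And>h1 h2 k1 k2. \<lbrakk>h1 \<in> carrier C; h2 \<in> carrier C; k1 \<in> carrier C; k2 \<in> carrier C\<rbrakk> \<Longrightarrow>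
      \<phi> (f h1 k1 \<otimes>\<^bsub>X\<^esub> g h2 k2) = F h1 h2 k1 k2"
  shows "\<phi> ((f \<otimes>\<^bsub>L (L X)\<^esub> g) h k) =
    tsum Z (comult C h) (\<lambda>h1 h2. tsum Z (comult C k) (\<lambda>k1 k2. F h1 h2 k1 k2))"
proof -
  note LX = L_assoc_algebra[OF X] and mX = assoc_algebra_module[OF X]
  have b1: "bilin R C C X (\<lambda>h1 h2. (f h1 \<otimes>\<^bsub>L X\<^esub> g h2) k)"
    using L_bilin[OF LX f g] by (intro bilinI[OF lin_comp[OF L_ev[OF k]] lin_comp[OF L_ev[OF k]]]) (auto simp: bilin_def)
  have b2: "bilin R C C Z (\<lambda>h1 h2. \<phi> ((f h1 \<otimes>\<^bsub>L X\<^esub> g h2) k))"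
    by (rule bilinI[OF lin_comp[OF p bilin_r[OF b1]] lin_comp[OF p bilin_l[OF b1]]])
  have "\<phi> ((f \<otimes>\<^bsub>L (L X)\<^esub> g) h k) = tsum Z (comult C h) (\<lambda>h1 h2. \<phi> ((f h1 \<otimes>\<^bsub>L X\<^esub> g h2) k))"
    unfolding LL_mult_apply(1)[OF X f g h k] by (rule tsum_map[OF mC mC mX Z b1 p comult_closed[OF h]])
  also have "\<dots> = tsum Z (comult C h) (\<lambda>h1 h2. tsum Z (comult C k) (\<lambda>k1 k2. F h1 h2 k1 k2))"
  proof (rule tsum_cong[OF mC mC Z b2 _ comult_closed[OF h]])
    fix h1 h2 assume hh: "h1 \<in> carrier C" "h2 \<in> carrier C"
    note b3 = L_bilin[OF X L_closed[OF f hh(1)] L_closed[OF g hh(2)]]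
    have b4: "bilin R C C Z (\<lambda>k1 k2. \<phi> (f h1 k1 \<otimes>\<^bsub>X\<^esub> g h2 k2))"
      by (rule bilinI[OF lin_comp[OF p bilin_r[OF b3]] lin_comp[OF p bilin_l[OF b3]]])
    show "\<phi> ((f h1 \<otimes>\<^bsub>L X\<^esub> g h2) k) = tsum Z (comult C k) (\<lambda>k1 k2. F h1 h2 k1 k2)"
      unfolding L_mult[OF k] tsum_map[OF mC mC mX Z b3 p comult_closed[OF k]]
      by (rule tsum_cong[OF mC mC Z b4 _ comult_closed[OF k]]) (rule eq[OF hh])
  qed
  finally show ?thesis .
qed

lemma LL_mult_eval:
  assumes "assoc_algebra R X" "f \<in> carrier (L (L X))" "g \<in> carrier (L (L X))" "h \<in> carrier C" "k \<in> carrier C"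
    and "\<And>h1 h2 k1 k2. \<lbrakk>h1 \<in> carrier C; h2 \<in> carrier C; k1 \<in> carrier C; k2 \<in> carrier C\<rbrakk> \<Longrightarrow>
      f h1 k1 \<otimes>\<^bsub>X\<^esub> g h2 k2 = F h1 h2 k1 k2"
  shows "(f \<otimes>\<^bsub>L (L X)\<^esub> g) h k =
    tsum X (comult C h) (\<lambda>h1 h2. tsum X (comult C k) (\<lambda>k1 k2. F h1 h2 k1 k2))"
  using LL_mult_map[where \<phi> = "\<lambda>x. x", OF assms(1) assoc_algebra_module[OF assms(1)] lin_id assms(2-6)] .

lemma L_mult_map:
  assumes X: "assoc_algebra R X" and Z: "module R Z" and p: "\<phi> \<in> linear_maps R X Z"
    and f: "f \<in> carrier (L X)" and g: "g \<in> carrier (L X)" and h: "h \<in> carrier C"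
    and eq: "\<And>h1 h2. \<lbrakk>h1 \<in> carrier C; h2 \<in> carrier C\<rbrakk> \<Longrightarrow> \<phi> (f h1 \<otimes>\<^bsub>X\<^esub> g h2) = F h1 h2"
  shows "\<phi> ((f \<otimes>\<^bsub>L X\<^esub> g) h) = tsum Z (comult C h) F"
proof -
  note b = L_bilin[OF X f g]
  have b': "bilin R C C Z (\<lambda>h1 h2. \<phi> (f h1 \<otimes>\<^bsub>X\<^esub> g h2))"
    by (rule bilinI[OF lin_comp[OF p bilin_r[OF b]] lin_comp[OF p bilin_l[OF b]]])
  show ?thesis
    unfolding L_mult[OF h] tsum_map[OF mC mC assoc_algebra_module[OF X] Z b p comult_closed[OF h]]
    by (rule tsum_cong[OF mC mC Z b' eq comult_closed[OF h]])
qed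

lemma L_mult_eval:
  assumes "assoc_algebra R X" "f \<in> carrier (L X)" "g \<in> carrier (L X)" "h \<in> carrier C"
    and "\<And>h1 h2. \<lbrakk>h1 \<in> carrier C; h2 \<in> carrier C\<rbrakk> \<Longrightarrow> f h1 \<otimes>\<^bsub>X\<^esub> g h2 = F h1 h2"
  shows "(f \<otimes>\<^bsub>L X\<^esub> g) h = tsum X (comult C h) F"
  using L_mult_map[where \<phi> = "\<lambda>x. x", OF assms(1) assoc_algebra_module[OF assms(1)] lin_id assms(2-5)] .

end

section \<open>The ring Hom(H \<otimes> H, X) as the two-variable algebra L (L X)\<close>

context hopf_algebra
begin

abbreviation "HH \<equiv> tensor_coalgebra R H H"
abbreviation "TH \<equiv> tensor R H H"

lemma HH_simps: "carrier HH = carrier TH" "add HH = add TH" "smult HH = smult TH"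
  "comult HH t = tsum (tensor R TH TH) t (\<lambda>c d. tsum (tensor R TH TH) (comult H c) (\<lambda>c1 c2.
      tsum (tensor R TH TH) (comult H d) (\<lambda>d1 d2. tens R TH TH (tens R H H c1 d1) (tens R H H c2 d2))))"
  "counit HH t = tsum R t (\<lambda>c d. counit H c \<otimes>\<^bsub>R\<^esub> counit H d)"
  by (simp_all add: tensor_coalgebra_def Let_def module.defs coalgebra.defs)

lemma HH_linear: "linear_maps R HH X = linear_maps R TH X"
  by (simp add: linear_maps_def HH_simps)

text \<open>Passage from words to the definitions, which speak of linear maps on H \<otimes> H and
  convolve them along its own comultiplication. By \<open>uncurry_ring_iso\<close> centrality and
  invertibility may be tested on either side.\<close>

definition uncurry where "uncurry X f = (\<lambda>t\<in>carrier TH. tsum X t f)"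

lemma uncurry_tens:
  "module R X \<Longrightarrow> f \<in> carrier (L (L X)) \<Longrightarrow> h \<in> carrier H \<Longrightarrow> k \<in> carrier H \<Longrightarrow>
    uncurry X f (tens R H H h k) = f h k"
  by (simp add: uncurry_def tens_closed[OF mC mC] tsum_pure[OF mC mC _ LL_bilin])

lemma uncurry_closed:
  assumes "module R X" "f \<in> carrier (L (L X))"
  shows "uncurry X f \<in> carrier (conv_algebra R HH X)" "uncurry X f \<in> linear_maps R TH X"
proof -
  show "uncurry X f \<in> linear_maps R TH X"
    using lin_cong[OF mHH, of "uncurry X f" "\<lambda>t. tsum X t f" X] tsum_lin[OF mC mC assms(1) LL_bilin[OF assms(2)]]
    by (simp add: uncurry_def)
  then show "uncurry X f \<in> carrier (conv_algebra R HH X)"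
    by (simp add: conv_algebra_def HH_simps HH_linear uncurry_def)
qed

lemma HH_eqI:
  assumes X: "module R X" and f: "f \<in> linear_maps R TH X" "f \<in> extensional (carrier TH)"
    and g: "g \<in> linear_maps R TH X" "g \<in> extensional (carrier TH)"
    and eq: "\<And>h k. h \<in> carrier H \<Longrightarrow> k \<in> carrier H \<Longrightarrow> f (tens R H H h k) = g (tens R H H h k)"
  shows "f = g"
  by (rule extensionalityI[OF f(2) g(2)]) (rule tensor_lin_eqI[OF mC mC X f(1) g(1) eq])

lemma curry_closed:
  assumes X: "module R X" and f: "f \<in> linear_maps R TH X"
  shows "(\<lambda>h\<in>carrier H. \<lambda>k\<in>carrier H. f (tens R H H h k)) \<in> carrier (L (L X))"
  by (rule LL_I) (rule bilinI[OF lin_comp[OF f bilin_r[OF tens_bilin[OF mC mC]]] lin_comp[OF f bilin_l[OF tens_bilin[OF mC mC]]]])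

lemma uncurry_curry:
  assumes X: "module R X" and f: "f \<in> linear_maps R TH X"
  shows "uncurry X (\<lambda>h\<in>carrier H. \<lambda>k\<in>carrier H. f (tens R H H h k)) = restrict f (carrier TH)"
proof (rule HH_eqI[OF X])
  note c = curry_closed[OF X f]
  show "restrict f (carrier TH) \<in> linear_maps R TH X"
    using lin_cong[OF mHH, of "restrict f (carrier TH)" f X] f by simp
  show "uncurry X (\<lambda>h\<in>carrier H. \<lambda>k\<in>carrier H. f (tens R H H h k)) \<in> extensional (carrier TH)"
    by (simp add: uncurry_def)
qed (use uncurry_closed[OF X curry_closed[OF X f]] in
  \<open>auto simp: uncurry_tens[OF X curry_closed[OF X f]] tens_closed[OF mC mC]\<close>)

lemma uncurry_surj:
  assumes X: "module R X" and g: "g \<in> carrier (conv_algebra R HH X)"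
  shows "\<exists>f\<in>carrier (L (L X)). g = uncurry X f"
proof -
  have l: "g \<in> linear_maps R TH X" and e: "g \<in> extensional (carrier TH)"
    using g by (auto simp: conv_algebra_def HH_simps HH_linear)
  show ?thesis
    using uncurry_curry[OF X l] curry_closed[OF X l] e by (metis extensional_restrict)
qed

lemma uncurry_inj:
  assumes X: "module R X" and f: "f \<in> carrier (L (L X))" and g: "g \<in> carrier (L (L X))"
    and eq: "uncurry X f = uncurry X g"
  shows "f = g"
  by (rule LL_eqI[OF f g]) (metis uncurry_tens[OF X] f g eq)

text \<open>The inner double sum is the convolution product of (h, k) \<mapsto> (h \<otimes> k)
  \<otimes> 1 and (h, k) \<mapsto> 1 \<otimes> (h \<otimes> k). Its bilinearity in h and k thus
  follows from closure of L (L -) under products.\<close>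

lemma comult_HH:
  shows "comult HH \<in> linear_maps R TH (tensor R TH TH)"
    and "h \<in> carrier H \<Longrightarrow> k \<in> carrier H \<Longrightarrow> comult HH (tens R H H h k) =
      tsum (tensor R TH TH) (comult H h) (\<lambda>c1 c2. tsum (tensor R TH TH) (comult H k)
        (\<lambda>d1 d2. tens R TH TH (tens R H H c1 d1) (tens R H H c2 d2)))"
proof -
  let ?TT = "tensor R TH TH"
  note aTT = tensor_assoc_algebra[OF aHH aHH]
  note LTT = L_assoc_algebra[OF aTT]
  note mTT = tensor_module[OF mHH mHH]
  let ?l = "post (post (\<lambda>x. tens R TH TH x \<one>\<^bsub>TH\<^esub>))" and ?r = "post (post (tens R TH TH \<one>\<^bsub>TH\<^esub>))"
  let ?p = "\<lambda>h\<in>carrier H. \<lambda>k\<in>carrier H. tens R H H h k"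
  interpret TH: assoc_algebra R TH by (rule aHH)
  have p: "?p \<in> carrier (L (L TH))" by (rule LL_I[OF tens_bilin[OF mC mC]])
  note l2 = post_hom[OF L_assoc_algebra[OF aHH] LTT post_hom[OF aHH aTT tens_left_hom[OF aHH aHH]]]
  note r2 = post_hom[OF L_assoc_algebra[OF aHH] LTT post_hom[OF aHH aTT tens_right_hom[OF aHH aHH]]]
  note lp = ahom_closed[OF l2 p] and rp = ahom_closed[OF r2 p]
  let ?K = "\<lambda>c d. tsum ?TT (comult H c) (\<lambda>c1 c2. tsum ?TT (comult H d)
      (\<lambda>d1 d2. tens R TH TH (tens R H H c1 d1) (tens R H H c2 d2)))"
  have K: "(?l ?p \<otimes>\<^bsub>L (L ?TT)\<^esub> ?r ?p) c d = ?K c d" if "c \<in> carrier H" "d \<in> carrier H" for c d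
    by (rule LL_mult_eval[OF aTT lp rp that])
      (simp add: post_apply tensor_mult_tens[OF aHH aHH] tens_closed[OF mC mC])
  have b: "bilin R H H ?TT ?K"
    by (rule iffD1[OF bilin_cong[OF mC mC K] LL_bilin[OF L_mult_closed[OF LTT lp rp]]])
  show "comult HH \<in> linear_maps R TH ?TT"
    using tsum_lin[OF mC mC mTT b] by (simp add: HH_simps[abs_def])
  show "comult HH (tens R H H h k) = ?K h k" if "h \<in> carrier H" "k \<in> carrier H"
    by (simp add: HH_simps tsum_pure[OF mC mC mTT b that])
qed

lemma uncurry_mult:
  assumes X: "assoc_algebra R X" and f: "f \<in> carrier (L (L X))" and g: "g \<in> carrier (L (L X))"
  shows "uncurry X (f \<otimes>\<^bsub>L (L X)\<^esub> g) = uncurry X f \<otimes>\<^bsub>conv_algebra R HH X\<^esub> uncurry X g"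
proof -
  let ?TT = "tensor R TH TH"
  note mX = assoc_algebra_module[OF X] and LX = L_assoc_algebra[OF X]
  note fg = L_mult_closed[OF LX f g] and mTT = tensor_module[OF mHH mHH]
  note U = uncurry_closed(2)[OF mX]
  have b: "bilin R TH TH X (\<lambda>s s'. uncurry X f s \<otimes>\<^bsub>X\<^esub> uncurry X g s')"
    by (rule bilin_mult[OF X U[OF f] U[OF g]])
  note F = tsum_lin[OF mHH mHH mX b]
  let ?G = "\<lambda>t. tsum X (comult HH t) (\<lambda>s s'. uncurry X f s \<otimes>\<^bsub>X\<^esub> uncurry X g s')"
  have rl: "(\<lambda>t. tsum X (comult HH t) (\<lambda>s s'. uncurry X f s \<otimes>\<^bsub>X\<^esub> uncurry X g s')) \<in> linear_maps R TH X"
    by (rule lin_comp[OF F comult_HH(1)])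
  have r: "uncurry X f \<otimes>\<^bsub>conv_algebra R HH X\<^esub> uncurry X g =
      (\<lambda>t\<in>carrier TH. tsum X (comult HH t) (\<lambda>s s'. uncurry X f s \<otimes>\<^bsub>X\<^esub> uncurry X g s'))"
    by (simp add: conv_algebra_def convolution_def HH_simps)
  note aTT = tensor_assoc_algebra[OF aHH aHH]
  note LTT = L_assoc_algebra[OF aTT]
  let ?l = "post (post (\<lambda>x. tens R TH TH x \<one>\<^bsub>TH\<^esub>))" and ?r = "post (post (tens R TH TH \<one>\<^bsub>TH\<^esub>))"
  let ?p = "\<lambda>h\<in>carrier H. \<lambda>k\<in>carrier H. tens R H H h k"
  interpret TH: assoc_algebra R TH by (rule aHH)
  have p: "?p \<in> carrier (L (L TH))" by (rule LL_I[OF tens_bilin[OF mC mC]])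
  note lp = ahom_closed[OF post_hom[OF L_assoc_algebra[OF aHH] LTT post_hom[OF aHH aTT tens_left_hom[OF aHH aHH]]] p]
  note rp = ahom_closed[OF post_hom[OF L_assoc_algebra[OF aHH] LTT post_hom[OF aHH aTT tens_right_hom[OF aHH aHH]]] p]
  show ?thesis
    unfolding r
  proof (rule HH_eqI[OF mX U[OF fg]])
    show "(\<lambda>t\<in>carrier TH. tsum X (comult HH t) (\<lambda>s s'. uncurry X f s \<otimes>\<^bsub>X\<^esub> uncurry X g s')) \<in> linear_maps R TH X"
      using lin_cong[OF mHH, of "restrict ?G (carrier TH)" ?G X] rl by simp
    fix h k assume h: "h \<in> carrier H" and k: "k \<in> carrier H"
    have K: "(?l ?p \<otimes>\<^bsub>L (L ?TT)\<^esub> ?r ?p) h k = comult HH (tens R H H h k)"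
      unfolding comult_HH(2)[OF h k]
      by (rule LL_mult_eval[OF aTT lp rp h k])
        (simp add: post_apply tensor_mult_tens[OF aHH aHH] tens_closed[OF mC mC])
    have "tsum X (comult HH (tens R H H h k)) (\<lambda>s s'. uncurry X f s \<otimes>\<^bsub>X\<^esub> uncurry X g s') =
      tsum X (comult H h) (\<lambda>h1 h2. tsum X (comult H k) (\<lambda>k1 k2. f h1 k1 \<otimes>\<^bsub>X\<^esub> g h2 k2))"
      unfolding K[symmetric]
      by (rule LL_mult_map[where \<phi> = "\<lambda>t. tsum X t (\<lambda>s s'. uncurry X f s \<otimes>\<^bsub>X\<^esub> uncurry X g s')",
            OF aTT mX F lp rp h k])
        (simp add: post_apply tensor_mult_tens[OF aHH aHH] tens_closed[OF mC mC] tsum_pure[OF mHH mHH mX b]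
          uncurry_tens[OF mX f] uncurry_tens[OF mX g])
    then show "uncurry X (f \<otimes>\<^bsub>L (L X)\<^esub> g) (tens R H H h k) =
      (\<lambda>t\<in>carrier TH. tsum X (comult HH t) (\<lambda>s s'. uncurry X f s \<otimes>\<^bsub>X\<^esub> uncurry X g s')) (tens R H H h k)"
      using h k by (simp add: uncurry_tens[OF mX fg] LL_mult_apply(2)[OF X f g] tens_closed[OF mC mC])
  qed (auto simp: uncurry_def)
qed

lemma uncurry_ring_iso:
  assumes X: "assoc_algebra R X"
  shows "uncurry X \<in> ring_iso (L (L X)) (conv_algebra R HH X)"
proof -
  interpret X: assoc_algebra R X by (rule X)
  note mX = X.module_axioms
  interpret LX: assoc_algebra R "L X" by (rule L_assoc_algebra[OF X])
  interpret LLX: assoc_algebra R "L (L X)" by (rule L_assoc_algebra[OF L_assoc_algebra[OF X]])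
  have add: "uncurry X (f \<oplus>\<^bsub>L (L X)\<^esub> g) = uncurry X f \<oplus>\<^bsub>conv_algebra R HH X\<^esub> uncurry X g"
    if f: "f \<in> carrier (L (L X))" and g: "g \<in> carrier (L (L X))" for f g
  proof (rule HH_eqI[OF mX uncurry_closed(2)[OF mX LLX.a_closed[OF f g]]])
    have r: "uncurry X f \<oplus>\<^bsub>conv_algebra R HH X\<^esub> uncurry X g = (\<lambda>t\<in>carrier TH. uncurry X f t \<oplus>\<^bsub>X\<^esub> uncurry X g t)"
      by (simp add: conv_algebra_def HH_simps)
    show "uncurry X f \<oplus>\<^bsub>conv_algebra R HH X\<^esub> uncurry X g \<in> linear_maps R TH X"
      unfolding r
      by (rule iffD2[OF lin_cong[OF mHH] lin_sum[OF mX uncurry_closed(2)[OF mX f] uncurry_closed(2)[OF mX g]]]) simp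
    show "uncurry X (f \<oplus>\<^bsub>L (L X)\<^esub> g) (tens R H H h k) = (uncurry X f \<oplus>\<^bsub>conv_algebra R HH X\<^esub> uncurry X g) (tens R H H h k)"
      if "h \<in> carrier H" "k \<in> carrier H" for h k
      unfolding r using that f g by (simp add: uncurry_tens[OF mX] tens_closed[OF mC mC] L_add)
  qed (auto simp: uncurry_def conv_algebra_def HH_simps)
  have mult: "uncurry X (f \<otimes>\<^bsub>L (L X)\<^esub> g) = uncurry X f \<otimes>\<^bsub>conv_algebra R HH X\<^esub> uncurry X g"
    if "f \<in> carrier (L (L X))" "g \<in> carrier (L (L X))" for f g
    by (rule uncurry_mult[OF X that])
  have one: "uncurry X \<one>\<^bsub>L (L X)\<^esub> = \<one>\<^bsub>conv_algebra R HH X\<^esub>"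
  proof (rule HH_eqI[OF mX uncurry_closed(2)[OF mX LLX.one_closed]])
    have mR: "module R (base_algebra R)"
    proof -
      have ab: "abelian_group (base_algebra R)"
        by (rule abelian_groupI) (auto simp: base_algebra_def R.a_ac intro: R.add.l_inv_ex)
      show ?thesis by (rule moduleI[OF R.cring_axioms ab])
        (auto simp: base_algebra_def R.l_distr R.r_distr R.m_assoc)
    qed
    have bb: "bilin R H H (base_algebra R) (\<lambda>c d. counit H c \<otimes>\<^bsub>R\<^esub> counit H d)"
      using lin_functional2[OF mR _ counit_linear] lin_functional[OF mR counit_linear]
      by (intro bilinI) (auto simp: base_algebra_def)
    \<comment> \<open>The counit of H \<otimes> H is a sum in the ring R, while the linearity of
      sums is proved for modules. \<open>base_algebra R\<close> is R as a module over itself and has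
      the same finite sums.\<close>
    have ts: "tsum R t (\<lambda>c d. counit H c \<otimes>\<^bsub>R\<^esub> counit H d) =
        tsum (base_algebra R) t (\<lambda>c d. counit H c \<otimes>\<^bsub>R\<^esub> counit H d)" for t :: "('c, 'c) tens"
    proof -
      have "add_pow R n x = add_pow (base_algebra R) n x" for n :: int and x
        by (simp add: add_pow_def int_pow_def nat_pow_def base_algebra_def m_inv_def Let_def)
      moreover have "finsum R f S = finsum (base_algebra R) f S" for f :: "'c \<times> 'c \<Rightarrow> 'a" and S
        by (simp add: finsum_def finprod_def base_algebra_def)
      ultimately show ?thesis by (simp add: tsum_def)
    qed
    have r: "\<one>\<^bsub>conv_algebra R HH X\<^esub> = (\<lambda>t\<in>carrier TH. counit HH t \<odot>\<^bsub>X\<^esub> \<one>\<^bsub>X\<^esub>)"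
      by (simp add: conv_algebra_def HH_simps)
    have cl: "counit HH \<in> linear_maps R TH (base_algebra R)"
      using tsum_lin[OF mC mC mR bb] by (simp add: HH_simps[abs_def] ts)
    show "\<one>\<^bsub>conv_algebra R HH X\<^esub> \<in> linear_maps R TH X"
      unfolding r by (rule iffD2[OF lin_cong[OF mHH] lin_functional[OF mX cl X.one_closed]]) simp
    show "uncurry X \<one>\<^bsub>L (L X)\<^esub> (tens R H H h k) = \<one>\<^bsub>conv_algebra R HH X\<^esub> (tens R H H h k)"
      if "h \<in> carrier H" "k \<in> carrier H" for h k
      unfolding r using that tsum_pure[OF mC mC mR bb that]
      by (simp add: uncurry_tens[OF mX] tens_closed[OF mC mC] HH_simps ts L_one L_smult X.smult_assoc1)
  qed (auto simp: uncurry_def conv_algebra_def HH_simps)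
  have "bij_betw (uncurry X) (carrier (L (L X))) (carrier (conv_algebra R HH X))"
    unfolding bij_betw_def
    using uncurry_inj[OF mX] uncurry_closed(1)[OF mX] uncurry_surj[OF mX] by (fastforce simp: inj_on_def image_iff)
  then show ?thesis
    using add mult one uncurry_closed(1)[OF mX] by (auto simp: ring_iso_def ring_hom_def)
qed

text \<open>The ring axioms are carried over from L (L X). The transport yields the ring with the
  image of zero as its zero, which is then identified with the zero of Hom(H \<otimes> H,
  X).\<close>

lemma HH_ring:
  assumes X: "assoc_algebra R X"
  shows "ring (conv_algebra R HH X)"
proof -
  interpret LLX: assoc_algebra R "L (L X)" by (rule L_assoc_algebra[OF L_assoc_algebra[OF X]])
  note i = uncurry_ring_iso[OF X]
  interpret X: assoc_algebra R X by (rule X)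
  let ?S = "conv_algebra R HH X"
  have "ring (?S\<lparr>zero := uncurry X \<zero>\<^bsub>L (L X)\<^esub>\<rparr>)"
    using LLX.ring_iso_imp_img_ring[OF i] .
  moreover have "uncurry X \<zero>\<^bsub>L (L X)\<^esub> = \<zero>\<^bsub>?S\<^esub>"
  proof -
    have z: "uncurry X \<zero>\<^bsub>L (L X)\<^esub> t = \<zero>\<^bsub>X\<^esub>" if t: "t \<in> carrier TH" for t
    proof -
      have "(\<lambda>t. \<zero>\<^bsub>X\<^esub>) \<in> linear_maps R TH X" by (rule linear_mapsI) auto
      then show ?thesis
        by (rule tensor_lin_eqI[OF mC mC X.module_axioms uncurry_closed(2)[OF X.module_axioms LLX.zero_closed] _ _ t])
          (simp add: uncurry_tens[OF X.module_axioms] L_zero)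
    qed
    then show ?thesis by (auto simp: conv_algebra_def HH_simps uncurry_def restrict_def fun_eq_iff)
  qed
  ultimately show ?thesis by simp
qed

lemma ring_center_uncurry:
  assumes X: "assoc_algebra R X" and f: "f \<in> carrier (L (L X))"
  shows "uncurry X f \<in> ring_center (conv_algebra R HH X) \<longleftrightarrow>
    (\<forall>g\<in>carrier (L (L X)). f \<otimes>\<^bsub>L (L X)\<^esub> g = g \<otimes>\<^bsub>L (L X)\<^esub> f)"
proof -
  note mX = assoc_algebra_module[OF X] and LX = L_assoc_algebra[OF X]
  have *: "uncurry X f \<otimes>\<^bsub>conv_algebra R HH X\<^esub> uncurry X g = uncurry X g \<otimes>\<^bsub>conv_algebra R HH X\<^esub> uncurry X f \<longleftrightarrow>
    f \<otimes>\<^bsub>L (L X)\<^esub> g = g \<otimes>\<^bsub>L (L X)\<^esub> f" if g: "g \<in> carrier (L (L X))" for g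
    using uncurry_mult[OF X f g] uncurry_mult[OF X g f]
      uncurry_inj[OF mX L_mult_closed[OF LX f g] L_mult_closed[OF LX g f]] by metis
  show ?thesis
    unfolding ring_center_def using uncurry_closed(1)[OF mX] uncurry_surj[OF mX] f *
    by (auto simp: Ball_def)
qed

end

section \<open>Partial crossed products\<close>

text \<open>Linearity of the two structure maps is enough to translate each axiom of a symmetric
  twisted partial action into words. The equivalences below then serve both directions of the
  theorem.\<close>

locale twisted_alg = hopf_algebra R H + A: assoc_algebra R A + twisted_action_data R H A \<alpha> \<omega>
  for R (structure) and H (structure) and A (structure) and \<alpha> and \<omega> +
  assumes alpha_lin: "\<alpha> \<in> linear_maps R (tensor R H A) A"
    and omega_lin: "\<omega> \<in> linear_maps R (tensor R H H) A"
begin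

lemmas aA = A.assoc_algebra_axioms
lemmas mA = A.module_axioms
lemmas aLA = L_assoc_algebra[OF aA]
lemmas aLLA = L_assoc_algebra[OF aLA]
lemmas mLA = assoc_algebra_module[OF aLA]

abbreviation mA1 (infixl \<open>\<star>\<close> 70) where "x \<star> y \<equiv> x \<otimes>\<^bsub>L A\<^esub> y"
abbreviation mA2 (infixl \<open>\<star>\<star>\<close> 70) where "x \<star>\<star> y \<equiv> x \<otimes>\<^bsub>L (L A)\<^esub> y"
abbreviation mA3 (infixl \<open>\<star>\<star>\<star>\<close> 70) where "x \<star>\<star>\<star> y \<equiv> x \<otimes>\<^bsub>L (L (L A))\<^esub> y"
abbreviation "fA y \<equiv> post (cst A) y"

definition "ac x = (\<lambda>h\<in>carrier H. h \<rightharpoonup> x)"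
definition "om = (\<lambda>h\<in>carrier H. \<lambda>k\<in>carrier H. cocyc h k)"
abbreviation "E \<equiv> ac \<one>\<^bsub>A\<^esub>"

lemma ac_apply: "h \<in> carrier H \<Longrightarrow> ac x h = h \<rightharpoonup> x"
  by (simp add: ac_def)

lemma om_apply: "h \<in> carrier H \<Longrightarrow> k \<in> carrier H \<Longrightarrow> om h k = cocyc h k"
  by (simp add: om_def)

lemma ac_bilin: "bilin R H A A (\<lambda>h x. h \<rightharpoonup> x)"
  by (rule bilinI[OF lin_comp[OF alpha_lin bilin_r[OF tens_bilin[OF mC mA]]] lin_comp[OF alpha_lin bilin_l[OF tens_bilin[OF mC mA]]]])

lemma ac_closed: "x \<in> carrier A \<Longrightarrow> ac x \<in> carrier (L A)"
  unfolding ac_def by (rule L_I[OF bilin_l[OF ac_bilin]])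

lemma act_closed: "h \<in> carrier H \<Longrightarrow> x \<in> carrier A \<Longrightarrow> h \<rightharpoonup> x \<in> carrier A"
  by (rule bilin_closed[OF ac_bilin])

lemma ac_lin: "ac \<in> linear_maps R A (L A)"
proof (rule linear_mapsI[OF ac_closed])
  interpret LA: assoc_algebra R "L A" by (rule aLA)
  show "ac (x \<oplus>\<^bsub>A\<^esub> y) = ac x \<oplus>\<^bsub>L A\<^esub> ac y" if "x \<in> carrier A" "y \<in> carrier A" for x y
    using that by (intro L_eqI[of _ A]) (auto simp: ac_closed L_add ac_apply lin_add[OF bilin_r[OF ac_bilin]])
  show "ac (r \<odot>\<^bsub>A\<^esub> x) = r \<odot>\<^bsub>L A\<^esub> ac x" if "r \<in> carrier R" "x \<in> carrier A" for r x
    using that by (intro L_eqI[of _ A]) (auto simp: ac_closed L_smult ac_apply lin_smult[OF bilin_r[OF ac_bilin]])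
qed

lemma om_closed: "om \<in> carrier (L (L A))"
  unfolding om_def by (rule curry_closed[OF mA omega_lin])

lemma uncurry_om: "uncurry A om = restrict \<omega> (carrier TH)"
  unfolding om_def by (rule uncurry_curry[OF mA omega_lin])

lemma E_closed: "E \<in> carrier (L A)"
  by (rule ac_closed) simp

lemma fA_hom: "post (cst A) \<in> algebra_homs R (L A) (L (L A))"
  by (rule post_hom[OF aA aLA cst_hom[OF aA]])

lemmas E_cs = ahom_closed[OF fA_hom E_closed] mpb_closed[OF E_closed]

lemma f1_eq: "f1 = uncurry A (fA E)"
proof (rule ext)
  fix t
  have "tsum A t (\<lambda>h k. counit H k \<odot>\<^bsub>A\<^esub> (h \<rightharpoonup> \<one>\<^bsub>A\<^esub>)) = tsum A t (fA E)" if t: "t \<in> carrier TH"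
    by (rule sym, rule tsum_cong[OF mC mC mA LL_bilin[OF E_cs(1)] _ t])
      (simp add: post_apply cst_apply ac_apply)
  then show "f1 t = uncurry A (fA E) t" by (simp add: f1_def uncurry_def)
qed

lemma f2_eq: "f2 = uncurry A (mpb E)"
proof (rule ext)
  fix t
  have "tsum A t (\<lambda>h k. (h \<otimes>\<^bsub>H\<^esub> k) \<rightharpoonup> \<one>\<^bsub>A\<^esub>) = tsum A t (mpb E)" if t: "t \<in> carrier TH"
    by (rule sym, rule tsum_cong[OF mC mC mA LL_bilin[OF E_cs(2)] _ t])
      (simp add: mpb_apply ac_apply)
  then show "f2 t = uncurry A (mpb E) t" by (simp add: f2_def uncurry_def)
qed

lemma LLL_eq_iff:
  assumes f: "f \<in> carrier (L (L (L X)))" and g: "g \<in> carrier (L (L (L X)))"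
  shows "f = g \<longleftrightarrow> (\<forall>h\<in>carrier H. \<forall>k\<in>carrier H. \<forall>l\<in>carrier H. f h k l = g h k l)"
proof
  assume eq: "\<forall>h\<in>carrier H. \<forall>k\<in>carrier H. \<forall>l\<in>carrier H. f h k l = g h k l"
  show "f = g"
  proof (rule L_eqI[OF f g])
    fix h assume h: "h \<in> carrier H"
    show "f h = g h" by (rule LL_eqI[OF L_closed[OF f h] L_closed[OF g h]]) (use eq h in blast)
  qed
qed simp

lemma act1_closed: "y \<in> carrier (L A) \<Longrightarrow> flp (post ac y) \<in> carrier (L (L A))"
  by (rule flp_closed[OF post_closed[OF ac_lin]])

lemma act1_lin: "(\<lambda>y. flp (post ac y)) \<in> linear_maps R (L A) (L (L A))"
  by (rule lin_comp[OF ahom_lin[OF flp_hom[OF aA]] post_linear[OF aA aLA ac_lin]])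

lemma twisted_partial_action_iff:
  "twisted_partial_action \<longleftrightarrow>
    (\<forall>x\<in>carrier A. ac x \<one>\<^bsub>H\<^esub> = x) \<and>
    (\<forall>x\<in>carrier A. \<forall>y\<in>carrier A. ac (x \<otimes>\<^bsub>A\<^esub> y) = ac x \<star> ac y) \<and>
    (\<forall>x\<in>carrier A. flp (post ac (ac x)) \<star>\<star> om = om \<star>\<star> mpb (ac x)) \<and>
    om = om \<star>\<star> mpb E"
proof -
  have 1: "ac (x \<otimes>\<^bsub>A\<^esub> y) = ac x \<star> ac y \<longleftrightarrow> (\<forall>h\<in>carrier H. h \<rightharpoonup> (x \<otimes>\<^bsub>A\<^esub> y) =
      tsum A (comult H h) (\<lambda>h1 h2. (h1 \<rightharpoonup> x) \<otimes>\<^bsub>A\<^esub> (h2 \<rightharpoonup> y)))"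
    if x: "x \<in> carrier A" and y: "y \<in> carrier A" for x y
  proof -
    have "(ac x \<star> ac y) h = tsum A (comult H h) (\<lambda>h1 h2. (h1 \<rightharpoonup> x) \<otimes>\<^bsub>A\<^esub> (h2 \<rightharpoonup> y))" if "h \<in> carrier H" for h
      by (rule L_mult_eval[OF aA ac_closed[OF x] ac_closed[OF y] that]) (simp add: ac_apply)
    then show ?thesis
      using x y by (subst L_eq_iff[of _ A]) (auto simp: ac_closed L_mult_closed[OF aA] ac_apply)
  qed
  have 2: "flp (post ac (ac x)) \<star>\<star> om = om \<star>\<star> mpb (ac x) \<longleftrightarrow> (\<forall>h\<in>carrier H. \<forall>l\<in>carrier H.
      tsum A (comult H h) (\<lambda>h1 h2. tsum A (comult H l) (\<lambda>l1 l2.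
        (h1 \<rightharpoonup> (l1 \<rightharpoonup> x)) \<otimes>\<^bsub>A\<^esub> cocyc h2 l2)) =
      tsum A (comult H h) (\<lambda>h1 h2. tsum A (comult H l) (\<lambda>l1 l2.
        cocyc h1 l1 \<otimes>\<^bsub>A\<^esub> ((h2 \<otimes>\<^bsub>H\<^esub> l2) \<rightharpoonup> x))))" if x: "x \<in> carrier A" for x
  proof -
    note c = act1_closed[OF ac_closed[OF x]] mpb_closed[OF ac_closed[OF x]]
    have l: "(flp (post ac (ac x)) \<star>\<star> om) h l = tsum A (comult H h) (\<lambda>h1 h2. tsum A (comult H l) (\<lambda>l1 l2.
        (h1 \<rightharpoonup> (l1 \<rightharpoonup> x)) \<otimes>\<^bsub>A\<^esub> cocyc h2 l2))" if "h \<in> carrier H" "l \<in> carrier H" for h l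
      by (rule LL_mult_eval[OF aA c(1) om_closed that]) (simp add: flp_apply post_apply ac_apply om_apply)
    have r: "(om \<star>\<star> mpb (ac x)) h l = tsum A (comult H h) (\<lambda>h1 h2. tsum A (comult H l) (\<lambda>l1 l2.
        cocyc h1 l1 \<otimes>\<^bsub>A\<^esub> ((h2 \<otimes>\<^bsub>H\<^esub> l2) \<rightharpoonup> x)))" if "h \<in> carrier H" "l \<in> carrier H" for h l
      by (rule LL_mult_eval[OF aA om_closed c(2) that]) (simp add: mpb_apply ac_apply om_apply)
    show ?thesis
      by (subst LL_eq_iff[OF L_mult_closed[OF aLA c(1) om_closed] L_mult_closed[OF aLA om_closed c(2)]]) (simp add: l r)
  qed
  have 3: "om = om \<star>\<star> mpb E \<longleftrightarrow> (\<forall>h\<in>carrier H. \<forall>l\<in>carrier H.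
      cocyc h l = tsum A (comult H h) (\<lambda>h1 h2. tsum A (comult H l) (\<lambda>l1 l2.
        cocyc h1 l1 \<otimes>\<^bsub>A\<^esub> ((h2 \<otimes>\<^bsub>H\<^esub> l2) \<rightharpoonup> \<one>\<^bsub>A\<^esub>))))"
  proof -
    have r: "(om \<star>\<star> mpb E) h l = tsum A (comult H h) (\<lambda>h1 h2. tsum A (comult H l) (\<lambda>l1 l2.
        cocyc h1 l1 \<otimes>\<^bsub>A\<^esub> ((h2 \<otimes>\<^bsub>H\<^esub> l2) \<rightharpoonup> \<one>\<^bsub>A\<^esub>)))" if "h \<in> carrier H" "l \<in> carrier H" for h l
      by (rule LL_mult_eval[OF aA om_closed E_cs(2) that]) (simp add: mpb_apply ac_apply om_apply)
    show ?thesis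
      by (subst LL_eq_iff[OF om_closed L_mult_closed[OF aLA om_closed E_cs(2)]]) (simp add: r om_apply)
  qed
  have 4: "(\<forall>h\<in>carrier H. \<forall>a\<in>carrier A. \<forall>b\<in>carrier A. Q h a b) \<longleftrightarrow>
      (\<forall>a\<in>carrier A. \<forall>b\<in>carrier A. \<forall>h\<in>carrier H. Q h a b)" for Q by blast
  have 5: "(\<forall>h\<in>carrier H. \<forall>l\<in>carrier H. \<forall>a\<in>carrier A. Q h l a) \<longleftrightarrow>
      (\<forall>a\<in>carrier A. \<forall>h\<in>carrier H. \<forall>l\<in>carrier H. Q h l a)" for Q by blast
  show ?thesis
    unfolding twisted_partial_action_def 3 4 5 using alpha_lin omega_lin 1 2 by (simp add: ac_apply)
qed

lemma cocycle_iff: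
  "(\<forall>h\<in>carrier H. \<forall>l\<in>carrier H. \<forall>m\<in>carrier H.
      tsum A (comult H h) (\<lambda>h1 h2. tsum A (comult H l) (\<lambda>l1 l2. tsum A (comult H m) (\<lambda>m1 m2.
        (h1 \<rightharpoonup> cocyc l1 m1) \<otimes>\<^bsub>A\<^esub> cocyc h2 (l2 \<otimes>\<^bsub>H\<^esub> m2)))) =
      tsum A (comult H h) (\<lambda>h1 h2. tsum A (comult H l) (\<lambda>l1 l2.
        cocyc h1 l1 \<otimes>\<^bsub>A\<^esub> cocyc (h2 \<otimes>\<^bsub>H\<^esub> l2) m))) \<longleftrightarrow>
    flp (post (\<lambda>y. flp (post ac y)) om) \<star>\<star>\<star> post mpb om = post (post (cst A)) om \<star>\<star>\<star> mpb om"
proof -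
  note c1 = flp_closed[OF post_closed[OF act1_lin om_closed]]
    and c2 = ahom_closed[OF post_hom[OF aLA aLLA mpb_hom[OF aA]] om_closed]
    and c3 = ahom_closed[OF post_hom[OF aLA aLLA fA_hom] om_closed]
    and c4 = mpb_closed[OF om_closed]
  have l: "(flp (post (\<lambda>y. flp (post ac y)) om) \<star>\<star>\<star> post mpb om) h l m =
      tsum A (comult H h) (\<lambda>h1 h2. tsum A (comult H l) (\<lambda>l1 l2. tsum A (comult H m) (\<lambda>m1 m2.
        (h1 \<rightharpoonup> cocyc l1 m1) \<otimes>\<^bsub>A\<^esub> cocyc h2 (l2 \<otimes>\<^bsub>H\<^esub> m2))))"
    if h: "h \<in> carrier H" and l: "l \<in> carrier H" and m: "m \<in> carrier H" for h l m
  proof (rule LL_mult_map[OF aLA mA L_ev[OF m] c1 c2 h l])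
    fix h1 h2 l1 l2 assume hl: "h1 \<in> carrier H" "h2 \<in> carrier H" "l1 \<in> carrier H" "l2 \<in> carrier H"
    show "(flp (post (\<lambda>y. flp (post ac y)) om) h1 l1 \<star> post mpb om h2 l2) m = tsum A (comult H m) (\<lambda>m1 m2.
        (h1 \<rightharpoonup> cocyc l1 m1) \<otimes>\<^bsub>A\<^esub> cocyc h2 (l2 \<otimes>\<^bsub>H\<^esub> m2))"
      by (rule L_mult_eval[OF aA L_closed[OF L_closed[OF c1 hl(1)] hl(3)] L_closed[OF L_closed[OF c2 hl(2)] hl(4)] m])
        (simp add: hl flp_apply post_apply mpb_apply ac_apply om_apply)
  qed
  have r: "(post (post (cst A)) om \<star>\<star>\<star> mpb om) h l m =
      tsum A (comult H h) (\<lambda>h1 h2. tsum A (comult H l) (\<lambda>l1 l2.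
        cocyc h1 l1 \<otimes>\<^bsub>A\<^esub> cocyc (h2 \<otimes>\<^bsub>H\<^esub> l2) m))"
    if h: "h \<in> carrier H" and l: "l \<in> carrier H" and m: "m \<in> carrier H" for h l m
  proof (rule LL_mult_map[OF aLA mA L_ev[OF m] c3 c4 h l])
    fix h1 h2 l1 l2 assume hl: "h1 \<in> carrier H" "h2 \<in> carrier H" "l1 \<in> carrier H" "l2 \<in> carrier H"
    show "(post (post (cst A)) om h1 l1 \<star> mpb om h2 l2) m = cocyc h1 l1 \<otimes>\<^bsub>A\<^esub> cocyc (h2 \<otimes>\<^bsub>H\<^esub> l2) m"
      using cst_mult_apply(1)[OF aA L_closed[OF L_closed[OF om_closed hl(1)] hl(3)]
          L_closed[OF om_closed m_closed[OF hl(2,4)]] m] hl m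
      by (simp add: post_apply mpb_apply om_apply)
  qed
  show ?thesis
    by (subst LLL_eq_iff[OF L_mult_closed[OF aLLA c1 c2] L_mult_closed[OF aLLA c3 c4]]) (simp add: l r)
qed

text \<open>An element y with y * f = y lies in every ideal containing f. For f = f1 * f2 this
  applies to \<omega> and to its inverse.\<close>

lemma ideal_intro:
  assumes v: "v \<in> carrier (L (L A))" and vf: "v \<star>\<star> (fA E \<star>\<star> mpb E) = v"
    and omf: "om \<star>\<star> (fA E \<star>\<star> mpb E) = om"
    and inv: "om \<star>\<star> v = fA E \<star>\<star> mpb E" "v \<star>\<star> om = fA E \<star>\<star> mpb E"
  shows "let I = Idl\<^bsub>Hom_HH_A\<^esub> {f1 \<otimes>\<^bsub>Hom_HH_A\<^esub> f2}; w = restrict \<omega> (carrier (tensor R H H)) in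
      w \<in> I \<and> (\<exists>w'\<in>I. w \<otimes>\<^bsub>Hom_HH_A\<^esub> w' = f1 \<otimes>\<^bsub>Hom_HH_A\<^esub> f2 \<and>
                      w' \<otimes>\<^bsub>Hom_HH_A\<^esub> w = f1 \<otimes>\<^bsub>Hom_HH_A\<^esub> f2)"
proof -
  interpret HA: ring Hom_HH_A by (rule HH_ring[OF aA])
  note um = uncurry_mult[OF aA, symmetric] and uc = uncurry_closed(1)[OF mA]
  have fc: "fA E \<star>\<star> mpb E \<in> carrier (L (L A))" by (rule L_mult_closed[OF aLA E_cs])
  have f: "f1 \<otimes>\<^bsub>Hom_HH_A\<^esub> f2 = uncurry A (fA E \<star>\<star> mpb E)" by (simp add: f1_eq f2_eq um E_cs)
  have in_I: "uncurry A y \<in> Idl\<^bsub>Hom_HH_A\<^esub> {f1 \<otimes>\<^bsub>Hom_HH_A\<^esub> f2}"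
    if y: "y \<in> carrier (L (L A))" "y \<star>\<star> (fA E \<star>\<star> mpb E) = y" for y
  proof -
    have sub: "{f1 \<otimes>\<^bsub>Hom_HH_A\<^esub> f2} \<subseteq> carrier Hom_HH_A" using uc[OF fc] by (simp add: f)
    interpret I: ideal "Idl\<^bsub>Hom_HH_A\<^esub> {f1 \<otimes>\<^bsub>Hom_HH_A\<^esub> f2}" Hom_HH_A by (rule HA.genideal_ideal[OF sub])
    have "uncurry A y \<otimes>\<^bsub>Hom_HH_A\<^esub> (f1 \<otimes>\<^bsub>Hom_HH_A\<^esub> f2) \<in> Idl\<^bsub>Hom_HH_A\<^esub> {f1 \<otimes>\<^bsub>Hom_HH_A\<^esub> f2}"
      by (rule I.I_l_closed[OF _ uc[OF y(1)]]) (use HA.genideal_self[OF sub] in simp)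
    then show ?thesis by (simp add: f um[OF y(1) fc] y(2))
  qed
  show ?thesis
    unfolding Let_def uncurry_om[symmetric]
    using in_I[OF om_closed omf] in_I[OF v vf] um[OF om_closed v] um[OF v om_closed] inv f by auto
qed

lemma ideal_elim:
  assumes "let I = Idl\<^bsub>Hom_HH_A\<^esub> {f1 \<otimes>\<^bsub>Hom_HH_A\<^esub> f2}; w = restrict \<omega> (carrier (tensor R H H)) in
      w \<in> I \<and> (\<exists>w'\<in>I. w \<otimes>\<^bsub>Hom_HH_A\<^esub> w' = f1 \<otimes>\<^bsub>Hom_HH_A\<^esub> f2 \<and>
                      w' \<otimes>\<^bsub>Hom_HH_A\<^esub> w = f1 \<otimes>\<^bsub>Hom_HH_A\<^esub> f2)"
  shows "\<exists>v\<in>carrier (L (L A)). om \<star>\<star> v = fA E \<star>\<star> mpb E \<and> v \<star>\<star> om = fA E \<star>\<star> mpb E"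
proof -
  interpret HA: ring Hom_HH_A by (rule HH_ring[OF aA])
  note um = uncurry_mult[OF aA, symmetric] and uc = uncurry_closed(1)[OF mA]
  have fc: "fA E \<star>\<star> mpb E \<in> carrier (L (L A))" by (rule L_mult_closed[OF aLA E_cs])
  have f: "f1 \<otimes>\<^bsub>Hom_HH_A\<^esub> f2 = uncurry A (fA E \<star>\<star> mpb E)" by (simp add: f1_eq f2_eq um E_cs)
  have sub: "{f1 \<otimes>\<^bsub>Hom_HH_A\<^esub> f2} \<subseteq> carrier Hom_HH_A" using uc[OF fc] by (simp add: f)
  interpret I: ideal "Idl\<^bsub>Hom_HH_A\<^esub> {f1 \<otimes>\<^bsub>Hom_HH_A\<^esub> f2}" Hom_HH_A by (rule HA.genideal_ideal[OF sub])
  obtain w' where w': "w' \<in> Idl\<^bsub>Hom_HH_A\<^esub> {f1 \<otimes>\<^bsub>Hom_HH_A\<^esub> f2}"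
    "uncurry A om \<otimes>\<^bsub>Hom_HH_A\<^esub> w' = f1 \<otimes>\<^bsub>Hom_HH_A\<^esub> f2"
    "w' \<otimes>\<^bsub>Hom_HH_A\<^esub> uncurry A om = f1 \<otimes>\<^bsub>Hom_HH_A\<^esub> f2"
    using assms unfolding Let_def uncurry_om[symmetric] by auto
  obtain v where v: "v \<in> carrier (L (L A))" "w' = uncurry A v"
    using uncurry_surj[OF mA I.Icarr[OF w'(1)]] by blast
  have "om \<star>\<star> v = fA E \<star>\<star> mpb E" "v \<star>\<star> om = fA E \<star>\<star> mpb E"
    using w'(2,3) uncurry_inj[OF mA L_mult_closed[OF aLA om_closed v(1)] fc]
      uncurry_inj[OF mA L_mult_closed[OF aLA v(1) om_closed] fc] by (simp_all add: v um om_closed f)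
  then show ?thesis using v(1) by blast
qed

lemma act_E_iff: "(\<forall>h\<in>carrier H. \<forall>k\<in>carrier H.
      h \<rightharpoonup> (k \<rightharpoonup> \<one>\<^bsub>A\<^esub>) =
        tsum A (comult H h) (\<lambda>h1 h2. (h1 \<rightharpoonup> \<one>\<^bsub>A\<^esub>) \<otimes>\<^bsub>A\<^esub> ((h2 \<otimes>\<^bsub>H\<^esub> k) \<rightharpoonup> \<one>\<^bsub>A\<^esub>)))
    \<longleftrightarrow> flp (post ac E) = fA E \<star>\<star> mpb E"
proof -
  have "(fA E \<star>\<star> mpb E) h k = tsum A (comult H h) (\<lambda>h1 h2. (h1 \<rightharpoonup> \<one>\<^bsub>A\<^esub>) \<otimes>\<^bsub>A\<^esub> ((h2 \<otimes>\<^bsub>H\<^esub> k) \<rightharpoonup> \<one>\<^bsub>A\<^esub>))"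
    if h: "h \<in> carrier H" and k: "k \<in> carrier H" for h k
    unfolding post_cst_mult_apply(1)[OF aA E_closed E_cs(2) h k]
    by (rule tsum_cong[OF mC mC mA bilin_mult[OF aA L_lin[OF E_closed] bilin_l[OF LL_bilin[OF E_cs(2)] k]] _ comult_closed[OF h]])
      (simp add: ac_apply mpb_apply k)
  then show ?thesis
    by (subst LL_eq_iff[OF act1_closed[OF E_closed] L_mult_closed[OF aLA E_cs]]) (simp add: flp_apply post_apply ac_apply)
qed

lemma norm_iff: "(\<forall>h\<in>carrier H. cocyc h \<one>\<^bsub>H\<^esub> = h \<rightharpoonup> \<one>\<^bsub>A\<^esub> \<and> cocyc \<one>\<^bsub>H\<^esub> h = h \<rightharpoonup> \<one>\<^bsub>A\<^esub>) \<longleftrightarrow>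
    (\<forall>h\<in>carrier H. om h \<one>\<^bsub>H\<^esub> = E h) \<and> om \<one>\<^bsub>H\<^esub> = E"
  using L_eq_iff[OF L_closed[OF om_closed one_closed] E_closed] by (auto simp: om_apply ac_apply)

lemma centers: "f1 \<in> ring_center Hom_HH_A \<longleftrightarrow> (\<forall>y\<in>carrier (L (L A)). fA E \<star>\<star> y = y \<star>\<star> fA E)"
  "f2 \<in> ring_center Hom_HH_A \<longleftrightarrow> (\<forall>y\<in>carrier (L (L A)). mpb E \<star>\<star> y = y \<star>\<star> mpb E)"
  unfolding f1_eq f2_eq by (rule ring_center_uncurry[OF aA E_cs(1)], rule ring_center_uncurry[OF aA E_cs(2)])

end

text \<open>The axioms from which products in A \<otimes> H are computed. They hold for the data of
  a cleft extension as well as for a given symmetric action.\<close>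

locale crossed_alg = twisted_alg +
  assumes ac_one: "\<And>x. x \<in> carrier A \<Longrightarrow> ac x \<one>\<^bsub>H\<^esub> = x"
    and ac_mult: "\<And>x y. x \<in> carrier A \<Longrightarrow> y \<in> carrier A \<Longrightarrow> ac (x \<otimes>\<^bsub>A\<^esub> y) = ac x \<star> ac y"
    and om_one: "om \<one>\<^bsub>H\<^esub> = E"
    and om_one': "\<And>h. h \<in> carrier H \<Longrightarrow> om h \<one>\<^bsub>H\<^esub> = E h"
    and om_f2: "om \<star>\<star> mpb E = om"
    and om_twisted: "flp (post ac E) \<star>\<star> om = om"
begin

section \<open>The crossed product as the image of a projection of A \<otimes> H\<close>

abbreviation "TA \<equiv> tensor R A H"
abbreviation inA where "inA x \<equiv> tens R A H x \<one>\<^bsub>H\<^esub>"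
abbreviation inHA where "inHA \<equiv> tens R A H \<one>\<^bsub>A\<^esub>"
abbreviation "jA \<equiv> post inHA idH"

lemmas aTA = tensor_assoc_algebra[OF aA aH]
lemmas aLTA = L_assoc_algebra[OF aTA]
lemmas aLLTA = L_assoc_algebra[OF aLTA]
lemmas mTA = assoc_algebra_module[OF aTA]
lemmas inA_hom = tens_left_hom[OF aA aH]
lemmas inHA_hom = tens_right_hom[OF aA aH]
lemmas inA1 = post_hom[OF aA aTA inA_hom]
lemmas inA2 = post_hom[OF aLA aLTA inA1]
lemmas mpbA = mpb_hom[OF aA]
lemmas mpbTA = mpb_hom[OF aTA]

interpretation TA: assoc_algebra R TA by (rule aTA)
interpretation LTA: assoc_algebra R "L TA" by (rule aLTA)
interpretation LLTA: assoc_algebra R "L (L TA)" by (rule aLLTA)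
interpretation LA: assoc_algebra R "L A" by (rule aLA)
interpretation LLA: assoc_algebra R "L (L A)" by (rule aLLA)

lemma jA_closed: "jA \<in> carrier (L TA)"
  by (rule ahom_closed[OF post_hom[OF aH aTA inHA_hom] idH_closed])

lemma pure: "x \<in> carrier A \<Longrightarrow> h \<in> carrier H \<Longrightarrow> inA x \<otimes>\<^bsub>TA\<^esub> inHA h = tens R A H x h"
  by (simp add: tensor_mult_tens[OF aA aH])

text \<open>Writes \<Sum> y(h1) \<otimes> h2 as a word, x \<otimes> h being the product (x \<otimes>
  1)(1 \<otimes> h) in the ordinary tensor product algebra. In particular \<open>emb E h\<close> is
  1 # h.\<close>

definition "emb y = post inA y \<otimes>\<^bsub>L TA\<^esub> jA"
definition "emb2 y = post (post inA) y \<otimes>\<^bsub>L (L TA)\<^esub> mpb jA"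

lemma emb_closed: "y \<in> carrier (L A) \<Longrightarrow> emb y \<in> carrier (L TA)"
  unfolding emb_def by (rule LTA.m_closed[OF ahom_closed[OF inA1] jA_closed])

lemma emb2_closed: "y \<in> carrier (L (L A)) \<Longrightarrow> emb2 y \<in> carrier (L (L TA))"
  unfolding emb2_def by (rule LLTA.m_closed[OF ahom_closed[OF inA2] mpb_closed[OF jA_closed]])

lemma emb_mult: "y \<in> carrier (L A) \<Longrightarrow> z \<in> carrier (L A) \<Longrightarrow> emb (y \<star> z) = post inA y \<otimes>\<^bsub>L TA\<^esub> emb z"
  unfolding emb_def using ahom_closed[OF inA1] by (simp add: ahom_mult[OF inA1] LTA.m_assoc jA_closed)

lemma emb2_mult: "y \<in> carrier (L (L A)) \<Longrightarrow> z \<in> carrier (L (L A)) \<Longrightarrow>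
    emb2 (y \<star>\<star> z) = post (post inA) y \<otimes>\<^bsub>L (L TA)\<^esub> emb2 z"
  unfolding emb2_def using ahom_closed[OF inA2] by (simp add: ahom_mult[OF inA2] LLTA.m_assoc mpb_closed[OF jA_closed])

lemma emb2_mpb: "y \<in> carrier (L A) \<Longrightarrow> emb2 (mpb y) = mpb (emb y)"
  unfolding emb_def emb2_def by (simp add: post_mpb ahom_mult[OF mpbTA] ahom_closed[OF inA1] jA_closed)

lemma emb_eval:
  assumes y: "y \<in> carrier (L A)" and h: "h \<in> carrier H"
  shows "emb y h = tsum TA (comult H h) (\<lambda>h1 h2. tens R A H (y h1) h2)"
  unfolding emb_def
  by (rule L_mult_eval[OF aTA ahom_closed[OF inA1 y] jA_closed h]) (simp add: post_apply pure L_closed[OF y])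

lemma inA_c: "x \<in> carrier A \<Longrightarrow> inA x \<in> carrier TA"
  by (rule ahom_closed[OF inA_hom])

lemma emb_cst_mult: "x \<in> carrier A \<Longrightarrow> z \<in> carrier (L A) \<Longrightarrow> h \<in> carrier H \<Longrightarrow>
    emb (cst A x \<star> z) h = inA x \<otimes>\<^bsub>TA\<^esub> emb z h"
  by (simp add: emb_mult cst_closed[OF mA] post_cst[OF mA ahom_lin[OF inA_hom]]
      cst_mult_apply[OF aTA inA_c emb_closed])

lemma emb2_lin: "emb2 \<in> linear_maps R (L (L A)) (L (L TA))"
  unfolding emb2_def[abs_def] by (rule lin_mult_right[OF aLLTA mpb_closed[OF jA_closed] ahom_lin[OF inA2]])

lemma E_E: "E \<star> E = E"
  using ac_mult[of "\<one>\<^bsub>A\<^esub>" "\<one>\<^bsub>A\<^esub>"] by simp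

lemma ac_E: "x \<in> carrier A \<Longrightarrow> ac x \<star> E = ac x" "x \<in> carrier A \<Longrightarrow> E \<star> ac x = ac x"
  using ac_mult[of x "\<one>\<^bsub>A\<^esub>"] ac_mult[of "\<one>\<^bsub>A\<^esub>" x] by simp_all

text \<open>The coefficient function of the crossed product: (a \<otimes> h)(b \<otimes> l) = \<Sum>
  X(h1, l1) \<otimes> h2 l2, by \<open>crossed_pure\<close>.\<close>

definition "X a b = fA (cst A a \<star> ac b) \<star>\<star> om"

lemma cab_closed: "a \<in> carrier A \<Longrightarrow> b \<in> carrier A \<Longrightarrow> cst A a \<star> ac b \<in> carrier (L A)"
  by (simp add: cst_closed[OF mA] ac_closed)

lemma X_closed: "a \<in> carrier A \<Longrightarrow> b \<in> carrier A \<Longrightarrow> X a b \<in> carrier (L (L A))"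
  unfolding X_def by (simp add: ahom_closed[OF fA_hom] cab_closed om_closed)

lemma X_bilin: "bilin R A A (L (L A)) X"
proof (rule bilinI)
  show "X a \<in> linear_maps R A (L (L A))" if a: "a \<in> carrier A" for a
    unfolding X_def[abs_def]
    by (rule lin_mult_right[OF aLLA om_closed lin_comp[OF ahom_lin[OF fA_hom]
      lin_mult_left[OF aLA cst_closed[OF mA a] ac_lin]]])
  show "(\<lambda>a. X a b) \<in> linear_maps R A (L (L A))" if b: "b \<in> carrier A" for b
    unfolding X_def[abs_def]
    by (rule lin_mult_right[OF aLLA om_closed lin_comp[OF ahom_lin[OF fA_hom]
      lin_mult_right[OF aLA ac_closed[OF b] ahom_lin[OF cst_hom[OF aA]]]]])
qed

lemma crossed_inner:
  assumes a: "a \<in> carrier A" and b: "b \<in> carrier A" and h: "h \<in> carrier H" and l: "l \<in> carrier H"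
  shows "tsum TA (comult H h) (\<lambda>h1 h'. tsum TA (comult H h') (\<lambda>h2 h3. tsum TA (comult H l) (\<lambda>l1 l2.
        tens R A H (a \<otimes>\<^bsub>A\<^esub> (h1 \<rightharpoonup> b) \<otimes>\<^bsub>A\<^esub> cocyc h2 l1) (h3 \<otimes>\<^bsub>H\<^esub> l2)))) = emb2 (X a b) h l"
proof -
  let ?z = "cst A a \<star> ac b"
  note z = cab_closed[OF a b]
  note iz = ahom_closed[OF inA1 z]
  have "emb2 (X a b) h l = (post (cst TA) (post inA ?z) \<otimes>\<^bsub>L (L TA)\<^esub> emb2 om) h l"
    by (simp add: X_def emb2_mult ahom_closed[OF fA_hom] z om_closed cst_natural[OF mA ahom_lin[OF inA_hom] z])
  also have "\<dots> = tsum TA (comult H h) (\<lambda>h1 h'. post inA ?z h1 \<otimes>\<^bsub>TA\<^esub> emb2 om h' l)"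
    by (rule post_cst_mult_apply(1)[OF aTA iz emb2_closed[OF om_closed] h l])
  also have "\<dots> = tsum TA (comult H h) (\<lambda>h1 h'. tsum TA (comult H h') (\<lambda>h2 h3. tsum TA (comult H l) (\<lambda>l1 l2.
        tens R A H (a \<otimes>\<^bsub>A\<^esub> (h1 \<rightharpoonup> b) \<otimes>\<^bsub>A\<^esub> cocyc h2 l1) (h3 \<otimes>\<^bsub>H\<^esub> l2))))"
  proof (rule tsum_cong[OF mC mC mTA bilin_mult[OF aTA L_lin[OF iz] bilin_l[OF LL_bilin[OF emb2_closed[OF om_closed]] l]]
        _ comult_closed[OF h]])
    fix h1 h' assume h1: "h1 \<in> carrier H" and h': "h' \<in> carrier H"
    have zh: "?z h1 = a \<otimes>\<^bsub>A\<^esub> (h1 \<rightharpoonup> b)"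
      by (simp add: cst_mult_apply[OF aA a ac_closed[OF b] h1] ac_apply h1)
    note zc = L_closed[OF z h1]
    show "post inA ?z h1 \<otimes>\<^bsub>TA\<^esub> emb2 om h' l = tsum TA (comult H h') (\<lambda>h2 h3. tsum TA (comult H l) (\<lambda>l1 l2.
        tens R A H (a \<otimes>\<^bsub>A\<^esub> (h1 \<rightharpoonup> b) \<otimes>\<^bsub>A\<^esub> cocyc h2 l1) (h3 \<otimes>\<^bsub>H\<^esub> l2)))"
      unfolding emb2_def post_apply[OF h1]
      by (rule LL_mult_map[OF aTA mTA lin_mult_left[OF aTA inA_c[OF zc] lin_id] ahom_closed[OF inA2 om_closed]
            mpb_closed[OF jA_closed] h' l])
        (use zc in \<open>simp add: post_apply mpb_apply pure zh[symmetric] om_apply[symmetric] L_closed[OF L_closed[OF om_closed]]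
          tensor_mult_tens[OF aA aH]\<close>)
  qed
  finally show ?thesis by simp
qed

lemma X_hl:
  assumes a: "a \<in> carrier A" and h: "h \<in> carrier H"
  shows "bilin R A H TA (\<lambda>b l. emb2 (X a b) h l)"
proof (rule bilinI)
  show "(\<lambda>l. emb2 (X a b) h l) \<in> linear_maps R H TA" if "b \<in> carrier A" for b
    by (rule bilin_r[OF LL_bilin[OF emb2_closed[OF X_closed[OF a that]]] h])
  show "(\<lambda>b. emb2 (X a b) h l) \<in> linear_maps R A TA" if "l \<in> carrier H" for l
    by (rule lin_comp[OF L_ev[OF that] lin_comp[OF L_ev[OF h] lin_comp[OF emb2_lin bilin_r[OF X_bilin a]]]])
qed

text \<open>A nested \<open>tsum\<close> is linear once its summand is known to be bilinear, which
  the formula for \<open>crossed_mult\<close> does not show. Recognising the innermost sums as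
  \<open>emb2 (X a b)\<close> supplies it.\<close>

lemma crossed_bilin: "bilin R TA TA TA crossed_mult"
  and crossed_pure: "\<lbrakk>a \<in> carrier A; b \<in> carrier A; h \<in> carrier H; l \<in> carrier H\<rbrakk> \<Longrightarrow>
    crossed_mult (tens R A H a h) (tens R A H b l) = emb2 (X a b) h l"
proof -
  let ?V = "\<lambda>t a h. tsum TA t (\<lambda>b l. emb2 (X a b) h l)"
  have V: "bilin R A H TA (?V t)" if t: "t \<in> carrier TA" for t
  proof (rule bilinI)
    fix a assume a: "a \<in> carrier A"
    show "?V t a \<in> linear_maps R H TA"
      by (rule lin_tsum_body[OF mA mC mTA mC X_hl[OF a] _ t], assumption)
        (rule bilin_l[OF LL_bilin[OF emb2_closed[OF X_closed[OF a]]]])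
  next
    fix h assume h: "h \<in> carrier H"
    show "(\<lambda>a. ?V t a h) \<in> linear_maps R A TA"
      by (rule lin_tsum_body[OF mA mC mTA mA X_hl[OF _ h] _ t], assumption)
        (rule lin_comp[OF L_ev lin_comp[OF L_ev[OF h] lin_comp[OF emb2_lin bilin_l[OF X_bilin]]]])
  qed
  have eq: "crossed_mult s t = tsum TA s (?V t)" if s: "s \<in> carrier TA" and t: "t \<in> carrier TA" for s t
    unfolding crossed_mult_def Let_def
  proof (rule sym, rule tsum_cong[OF mA mC mTA V[OF t] _ s])
    fix a h assume a: "a \<in> carrier A" and h: "h \<in> carrier H"
    show "?V t a h = tsum TA t (\<lambda>b l. tsum TA (comult H h) (\<lambda>h1 h'. tsum TA (comult H h') (\<lambda>h2 h3. tsum TA (comult H l) (\<lambda>l1 l2.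
        tens R A H (a \<otimes>\<^bsub>A\<^esub> (h1 \<rightharpoonup> b) \<otimes>\<^bsub>A\<^esub> cocyc h2 l1) (h3 \<otimes>\<^bsub>H\<^esub> l2)))))"
      by (rule tsum_cong[OF mA mC mTA X_hl[OF a h] _ t]) (simp add: crossed_inner[OF a _ h])
  qed
  have VV: "bilin R TA TA TA (\<lambda>s t. tsum TA s (?V t))"
  proof (rule bilinI)
    show "(\<lambda>s. tsum TA s (?V t)) \<in> linear_maps R TA TA" if "t \<in> carrier TA" for t
      by (rule tsum_lin[OF mA mC mTA V[OF that]])
    show "(\<lambda>t. tsum TA s (?V t)) \<in> linear_maps R TA TA" if s: "s \<in> carrier TA" for s
      by (rule lin_tsum_body[OF mA mC mTA mTA V _ s], assumption) (rule tsum_lin[OF mA mC mTA X_hl])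
  qed
  show "bilin R TA TA TA crossed_mult"
    by (rule iffD2[OF bilin_cong[OF mTA mTA eq] VV])
  show "crossed_mult (tens R A H a h) (tens R A H b l) = emb2 (X a b) h l"
    if "a \<in> carrier A" "b \<in> carrier A" "h \<in> carrier H" "l \<in> carrier H"
    using that by (simp add: eq tens_closed[OF mA mC] tsum_pure[OF mA mC mTA V] tsum_pure[OF mA mC mTA X_hl])
qed

lemma emb2_at_one_right:
  assumes z: "z \<in> carrier (L A)" and h: "h \<in> carrier H"
  shows "emb2 (fA z \<star>\<star> om) h \<one>\<^bsub>H\<^esub> = emb (z \<star> E) h"
proof -
  let ?p = "post (\<lambda>f. f \<one>\<^bsub>H\<^esub>)"
  have pA: "?p (f \<otimes>\<^bsub>L (L X)\<^esub> g) = ?p f \<otimes>\<^bsub>L X\<^esub> ?p g"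
    if X: "assoc_algebra R X" and "f \<in> carrier (L (L X))" "g \<in> carrier (L (L X))" for f g and X :: "('a, 'x, 'y) module_scheme"
    by (rule post_mult[OF L_assoc_algebra[OF X] X L_ev[OF one_closed] _ that(2,3)]) (rule L_mult_at_one[OF X])
  note fz = ahom_closed[OF fA_hom z]
  note y = LLA.m_closed[OF fz om_closed]
  have pz: "?p (fA z) = z"
    by (rule L_eqI[OF post_closed[OF L_ev[OF one_closed] fz] z]) (simp add: post_apply cst_at_one[OF mA] L_closed[OF z])
  have po: "?p om = E"
    by (rule L_eqI[OF post_closed[OF L_ev[OF one_closed] om_closed] E_closed]) (simp add: post_apply om_one')
  have pj: "?p (mpb jA) = jA"
    by (rule L_eqI[OF post_closed[OF L_ev[OF one_closed] mpb_closed[OF jA_closed]] jA_closed]) (simp add: post_apply mpb_apply)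
  have pi: "?p (post (post inA) (fA z \<star>\<star> om)) = post inA (?p (fA z \<star>\<star> om))"
    by (auto simp: post_def restrict_def fun_eq_iff)
  have "?p (emb2 (fA z \<star>\<star> om)) = emb (z \<star> E)"
    unfolding emb2_def emb_def pA[OF aTA ahom_closed[OF inA2 y] mpb_closed[OF jA_closed]] pi pj pA[OF aA fz om_closed] pz po ..
  then have "?p (emb2 (fA z \<star>\<star> om)) h = emb (z \<star> E) h" by simp
  then show ?thesis by (simp only: post_apply[OF h])
qed

lemma crossed_right_one:
  assumes "a \<in> carrier A" "x \<in> carrier A" "h \<in> carrier H"
  shows "crossed_mult (tens R A H a h) (inA x) = emb (cst A a \<star> ac x) h"
  using assms by (simp add: crossed_pure X_def emb2_at_one_right cab_closed LA.m_assoc cst_closed[OF mA] ac_closed E_closed ac_E)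

lemma smash_eq: "a \<in> carrier A \<Longrightarrow> h \<in> carrier H \<Longrightarrow> a \<sharp> h = emb (cst A a \<star> E) h"
  unfolding smash_def emb_eval[OF cab_closed[OF _ A.one_closed]]
  by (rule sym, rule tsum_cong[OF mC mC mTA _ _ comult_closed],
      rule bilinI[OF bilin_r[OF tens_bilin[OF mA mC]] lin_comp[OF bilin_l[OF tens_bilin[OF mA mC]] L_lin[OF cab_closed[OF _ A.one_closed]]]])
    (auto simp: L_closed[OF cab_closed] cst_mult_apply[OF aA _ E_closed] ac_apply act_closed)

lemma crossed_left_one:
  assumes a: "a \<in> carrier A" and b: "b \<in> carrier A" and l: "l \<in> carrier H"
  shows "crossed_mult (inA a) (tens R A H b l) = (a \<otimes>\<^bsub>A\<^esub> b) \<sharp> l"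
proof -
  note Xc = X_closed[OF a b] and z = cab_closed[OF a b]
  have 1: "X a b \<one>\<^bsub>H\<^esub> = cst A (a \<otimes>\<^bsub>A\<^esub> b) \<star> E"
    unfolding X_def L_mult_at_one[OF aLA ahom_closed[OF fA_hom z] om_closed]
    by (simp add: post_apply om_one L_mult_at_one[OF aA cst_closed[OF mA a] ac_closed[OF b]] cst_at_one[OF mA] a ac_one b)
  have "emb2 (X a b) \<one>\<^bsub>H\<^esub> = emb (X a b \<one>\<^bsub>H\<^esub>)"
    unfolding emb2_def emb_def L_mult_at_one[OF aLTA ahom_closed[OF inA2 Xc] mpb_closed[OF jA_closed]]
    by (simp add: post_apply mpb_at_one[OF jA_closed])
  then show ?thesis
    using a b l by (simp add: crossed_pure smash_eq 1)
qed

text \<open>Right multiplication by 1 \<otimes> 1, a linear projection by \<open>P_P\<close>. It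
  describes the carrier of A # H by the equation P t = t.\<close>

definition "P t = crossed_mult t (inA \<one>\<^bsub>A\<^esub>)"

lemma P_lin: "P \<in> linear_maps R TA TA"
  unfolding P_def[abs_def] by (rule bilin_l[OF crossed_bilin]) (simp add: inA_c)

lemma P_pure: "a \<in> carrier A \<Longrightarrow> h \<in> carrier H \<Longrightarrow> P (tens R A H a h) = a \<sharp> h"
  by (simp add: P_def crossed_right_one smash_eq)

lemma smash_bilin: "bilin R A H TA (\<lambda>a h. a \<sharp> h)"
  by (rule iffD1[OF bilin_cong[OF mA mC P_pure]])
    (auto intro: bilinI lin_comp[OF P_lin bilin_r[OF tens_bilin[OF mA mC]]] lin_comp[OF P_lin bilin_l[OF tens_bilin[OF mA mC]]])

lemma P_emb:
  assumes y: "y \<in> carrier (L A)" and h: "h \<in> carrier H"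
  shows "P (emb y h) = emb (y \<star> E) h"
proof -
  let ?F = "\<lambda>h1 h2. inA (y h1) \<otimes>\<^bsub>TA\<^esub> emb E h2"
  have "P (emb y h) = tsum TA (comult H h) ?F"
    unfolding emb_def[of y]
    by (rule L_mult_map[OF aTA mTA P_lin ahom_closed[OF inA1 y] jA_closed h])
      (simp add: post_apply pure P_pure smash_eq emb_cst_mult E_closed L_closed[OF y])
  also have "\<dots> = emb (y \<star> E) h"
    unfolding emb_mult[OF y E_closed]
    by (rule sym, rule L_mult_eval[OF aTA ahom_closed[OF inA1 y] emb_closed[OF E_closed] h]) (simp add: post_apply)
  finally show ?thesis .
qed

lemma P_emb2:
  assumes y: "y \<in> carrier (L (L A))" and h: "h \<in> carrier H" and l: "l \<in> carrier H"
  shows "P (emb2 y h l) = emb2 (y \<star>\<star> mpb E) h l"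
proof -
  note jc = mpb_closed[OF jA_closed] and ec = mpb_closed[OF emb_closed[OF E_closed]]
  let ?F = "\<lambda>h1 h2 l1 l2. inA (y h1 l1) \<otimes>\<^bsub>TA\<^esub> emb E (h2 \<otimes>\<^bsub>H\<^esub> l2)"
  have "P (emb2 y h l) = tsum TA (comult H h) (\<lambda>h1 h2. tsum TA (comult H l) (\<lambda>l1 l2. ?F h1 h2 l1 l2))"
    unfolding emb2_def[of y]
    by (rule LL_mult_map[OF aTA mTA P_lin ahom_closed[OF inA2 y] jc h l])
      (simp add: post_apply mpb_apply pure P_pure smash_eq emb_cst_mult E_closed L_closed[OF L_closed[OF y]])
  also have "\<dots> = emb2 (y \<star>\<star> mpb E) h l"
    unfolding emb2_mult[OF y E_cs(2)] emb2_mpb[OF E_closed]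
    by (rule sym, rule LL_mult_eval[OF aTA ahom_closed[OF inA2 y] ec h l]) (simp add: post_apply mpb_apply)
  finally show ?thesis .
qed

lemma P_smash: "a \<in> carrier A \<Longrightarrow> h \<in> carrier H \<Longrightarrow> P (a \<sharp> h) = a \<sharp> h"
  by (simp add: smash_eq P_emb cab_closed LA.m_assoc cst_closed[OF mA] E_closed E_E)

lemma P_P: "t \<in> carrier TA \<Longrightarrow> P (P t) = P t"
  by (rule tensor_lin_eqI[OF mA mC mTA lin_comp[OF P_lin P_lin] P_lin]) (simp_all add: P_pure P_smash)

text \<open>Products already lie in A # H because \<omega> absorbs hl \<cdot> 1 on the right
  (\<open>om_f2\<close>).\<close>

lemma P_crossed:
  assumes s: "s \<in> carrier TA" and t: "t \<in> carrier TA"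
  shows "P (crossed_mult s t) = crossed_mult s t"
proof (rule tensor_lin_eqI[OF mA mC mTA lin_comp[OF P_lin bilin_l[OF crossed_bilin t]] bilin_l[OF crossed_bilin t] _ s])
  fix a h assume a: "a \<in> carrier A" and h: "h \<in> carrier H"
  note ah = tens_closed[OF mA mC a h]
  show "P (crossed_mult (tens R A H a h) t) = crossed_mult (tens R A H a h) t"
  proof (rule tensor_lin_eqI[OF mA mC mTA lin_comp[OF P_lin bilin_r[OF crossed_bilin ah]] bilin_r[OF crossed_bilin ah] _ t])
    fix b l assume b: "b \<in> carrier A" and l: "l \<in> carrier H"
    show "P (crossed_mult (tens R A H a h) (tens R A H b l)) = crossed_mult (tens R A H a h) (tens R A H b l)"
      using a b h l by (simp add: crossed_pure P_emb2 X_closed)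
        (simp add: X_def LLA.m_assoc ahom_closed[OF fA_hom] cab_closed om_closed E_cs om_f2)
  qed
qed

abbreviation "CA \<equiv> crossed_algebra"
abbreviation "CP \<equiv> crossed_product"

lemma CA_simps: "carrier CA = P ` carrier TA" "mult CA = crossed_mult" "one CA = \<one>\<^bsub>A\<^esub> \<sharp> \<one>\<^bsub>H\<^esub>"
  "zero CA = \<zero>\<^bsub>TA\<^esub>" "add CA = add TA" "smult CA = smult TA"
  by (simp_all add: crossed_algebra_def P_def[abs_def])

lemma CP_simps: "carrier CP = P ` carrier TA" "mult CP = crossed_mult" "one CP = \<one>\<^bsub>A\<^esub> \<sharp> \<one>\<^bsub>H\<^esub>"
  "zero CP = \<zero>\<^bsub>TA\<^esub>" "add CP = add TA" "smult CP = smult TA"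
  "coaction CP t = tsum (tensor R CA H) t (\<lambda>a h. tsum (tensor R CA H) (comult H h) (\<lambda>h1 h2. tens R CA H (a \<sharp> h1) h2))"
  by (simp_all add: crossed_product_def Let_def module.defs comodule_algebra.defs CA_simps)

lemma CA_iff: "t \<in> carrier CA \<longleftrightarrow> t \<in> carrier TA \<and> P t = t"
  unfolding CA_simps using P_P lin_closed[OF P_lin] by (auto simp: image_iff)

lemma CP_carrier: "carrier CP = carrier CA"
  by (simp add: CA_simps CP_simps)

lemma smash_CA: "a \<in> carrier A \<Longrightarrow> h \<in> carrier H \<Longrightarrow> a \<sharp> h \<in> carrier CA"
  by (simp add: CA_iff P_smash bilin_closed[OF smash_bilin])

lemma CA_lin: "linear_maps R CP Z = linear_maps R CA Z" "linear_maps R Z CP = linear_maps R Z CA"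
  by (simp_all add: linear_maps_def CA_simps CP_simps)

lemma mCA: "module R CA"
proof -
  have ab: "abelian_group CA"
  proof (rule abelian_groupI)
    fix x assume x: "x \<in> carrier CA"
    then have xT: "x \<in> carrier TA" "P x = x" by (auto simp: CA_iff)
    have "P (\<ominus>\<^bsub>TA\<^esub> x) = \<ominus>\<^bsub>TA\<^esub> P x"
      by (rule additive_minus[OF TA.abelian_group_axioms TA.abelian_group_axioms lin_closed[OF P_lin] lin_add[OF P_lin] xT(1)])
    then have "\<ominus>\<^bsub>TA\<^esub> x \<in> carrier CA" using xT by (simp add: CA_iff)
    moreover have "\<ominus>\<^bsub>TA\<^esub> x \<oplus>\<^bsub>CA\<^esub> x = \<zero>\<^bsub>CA\<^esub>" using xT by (simp add: CA_simps TA.l_neg)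
    ultimately show "\<exists>y\<in>carrier CA. y \<oplus>\<^bsub>CA\<^esub> x = \<zero>\<^bsub>CA\<^esub>" by blast
  next
    show "\<zero>\<^bsub>CA\<^esub> \<in> carrier CA"
      unfolding CA_iff using additive_zero[OF TA.abelian_group_axioms TA.abelian_group_axioms lin_closed[OF P_lin] lin_add[OF P_lin]]
      by (simp add: CA_simps)
  qed (auto simp: CA_iff CA_simps(4-6) lin_add[OF P_lin] TA.a_ac)
  show ?thesis
    by (rule moduleI[OF R.cring_axioms ab])
      (auto simp: CA_iff CA_simps(4-6) lin_smult[OF P_lin] TA.smult_l_distr TA.smult_r_distr TA.smult_assoc1)
qed

lemma CA_TA: "(\<lambda>t. t) \<in> linear_maps R CA TA"
  by (rule linear_mapsI) (auto simp: CA_iff CA_simps(4-6))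

lemma P_CA: "P \<in> linear_maps R TA CA"
  by (rule linear_mapsI) (auto simp: CA_iff CA_simps(4-6) lin_closed[OF P_lin] P_P lin_add[OF P_lin] lin_smult[OF P_lin])

lemma smash_CA_bilin: "bilin R A H CA (\<lambda>a h. a \<sharp> h)"
  by (intro bilinI linear_mapsI) (simp_all add: smash_CA CA_simps(4-6)
    lin_add[OF bilin_r[OF smash_bilin]] lin_add[OF bilin_l[OF smash_bilin]]
    lin_smult[OF bilin_r[OF smash_bilin]] lin_smult[OF bilin_l[OF smash_bilin]])

lemma one_CA: "\<one>\<^bsub>A\<^esub> \<sharp> \<one>\<^bsub>H\<^esub> = inA \<one>\<^bsub>A\<^esub>" "x \<in> carrier A \<Longrightarrow> x \<sharp> \<one>\<^bsub>H\<^esub> = inA x"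
proof -
  show *: "x \<sharp> \<one>\<^bsub>H\<^esub> = inA x" if x: "x \<in> carrier A" for x
  proof -
    note z = cab_closed[OF x A.one_closed]
    have "(cst A x \<star> E) \<one>\<^bsub>H\<^esub> = x"
      by (simp add: L_mult_at_one[OF aA cst_closed[OF mA x] E_closed] cst_at_one[OF mA] x ac_one)
    then show ?thesis
      unfolding smash_eq[OF x one_closed] emb_def L_mult_at_one[OF aTA ahom_closed[OF inA1 z] jA_closed]
      by (simp add: post_apply pure x)
  qed
  then show "\<one>\<^bsub>A\<^esub> \<sharp> \<one>\<^bsub>H\<^esub> = inA \<one>\<^bsub>A\<^esub>" by simp
qed

text \<open>The coaction formula of A # H, considered on all of A \<otimes> H, where it is a linear
  map determined by pure tensors.\<close>

definition "kappa t = tsum (tensor R CA H) t (\<lambda>a h. tsum (tensor R CA H) (comult H h) (\<lambda>h1 h2. tens R CA H (a \<sharp> h1) h2))"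

lemma kappa_trilin: "bilin R H H (tensor R CA H) (\<lambda>h1 h2. tens R CA H (a \<sharp> h1) h2)" if a: "a \<in> carrier A"
  by (rule bilinI[OF bilin_r[OF tens_bilin[OF mCA mC] smash_CA[OF a]]
      lin_comp[OF bilin_l[OF tens_bilin[OF mCA mC]] bilin_r[OF smash_CA_bilin a]]])

lemma kappa_bilin: "bilin R A H (tensor R CA H) (\<lambda>a h. tsum (tensor R CA H) (comult H h) (\<lambda>h1 h2. tens R CA H (a \<sharp> h1) h2))"
proof (rule bilinI)
  note mT = tensor_module[OF mCA mC]
  show "(\<lambda>h. tsum (tensor R CA H) (comult H h) (\<lambda>h1 h2. tens R CA H (a \<sharp> h1) h2)) \<in> linear_maps R H (tensor R CA H)"
    if "a \<in> carrier A" for a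
    by (rule lin_tsum_arg[OF mC mC mT kappa_trilin[OF that] comult_linear])
  show "(\<lambda>a. tsum (tensor R CA H) (comult H h) (\<lambda>h1 h2. tens R CA H (a \<sharp> h1) h2)) \<in> linear_maps R A (tensor R CA H)"
    if "h \<in> carrier H" for h
    by (rule lin_tsum_body[OF mC mC mT mA kappa_trilin _ comult_closed[OF that]], assumption)
      (rule lin_comp[OF bilin_l[OF tens_bilin[OF mCA mC]] bilin_l[OF smash_CA_bilin]])
qed

lemma kappa_lin: "kappa \<in> linear_maps R TA (tensor R CA H)"
  unfolding kappa_def[abs_def] by (rule tsum_lin[OF mA mC tensor_module[OF mCA mC] kappa_bilin])

lemma kappa_pure: "a \<in> carrier A \<Longrightarrow> h \<in> carrier H \<Longrightarrow>
    kappa (tens R A H a h) = tsum (tensor R CA H) (comult H h) (\<lambda>h1 h2. tens R CA H (a \<sharp> h1) h2)"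
  unfolding kappa_def by (rule tsum_pure[OF mA mC tensor_module[OF mCA mC] kappa_bilin])

lemma coaction_kappa: "coaction CP t = kappa t"
  by (simp add: CP_simps kappa_def)

end

section \<open>The action of L X on Hom(B, X) through the coaction\<close>

context comodule_algebra
begin

text \<open>For linear f this is the right action of L X on Hom(B, X); \<open>star_assoc\<close> is
  its associativity, a consequence of the coassociativity of the coaction.\<close>

definition star where "star X f g b = tsum X (coaction B b) (\<lambda>x h. f x \<otimes>\<^bsub>X\<^esub> g h)"

lemma coaction_closed: "b \<in> carrier B \<Longrightarrow> coaction B b \<in> carrier (tensor R B H)"
  by (rule lin_closed[OF ahom_lin[OF coaction_hom]])

lemma star_lin:
  assumes X: "assoc_algebra R X" and f: "f \<in> linear_maps R B X" and g: "g \<in> carrier (L X)"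
  shows "star X f g \<in> linear_maps R B X"
  unfolding star_def[abs_def]
  by (rule lin_tsum_arg[OF B.module_axioms mC assoc_algebra_module[OF X] bilin_mult[OF X f L_lin[OF g]] ahom_lin[OF coaction_hom]])

lemma star_assoc:
  assumes X: "assoc_algebra R X" and f: "f \<in> linear_maps R B X" and g: "g \<in> carrier (L X)" and k: "k \<in> carrier (L X)"
    and b: "b \<in> carrier B"
  shows "star X (star X f g) k b = star X f (g \<otimes>\<^bsub>L X\<^esub> k) b"
proof -
  interpret X: assoc_algebra R X by (rule X)
  note mB = B.module_axioms and mX = X.module_axioms
  note fg = bilin_mult[OF X f L_lin[OF g]] and gk = bilin_mult[OF X L_lin[OF g] L_lin[OF k]]
  note cl = lin_closed[OF f] L_closed[OF g] L_closed[OF k]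
  have tri: "trilin R B H H X (\<lambda>x x1 h. f x \<otimes>\<^bsub>X\<^esub> (g x1 \<otimes>\<^bsub>X\<^esub> k h))"
    by (rule trilinI)
      (auto intro!: lin_mult_left[OF X] lin_mult_right[OF X] f L_lin[OF g] L_lin[OF k] X.m_closed cl)
  have "star X (star X f g) k b = tsum X (coaction B b) (\<lambda>x h. tsum X (coaction B x) (\<lambda>x0 x1. f x0 \<otimes>\<^bsub>X\<^esub> (g x1 \<otimes>\<^bsub>X\<^esub> k h)))"
    unfolding star_def[of X "star X f g"]
  proof (rule tsum_cong[OF mB mC mX bilin_mult[OF X star_lin[OF X f g] L_lin[OF k]] _ coaction_closed[OF b]])
    fix x h assume x: "x \<in> carrier B" and h: "h \<in> carrier H"
    have "star X f g x \<otimes>\<^bsub>X\<^esub> k h = tsum X (coaction B x) (\<lambda>x0 x1. (f x0 \<otimes>\<^bsub>X\<^esub> g x1) \<otimes>\<^bsub>X\<^esub> k h)"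
      unfolding star_def
      by (rule tsum_map[OF mB mC mX mX fg lin_mult_right[OF X L_closed[OF k h] lin_id] coaction_closed[OF x]])
    also have "\<dots> = tsum X (coaction B x) (\<lambda>x0 x1. f x0 \<otimes>\<^bsub>X\<^esub> (g x1 \<otimes>\<^bsub>X\<^esub> k h))"
      by (rule sym, rule tsum_cong[OF mB mC mX trilinD(3)[OF tri h] _ coaction_closed[OF x]])
        (simp add: X.m_assoc cl h)
    finally show "star X f g x \<otimes>\<^bsub>X\<^esub> k h = \<dots>" .
  qed
  also have "\<dots> = tsum X (coaction B b) (\<lambda>x h. tsum X (comult H h) (\<lambda>h1 h2. f x \<otimes>\<^bsub>X\<^esub> (g h1 \<otimes>\<^bsub>X\<^esub> k h2)))"
    by (rule coassoc_transfer[OF mB mC mC mX ahom_lin[OF coaction_hom] comult_linear coaction_closed[OF b] coaction_coassoc[OF b] tri])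
  also have "\<dots> = star X f (g \<otimes>\<^bsub>L X\<^esub> k) b"
    unfolding star_def
  proof (rule sym, rule tsum_cong[OF mB mC mX bilin_mult[OF X f L_lin[OF L_mult_closed[OF X g k]]] _ coaction_closed[OF b]])
    fix x h assume x: "x \<in> carrier B" and h: "h \<in> carrier H"
    show "f x \<otimes>\<^bsub>X\<^esub> (g \<otimes>\<^bsub>L X\<^esub> k) h = tsum X (comult H h) (\<lambda>h1 h2. f x \<otimes>\<^bsub>X\<^esub> (g h1 \<otimes>\<^bsub>X\<^esub> k h2))"
      unfolding L_mult[OF h]
      by (rule tsum_map[OF mC mC mX mX gk lin_mult_left[OF X lin_closed[OF f x] lin_id] comult_closed[OF h]])
  qed
  finally show ?thesis .
qed

end

section \<open>The coaction on words, and linear maps out of A \<otimes> H\<close>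

context crossed_alg
begin

abbreviation "TC \<equiv> tensor R CA H"

text \<open>Coassociativity leaves the last leg outside and turns the inner sum into P applied to
  \<open>emb y h1\<close>; P multiplies the coefficient by \<open>E\<close>.\<close>

lemma kappa_emb:
  assumes y: "y \<in> carrier (L A)" and h: "h \<in> carrier H"
  shows "kappa (emb y h) = tsum TC (comult H h) (\<lambda>h1 h2. tens R CA H (emb (y \<otimes>\<^bsub>L A\<^esub> E) h1) h2)"
proof -
  note mTC = tensor_module[OF mCA mC]
  have tri: "trilin R H H H TC (\<lambda>h1 h2 h3. tens R CA H (y h1 \<sharp> h2) h3)"
  proof (rule trilinI)
    show "(\<lambda>h3. tens R CA H (y h1 \<sharp> h2) h3) \<in> linear_maps R H TC" if "h1 \<in> carrier H" "h2 \<in> carrier H" for h1 h2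
      by (rule bilin_r[OF tens_bilin[OF mCA mC] smash_CA[OF L_closed[OF y that(1)] that(2)]])
    show "(\<lambda>h2. tens R CA H (y h1 \<sharp> h2) h3) \<in> linear_maps R H TC" if "h1 \<in> carrier H" "h3 \<in> carrier H" for h1 h3
      by (rule lin_comp[OF bilin_l[OF tens_bilin[OF mCA mC] that(2)] bilin_r[OF smash_CA_bilin L_closed[OF y that(1)]]])
    show "(\<lambda>h1. tens R CA H (y h1 \<sharp> h2) h3) \<in> linear_maps R H TC" if "h2 \<in> carrier H" "h3 \<in> carrier H" for h2 h3
      by (rule lin_comp[OF bilin_l[OF tens_bilin[OF mCA mC] that(2)] lin_comp[OF bilin_l[OF smash_CA_bilin that(1)] L_lin[OF y]]])
  qed
  have "kappa (emb y h) = tsum TC (comult H h) (\<lambda>h1 h2. tsum TC (comult H h2) (\<lambda>h2 h3. tens R CA H (y h1 \<sharp> h2) h3))"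
    unfolding emb_def
    by (rule L_mult_map[OF aTA mTC kappa_lin ahom_closed[OF inA1 y] jA_closed h])
      (simp add: post_apply pure kappa_pure L_closed[OF y])
  also have "\<dots> = tsum TC (comult H h) (\<lambda>h' h3. tsum TC (comult H h') (\<lambda>h1 h2. tens R CA H (y h1 \<sharp> h2) h3))"
    by (rule sym, rule coassoc_tsum[OF mTC tri h])
  also have "\<dots> = tsum TC (comult H h) (\<lambda>h1 h2. tens R CA H (P (emb y h1)) h2)"
  proof (rule sym, rule tsum_cong[OF mC mC mTC _ _ comult_closed[OF h]])
    show "bilin R H H TC (\<lambda>h1 h2. tens R CA H (P (emb y h1)) h2)"
      by (rule bilinI[OF bilin_r[OF tens_bilin[OF mCA mC] lin_closed[OF P_CA L_closed[OF emb_closed[OF y]]]]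
        lin_comp[OF bilin_l[OF tens_bilin[OF mCA mC]] lin_comp[OF P_CA L_lin[OF emb_closed[OF y]]]]])
    fix h' h3 assume h': "h' \<in> carrier H" and h3: "h3 \<in> carrier H"
    show "tens R CA H (P (emb y h')) h3 = tsum TC (comult H h') (\<lambda>h1 h2. tens R CA H (y h1 \<sharp> h2) h3)"
      unfolding emb_def
      by (rule L_mult_map[where \<phi> = "\<lambda>s. tens R CA H (P s) h3", OF aTA mTC lin_comp[OF bilin_l[OF tens_bilin[OF mCA mC] h3] P_CA]
            ahom_closed[OF inA1 y] jA_closed h'])
        (simp add: post_apply pure P_pure L_closed[OF y])
  qed
  also have "\<dots> = tsum TC (comult H h) (\<lambda>h1 h2. tens R CA H (emb (y \<otimes>\<^bsub>L A\<^esub> E) h1) h2)"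
    by (rule tsum_cong[OF mC mC mTC _ _ comult_closed[OF h]],
      rule bilinI[OF bilin_r[OF tens_bilin[OF mCA mC] lin_closed[OF P_CA L_closed[OF emb_closed[OF y]]]]
        lin_comp[OF bilin_l[OF tens_bilin[OF mCA mC]] lin_comp[OF P_CA L_lin[OF emb_closed[OF y]]]]])
      (simp_all add: P_emb y)
  finally show ?thesis .
qed

lemma emb_map:
  assumes Z: "assoc_algebra R Z" and j: "j \<in> linear_maps R A Z" and g: "g \<in> carrier (L Z)"
    and F: "F \<in> linear_maps R TA Z" "\<And>a h. a \<in> carrier A \<Longrightarrow> h \<in> carrier H \<Longrightarrow> F (tens R A H a h) = j a \<otimes>\<^bsub>Z\<^esub> g h"
    and y: "y \<in> carrier (L A)" and h: "h \<in> carrier H"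
  shows "F (emb y h) = (post j y \<otimes>\<^bsub>L Z\<^esub> g) h"
proof -
  have "F (emb y h) = tsum Z (comult H h) (\<lambda>h1 h2. j (y h1) \<otimes>\<^bsub>Z\<^esub> g h2)"
    unfolding emb_def
    by (rule L_mult_map[OF aTA assoc_algebra_module[OF Z] F(1) ahom_closed[OF inA1 y] jA_closed h])
      (simp add: post_apply pure F(2) L_closed[OF y])
  also have "\<dots> = (post j y \<otimes>\<^bsub>L Z\<^esub> g) h"
    by (rule sym, rule L_mult_eval[OF Z post_closed[OF j y] g h]) (simp add: post_apply)
  finally show ?thesis .
qed

lemma emb2_map:
  assumes Z: "assoc_algebra R Z" and j: "j \<in> linear_maps R A Z" and g: "g \<in> carrier (L Z)"
    and F: "F \<in> linear_maps R TA Z" "\<And>a h. a \<in> carrier A \<Longrightarrow> h \<in> carrier H \<Longrightarrow> F (tens R A H a h) = j a \<otimes>\<^bsub>Z\<^esub> g h"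
    and y: "y \<in> carrier (L (L A))" and h: "h \<in> carrier H" and l: "l \<in> carrier H"
  shows "F (emb2 y h l) = (post (post j) y \<otimes>\<^bsub>L (L Z)\<^esub> mpb g) h l"
proof -
  note jy = post_closed[OF post_linear[OF aA Z j] y]
  have "F (emb2 y h l) = tsum Z (comult H h) (\<lambda>h1 h2. tsum Z (comult H l) (\<lambda>l1 l2. j (y h1 l1) \<otimes>\<^bsub>Z\<^esub> g (h2 \<otimes>\<^bsub>H\<^esub> l2)))"
    unfolding emb2_def
    by (rule LL_mult_map[OF aTA assoc_algebra_module[OF Z] F(1) ahom_closed[OF inA2 y] mpb_closed[OF jA_closed] h l])
      (simp add: post_apply mpb_apply pure F(2) L_closed[OF L_closed[OF y]])
  also have "\<dots> = (post (post j) y \<otimes>\<^bsub>L (L Z)\<^esub> mpb g) h l"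
    by (rule sym, rule LL_mult_eval[OF Z jy mpb_closed[OF g] h l]) (simp add: post_apply mpb_apply)
  finally show ?thesis .
qed

text \<open>A tensor product does not see the coaction field, by which the two records
  differ.\<close>

lemma CP_tensor: "tensor R CP H = TC" "tens R CP H = tens R CA H"
  by (simp_all add: fun_eq_iff tensor_def tens_def tensor_class_def tensor_null_def tensor_rels_def tensor_free_def
      CP_carrier CP_simps(2-6) CA_simps(2-6))

end

section \<open>Cleft extensions as crossed products\<close>

locale cleft_crossed = cleft_data R H B A \<iota> \<gamma> \<gamma>' + TW: crossed_alg R H A \<alpha> \<omega>
  for R (structure) and H (structure) and B (structure) and A (structure) and \<iota> \<gamma> \<gamma>' \<alpha> \<omega> +
  assumes ac_eq: "\<And>x. x \<in> carrier A \<Longrightarrow> TW.ac x = act x"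
    and om_eq: "TW.om = w"
begin

interpretation B: assoc_algebra R B by (rule aB)
interpretation T: assoc_algebra R T by (rule aT)
interpretation LA: assoc_algebra R "L A" by (rule aLA)
interpretation LB: assoc_algebra R "L B" by (rule aLB)
interpretation LT: assoc_algebra R "L T" by (rule aLT)
interpretation LLB: assoc_algebra R "L (L B)" by (rule aLLB)

abbreviation "TA \<equiv> TW.TA"

definition "Phi u = tsum B u (\<lambda>a h. \<iota> a \<otimes>\<^bsub>B\<^esub> \<gamma> h)"

lemma Phi_bilin: "bilin R A H B (\<lambda>a h. \<iota> a \<otimes>\<^bsub>B\<^esub> \<gamma> h)"
  by (rule bilin_mult[OF aB ahom_lin[OF iota_hom] L_lin[OF gamma_closed]])

lemma Phi_lin: "Phi \<in> linear_maps R TA B"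
  unfolding Phi_def[abs_def] by (rule tsum_lin[OF mA mC mB Phi_bilin])

lemma Phi_pure: "a \<in> carrier A \<Longrightarrow> h \<in> carrier H \<Longrightarrow> Phi (tens R A H a h) = \<iota> a \<otimes>\<^bsub>B\<^esub> \<gamma> h"
  unfolding Phi_def by (rule tsum_pure[OF mA mC mB Phi_bilin])

lemma Phi_emb2: "y \<in> carrier (L (L A)) \<Longrightarrow> h \<in> carrier H \<Longrightarrow> l \<in> carrier H \<Longrightarrow>
    Phi (TW.emb2 y h l) = (i2 y \<otimes>\<^bsub>L (L B)\<^esub> mpb \<gamma>) h l"
  by (rule TW.emb2_map[OF aB ahom_lin[OF iota_hom] gamma_closed Phi_lin Phi_pure])

lemma fs_apply:
  assumes f: "f \<in> carrier (L B)" and h: "h \<in> carrier H" and l: "l \<in> carrier H"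
  shows "(fB f \<otimes>\<^bsub>L (L B)\<^esub> sB \<gamma>) h l = f h \<otimes>\<^bsub>B\<^esub> \<gamma> l"
  by (simp add: cst_mult_apply(2)[OF aLB gamma_closed ahom_closed[OF fB_hom f] h] post_apply h
      cst_mult_apply(1)[OF aB L_closed[OF f h] gamma_closed l])

text \<open>The factor \<omega>(h, l) \<gamma>(hl) is \<gamma>(h) \<gamma>(l), and (h \<cdot> b)
  \<gamma>(h) is \<gamma>(h) b. What remains at (h, l) is the product of a \<gamma>(h) and b
  \<gamma>(l) in B.\<close>

lemma Phi_X:
  assumes a: "a \<in> carrier A" and b: "b \<in> carrier A"
  shows "i2 (TW.X a b) \<otimes>\<^bsub>L (L B)\<^esub> mpb \<gamma> =
    fB (cst B (\<iota> a) \<otimes>\<^bsub>L B\<^esub> (\<gamma> \<otimes>\<^bsub>L B\<^esub> cst B (\<iota> b))) \<otimes>\<^bsub>L (L B)\<^esub> sB \<gamma>"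
proof -
  note ca = cst_closed[OF mA a]
  note z = LA.m_closed[OF ca act(1)[OF b]]
  note ab = cx[OF a] cx[OF b]
  have "i2 (TW.X a b) = fB (i1 (cst A a \<otimes>\<^bsub>L A\<^esub> act b)) \<otimes>\<^bsub>L (L B)\<^esub> i2 w"
    by (simp add: TW.X_def ac_eq om_eq b i2_m ahom_closed[OF fA_hom] z w(1) cst_natural[OF mA ahom_lin[OF iota_hom] z])
  then have "i2 (TW.X a b) \<otimes>\<^bsub>L (L B)\<^esub> mpb \<gamma> = fB (i1 (cst A a \<otimes>\<^bsub>L A\<^esub> act b)) \<otimes>\<^bsub>L (L B)\<^esub> (fB \<gamma> \<otimes>\<^bsub>L (L B)\<^esub> sB \<gamma>)"
    unfolding gamma_gamma
    by (simp add: LLB.m_assoc ahom_closed[OF fB_hom] i1_c z i2_c w(1) mpb_closed gamma_closed)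
  also have "\<dots> = fB (i1 (cst A a \<otimes>\<^bsub>L A\<^esub> act b) \<otimes>\<^bsub>L B\<^esub> \<gamma>) \<otimes>\<^bsub>L (L B)\<^esub> sB \<gamma>"
    by (simp add: fB_m i1_c z gamma_closed LLB.m_assoc cB ahom_closed[OF fB_hom])
  also have "i1 (cst A a \<otimes>\<^bsub>L A\<^esub> act b) \<otimes>\<^bsub>L B\<^esub> \<gamma> = cst B (\<iota> a) \<otimes>\<^bsub>L B\<^esub> (\<gamma> \<otimes>\<^bsub>L B\<^esub> cst B (\<iota> b))"
    by (simp add: i1_m ca act(1)[OF b] post_cst[OF mA ahom_lin[OF iota_hom] a] gamma_iota[OF b] LB.m_assoc
        ab i1_c gamma_closed)
  finally show ?thesis .
qed

lemma Phi_mult: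
  assumes s: "s \<in> carrier TA" and u: "u \<in> carrier TA"
  shows "Phi (TW.crossed_mult s u) = Phi s \<otimes>\<^bsub>B\<^esub> Phi u"
proof (rule tensor_lin_eqI[OF mA mC mB lin_comp[OF Phi_lin bilin_l[OF TW.crossed_bilin u]]
    lin_mult_right[OF aB lin_closed[OF Phi_lin u] Phi_lin] _ s])
  fix a h assume a: "a \<in> carrier A" and h: "h \<in> carrier H"
  note ah = tens_closed[OF mA mC a h]
  show "Phi (TW.crossed_mult (tens R A H a h) u) = Phi (tens R A H a h) \<otimes>\<^bsub>B\<^esub> Phi u"
  proof (rule tensor_lin_eqI[OF mA mC mB lin_comp[OF Phi_lin bilin_r[OF TW.crossed_bilin ah]]
      lin_mult_left[OF aB lin_closed[OF Phi_lin ah] Phi_lin] _ u])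
    fix b l assume b: "b \<in> carrier A" and l: "l \<in> carrier H"
    note ia = ahom_closed[OF iota_hom a] and ib = ahom_closed[OF iota_hom b]
    have gb: "\<gamma> \<otimes>\<^bsub>L B\<^esub> cst B (\<iota> b) \<in> carrier (L B)" by (simp add: gamma_closed cx b)
    show "Phi (TW.crossed_mult (tens R A H a h) (tens R A H b l)) = Phi (tens R A H a h) \<otimes>\<^bsub>B\<^esub> Phi (tens R A H b l)"
      using a b h l ia ib
      by (simp add: TW.crossed_pure Phi_emb2 TW.X_closed Phi_X fs_apply gb cx cst_mult_apply[OF aB _ gb]
          cst_mult_apply[OF aB _ gamma_closed] Phi_pure L_closed[OF gamma_closed] B.m_assoc)
  qed
qed

definition "q b = contract \<gamma>' (coaction B b)"
definition "pi b = inv_into (carrier A) \<iota> (q b)"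
definition "Psi b = tsum TA (coaction B b) (\<lambda>x h. tens R A H (pi x) h)"

lemma q_star: "q = star B (\<lambda>x. x) \<gamma>'"
  by (simp add: fun_eq_iff q_def contract_def star_def)

lemma q_lin: "q \<in> linear_maps R B B"
  unfolding q_star by (rule star_lin[OF aB lin_id gamma'_closed])

lemma star_in: "b \<in> carrier B \<Longrightarrow> star T inB jH b = coaction B b"
  using tsum_tens_id[OF mB mC coaction_closed[of b]]
    tsum_cong[OF mB mC mT tens_bilin[OF mB mC] _ coaction_closed[of b], of "\<lambda>x h. inB x \<otimes>\<^bsub>T\<^esub> jH h"]
  by (simp add: star_def post_apply tensor_mult_tens[OF aB aH])

text \<open>The H-part of the coaction of \<Sum> b0 \<gamma>'(b1) is b1 S(b2). Written with
  \<open>star\<close>, this cancellation is \<open>jH_preL\<close>.\<close>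

lemma q_coinvariant:
  assumes b: "b \<in> carrier B"
  shows "coaction B (q b) = inB (q b)"
proof -
  let ?v = "post inB \<gamma>'"
  have v: "?v \<in> carrier (L T)" by (rule ahom_closed[OF inB1 gamma'_closed])
  have p: "preL jH \<in> carrier (L T)" by (rule preL_closed[OF jH_closed])
  have pv: "preL jH \<otimes>\<^bsub>L T\<^esub> ?v \<in> carrier (L T)" using p v by simp
  have body: "bilin R B H B (\<lambda>x h. x \<otimes>\<^bsub>B\<^esub> \<gamma>' h)" by (rule bilin_mult[OF aB lin_id L_lin[OF gamma'_closed]])
  have "coaction B (q b) = tsum T (coaction B b) (\<lambda>x h. coaction B (x \<otimes>\<^bsub>B\<^esub> \<gamma>' h))"
    unfolding q_def contract_def
    by (rule tsum_map[OF mB mC mB mT body ahom_lin[OF coaction_hom] coaction_closed[OF b]])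
  also have "\<dots> = star T (star T inB jH) (preL jH \<otimes>\<^bsub>L T\<^esub> ?v) b"
    unfolding star_def[of T "star T inB jH"]
    by (rule sym, rule tsum_cong[OF mB mC mT bilin_mult[OF aT star_lin[OF aT ahom_lin[OF inB_hom] jH_closed] L_lin[OF pv]] _ coaction_closed[OF b]])
      (simp add: star_in rho_gamma'[symmetric] post_apply ahom_mult[OF coaction_hom] L_closed[OF gamma'_closed])
  also have "\<dots> = star T inB (jH \<otimes>\<^bsub>L T\<^esub> (preL jH \<otimes>\<^bsub>L T\<^esub> ?v)) b"
    by (rule star_assoc[OF aT ahom_lin[OF inB_hom] jH_closed pv b])
  also have "jH \<otimes>\<^bsub>L T\<^esub> (preL jH \<otimes>\<^bsub>L T\<^esub> ?v) = ?v"
    using v p jH_closed by (simp add: LT.m_assoc[symmetric] jH_preL)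
  also have "star T inB ?v b = inB (q b)"
    unfolding q_def contract_def tsum_map[OF mB mC mB mT body ahom_lin[OF inB_hom] coaction_closed[OF b]] star_def
    by (rule tsum_cong[OF mB mC mT bilin_mult[OF aT ahom_lin[OF inB_hom] L_lin[OF v]] _ coaction_closed[OF b]])
      (simp add: post_apply ahom_mult[OF inB_hom] L_closed[OF gamma'_closed])
  finally show ?thesis .
qed

lemma q_image: "b \<in> carrier B \<Longrightarrow> q b \<in> \<iota> ` carrier A"
  unfolding iota_image coinvariants_def by (simp add: q_coinvariant lin_closed[OF q_lin])

lemma pi: "b \<in> carrier B \<Longrightarrow> pi b \<in> carrier A" "b \<in> carrier B \<Longrightarrow> \<iota> (pi b) = q b"
  unfolding pi_def by (rule inv_into_into[OF q_image], assumption) (rule f_inv_into_f[OF q_image])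

lemma pi_eq: "b \<in> carrier B \<Longrightarrow> a \<in> carrier A \<Longrightarrow> q b = \<iota> a \<Longrightarrow> pi b = a"
  using inj_onD[OF iota_inj] pi by metis

lemma pi_lin: "pi \<in> linear_maps R B A"
  by (rule linear_mapsI) (auto simp: pi lin_add[OF q_lin] lin_smult[OF q_lin] lin_add[OF ahom_lin[OF iota_hom]]
      lin_smult[OF ahom_lin[OF iota_hom]] intro!: pi_eq)

lemma Psi_bilin: "bilin R B H TA (\<lambda>x h. tens R A H (pi x) h)"
  by (rule bilinI[OF bilin_r[OF tens_bilin[OF mA mC] pi(1)] lin_comp[OF bilin_l[OF tens_bilin[OF mA mC]] pi_lin]])

lemma Psi_lin: "Psi \<in> linear_maps R B TA"
  unfolding Psi_def[abs_def] by (rule lin_tsum_arg[OF mB mC TW.mTA Psi_bilin ahom_lin[OF coaction_hom]])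

text \<open>By \<open>star_assoc\<close> the composite multiplies b0 by (\<gamma>' * \<gamma>)(b1),
  so the claim is condition (iv).\<close>

lemma Phi_Psi:
  assumes b: "b \<in> carrier B"
  shows "Phi (Psi b) = b"
proof -
  have "Phi (Psi b) = tsum B (coaction B b) (\<lambda>x h. Phi (tens R A H (pi x) h))"
    unfolding Psi_def by (rule tsum_map[OF mB mC TW.mTA mB Psi_bilin Phi_lin coaction_closed[OF b]])
  also have "\<dots> = star B (star B (\<lambda>x. x) \<gamma>') \<gamma> b"
    unfolding q_star[symmetric] star_def[of B q]
    by (rule sym, rule tsum_cong[OF mB mC mB bilin_mult[OF aB q_lin L_lin[OF gamma_closed]] _ coaction_closed[OF b]])
      (simp add: Phi_pure pi)
  also have "\<dots> = star B (\<lambda>x. x) (\<gamma>' \<otimes>\<^bsub>L B\<^esub> \<gamma>) b"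
    by (rule star_assoc[OF aB lin_id gamma'_closed gamma_closed b])
  also have "\<dots> = contract (\<gamma>' \<otimes>\<^bsub>L B\<^esub> \<gamma>) (coaction B b)"
    by (simp add: star_def contract_def)
  also have "\<dots> = b" by (rule contract_rho[OF b])
  finally show ?thesis .
qed

text \<open>For f that transforms like \<gamma>, a sum over the legs of f(h) under the coaction is a
  sum over the legs of h.\<close>

lemma colinear_map:
  assumes f: "f \<in> carrier (L B)" and rf: "post (coaction B) f = post inB f \<otimes>\<^bsub>L T\<^esub> jH"
    and Z: "module R Z" and F: "bilin R B H Z F" and h: "h \<in> carrier H"
  shows "tsum Z (coaction B (f h)) F = tsum Z (comult H h) (\<lambda>h1 h2. F (f h1) h2)"
proof -
  have "coaction B (f h) = (post inB f \<otimes>\<^bsub>L T\<^esub> jH) h"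
    using rf h by (metis post_apply)
  then show ?thesis
    using L_mult_map[OF aT Z tsum_lin[OF mB mC Z F] ahom_closed[OF inB1 f] jH_closed h, of "\<lambda>h1 h2. F (f h1) h2"]
    by (simp add: post_apply tensor_mult_tens[OF aB aH] tsum_pure[OF mB mC Z F] L_closed[OF f])
qed

lemma Psi_colinear:
  assumes f: "f \<in> carrier (L B)" and rf: "post (coaction B) f = post inB f \<otimes>\<^bsub>L T\<^esub> jH"
    and y: "y \<in> carrier (L A)" and eq: "f \<otimes>\<^bsub>L B\<^esub> \<gamma>' = i1 y" and h: "h \<in> carrier H"
  shows "Psi (f h) = TW.emb y h"
proof -
  have q: "q (f h) = \<iota> (y h)" if h: "h \<in> carrier H" for h
  proof -
    have "q (f h) = tsum B (comult H h) (\<lambda>h1 h2. f h1 \<otimes>\<^bsub>B\<^esub> \<gamma>' h2)"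
      unfolding q_def contract_def
      by (rule colinear_map[OF f rf mB bilin_mult[OF aB lin_id L_lin[OF gamma'_closed]] h])
    then show ?thesis using h by (simp add: L_mult[OF h, symmetric] eq post_apply)
  qed
  have p: "pi (f h) = y h" if "h \<in> carrier H" for h
    by (rule pi_eq[OF L_closed[OF f that] L_closed[OF y that] q[OF that]])
  show ?thesis
    unfolding Psi_def colinear_map[OF f rf TW.mTA Psi_bilin h] TW.emb_eval[OF y h]
    by (rule sym, rule tsum_cong[OF mC mC TW.mTA _ _ comult_closed[OF h]],
      rule bilinI[OF bilin_r[OF tens_bilin[OF mA mC] L_closed[OF y]] lin_comp[OF bilin_l[OF tens_bilin[OF mA mC]] L_lin[OF y]]])
      (simp_all add: p)
qed

lemma rho_iota_gamma: "a \<in> carrier A \<Longrightarrow>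
    post (coaction B) (cst B (\<iota> a) \<otimes>\<^bsub>L B\<^esub> \<gamma>) = post inB (cst B (\<iota> a) \<otimes>\<^bsub>L B\<^esub> \<gamma>) \<otimes>\<^bsub>L T\<^esub> jH"
  by (simp add: ahom_mult[OF rho1] ahom_mult[OF inB1] cx gamma_closed rho_gamma jH_closed ahom_closed[OF inB1] LT.m_assoc
      post_cst[OF mB ahom_lin[OF coaction_hom]] post_cst[OF mB ahom_lin[OF inB_hom]] iota_coinvariant ahom_closed[OF iota_hom]
      cst_closed[OF mT] ahom_closed[OF inB_hom])

lemma Psi_smash:
  assumes a: "a \<in> carrier A" and h: "h \<in> carrier H"
  shows "Psi (\<iota> a \<otimes>\<^bsub>B\<^esub> \<gamma> h) = TW.smash a h"
proof -
  let ?f = "cst B (\<iota> a) \<otimes>\<^bsub>L B\<^esub> \<gamma>"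
  have f: "?f \<in> carrier (L B)" by (simp add: cx a gamma_closed)
  have y: "cst A a \<otimes>\<^bsub>L A\<^esub> act \<one>\<^bsub>A\<^esub> \<in> carrier (L A)" by (simp add: cst_closed[OF mA a] E_closed)
  have "?f \<otimes>\<^bsub>L B\<^esub> \<gamma>' = i1 (cst A a \<otimes>\<^bsub>L A\<^esub> act \<one>\<^bsub>A\<^esub>)"
    by (simp add: LB.m_assoc cx a gamma_closed gamma'_closed i1_m cst_closed[OF mA a] E_closed iE
        post_cst[OF mA ahom_lin[OF iota_hom] a])
  from Psi_colinear[OF f rho_iota_gamma[OF a] y this h] show ?thesis
    by (simp add: TW.smash_eq a h ac_eq cst_mult_apply[OF aB ahom_closed[OF iota_hom a] gamma_closed h])
qed

text \<open>Together with \<open>Phi_Psi\<close> this makes the two maps mutually inverse between B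
  and the image of P.\<close>

lemma Psi_Phi: "u \<in> carrier TA \<Longrightarrow> Psi (Phi u) = TW.P u"
  by (rule tensor_lin_eqI[OF mA mC TW.mTA lin_comp[OF Psi_lin Phi_lin] TW.P_lin]) (simp_all add: Phi_pure Psi_smash TW.P_pure)

lemma Psi_CA: "b \<in> carrier B \<Longrightarrow> Psi b \<in> carrier TW.CA"
  unfolding TW.CA_iff using Psi_Phi[OF lin_closed[OF Psi_lin]] by (auto simp: Phi_Psi lin_closed[OF Psi_lin])

lemma Psi_CA_lin: "Psi \<in> linear_maps R B TW.CA"
  by (rule linear_mapsI) (simp_all add: Psi_CA TW.CA_simps(5,6) lin_add[OF Psi_lin] lin_smult[OF Psi_lin])

text \<open>Every b is of the form \<open>Phi u\<close>, so it suffices to check products \<iota>(a)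
  \<gamma>(h), whose legs are known by \<open>colinear_map\<close>.\<close>

lemma Psi_coaction:
  assumes b: "b \<in> carrier B"
  shows "TW.kappa (Psi b) = tsum TW.TC (coaction B b) (\<lambda>x h. tens R TW.CA H (Psi x) h)"
proof -
  note mTC = tensor_module[OF TW.mCA mC]
  have bi: "bilin R B H TW.TC (\<lambda>x h. tens R TW.CA H (Psi x) h)"
    by (rule bilinI[OF bilin_r[OF tens_bilin[OF TW.mCA mC] Psi_CA] lin_comp[OF bilin_l[OF tens_bilin[OF TW.mCA mC]] Psi_CA_lin]])
  let ?G = "\<lambda>b. tsum TW.TC (coaction B b) (\<lambda>x h. tens R TW.CA H (Psi x) h)"
  have G: "?G \<in> linear_maps R B TW.TC"
    by (rule lin_tsum_arg[OF mB mC mTC bi ahom_lin[OF coaction_hom]])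
  have "TW.kappa (Psi (Phi u)) = ?G (Phi u)" if u: "u \<in> carrier TA" for u
  proof (rule tensor_lin_eqI[OF mA mC mTC lin_comp[OF TW.kappa_lin lin_comp[OF Psi_lin Phi_lin]] lin_comp[OF G Phi_lin] _ u])
    fix a h assume a: "a \<in> carrier A" and h: "h \<in> carrier H"
    let ?f = "cst B (\<iota> a) \<otimes>\<^bsub>L B\<^esub> \<gamma>" and ?y = "cst A a \<otimes>\<^bsub>L A\<^esub> act \<one>\<^bsub>A\<^esub>"
    have f: "?f \<in> carrier (L B)" by (simp add: cx a gamma_closed)
    have fa: "?f h = \<iota> a \<otimes>\<^bsub>B\<^esub> \<gamma> h" if "h \<in> carrier H" for h
      by (rule cst_mult_apply[OF aB ahom_closed[OF iota_hom a] gamma_closed that])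
    have y: "?y \<in> carrier (L A)" by (simp add: cst_closed[OF mA a] E_closed)
    have yE: "?y \<otimes>\<^bsub>L A\<^esub> TW.ac \<one>\<^bsub>A\<^esub> = ?y"
      using TW.E_E by (simp add: ac_eq LA.m_assoc cst_closed[OF mA a] E_closed)
    have s: "TW.smash a h = TW.emb ?y h" if "h \<in> carrier H" for h
      using that a by (simp add: TW.smash_eq ac_eq)
    have "?G (?f h) = tsum TW.TC (comult H h) (\<lambda>h1 h2. tens R TW.CA H (Psi (?f h1)) h2)"
      by (rule colinear_map[OF f rho_iota_gamma[OF a] mTC bi h])
    also have "\<dots> = tsum TW.TC (comult H h) (\<lambda>h1 h2. tens R TW.CA H (TW.emb ?y h1) h2)"
      by (rule tsum_cong[OF mC mC mTC _ _ comult_closed[OF h]],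
        rule bilinI[OF bilin_r[OF bi L_closed[OF f]] lin_comp[OF bilin_l[OF bi] L_lin[OF f]]])
        (simp_all add: fa Psi_smash a s)
    also have "\<dots> = TW.kappa (TW.emb ?y h)"
      unfolding TW.kappa_emb[OF y h] yE ..
    finally show "TW.kappa (Psi (Phi (tens R A H a h))) = ?G (Phi (tens R A H a h))"
      using a h by (simp add: Phi_pure Psi_smash s fa)
  qed
  from this[OF lin_closed[OF Psi_lin b]] show ?thesis by (simp add: Phi_Psi b)
qed

theorem Psi_iso: "Psi \<in> comodule_algebra_isos R H B TW.CP"
proof -
  have one: "Psi \<one>\<^bsub>B\<^esub> = \<one>\<^bsub>TW.CP\<^esub>"
    using Psi_smash[OF A.one_closed one_closed] by (simp add: TW.CP_simps ahom_one[OF iota_hom] gamma_one)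
  \<comment> \<open>\<open>Phi\<close> is multiplicative on all of A \<otimes> H. Applying
    \<open>Psi\<close> to this identity produces P of a product, and P fixes products.\<close>
  have mult: "Psi (b \<otimes>\<^bsub>B\<^esub> b') = TW.crossed_mult (Psi b) (Psi b')" if "b \<in> carrier B" "b' \<in> carrier B" for b b'
    using Phi_mult[of "Psi b" "Psi b'"] Psi_Phi[of "TW.crossed_mult (Psi b) (Psi b')"] TW.P_crossed[of "Psi b" "Psi b'"] that
    by (simp add: lin_closed[OF Psi_lin] Phi_Psi bilin_closed[OF TW.crossed_bilin])
  have bij: "bij_betw Psi (carrier B) (carrier TW.CP)"
    unfolding TW.CP_carrier
    by (rule bij_betw_byWitness[where f' = Phi])
      (auto simp: Phi_Psi Psi_CA Psi_Phi lin_closed[OF Phi_lin] dest: iffD1[OF TW.CA_iff])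
  show ?thesis
    unfolding comodule_algebra_isos_def TW.CP_tensor TW.coaction_kappa TW.CA_lin ring_iso_def ring_hom_def
    using bij mult one by (auto simp: Psi_coaction Psi_CA_lin TW.CP_carrier Psi_CA TW.CP_simps(2,5) lin_add[OF Psi_lin])
qed

end

section \<open>Products with 1 # h, and recovery of A from the crossed product\<close>

context crossed_alg
begin

interpretation TA: assoc_algebra R TA by (rule aTA)
interpretation LTA: assoc_algebra R "L TA" by (rule aLTA)
interpretation LLTA: assoc_algebra R "L (L TA)" by (rule aLLTA)
interpretation LA: assoc_algebra R "L A" by (rule aLA)
interpretation LLA: assoc_algebra R "L (L A)" by (rule aLLA)

lemma one_smash: "h \<in> carrier H \<Longrightarrow> \<one>\<^bsub>A\<^esub> \<sharp> h = emb E h"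
  using ahom_one[OF cst_hom[OF aA]] by (simp add: smash_eq E_closed)

lemma crossed_left_emb:
  assumes a: "a \<in> carrier A" and h: "h \<in> carrier H"
  shows "crossed_mult (inA a) (emb E h) = a \<sharp> h"
proof -
  note z = cab_closed[OF a A.one_closed]
  have "crossed_mult (inA a) (emb E h) = tsum TA (comult H h) (\<lambda>h1 h2. (a \<otimes>\<^bsub>A\<^esub> E h1) \<sharp> h2)"
    unfolding emb_def
    by (rule L_mult_map[OF aTA mTA bilin_r[OF crossed_bilin inA_c[OF a]] ahom_closed[OF inA1 E_closed] jA_closed h])
      (simp add: post_apply pure crossed_left_one a L_closed[OF E_closed])
  also have "\<dots> = P (emb (cst A a \<star> E) h)"
    unfolding emb_def[of "cst A a \<star> E"]
    by (rule sym, rule L_mult_map[OF aTA mTA P_lin ahom_closed[OF inA1 z] jA_closed h])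
      (simp add: post_apply pure P_pure L_closed[OF z] L_closed[OF E_closed] cst_mult_apply[OF aA a E_closed] a)
  also have "\<dots> = a \<sharp> h" using P_smash[OF a h] by (simp add: smash_eq a h)
  finally show ?thesis .
qed

lemma crossed_emb_right:
  assumes y: "y \<in> carrier (L A)" and x: "x \<in> carrier A" and h: "h \<in> carrier H"
  shows "crossed_mult (emb y h) (inA x) = emb (y \<star> ac x) h"
proof -
  have "crossed_mult (emb y h) (inA x) = tsum TA (comult H h) (\<lambda>h1 h2. inA (y h1) \<otimes>\<^bsub>TA\<^esub> emb (ac x) h2)"
    unfolding emb_def[of y]
    by (rule L_mult_map[OF aTA mTA bilin_l[OF crossed_bilin inA_c[OF x]] ahom_closed[OF inA1 y] jA_closed h])
      (simp add: post_apply pure crossed_right_one x L_closed[OF y] emb_cst_mult ac_closed)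
  also have "\<dots> = emb (y \<star> ac x) h"
    unfolding emb_mult[OF y ac_closed[OF x]]
    by (rule sym, rule L_mult_eval[OF aTA ahom_closed[OF inA1 y] emb_closed[OF ac_closed[OF x]] h]) (simp add: post_apply)
  finally show ?thesis .
qed

lemma emb2_fA:
  assumes y: "y \<in> carrier (L A)" and z: "z \<in> carrier (L (L A))"
  shows "emb2 (fA y \<star>\<star> z) = post (cst TA) (post inA y) \<otimes>\<^bsub>L (L TA)\<^esub> emb2 z"
  by (simp add: emb2_mult ahom_closed[OF fA_hom] y z cst_natural[OF mA ahom_lin[OF inA_hom] y])

lemma emb2_fA_apply:
  assumes y: "y \<in> carrier (L A)" and z: "z \<in> carrier (L (L A))" and h: "h \<in> carrier H" and l: "l \<in> carrier H"
  shows "emb2 (fA y \<star>\<star> z) h l = tsum TA (comult H h) (\<lambda>h1 h2. inA (y h1) \<otimes>\<^bsub>TA\<^esub> emb2 z h2 l)"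
  unfolding emb2_fA[OF y z] post_cst_mult_apply(1)[OF aTA ahom_closed[OF inA1 y] emb2_closed[OF z] h l]
  by (rule tsum_cong[OF mC mC mTA bilin_mult[OF aTA L_lin[OF ahom_closed[OF inA1 y]] bilin_l[OF LL_bilin[OF emb2_closed[OF z]] l]]
      _ comult_closed[OF h]]) (simp add: post_apply)

lemma crossed_emb_tens:
  assumes y: "y \<in> carrier (L A)" and b: "b \<in> carrier A" and h: "h \<in> carrier H" and l: "l \<in> carrier H"
  shows "crossed_mult (emb y h) (tens R A H b l) = emb2 (fA (y \<star> ac b) \<star>\<star> om) h l"
proof -
  note fb = ahom_closed[OF fA_hom ac_closed[OF b]]
  note bo = LLA.m_closed[OF fb om_closed]
  have X: "emb2 (X a b) h2 l = inA a \<otimes>\<^bsub>TA\<^esub> emb2 (fA (ac b) \<star>\<star> om) h2 l" if a: "a \<in> carrier A" and h2: "h2 \<in> carrier H" for a h2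
  proof -
    note ca = cst_closed[OF mA a] cst_closed[OF mLA cst_closed[OF mA a]]
    have 1: "X a b = cst (L A) (cst A a) \<star>\<star> (fA (ac b) \<star>\<star> om)"
      by (simp add: X_def ahom_mult[OF fA_hom] ca ac_closed b LLA.m_assoc fb om_closed post_cst[OF mA ahom_lin[OF cst_hom[OF aA]] a])
    have 2: "post (post inA) (cst (L A) (cst A a)) = cst (L TA) (cst TA (inA a))"
      by (simp add: post_cst[OF mLA ahom_lin[OF inA1] ca(1)] post_cst[OF mA ahom_lin[OF inA_hom] a])
    show ?thesis
      unfolding 1 emb2_mult[OF ca(2) bo] 2
      by (simp add: cst_mult_apply[OF aLTA cst_closed[OF mTA inA_c[OF a]] emb2_closed[OF bo] h2]
        cst_mult_apply[OF aTA inA_c[OF a] L_closed[OF emb2_closed[OF bo] h2] l])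
  qed
  have "crossed_mult (emb y h) (tens R A H b l) = tsum TA (comult H h) (\<lambda>h1 h2. inA (y h1) \<otimes>\<^bsub>TA\<^esub> emb2 (fA (ac b) \<star>\<star> om) h2 l)"
    unfolding emb_def[of y]
    by (rule L_mult_map[OF aTA mTA bilin_l[OF crossed_bilin tens_closed[OF mA mC b l]] ahom_closed[OF inA1 y] jA_closed h])
      (simp add: post_apply pure crossed_pure X b l L_closed[OF y])
  also have "\<dots> = emb2 (fA y \<star>\<star> (fA (ac b) \<star>\<star> om)) h l"
    by (rule emb2_fA_apply[OF y bo h l, symmetric])
  also have "fA y \<star>\<star> (fA (ac b) \<star>\<star> om) = fA (y \<star> ac b) \<star>\<star> om"
    by (simp add: ahom_mult[OF fA_hom] y ac_closed b LLA.m_assoc ahom_closed[OF fA_hom] om_closed)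
  finally show ?thesis .
qed

text \<open>The coefficient obtained directly is \<Sum> (h1 \<cdot> (k1 \<cdot> 1)) \<omega>(h2,
  k2). The twisted module condition at 1 reduces it to \<omega>(h, k).\<close>

lemma crossed_emb_emb:
  assumes h: "h \<in> carrier H" and k: "k \<in> carrier H"
  shows "crossed_mult (emb E h) (emb E k) = emb2 om h k"
proof -
  let ?G = "emb2 om" and ?u = "post (post inA) (post ac E)"
  note G = emb2_closed[OF om_closed] and fG = flp_closed[OF emb2_closed[OF om_closed]]
  have acE: "post ac E \<in> carrier (L (L A))" by (rule post_closed[OF ac_lin E_closed])
  have u: "?u \<in> carrier (L (L TA))" by (rule ahom_closed[OF inA2 acE])
  have "crossed_mult (emb E h) (emb E k) = tsum TA (comult H k) (\<lambda>k1 k2. emb2 (fA (ac (E k1)) \<star>\<star> om) h k2)"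
    unfolding emb_def[of E]
    by (rule L_mult_map[OF aTA mTA bilin_r[OF crossed_bilin] ahom_closed[OF inA1 E_closed] jA_closed k])
      (simp_all add: post_apply pure crossed_emb_tens[unfolded emb_def] L_closed[OF E_closed] h E_closed ac_E
        L_closed[OF emb_closed[unfolded emb_def]])
  \<comment> \<open>The outer sum runs over the legs of k, the inner one over those of h. A flip
    exhibits them as a single product in two variables, and a second flip restores the
    order.\<close>
  also have "\<dots> = (?u \<otimes>\<^bsub>L (L TA)\<^esub> flp ?G) k h"
  proof (rule sym, rule L_mult_map[where \<phi> = "\<lambda>f. f h", OF aLTA mTA L_ev[OF h] u fG k])
    fix k1 k2 assume k1: "k1 \<in> carrier H" and k2: "k2 \<in> carrier H"
    note E1 = ac_closed[OF L_closed[OF E_closed k1]]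
    show "(?u k1 \<otimes>\<^bsub>L TA\<^esub> flp ?G k2) h = emb2 (fA (ac (E k1)) \<star>\<star> om) h k2"
      unfolding emb2_fA_apply[OF E1 om_closed h k2]
      by (rule L_mult_eval[OF aTA L_closed[OF u k1] L_closed[OF fG k2] h]) (simp add: post_apply flp_apply k1 k2)
  qed
  also have "\<dots> = flp (?u \<otimes>\<^bsub>L (L TA)\<^esub> flp ?G) h k" by (simp add: flp_apply h k)
  also have "flp (?u \<otimes>\<^bsub>L (L TA)\<^esub> flp ?G) = post (post inA) (flp (post ac E)) \<otimes>\<^bsub>L (L TA)\<^esub> ?G"
    by (simp add: ahom_mult[OF flp_hom[OF aTA]] u fG flp_flp[OF G] flp_post)
  also have "\<dots> = emb2 (flp (post ac E) \<star>\<star> om)"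
    by (rule emb2_mult[OF flp_closed[OF acE] om_closed, symmetric])
  also have "\<dots> = emb2 om" by (simp only: om_twisted)
  finally show ?thesis .
qed

text \<open>The map id \<otimes> \<epsilon>. It recovers x from x \<otimes> 1 and the coefficient
  function y from \<open>emb y\<close>.\<close>

definition "epsA t = tsum A t (\<lambda>a h. counit H h \<odot>\<^bsub>A\<^esub> a)"

lemma epsA_bilin: "bilin R A H A (\<lambda>a h. counit H h \<odot>\<^bsub>A\<^esub> a)"
  by (rule bilinI[OF lin_functional[OF mA counit_linear] lin_functional2[OF mA counit_closed lin_id]])

lemma epsA_lin: "epsA \<in> linear_maps R TA A"
  unfolding epsA_def[abs_def] by (rule tsum_lin[OF mA mC mA epsA_bilin])

lemma epsA_pure: "a \<in> carrier A \<Longrightarrow> h \<in> carrier H \<Longrightarrow> epsA (tens R A H a h) = counit H h \<odot>\<^bsub>A\<^esub> a"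
  unfolding epsA_def by (rule tsum_pure[OF mA mC mA epsA_bilin])

lemma epsA_inA: "a \<in> carrier A \<Longrightarrow> epsA (inA a) = a"
  by (simp add: epsA_pure counit_one)

lemma epsA_emb:
  assumes y: "y \<in> carrier (L A)" and h: "h \<in> carrier H"
  shows "epsA (emb y h) = y h"
proof -
  have "epsA (emb y h) = tsum A (comult H h) (\<lambda>h1 h2. counit H h2 \<odot>\<^bsub>A\<^esub> y h1)"
    unfolding emb_def
    by (rule L_mult_map[OF aTA mA epsA_lin ahom_closed[OF inA1 y] jA_closed h])
      (simp add: post_apply pure epsA_pure L_closed[OF y])
  also have "\<dots> = y h" by (rule sw_counit_right[OF mA L_lin[OF y] h])
  finally show ?thesis .
qed

text \<open>Undoes the coaction on A # H by \<open>Lam_kappa\<close>. Applied to a coinvariance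
  equation it yields c = epsA(c) \<otimes> 1.\<close>

definition "Lam s = tsum TA s (\<lambda>c h. tens R A H (epsA c) h)"

lemma epsA_CA: "epsA \<in> linear_maps R CA A"
  using lin_comp[OF epsA_lin CA_TA] by simp

lemma Lam_bilin: "bilin R CA H TA (\<lambda>c h. tens R A H (epsA c) h)"
  by (rule bilinI[OF bilin_r[OF tens_bilin[OF mA mC] lin_closed[OF epsA_CA]]
    lin_comp[OF bilin_l[OF tens_bilin[OF mA mC]] epsA_CA]])

lemma Lam_lin: "Lam \<in> linear_maps R TC TA"
  unfolding Lam_def[abs_def] by (rule tsum_lin[OF mCA mC mTA Lam_bilin])

lemma Lam_pure: "c \<in> carrier CA \<Longrightarrow> h \<in> carrier H \<Longrightarrow> Lam (tens R CA H c h) = tens R A H (epsA c) h"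
  unfolding Lam_def by (rule tsum_pure[OF mCA mC mTA Lam_bilin])

lemma Lam_kappa: "t \<in> carrier TA \<Longrightarrow> Lam (kappa t) = P t"
proof (rule tensor_lin_eqI[OF mA mC mTA lin_comp[OF Lam_lin kappa_lin] P_lin])
  fix a h assume a: "a \<in> carrier A" and h: "h \<in> carrier H"
  note z = cab_closed[OF a A.one_closed]
  note mTC = tensor_module[OF mCA mC]
  have ec: "emb (cst A a \<star> E) k \<in> carrier CA" if "k \<in> carrier H" for k
    using smash_CA[OF a that] by (simp add: smash_eq a that)
  have "Lam (kappa (tens R A H a h)) = tsum TA (comult H h) (\<lambda>h1 h2. Lam (tens R CA H (a \<sharp> h1) h2))"
    unfolding kappa_pure[OF a h]
    by (rule tsum_map[OF mC mC mTC mTA kappa_trilin[OF a] Lam_lin comult_closed[OF h]])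
  also have "\<dots> = emb (cst A a \<star> E) h"
    unfolding emb_eval[OF z h]
    by (rule sym, rule tsum_cong[OF mC mC mTA _ _ comult_closed[OF h]],
      rule bilinI[OF bilin_r[OF tens_bilin[OF mA mC] L_closed[OF z]] lin_comp[OF bilin_l[OF tens_bilin[OF mA mC]] L_lin[OF z]]])
      (simp_all add: Lam_pure ec smash_eq a epsA_emb z)
  finally show "Lam (kappa (tens R A H a h)) = P (tens R A H a h)" by (simp add: P_pure a h smash_eq)
qed

lemma kappa_inA: "x \<in> carrier A \<Longrightarrow> kappa (inA x) = tens R CA H (inA x) \<one>\<^bsub>H\<^esub>"
  by (simp add: kappa_pure tsum_comult_one[OF tensor_module[OF mCA mC] kappa_trilin] one_CA)

lemma inA_CA: "x \<in> carrier A \<Longrightarrow> inA x \<in> carrier CA"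
  using smash_CA[of x "\<one>\<^bsub>H\<^esub>"] by (simp add: one_CA)

end

section \<open>Crossed products as cleft extensions\<close>

text \<open>\<open>v\<close> is the inverse of \<omega> provided by the symmetry axiom. Statements
  about A # H are carried to B by \<open>psi\<close>, the inverse of \<phi>.\<close>

locale crossed_iso = crossed_alg R H A \<alpha> \<omega> + comodule_algebra R H B
  for R (structure) and H (structure) and A (structure) and \<alpha> and \<omega> and B (structure) +
  fixes \<phi> v
  assumes iso: "\<phi> \<in> comodule_algebra_isos R H B CP"
    and v_closed: "v \<in> carrier (L (L A))"
    and v_om: "v \<star>\<star> om = fA E \<star>\<star> mpb E"
    and om_cocycle: "flp (post (\<lambda>y. flp (post ac y)) om) \<star>\<star>\<star> post mpb om = post (post (cst A)) om \<star>\<star>\<star> mpb om"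
    and E1_central: "\<And>y. y \<in> carrier (L (L A)) \<Longrightarrow> fA E \<star>\<star> y = y \<star>\<star> fA E"
    and E2_central: "\<And>y. y \<in> carrier (L (L A)) \<Longrightarrow> mpb E \<star>\<star> y = y \<star>\<star> mpb E"
    and ac_ac_E: "flp (post ac E) = fA E \<star>\<star> mpb E"
begin

interpretation TA: assoc_algebra R TA by (rule aTA)
interpretation LA: assoc_algebra R "L A" by (rule aLA)
interpretation LLA: assoc_algebra R "L (L A)" by (rule aLLA)

lemmas aB = B.assoc_algebra_axioms
lemmas mB = B.module_axioms
lemmas aLB = L_assoc_algebra[OF aB]

abbreviation "T \<equiv> tensor R B H"
abbreviation inB where "inB b \<equiv> tens R B H b \<one>\<^bsub>H\<^esub>"

lemmas aT = tensor_assoc_algebra[OF aB aH]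
lemmas mT = assoc_algebra_module[OF aT]
lemmas inB1 = post_hom[OF aB aT tens_left_hom[OF aB aH]]

definition "psi = inv_into (carrier B) \<phi>"

lemma phi: "\<phi> \<in> linear_maps R B CA" "bij_betw \<phi> (carrier B) (carrier CA)" "\<phi> \<one>\<^bsub>B\<^esub> = inA \<one>\<^bsub>A\<^esub>"
  "b \<in> carrier B \<Longrightarrow> b' \<in> carrier B \<Longrightarrow> \<phi> (b \<otimes>\<^bsub>B\<^esub> b') = crossed_mult (\<phi> b) (\<phi> b')"
  "b \<in> carrier B \<Longrightarrow> kappa (\<phi> b) = tsum TC (coaction B b) (\<lambda>x h. tens R CA H (\<phi> x) h)"
  using iso unfolding comodule_algebra_isos_def CP_tensor coaction_kappa CA_lin ring_iso_def ring_hom_def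
  by (auto simp: CP_carrier CP_simps(2,3) one_CA)

lemma psi: "c \<in> carrier CA \<Longrightarrow> psi c \<in> carrier B" "c \<in> carrier CA \<Longrightarrow> \<phi> (psi c) = c"
  "b \<in> carrier B \<Longrightarrow> psi (\<phi> b) = b"
  unfolding psi_def using bij_betwE[OF bij_betw_inv_into[OF phi(2)]]
  by (auto simp: bij_betw_inv_into_right[OF phi(2)] bij_betw_inv_into_left[OF phi(2)])

lemma psi_eq: "c \<in> carrier CA \<Longrightarrow> b \<in> carrier B \<Longrightarrow> c = \<phi> b \<Longrightarrow> psi c = b"
  by (simp add: psi)

lemma psi_lin: "psi \<in> linear_maps R CA B"
proof -
  interpret CA: module R CA by (rule mCA)
  show ?thesis
    by (rule linear_mapsI) (auto simp: psi lin_add[OF phi(1)] lin_smult[OF phi(1)] intro!: psi_eq)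
qed

lemma psi_mult: "s \<in> carrier CA \<Longrightarrow> t \<in> carrier CA \<Longrightarrow> psi (crossed_mult s t) = psi s \<otimes>\<^bsub>B\<^esub> psi t"
  using phi(4)[of "psi s" "psi t"] psi(3)[of "psi s \<otimes>\<^bsub>B\<^esub> psi t"] by (simp add: psi(1,2))

lemma Theta_bilin: "bilin R CA H T (\<lambda>c h. tens R B H (psi c) h)"
  by (rule bilinI[OF bilin_r[OF tens_bilin[OF mB mC] psi(1)] lin_comp[OF bilin_l[OF tens_bilin[OF mB mC]] psi_lin]])

lemma rho_psi:
  assumes c: "c \<in> carrier CA"
  shows "coaction B (psi c) = tsum T (kappa c) (\<lambda>c h. tens R B H (psi c) h)"
proof -
  note mTC = tensor_module[OF mCA mC]
  let ?b = "psi c"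
  have bi: "bilin R B H TC (\<lambda>x h. tens R CA H (\<phi> x) h)"
    by (rule bilinI[OF bilin_r[OF tens_bilin[OF mCA mC] lin_closed[OF phi(1)]] lin_comp[OF bilin_l[OF tens_bilin[OF mCA mC]] phi(1)]])
  have "tsum T (kappa c) (\<lambda>c h. tens R B H (psi c) h) =
      tsum T (coaction B ?b) (\<lambda>x h. tsum T (tens R CA H (\<phi> x) h) (\<lambda>c h. tens R B H (psi c) h))"
    using tsum_map[OF mB mC mTC mT bi tsum_lin[OF mCA mC mT Theta_bilin] coaction_closed[OF psi(1)[OF c]]]
    by (simp add: phi(5)[OF psi(1)[OF c], symmetric] psi(2) c)
  also have "\<dots> = tsum T (coaction B ?b) (tens R B H)"
    by (rule sym, rule tsum_cong[OF mB mC mT tens_bilin[OF mB mC] _ coaction_closed[OF psi(1)[OF c]]])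
      (simp add: tsum_pure[OF mCA mC mT Theta_bilin] lin_closed[OF phi(1)] psi(3))
  also have "\<dots> = coaction B ?b" by (rule tsum_tens_id[OF mB mC coaction_closed[OF psi(1)[OF c]]])
  finally show ?thesis by simp
qed

text \<open>Onto the coinvariants by \<open>iota_image\<close>, but in general not the inclusion,
  since \<phi> is not prescribed on A.\<close>

definition "iota x = psi (inA x)"
definition "gam = (\<lambda>h\<in>carrier H. psi (emb E h))"

lemma emb_E_CA: "h \<in> carrier H \<Longrightarrow> emb E h \<in> carrier CA"
  using smash_CA[OF A.one_closed] by (simp add: one_smash)

lemma gam_apply: "h \<in> carrier H \<Longrightarrow> gam h = psi (emb E h)"
  by (simp add: gam_def)

lemma gam_closed: "gam \<in> carrier (L B)"
proof -
  have "(\<lambda>h. psi (\<one>\<^bsub>A\<^esub> \<sharp> h)) \<in> linear_maps R H B"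
    by (rule lin_comp[OF psi_lin bilin_r[OF smash_CA_bilin A.one_closed]])
  from L_I[OF this] have "(\<lambda>h\<in>carrier H. psi (\<one>\<^bsub>A\<^esub> \<sharp> h)) \<in> carrier (L B)" .
  also have "(\<lambda>h\<in>carrier H. psi (\<one>\<^bsub>A\<^esub> \<sharp> h)) = gam"
    unfolding gam_def by (rule restrict_ext) (simp add: one_smash)
  finally show ?thesis .
qed

lemma iota_hom: "iota \<in> algebra_homs R A B"
proof (rule ahomI)
  have "inA \<in> linear_maps R A CA"
    by (rule linear_mapsI) (simp_all add: inA_CA CA_simps(5,6) lin_add[OF ahom_lin[OF inA_hom]] lin_smult[OF ahom_lin[OF inA_hom]])
  then show "iota \<in> linear_maps R A B" unfolding iota_def[abs_def] by (rule lin_comp[OF psi_lin])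
  show "iota (x \<otimes>\<^bsub>A\<^esub> y) = iota x \<otimes>\<^bsub>B\<^esub> iota y" if "x \<in> carrier A" "y \<in> carrier A" for x y
    using that by (simp add: iota_def psi_mult[symmetric] inA_CA crossed_left_one one_CA)
  show "iota \<one>\<^bsub>A\<^esub> = \<one>\<^bsub>B\<^esub>"
    using psi(3)[OF B.one_closed] by (simp add: iota_def phi(3))
qed

lemma psi_P_pure:
  assumes a: "a \<in> carrier A" and h: "h \<in> carrier H"
  shows "psi (P (tens R A H a h)) = iota a \<otimes>\<^bsub>B\<^esub> gam h"
  using a h by (simp add: P_pure iota_def gam_apply psi_mult[symmetric] inA_CA emb_E_CA crossed_left_emb)

lemma psi_P_lin: "(\<lambda>t. psi (P t)) \<in> linear_maps R TA B"
  by (rule lin_comp[OF psi_lin P_CA])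

lemma psi_emb: "y \<in> carrier (L A) \<Longrightarrow> h \<in> carrier H \<Longrightarrow> psi (P (emb y h)) = (post iota y \<otimes>\<^bsub>L B\<^esub> gam) h"
  by (rule emb_map[where F = "\<lambda>t. psi (P t)", OF aB ahom_lin[OF iota_hom] gam_closed psi_P_lin psi_P_pure])

lemma psi_emb2: "y \<in> carrier (L (L A)) \<Longrightarrow> h \<in> carrier H \<Longrightarrow> l \<in> carrier H \<Longrightarrow>
    psi (P (emb2 y h l)) = (post (post iota) y \<otimes>\<^bsub>L (L B)\<^esub> mpb gam) h l"
  by (rule emb2_map[where F = "\<lambda>t. psi (P t)", OF aB ahom_lin[OF iota_hom] gam_closed psi_P_lin psi_P_pure])

lemma psi_emb':
  assumes "y \<in> carrier (L A)" "h \<in> carrier H" "y \<star> E = y"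
  shows "psi (emb y h) = (post iota y \<otimes>\<^bsub>L B\<^esub> gam) h"
  using psi_emb[OF assms(1,2)] by (simp add: P_emb assms)

lemma gam_iota:
  assumes x: "x \<in> carrier A"
  shows "gam \<otimes>\<^bsub>L B\<^esub> cst B (iota x) = post iota (ac x) \<otimes>\<^bsub>L B\<^esub> gam"
proof (rule L_eqI[where X = B])
  note ix = ahom_closed[OF iota_hom x]
  note ia = post_closed[OF ahom_lin[OF iota_hom] ac_closed[OF x]]
  show "gam \<otimes>\<^bsub>L B\<^esub> cst B (iota x) \<in> carrier (L B)" by (rule L_mult_closed[OF aB gam_closed cst_closed[OF mB ix]])
  show "post iota (ac x) \<otimes>\<^bsub>L B\<^esub> gam \<in> carrier (L B)" by (rule L_mult_closed[OF aB ia gam_closed])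
  fix h assume h: "h \<in> carrier H"
  have "(gam \<otimes>\<^bsub>L B\<^esub> cst B (iota x)) h = psi (emb E h) \<otimes>\<^bsub>B\<^esub> psi (inA x)"
    unfolding cst_mult_apply(2)[OF aB ix gam_closed h] by (simp add: gam_apply h iota_def)
  also have "\<dots> = psi (emb (ac x) h)"
    by (simp add: psi_mult[symmetric] emb_E_CA inA_CA h x crossed_emb_right E_closed ac_E)
  also have "\<dots> = (post iota (ac x) \<otimes>\<^bsub>L B\<^esub> gam) h"
    by (rule psi_emb'[OF ac_closed[OF x] h ac_E(1)[OF x]])
  finally show "(gam \<otimes>\<^bsub>L B\<^esub> cst B (iota x)) h = (post iota (ac x) \<otimes>\<^bsub>L B\<^esub> gam) h" .
qed

lemma gam_gam: "post (cst B) gam \<otimes>\<^bsub>L (L B)\<^esub> cst (L B) gam = post (post iota) om \<otimes>\<^bsub>L (L B)\<^esub> mpb gam"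
proof (rule LL_eqI[where X = B])
  note fg = post_closed[OF ahom_lin[OF cst_hom[OF aB]] gam_closed]
  note io = post_closed[OF post_linear[OF aA aB ahom_lin[OF iota_hom]] om_closed]
  show "post (cst B) gam \<otimes>\<^bsub>L (L B)\<^esub> cst (L B) gam \<in> carrier (L (L B))"
    by (rule L_mult_closed[OF aLB fg cst_closed[OF assoc_algebra_module[OF aLB] gam_closed]])
  show "post (post iota) om \<otimes>\<^bsub>L (L B)\<^esub> mpb gam \<in> carrier (L (L B))"
    by (rule L_mult_closed[OF aLB io mpb_closed[OF gam_closed]])
  fix h k assume h: "h \<in> carrier H" and k: "k \<in> carrier H"
  have "(post (cst B) gam \<otimes>\<^bsub>L (L B)\<^esub> cst (L B) gam) h k = gam h \<otimes>\<^bsub>B\<^esub> gam k"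
    by (simp add: cst_mult_apply(2)[OF aLB gam_closed fg h] post_apply h
        cst_mult_apply(1)[OF aB L_closed[OF gam_closed h] gam_closed k])
  also have "\<dots> = psi (emb2 om h k)"
    by (simp add: gam_apply h k psi_mult[symmetric] emb_E_CA crossed_emb_emb)
  also have "\<dots> = (post (post iota) om \<otimes>\<^bsub>L (L B)\<^esub> mpb gam) h k"
    using psi_emb2[OF om_closed h k] by (simp add: P_emb2 om_closed h k om_f2)
  finally show "(post (cst B) gam \<otimes>\<^bsub>L (L B)\<^esub> cst (L B) gam) h k = (post (post iota) om \<otimes>\<^bsub>L (L B)\<^esub> mpb gam) h k" .
qed

lemma E_gam: "post iota E \<otimes>\<^bsub>L B\<^esub> gam = gam"
proof (rule L_eqI[where X = B, OF L_mult_closed[OF aB post_closed[OF ahom_lin[OF iota_hom] E_closed] gam_closed] gam_closed])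
  fix h assume h: "h \<in> carrier H"
  show "(post iota E \<otimes>\<^bsub>L B\<^esub> gam) h = gam h"
    using psi_emb'[OF E_closed h E_E] by (simp add: gam_apply h)
qed

lemma gam_one: "gam \<one>\<^bsub>H\<^esub> = \<one>\<^bsub>B\<^esub>"
  using ahom_one[OF iota_hom] one_smash[OF one_closed] by (simp add: gam_apply iota_def one_CA)

lemma rho_gam: "post (coaction B) gam = post inB gam \<otimes>\<^bsub>L T\<^esub> post (tens R B H \<one>\<^bsub>B\<^esub>) idH"
proof (rule L_eqI[where X = T])
  note ig = ahom_closed[OF inB1 gam_closed]
  note j = post_closed[OF ahom_lin[OF tens_right_hom[OF aB aH]] idH_closed]
  show "post (coaction B) gam \<in> carrier (L T)" by (rule post_closed[OF ahom_lin[OF coaction_hom] gam_closed])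
  show "post inB gam \<otimes>\<^bsub>L T\<^esub> post (tens R B H \<one>\<^bsub>B\<^esub>) idH \<in> carrier (L T)" by (rule L_mult_closed[OF aT ig j])
  fix h assume h: "h \<in> carrier H"
  note mTC = tensor_module[OF mCA mC]
  have bi: "bilin R H H TC (\<lambda>h1 h2. tens R CA H (emb E h1) h2)"
    by (rule iffD1[OF bilin_cong[OF mC mC] kappa_trilin[OF A.one_closed]]) (simp add: one_smash)
  have "coaction B (gam h) = tsum T (kappa (emb E h)) (\<lambda>c h. tens R B H (psi c) h)"
    by (simp add: gam_apply h rho_psi emb_E_CA)
  also have "\<dots> = tsum T (comult H h) (\<lambda>h1 h2. tsum T (tens R CA H (emb E h1) h2) (\<lambda>c h. tens R B H (psi c) h))"
    unfolding kappa_emb[OF E_closed h] E_E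
    by (rule tsum_map[OF mC mC mTC mT bi tsum_lin[OF mCA mC mT Theta_bilin] comult_closed[OF h]])
  also have "\<dots> = (post inB gam \<otimes>\<^bsub>L T\<^esub> post (tens R B H \<one>\<^bsub>B\<^esub>) idH) h"
    unfolding L_mult[OF h, where X = T]
    by (rule sym, rule tsum_cong[OF mC mC mT L_bilin[OF aT ig j] _ comult_closed[OF h]])
      (simp add: tsum_pure[OF mCA mC mT Theta_bilin] emb_E_CA post_apply tensor_mult_tens[OF aB aH] gam_apply psi(1))
  finally show "post (coaction B) gam h = (post inB gam \<otimes>\<^bsub>L T\<^esub> post (tens R B H \<one>\<^bsub>B\<^esub>) idH) h"
    by (simp add: post_apply h)
qed

lemma iota_inj: "inj_on iota (carrier A)"
proof (rule inj_onI)
  fix x y assume x: "x \<in> carrier A" and y: "y \<in> carrier A" and eq: "iota x = iota y"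
  have inv: "epsA (\<phi> (iota z)) = z" if "z \<in> carrier A" for z
    using that by (simp add: iota_def psi(2) inA_CA epsA_inA)
  show "x = y" using inv[OF x] inv[OF y] eq by argo
qed

text \<open>For coinvariant b the image c = \<phi>(b) has coaction c \<otimes> 1, and
  \<open>Lam\<close> then shows c = epsA(c) \<otimes> 1, the image of an element of A.\<close>

lemma iota_image: "iota ` carrier A = coinvariants R H B"
proof (intro equalityI subsetI)
  fix b assume "b \<in> iota ` carrier A"
  then obtain x where x: "x \<in> carrier A" "b = iota x" by blast
  note c = inA_CA[OF x(1)]
  have "coaction B (psi (inA x)) = inB (psi (inA x))"
    unfolding rho_psi[OF c] kappa_inA[OF x(1)] by (rule tsum_pure[OF mCA mC mT Theta_bilin c one_closed])
  then show "b \<in> coinvariants R H B"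
    using psi(1)[OF c] x(2) by (simp add: coinvariants_def iota_def)
next
  fix b assume "b \<in> coinvariants R H B"
  then have b: "b \<in> carrier B" "coaction B b = inB b" by (auto simp: coinvariants_def)
  note c = lin_closed[OF phi(1) b(1)]
  have bi: "bilin R B H TC (\<lambda>x h. tens R CA H (\<phi> x) h)"
    by (rule bilinI[OF bilin_r[OF tens_bilin[OF mCA mC] lin_closed[OF phi(1)]] lin_comp[OF bilin_l[OF tens_bilin[OF mCA mC]] phi(1)]])
  have "kappa (\<phi> b) = tens R CA H (\<phi> b) \<one>\<^bsub>H\<^esub>"
    using b by (simp add: phi(5) tsum_pure[OF mB mC tensor_module[OF mCA mC] bi])
  then have "\<phi> b = inA (epsA (\<phi> b))"
    using Lam_kappa[of "\<phi> b"] c by (simp add: Lam_pure CA_iff)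
  then have "b = iota (epsA (\<phi> b))" using psi(3)[OF b(1)] by (simp add: iota_def)
  then show "b \<in> iota ` carrier A" using lin_closed[OF epsA_CA c] by blast
qed

lemma spanning:
  assumes b: "b \<in> carrier B"
  shows "\<exists>s\<in>carrier TA. b = tsum B s (\<lambda>x h. iota x \<otimes>\<^bsub>B\<^esub> gam h)"
proof -
  note c = lin_closed[OF phi(1) b]
  have cT: "\<phi> b \<in> carrier TA" "P (\<phi> b) = \<phi> b" using c by (simp_all add: CA_iff)
  have bi: "bilin R A H B (\<lambda>x h. iota x \<otimes>\<^bsub>B\<^esub> gam h)" by (rule bilin_mult[OF aB ahom_lin[OF iota_hom] L_lin[OF gam_closed]])
  have "psi (P (\<phi> b)) = tsum B (\<phi> b) (\<lambda>x h. iota x \<otimes>\<^bsub>B\<^esub> gam h)"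
    by (rule tensor_lin_eqI[OF mA mC mB psi_P_lin tsum_lin[OF mA mC mB bi] _ cT(1)])
      (simp add: psi_P_pure tsum_pure[OF mA mC mB bi])
  then show ?thesis using cT psi(3)[OF b] by auto
qed

text \<open>The choice of \<open>v\<close> records only that it inverts \<omega>. Multiplication by
  f1 * f2 makes it absorb f2 as well; it remains an inverse because f1 * f2 * \<omega> =
  \<omega>.\<close>

theorem crossed_data: "crossed_data R H B A iota ac om (v \<star>\<star> (fA E \<star>\<star> mpb E)) gam"
proof -
  note c = E_cs v_closed om_closed
  have EE: "fA E \<star>\<star> fA E = fA E" "mpb E \<star>\<star> mpb E = mpb E"
    using E_E by (simp_all add: ahom_mult[OF fA_hom, symmetric] ahom_mult[OF mpbA, symmetric] E_closed)
  have fom: "(fA E \<star>\<star> mpb E) \<star>\<star> om = om" using om_twisted by (simp add: ac_ac_E)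
  show ?thesis
  proof (unfold_locales)
    show "v \<star>\<star> (fA E \<star>\<star> mpb E) \<star>\<star> om = fA E \<star>\<star> mpb E"
      using fom v_om by (simp add: LLA.m_assoc c)
    show "v \<star>\<star> (fA E \<star>\<star> mpb E) \<star>\<star> mpb E = v \<star>\<star> (fA E \<star>\<star> mpb E)"
      using EE by (simp add: LLA.m_assoc c)
    show "v \<star>\<star> (fA E \<star>\<star> mpb E) \<in> carrier (L (L A))" by (simp add: c)
    show "ac (x \<otimes>\<^bsub>A\<^esub> y) = ac x \<star> ac y" if "x \<in> carrier A" "y \<in> carrier A" for x y by (rule ac_mult[OF that])
    show "ac x \<one>\<^bsub>H\<^esub> = x" if "x \<in> carrier A" for x by (rule ac_one[OF that])
  qed (fact iota_hom iota_inj iota_image ac_lin om_closed gam_closed om_one om_one' om_twisted om_cocycle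
      E1_central E2_central ac_ac_E gam_iota gam_gam E_gam gam_one rho_gam spanning)+
qed

end

section \<open>The coinvariants as an algebra\<close>

context comodule_algebra
begin

abbreviation "A0 \<equiv> subalgebra_on B (coinvariants R H B)"

lemma A0_simps: "carrier A0 = coinvariants R H B" "mult A0 = mult B" "one A0 = \<one>\<^bsub>B\<^esub>" "zero A0 = \<zero>\<^bsub>B\<^esub>"
  "add A0 = add B" "smult A0 = smult B"
  by (simp_all add: subalgebra_on_def module.defs)

lemma A0_iff: "x \<in> carrier A0 \<longleftrightarrow> x \<in> carrier B \<and> coaction B x = tens R B H x \<one>\<^bsub>H\<^esub>"
  by (subst A0_simps) (simp add: coinvariants_def)

lemma coinvariants_A0: "x \<in> coinvariants R H B \<longleftrightarrow> x \<in> carrier A0"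
  by (simp add: A0_simps)

lemma A0_alg: "assoc_algebra R A0"
proof -
  note aB = B.assoc_algebra_axioms and mB = B.module_axioms
  note aT = tensor_assoc_algebra[OF aB aH]
  interpret T: assoc_algebra R "tensor R B H" by (rule aT)
  note rho = coaction_hom and inB = tens_left_hom[OF aB aH]
  note iff = A0_iff
  have ab: "abelian_group A0"
  proof (rule abelian_groupI)
    fix x assume "x \<in> carrier A0"
    then have x: "x \<in> carrier B" "coaction B x = tens R B H x \<one>\<^bsub>H\<^esub>" by (simp_all add: iff)
    have "f (\<ominus>\<^bsub>B\<^esub> x) = \<ominus>\<^bsub>tensor R B H\<^esub> f x" if "f \<in> algebra_homs R B (tensor R B H)" for f
      by (rule additive_minus[OF B.abelian_group_axioms T.abelian_group_axioms lin_closed[OF ahom_lin[OF that]] lin_add[OF ahom_lin[OF that]] x(1)])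
    from this[OF rho] this[OF inB] have "\<ominus>\<^bsub>B\<^esub> x \<in> carrier A0" using x by (simp add: iff)
    moreover have "\<ominus>\<^bsub>B\<^esub> x \<oplus>\<^bsub>A0\<^esub> x = \<zero>\<^bsub>A0\<^esub>" using x by (simp add: A0_simps B.l_neg)
    ultimately show "\<exists>y\<in>carrier A0. y \<oplus>\<^bsub>A0\<^esub> x = \<zero>\<^bsub>A0\<^esub>" by blast
  next
    have "f \<zero>\<^bsub>B\<^esub> = \<zero>\<^bsub>tensor R B H\<^esub>" if "f \<in> algebra_homs R B (tensor R B H)" for f
      by (rule additive_zero[OF B.abelian_group_axioms T.abelian_group_axioms lin_closed[OF ahom_lin[OF that]] lin_add[OF ahom_lin[OF that]]])
    from this[OF rho] this[OF inB] show "\<zero>\<^bsub>A0\<^esub> \<in> carrier A0" unfolding iff by (simp add: A0_simps)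
  qed (auto simp: iff A0_simps(2-) lin_add[OF ahom_lin[OF rho]] lin_add[OF ahom_lin[OF inB]] B.a_ac)
  have mon: "monoid A0"
    by (rule monoidI) (auto simp: iff A0_simps(2-) ahom_mult[OF rho] ahom_mult[OF inB] ahom_one[OF rho] ahom_one[OF inB] B.m_assoc)
  have ring: "ring A0"
    by (rule ringI[OF ab mon]) (auto simp: iff A0_simps(2-) B.l_distr B.r_distr)
  have mod: "module R A0"
    by (rule moduleI[OF R.cring_axioms ab])
      (auto simp: iff A0_simps(2-) lin_smult[OF ahom_lin[OF rho]] lin_smult[OF ahom_lin[OF inB]]
        B.smult_l_distr B.smult_r_distr B.smult_assoc1)
  show ?thesis
    by (intro assoc_algebra.intro assoc_algebra_axioms.intro mod ring)
      (auto simp: iff A0_simps(2-) B.smult_mult_left B.smult_mult_right)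
qed

lemma A0_incl: "(\<lambda>x. x) \<in> algebra_homs R A0 B"
  by (rule ahomI, rule linear_mapsI) (auto simp: A0_iff A0_simps(2-))

lemma A0_extension: "coinvariant_extension R H B A0 (\<lambda>x. x)"
  by (intro coinvariant_extension.intro coinvariant_extension_axioms.intro comodule_algebra_axioms A0_alg A0_incl)
    (auto simp: A0_simps)

end

section \<open>Translation of partial cleftness into words\<close>

context coinvariant_extension
begin

interpretation B: assoc_algebra R B by (rule aB)
interpretation LB: assoc_algebra R "L B" by (rule aLB)
interpretation LT: assoc_algebra R "L T" by (rule aLT)
interpretation LLB: assoc_algebra R "L (L B)" by (rule aLLB)

lemma iota_A0: "\<iota> \<in> linear_maps R A A0"
  using iota_image by (auto intro!: linear_mapsI simp: A0_simps lin_add[OF ahom_lin[OF iota_hom]] lin_smult[OF ahom_lin[OF iota_hom]])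

text \<open>The values of g are coinvariant, so g factors through \<iota> by
  \<open>coinvariant2\<close>. A and the subalgebra of coinvariants therefore yield the same
  functions into B.\<close>

lemma LLA0_image: "g \<in> carrier (L (L A0)) \<longleftrightarrow> (\<exists>z\<in>carrier (L (L A)). g = post (post \<iota>) z)"
proof
  assume g: "g \<in> carrier (L (L A0))"
  note i1 = post_hom[OF A0_alg aB A0_incl]
  note i2 = post_hom[OF L_assoc_algebra[OF A0_alg] aLB i1]
  have gB: "g \<in> carrier (L (L B))"
  proof -
    have "post (post (\<lambda>x. x)) g = g"
      by (rule LL_eqI[where X = A0, OF post_closed[OF _ g] g]) (auto simp: post_apply post_linear[OF A0_alg A0_alg lin_id])
    then show ?thesis using ahom_closed[OF i2 g] by simp
  qed
  have "post (post (coaction B)) g = post (post inB) g"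
  proof (rule LL_eqI[where X = T, OF ahom_closed[OF rho2 gB] ahom_closed[OF inB2 gB]])
    fix h k assume "h \<in> carrier H" "k \<in> carrier H"
    then show "post (post (coaction B)) g h k = post (post inB) g h k"
      using L_closed[OF L_closed[OF g]] by (simp add: post_apply A0_iff)
  qed
  from coinvariant2[OF gB this] show "\<exists>z\<in>carrier (L (L A)). g = post (post \<iota>) z" by blast
next
  assume "\<exists>z\<in>carrier (L (L A)). g = post (post \<iota>) z"
  then show "g \<in> carrier (L (L A0))"
    using post_closed[OF post_linear[OF aA A0_alg iota_A0]] by blast
qed

lemma LLA0_mult:
  assumes f: "f \<in> carrier (L (L A0))" and g: "g \<in> carrier (L (L A0))"
  shows "f \<otimes>\<^bsub>L (L A0)\<^esub> g = f \<bullet>\<bullet> g"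
proof -
  note i1 = post_hom[OF A0_alg aB A0_incl]
  note i2 = post_hom[OF L_assoc_algebra[OF A0_alg] aLB i1]
  have id: "post (post (\<lambda>x. x)) z = z" if "z \<in> carrier (L (L A0))" for z
    by (rule LL_eqI[where X = A0, OF post_closed[OF post_linear[OF A0_alg A0_alg lin_id] that] that]) (auto simp: post_apply)
  show ?thesis
    using ahom_mult[OF i2 f g] by (simp add: id f g L_mult_closed[OF L_assoc_algebra[OF A0_alg]])
qed

text \<open>\<open>e0\<close> is the unrestricted convolution of the definition, and its composite
  with multiplication is \<open>mpb e\<close> uncurried. Centrality in Hom(H \<otimes> H, A) becomes
  commutation, inside L (L B), with the image of L (L A) under any chosen embedding.\<close>

lemma center_iff:
  assumes e: "e \<in> carrier (L A0)" and e0: "\<And>h. h \<in> carrier H \<Longrightarrow> e h = e0 h"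
  shows "(\<lambda>t\<in>carrier TH. e0 (tsum H t (\<lambda>h k. h \<otimes>\<^bsub>H\<^esub> k))) \<in> ring_center (conv_algebra R HH A0) \<longleftrightarrow>
    (\<forall>z\<in>carrier (L (L A)). mpb e \<bullet>\<bullet> post (post \<iota>) z = post (post \<iota>) z \<bullet>\<bullet> mpb e)"
proof -
  note mA0 = assoc_algebra_module[OF A0_alg]
  note me = mpb_closed[OF e]
  have mb: "bilin R H H H (\<lambda>h k. h \<otimes>\<^bsub>H\<^esub> k)" by (rule bilin_mult[OF aH lin_id lin_id])
  have "(\<lambda>t\<in>carrier TH. e0 (tsum H t (\<lambda>h k. h \<otimes>\<^bsub>H\<^esub> k))) = uncurry A0 (mpb e)"
    unfolding uncurry_def
  proof (rule restrict_ext)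
    fix t assume t: "t \<in> carrier TH"
    have "e (tsum H t (\<lambda>h k. h \<otimes>\<^bsub>H\<^esub> k)) = tsum A0 t (mpb e)"
      by (rule tensor_lin_eqI[OF mC mC mA0 lin_comp[OF L_lin[OF e] tsum_lin[OF mC mC mC mb]] tsum_lin[OF mC mC mA0 LL_bilin[OF me]] _ t])
        (simp add: tsum_pure[OF mC mC mC mb] tsum_pure[OF mC mC mA0 LL_bilin[OF me]] mpb_apply)
    then show "e0 (tsum H t (\<lambda>h k. h \<otimes>\<^bsub>H\<^esub> k)) = tsum A0 t (mpb e)"
      by (simp add: e0[symmetric] tsum_closed[OF mC mC mC mb t])
  qed
  moreover have "(\<forall>g\<in>carrier (L (L A0)). Q g) \<longleftrightarrow> (\<forall>z\<in>carrier (L (L A)). Q (post (post \<iota>) z))" for Q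
    by (metis LLA0_image)
  ultimately show ?thesis
    by (simp add: ring_center_uncurry[OF A0_alg me] LLA0_mult me)
qed

lemma L_A0: "f \<in> carrier (L A0) \<longleftrightarrow> f \<in> carrier (L B) \<and> (\<forall>h\<in>carrier H. f h \<in> coinvariants R H B)"
  unfolding coinvariants_A0 using A0_iff by (auto simp: conv_algebra_def linear_maps_def A0_simps(2-) Pi_iff)

lemma fs_mult_apply:
  assumes f: "f \<in> carrier (L B)" and g: "g \<in> carrier (L B)" and h: "h \<in> carrier H" and k: "k \<in> carrier H"
  shows "(post (cst B) f \<bullet>\<bullet> cst (L B) g) h k = f h \<otimes>\<^bsub>B\<^esub> g k" "(cst (L B) g \<bullet>\<bullet> post (cst B) f) h k = g k \<otimes>\<^bsub>B\<^esub> f h"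
  using post_closed[OF ahom_lin[OF cst_hom[OF aB]] f]
  by (simp_all add: cst_mult_apply[OF aLB g _ h] post_apply h cst_mult_apply[OF aB L_closed[OF f h] g k])

context
  fixes g0 g1
  assumes g0: "g0 \<in> linear_maps R H B" and g1: "g1 \<in> linear_maps R H B"
begin

text \<open>Partial cleftness quantifies over linear maps with arbitrary values outside H. Elements
  of L B are extensional, hence the restriction.\<close>

abbreviation (input) "c \<equiv> restrict g0 (carrier H)"
abbreviation (input) "d \<equiv> restrict g1 (carrier H)"
abbreviation (input) "e0 \<equiv> convolution H B g0 g1"
abbreviation (input) "t0 \<equiv> convolution H B g1 g0"

lemma cd: "c \<in> carrier (L B)" "d \<in> carrier (L B)"
  by (rule L_I[OF g0], rule L_I[OF g1])

lemma cd_e: "h \<in> carrier H \<Longrightarrow> (c \<bullet> d) h = e0 h" "h \<in> carrier H \<Longrightarrow> (d \<bullet> c) h = t0 h"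
  unfolding L_mult convolution_def
  by (rule tsum_cong[OF mC mC mB L_bilin[OF aB cd]], simp, simp)
    (rule tsum_cong[OF mC mC mB L_bilin[OF aB cd(2,1)]], simp, simp)

lemma cd_closed: "c \<bullet> d \<in> carrier (L B)" "d \<bullet> c \<in> carrier (L B)"
  using cd by simp_all

lemma rho_c_iff: "(\<forall>h\<in>carrier H. coaction B (g0 h) = tsum T (comult H h) (\<lambda>h1 h2. tens R B H (g0 h1) h2)) \<longleftrightarrow>
    post (coaction B) c = post inB c \<otimes>\<^bsub>L T\<^esub> jH"
proof -
  note ic = ahom_closed[OF inB1 cd(1)]
  have "(post inB c \<otimes>\<^bsub>L T\<^esub> jH) h = tsum T (comult H h) (\<lambda>h1 h2. tens R B H (g0 h1) h2)" if "h \<in> carrier H" for h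
    by (rule L_mult_eval[OF aT ic jH_closed that]) (simp add: post_apply tensor_mult_tens[OF aB aH] lin_closed[OF g0])
  then show ?thesis
    by (subst L_eq_iff[OF ahom_closed[OF rho1 cd(1)] L_mult_closed[OF aT ic jH_closed]]) (simp add: post_apply)
qed

lemma rho_d_iff: "(\<forall>h\<in>carrier H. coaction B (g1 h) = tsum T (comult H h) (\<lambda>h1 h2. tens R B H (g1 h2) (antipode H h1))) \<longleftrightarrow>
    post (coaction B) d = preL jH \<otimes>\<^bsub>L T\<^esub> post inB d"
proof -
  note id = ahom_closed[OF inB1 cd(2)] and p = preL_closed[OF jH_closed]
  have "(preL jH \<otimes>\<^bsub>L T\<^esub> post inB d) h = tsum T (comult H h) (\<lambda>h1 h2. tens R B H (g1 h2) (antipode H h1))" if "h \<in> carrier H" for h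
    by (rule L_mult_eval[OF aT p id that]) (simp add: post_apply preL_apply tensor_mult_tens[OF aB aH] lin_closed[OF g1])
  then show ?thesis
    by (subst L_eq_iff[OF ahom_closed[OF rho1 cd(2)] L_mult_closed[OF aT p id]]) (simp add: post_apply)
qed

lemma contract_iff: "(\<forall>b\<in>carrier B. tsum B (coaction B b)
        (\<lambda>b0 x. tsum B (comult H x) (\<lambda>b1 b2. b0 \<otimes>\<^bsub>B\<^esub> g1 b1 \<otimes>\<^bsub>B\<^esub> g0 b2)) = b) \<longleftrightarrow>
    (\<forall>b\<in>carrier B. contract (d \<bullet> c) (coaction B b) = b)"
proof -
  have "contract (d \<bullet> c) (coaction B b) = tsum B (coaction B b)
        (\<lambda>b0 x. tsum B (comult H x) (\<lambda>b1 b2. b0 \<otimes>\<^bsub>B\<^esub> g1 b1 \<otimes>\<^bsub>B\<^esub> g0 b2))" if b: "b \<in> carrier B" for b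
    unfolding contract_def
  proof (rule tsum_cong[OF mB mC mB bilin_mult[OF aB lin_id L_lin[OF cd_closed(2)]] _ coaction_closed[OF b]])
    fix x h assume x: "x \<in> carrier B" and h: "h \<in> carrier H"
    show "x \<otimes>\<^bsub>B\<^esub> (d \<bullet> c) h = tsum B (comult H h) (\<lambda>b1 b2. x \<otimes>\<^bsub>B\<^esub> g1 b1 \<otimes>\<^bsub>B\<^esub> g0 b2)"
      by (rule L_mult_map[OF aB mB lin_mult_left[OF aB x lin_id] cd(2,1) h])
        (simp add: x lin_closed[OF g0] lin_closed[OF g1] B.m_assoc)
  qed
  then show ?thesis by simp
qed

lemma g_E2_iff: "(\<forall>h\<in>carrier H. \<forall>k\<in>carrier H.
        g0 h \<otimes>\<^bsub>B\<^esub> e0 k = tsum B (comult H h) (\<lambda>h1 h2. e0 (h1 \<otimes>\<^bsub>H\<^esub> k) \<otimes>\<^bsub>B\<^esub> g0 h2)) \<longleftrightarrow>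
    post (cst B) c \<bullet>\<bullet> cst (L B) (c \<bullet> d) = mpb (c \<bullet> d) \<bullet>\<bullet> post (cst B) c"
proof -
  note fc = post_closed[OF ahom_lin[OF cst_hom[OF aB]] cd(1)] and se = cst_closed[OF mLB cd_closed(1)] and me = mpb_closed[OF cd_closed(1)]
  have r: "(mpb (c \<bullet> d) \<bullet>\<bullet> post (cst B) c) h k = tsum B (comult H h) (\<lambda>h1 h2. e0 (h1 \<otimes>\<^bsub>H\<^esub> k) \<otimes>\<^bsub>B\<^esub> g0 h2)"
    if h: "h \<in> carrier H" and k: "k \<in> carrier H" for h k
    unfolding post_cst_mult_apply(2)[OF aB cd(1) me h k]
    by (rule tsum_cong[OF mC mC mB bilin_mult[OF aB bilin_l[OF LL_bilin[OF me] k] L_lin[OF cd(1)]] _ comult_closed[OF h]])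
      (simp add: mpb_apply k cd_e)
  show ?thesis
    by (subst LL_eq_iff[OF LLB.m_closed[OF fc se] LLB.m_closed[OF me fc]])
      (simp add: r fs_mult_apply[OF cd(1) cd_closed(1)] cd_e)
qed

lemma g'_t1_iff: "(\<forall>h\<in>carrier H. \<forall>k\<in>carrier H.
        g1 k \<otimes>\<^bsub>B\<^esub> t0 h = tsum B (comult H k) (\<lambda>k1 k2. t0 (h \<otimes>\<^bsub>H\<^esub> k1) \<otimes>\<^bsub>B\<^esub> g1 k2)) \<longleftrightarrow>
    cst (L B) d \<bullet>\<bullet> post (cst B) (d \<bullet> c) = mpb (d \<bullet> c) \<bullet>\<bullet> cst (L B) d"
proof -
  note ft = post_closed[OF ahom_lin[OF cst_hom[OF aB]] cd_closed(2)] and sd = cst_closed[OF mLB cd(2)] and mt = mpb_closed[OF cd_closed(2)]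
  have r: "(mpb (d \<bullet> c) \<bullet>\<bullet> cst (L B) d) h k = tsum B (comult H k) (\<lambda>k1 k2. t0 (h \<otimes>\<^bsub>H\<^esub> k1) \<otimes>\<^bsub>B\<^esub> g1 k2)"
    if h: "h \<in> carrier H" and k: "k \<in> carrier H" for h k
    unfolding cst_mult_apply(2)[OF aLB cd(2) mt h]
    by (rule L_mult_eval[OF aB L_closed[OF mt h] cd(2) k]) (simp add: mpb_apply h cd_e)
  show ?thesis
    by (subst LL_eq_iff[OF LLB.m_closed[OF sd ft] LLB.m_closed[OF mt sd]])
      (simp add: r fs_mult_apply[OF cd_closed(2) cd(2)] cd_e)
qed

lemma mg_t2_iff: "(\<forall>h\<in>carrier H. \<forall>k\<in>carrier H.
        tsum B (comult H k) (\<lambda>k1 k2. g0 (h \<otimes>\<^bsub>H\<^esub> k1) \<otimes>\<^bsub>B\<^esub> t0 k2) =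
        tsum B (comult H h) (\<lambda>h1 h2. e0 h1 \<otimes>\<^bsub>B\<^esub> g0 (h2 \<otimes>\<^bsub>H\<^esub> k))) \<longleftrightarrow>
    mpb c \<bullet>\<bullet> cst (L B) (d \<bullet> c) = post (cst B) (c \<bullet> d) \<bullet>\<bullet> mpb c"
proof -
  note fe = post_closed[OF ahom_lin[OF cst_hom[OF aB]] cd_closed(1)] and st = cst_closed[OF mLB cd_closed(2)] and mc = mpb_closed[OF cd(1)]
  have l: "(mpb c \<bullet>\<bullet> cst (L B) (d \<bullet> c)) h k = tsum B (comult H k) (\<lambda>k1 k2. g0 (h \<otimes>\<^bsub>H\<^esub> k1) \<otimes>\<^bsub>B\<^esub> t0 k2)"
    if h: "h \<in> carrier H" and k: "k \<in> carrier H" for h k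
    unfolding cst_mult_apply(2)[OF aLB cd_closed(2) mc h]
    by (rule L_mult_eval[OF aB L_closed[OF mc h] cd_closed(2) k]) (simp add: mpb_apply h cd_e)
  have r: "(post (cst B) (c \<bullet> d) \<bullet>\<bullet> mpb c) h k = tsum B (comult H h) (\<lambda>h1 h2. e0 h1 \<otimes>\<^bsub>B\<^esub> g0 (h2 \<otimes>\<^bsub>H\<^esub> k))"
    if h: "h \<in> carrier H" and k: "k \<in> carrier H" for h k
    unfolding post_cst_mult_apply(1)[OF aB cd_closed(1) mc h k]
    by (rule tsum_cong[OF mC mC mB bilin_mult[OF aB L_lin[OF cd_closed(1)] bilin_l[OF LL_bilin[OF mc] k]] _ comult_closed[OF h]])
      (simp add: mpb_apply k cd_e)
  show ?thesis
    by (subst LL_eq_iff[OF LLB.m_closed[OF mc st] LLB.m_closed[OF fe mc]]) (simp add: l r)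
qed

lemma t_iota_iff: "(\<forall>h\<in>carrier H. \<forall>a\<in>coinvariants R H B. t0 h \<otimes>\<^bsub>B\<^esub> a = a \<otimes>\<^bsub>B\<^esub> t0 h) \<longleftrightarrow>
    (\<forall>x\<in>carrier A. (d \<bullet> c) \<bullet> cst B (\<iota> x) = cst B (\<iota> x) \<bullet> (d \<bullet> c))"
proof -
  have "(d \<bullet> c) \<bullet> cst B (\<iota> x) = cst B (\<iota> x) \<bullet> (d \<bullet> c) \<longleftrightarrow> (\<forall>h\<in>carrier H. t0 h \<otimes>\<^bsub>B\<^esub> \<iota> x = \<iota> x \<otimes>\<^bsub>B\<^esub> t0 h)"
    if x: "x \<in> carrier A" for x
  proof -
    note ix = ahom_closed[OF iota_hom x] and tc = cd_closed(2)
    show ?thesis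
      by (subst L_eq_iff[OF LB.m_closed[OF tc cst_closed[OF mB ix]] LB.m_closed[OF cst_closed[OF mB ix] tc]])
        (simp add: cst_mult_apply[OF aB ix tc] cd_e)
  qed
  then show ?thesis unfolding iota_image[symmetric] by auto
qed

lemma center_cd_iff:
  assumes "\<And>h. h \<in> carrier H \<Longrightarrow> (c \<bullet> d) h \<in> coinvariants R H B"
  shows "(\<lambda>t\<in>carrier TH. e0 (tsum H t (\<lambda>h k. h \<otimes>\<^bsub>H\<^esub> k))) \<in> ring_center (conv_algebra R HH A0) \<longleftrightarrow>
    (\<forall>z\<in>carrier (L (L A)). mpb (c \<bullet> d) \<bullet>\<bullet> post (post \<iota>) z = post (post \<iota>) z \<bullet>\<bullet> mpb (c \<bullet> d))"
proof (rule center_iff[OF _ cd_e(1)])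
  show "c \<bullet> d \<in> carrier (L A0)" using cd_closed(1) assms by (simp add: L_A0)
qed

text \<open>Central elements of Hom(H \<otimes> H, A) are A-valued by definition. Evaluation at h
  \<otimes> 1 shows that (\<gamma> * \<gamma>')(h) is coinvariant.\<close>

lemma center_coinvariant:
  assumes "(\<lambda>t\<in>carrier TH. e0 (tsum H t (\<lambda>h k. h \<otimes>\<^bsub>H\<^esub> k))) \<in> ring_center (conv_algebra R HH A0)" and h: "h \<in> carrier H"
  shows "(c \<bullet> d) h \<in> coinvariants R H B"
proof -
  have mb: "bilin R H H H (\<lambda>h k. h \<otimes>\<^bsub>H\<^esub> k)" by (rule bilin_mult[OF aH lin_id lin_id])
  have "(\<lambda>t\<in>carrier TH. e0 (tsum H t (\<lambda>h k. h \<otimes>\<^bsub>H\<^esub> k))) \<in> linear_maps R TH A0"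
    using assms(1) by (simp add: ring_center_def conv_algebra_def HH_linear)
  from lin_closed[OF this tens_closed[OF mC mC h one_closed]] show ?thesis
    by (simp add: tens_closed[OF mC mC] h tsum_pure[OF mC mC mC mb] A0_simps cd_e)
qed

end

text \<open>The left side refers to the set of coinvariants, the right side to one embedding onto
  it. Existence of a cleaving pair thus does not depend on the embedding.\<close>

theorem partially_cleft_iff:
  "partially_cleft R H B (coinvariants R H B) \<longleftrightarrow> (\<exists>\<gamma> \<gamma>'. cleft_data R H B A \<iota> \<gamma> \<gamma>')"
proof
  assume "partially_cleft R H B (coinvariants R H B)"
  then obtain g0 g1 where g: "g0 \<in> linear_maps R H B" "g1 \<in> linear_maps R H B"
    and p: "g0 \<one>\<^bsub>H\<^esub> = \<one>\<^bsub>B\<^esub>"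
      "\<forall>h\<in>carrier H. coaction B (g0 h) = tsum T (comult H h) (\<lambda>h1 h2. tens R B H (g0 h1) h2)"
      "\<forall>h\<in>carrier H. coaction B (g1 h) = tsum T (comult H h) (\<lambda>h1 h2. tens R B H (g1 h2) (antipode H h1))"
      "(\<lambda>t\<in>carrier TH. convolution H B g0 g1 (tsum H t (\<lambda>h k. h \<otimes>\<^bsub>H\<^esub> k))) \<in> ring_center (conv_algebra R HH A0)"
      "\<forall>h\<in>carrier H. \<forall>a\<in>coinvariants R H B. convolution H B g1 g0 h \<otimes>\<^bsub>B\<^esub> a = a \<otimes>\<^bsub>B\<^esub> convolution H B g1 g0 h"
      "\<forall>b\<in>carrier B. tsum B (coaction B b)
        (\<lambda>b0 x. tsum B (comult H x) (\<lambda>b1 b2. b0 \<otimes>\<^bsub>B\<^esub> g1 b1 \<otimes>\<^bsub>B\<^esub> g0 b2)) = b"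
      "\<forall>h\<in>carrier H. \<forall>k\<in>carrier H.
        g0 h \<otimes>\<^bsub>B\<^esub> convolution H B g0 g1 k = tsum B (comult H h) (\<lambda>h1 h2. convolution H B g0 g1 (h1 \<otimes>\<^bsub>H\<^esub> k) \<otimes>\<^bsub>B\<^esub> g0 h2)"
      "\<forall>h\<in>carrier H. \<forall>k\<in>carrier H.
        g1 k \<otimes>\<^bsub>B\<^esub> convolution H B g1 g0 h = tsum B (comult H k) (\<lambda>k1 k2. convolution H B g1 g0 (h \<otimes>\<^bsub>H\<^esub> k1) \<otimes>\<^bsub>B\<^esub> g1 k2)"
      "\<forall>h\<in>carrier H. \<forall>k\<in>carrier H.
        tsum B (comult H k) (\<lambda>k1 k2. g0 (h \<otimes>\<^bsub>H\<^esub> k1) \<otimes>\<^bsub>B\<^esub> convolution H B g1 g0 k2) =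
        tsum B (comult H h) (\<lambda>h1 h2. convolution H B g0 g1 h1 \<otimes>\<^bsub>B\<^esub> g0 (h2 \<otimes>\<^bsub>H\<^esub> k))"
    unfolding partially_cleft_def Let_def by blast
  note q = p(1) iffD1[OF rho_c_iff[OF g] p(2)] iffD1[OF rho_d_iff[OF g] p(3)]
    iffD1[OF center_cd_iff[OF g center_coinvariant[OF g p(4)]] p(4)] iffD1[OF t_iota_iff[OF g] p(5)]
    iffD1[OF contract_iff[OF g] p(6)] iffD1[OF g_E2_iff[OF g] p(7)] iffD1[OF g'_t1_iff[OF g] p(8)] iffD1[OF mg_t2_iff[OF g] p(9)]
  have "cleft_data R H B A \<iota> (restrict g0 (carrier H)) (restrict g1 (carrier H))"
    by unfold_locales (use cd[OF g] q in auto)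
  then show "\<exists>\<gamma> \<gamma>'. cleft_data R H B A \<iota> \<gamma> \<gamma>'" by blast
next
  assume "\<exists>\<gamma> \<gamma>'. cleft_data R H B A \<iota> \<gamma> \<gamma>'"
  then obtain \<gamma> \<gamma>' where cl: "cleft_data R H B A \<iota> \<gamma> \<gamma>'" by blast
  interpret cleft: cleft_data R H B A \<iota> \<gamma> \<gamma>' by (rule cl)
  note g = L_lin[OF cleft.gamma_closed] L_lin[OF cleft.gamma'_closed]
  have r: "restrict \<gamma> (carrier H) = \<gamma>" "restrict \<gamma>' (carrier H) = \<gamma>'"
    using cleft.gamma_closed cleft.gamma'_closed by (auto simp: L_carrier extensional_restrict)
  have co: "(\<gamma> \<bullet> \<gamma>') h \<in> coinvariants R H B" if "h \<in> carrier H" for h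
    unfolding cleft.iE[symmetric] using that L_closed[OF cleft.E_closed that] iota_image by (auto simp: post_apply)
  note p = cleft.gamma_one iffD2[OF rho_c_iff[OF g, unfolded r] cleft.rho_gamma] iffD2[OF rho_d_iff[OF g, unfolded r] cleft.rho_gamma']
    iffD2[OF center_cd_iff[OF g, unfolded r, OF co] ballI[OF cleft.e12_central]] iffD2[OF t_iota_iff[OF g, unfolded r] ballI[OF cleft.t_iota]]
    iffD2[OF contract_iff[OF g, unfolded r] ballI[OF cleft.contract_rho]] iffD2[OF g_E2_iff[OF g, unfolded r] cleft.g_E2]
    iffD2[OF g'_t1_iff[OF g, unfolded r] cleft.g'_t1] iffD2[OF mg_t2_iff[OF g, unfolded r] cleft.mg_t2]
  show "partially_cleft R H B (coinvariants R H B)"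
    unfolding partially_cleft_def Let_def H_extension_def
    by (rule conjI[OF refl], rule bexI[OF _ g(1)], rule bexI[OF _ g(2)], intro conjI) (rule p; assumption)+
qed

end

section \<open>From a cleft extension to a symmetric action and its crossed product\<close>

context cleft_data
begin

interpretation LA: assoc_algebra R "L A" by (rule aLA)
interpretation LLA: assoc_algebra R "L (L A)" by (rule aLLA)

definition "alpha s = tsum A s (\<lambda>h x. act x h)"
definition "omega s = tsum A s w"

lemma alpha_bilin: "bilin R H A A (\<lambda>h x. act x h)"
  by (rule bilinI[OF lin_comp[OF L_ev act_lin] L_lin[OF act(1)]])

lemma twisted_alg: "twisted_alg R H A alpha omega"
proof (intro twisted_alg.intro twisted_alg_axioms.intro hopf_algebra_axioms aA)
  show "alpha \<in> linear_maps R (tensor R H A) A"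
    unfolding alpha_def[abs_def] by (rule tsum_lin[OF mC mA mA alpha_bilin])
  show "omega \<in> linear_maps R (tensor R H H) A"
    unfolding omega_def[abs_def] by (rule tsum_lin[OF mC mC mA LL_bilin[OF w(1)]])
qed

interpretation TW: twisted_alg R H A alpha omega by (rule twisted_alg)

lemma ac_eq: "x \<in> carrier A \<Longrightarrow> TW.ac x = act x"
  by (rule L_eqI[of _ A]) (simp_all add: TW.ac_closed act TW.ac_apply alpha_def tsum_pure[OF mC mA mA alpha_bilin])

lemma om_eq: "TW.om = w"
  by (rule LL_eqI[of _ A]) (simp_all add: TW.om_closed w TW.om_apply omega_def tsum_pure[OF mC mC mA LL_bilin[OF w(1)]])

lemma act1_eq: "y \<in> carrier (L A) \<Longrightarrow> flp (post TW.ac y) = act1 y"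
  by (simp add: post_cong[OF ac_eq])

lemma TW_twisted_partial_action: "TW.twisted_partial_action"
  unfolding TW.twisted_partial_action_iff om_eq
  by (simp add: ac_eq act_at_one act_mult act1_eq act(1) twisted w_f2)

lemma crossed: "cleft_crossed R H B A \<iota> \<gamma> \<gamma>' alpha omega"
proof -
  note one = ac_eq[OF A.one_closed] act1_eq[OF E_closed]
  have "crossed_alg R H A alpha omega"
  proof (intro crossed_alg.intro crossed_alg_axioms.intro twisted_alg, unfold om_eq one)
    show "TW.ac x \<one>\<^bsub>H\<^esub> = x" if "x \<in> carrier A" for x using that by (simp only: ac_eq act_at_one)
    show "TW.ac (x \<otimes>\<^bsub>A\<^esub> y) = TW.ac x \<otimes>\<^bsub>L A\<^esub> TW.ac y" if "x \<in> carrier A" "y \<in> carrier A" for x y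
      using that by (simp only: ac_eq act_mult A.m_closed)
    show "act1 E \<otimes>\<^bsub>L (L A)\<^esub> w = w" by (simp only: twisted[OF A.one_closed] w_f2)
  qed (fact w_one w_one' w_f2)+
  then show ?thesis
    by (intro cleft_crossed.intro cleft_crossed_axioms.intro cleft_data_axioms om_eq ac_eq)
qed

lemma symmetric: "TW.symmetric_twisted_partial_action"
proof -
  note c = E_cs w(1) w'(1)
  note one = ac_eq[OF A.one_closed] act1_eq[OF E_closed]
  have f: "w \<otimes>\<^bsub>L (L A)\<^esub> (fA E \<otimes>\<^bsub>L (L A)\<^esub> mpb E) = w" "w' \<otimes>\<^bsub>L (L A)\<^esub> (fA E \<otimes>\<^bsub>L (L A)\<^esub> mpb E) = w'"
    by (simp_all add: LLA.m_assoc[symmetric] c w_f1 w_f2 w'_f1 w'_f2)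
  have act2: "flp (post (\<lambda>y. flp (post TW.ac y)) w) = act2 w"
    by (rule arg_cong[where f = flp], rule post_cong[OF act1_eq w(1)])
  have centers: "\<forall>y\<in>carrier (L (L A)). fA E \<otimes>\<^bsub>L (L A)\<^esub> y = y \<otimes>\<^bsub>L (L A)\<^esub> fA E"
    "\<forall>y\<in>carrier (L (L A)). mpb E \<otimes>\<^bsub>L (L A)\<^esub> y = y \<otimes>\<^bsub>L (L A)\<^esub> mpb E"
    by (rule ballI, rule f1_central, assumption, rule ballI, rule f2_central, assumption)
  have norm: "\<forall>h\<in>carrier H. w h \<one>\<^bsub>H\<^esub> = E h"
    by (rule ballI, rule w_one')
  note ideal = TW.ideal_intro[of w', unfolded om_eq one, OF w'(1) f(2,1) w_w' w'_w]
  show ?thesis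
    unfolding TW.symmetric_twisted_partial_action_def TW.centers TW.norm_iff TW.cocycle_iff TW.act_E_iff om_eq one act2
    by (intro conjI TW_twisted_partial_action centers norm w_one cocycle ideal act_E)
qed

lemma crossed_product_iso:
  "\<exists>\<alpha> \<omega>. twisted_action_data.symmetric_twisted_partial_action R H A \<alpha> \<omega> \<and>
    comodule_algebra_isos R H B (twisted_action_data.crossed_product R H A \<alpha> \<omega>) \<noteq> {}"
proof -
  interpret CC: cleft_crossed R H B A \<iota> \<gamma> \<gamma>' alpha omega by (rule crossed)
  show ?thesis using symmetric CC.Psi_iso by blast
qed

end

section \<open>From an isomorphism with a crossed product to a cleaving pair\<close>

context twisted_alg
begin

lemma crossed_algI:
  assumes "symmetric_twisted_partial_action"
  shows "crossed_alg R H A \<alpha> \<omega>"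
proof -
  interpret LLA: assoc_algebra R "L (L A)" by (rule aLLA)
  note s = assms[unfolded symmetric_twisted_partial_action_def centers norm_iff cocycle_iff act_E_iff twisted_partial_action_iff]
  obtain v where v: "v \<in> carrier (L (L A))" "om \<star>\<star> v = fA E \<star>\<star> mpb E" "v \<star>\<star> om = fA E \<star>\<star> mpb E"
    using s ideal_elim by blast
  have f2: "om \<star>\<star> mpb E = om" using s by simp
  show ?thesis
  proof (intro crossed_alg.intro crossed_alg_axioms.intro twisted_alg_axioms)
    have "flp (post ac E) \<star>\<star> om = om \<star>\<star> mpb E" using s A.one_closed by blast
    then show "flp (post ac E) \<star>\<star> om = om" by (simp only: f2)
  qed (use s f2 in blast)+
qed

end

context twisted_alg
begin

lemma crossed_isoI:
  assumes sym: "symmetric_twisted_partial_action" and B: "comodule_algebra R H B"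
    and iso: "\<phi> \<in> comodule_algebra_isos R H B crossed_product"
  shows "\<exists>v. crossed_iso R H A \<alpha> \<omega> B \<phi> v"
proof -
  note s = sym[unfolded symmetric_twisted_partial_action_def centers norm_iff cocycle_iff act_E_iff]
  obtain v where v: "v \<in> carrier (L (L A))" "v \<star>\<star> om = fA E \<star>\<star> mpb E"
    using s ideal_elim by blast
  have c: "\<forall>y\<in>carrier (L (L A)). fA E \<star>\<star> y = y \<star>\<star> fA E" "\<forall>y\<in>carrier (L (L A)). mpb E \<star>\<star> y = y \<star>\<star> mpb E"
    and cc: "flp (post (\<lambda>y. flp (post ac y)) om) \<star>\<star>\<star> post mpb om = post (post (cst A)) om \<star>\<star>\<star> mpb om"
    and ae: "flp (post ac E) = fA E \<star>\<star> mpb E"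
    using s by simp_all
  have "crossed_iso R H A \<alpha> \<omega> B \<phi> v"
    by (rule crossed_iso.intro[OF crossed_algI[OF sym] B], rule crossed_iso_axioms.intro[OF iso v cc _ _ ae])
      (rule bspec[OF c(1)], assumption, rule bspec[OF c(2)], assumption)
  then show ?thesis by blast
qed

end

context crossed_data
begin

lemma cleft: "cleft_data R H B A \<iota> \<gamma> g'"
proof (intro cleft_data.intro cleft_data_axioms.intro comodule_pair.intro comodule_pair_axioms.intro
    coinvariant_extension_axioms g_closed g'_closed rho_g rho_g' g_one, unfold t_def[symmetric] g_g')
  show "mpb (i1 e) \<otimes>\<^bsub>L (L B)\<^esub> i2 z = i2 z \<otimes>\<^bsub>L (L B)\<^esub> mpb (i1 e)" if "z \<in> carrier (L (L A))" for z
    using f2_central[OF that] i2_m[OF that mpb_c[OF e_closed]] i2_m[OF mpb_c[OF e_closed] that]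
    by (simp add: mpb_i e_closed)
qed (fact t_iota contract_rho g_E2 g'_t1 mg_t2)+

lemma partially_cleft: "partially_cleft R H B (coinvariants R H B)"
  unfolding partially_cleft_iff using cleft by blast

end

theorem theorem5p1:
  fixes R :: "'k ring"
    and H :: "('k, 'h) hopf_algebra"
    and B :: "('k, 'h, 'b) comodule_algebra"
    and A :: "'b set"
  assumes "hopf_algebra R H"
    and "comodule_algebra R H B"
    and "A = coinvariants R H B"
  shows "partially_cleft R H B A \<longleftrightarrow>
    (\<exists>\<alpha> \<omega>.
      twisted_action_data.symmetric_twisted_partial_action R H (subalgebra_on B A) \<alpha> \<omega> \<and>
      comodule_algebra_isos R H B
        (twisted_action_data.crossed_product R H (subalgebra_on B A) \<alpha> \<omega>) \<noteq> {})"
proof -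
  interpret comodule_algebra R H B by (rule assms(2))
  interpret CE: coinvariant_extension R H B A0 "\<lambda>x. x" by (rule A0_extension)
  show ?thesis
    unfolding assms(3)
  proof
    assume "partially_cleft R H B (coinvariants R H B)"
    then obtain \<gamma> \<gamma>' where "cleft_data R H B A0 (\<lambda>x. x) \<gamma> \<gamma>'"
      unfolding CE.partially_cleft_iff by blast
    then show "\<exists>\<alpha> \<omega>. twisted_action_data.symmetric_twisted_partial_action R H A0 \<alpha> \<omega> \<and>
        comodule_algebra_isos R H B (twisted_action_data.crossed_product R H A0 \<alpha> \<omega>) \<noteq> {}"
      by (rule cleft_data.crossed_product_iso)
  next
    assume "\<exists>\<alpha> \<omega>. twisted_action_data.symmetric_twisted_partial_action R H A0 \<alpha> \<omega> \<and>
        comodule_algebra_isos R H B (twisted_action_data.crossed_product R H A0 \<alpha> \<omega>) \<noteq> {}"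
    then obtain \<alpha> \<omega> \<phi> where sym: "twisted_action_data.symmetric_twisted_partial_action R H A0 \<alpha> \<omega>"
      and iso: "\<phi> \<in> comodule_algebra_isos R H B (twisted_action_data.crossed_product R H A0 \<alpha> \<omega>)" by blast
    have "twisted_alg R H A0 \<alpha> \<omega>"
      by (intro twisted_alg.intro twisted_alg_axioms.intro hopf_algebra_axioms A0_alg)
        (use sym in \<open>simp_all add: twisted_action_data.symmetric_twisted_partial_action_def
          twisted_action_data.twisted_partial_action_def\<close>)
    from twisted_alg.crossed_isoI[OF this sym assms(2) iso] obtain v where "crossed_iso R H A0 \<alpha> \<omega> B \<phi> v" by blast
    \<comment> \<open>The data obtained here involve the embedding induced by \<phi>; their
      conclusion mentions the coinvariants alone.\<close>
    then show "partially_cleft R H B (coinvariants R H B)"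
      by (rule crossed_data.partially_cleft[OF crossed_iso.crossed_data])
  qed
qed

end
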